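(* Let $Y_1,Y_2,\dots$ be i.i.d. from the negative exponential distribution with density $f(y;\mu,\sigma)=\sigma^{-1}\exp\{-(y-\mu)/\sigma\}I(y>\mu)$, with $\mu\in\mathbb{R}$, $\sigma>0$ unknown. For $n\ge2$ let $Y_{n:1}=\min\{Y_1,\dots,Y_n\}$ and $V_n=(n-1)^{-1}\sum_{i=1}^n(Y_i-Y_{n:1})$. For a prescribed $b>0$ let $n^*=\sigma/b$. Fix an integer $k\ge1$ and $0<\rho<1$. Let the pilot size be $m=m_0k+1$ for an integer $m_0\ge1$, and define $$T=\inf\{n\ge0:\ m+kn\ge \rho V_{m+kn}/b\},\qquad N=\lfloor\rho^{-1}(m+kT)\rfloor+1,$$ where $\lfloor u\rfloor$ denotes the largest integer strictly smaller than $u$. Let $$\eta_2(k)=\frac{k-1}{2}-\frac12\sum_{n=1}^\infty n^{-1}E\big[\{\chi^2_{2kn}-4kn\}^+\big],$$ where $\chi^2_d$ denotes a chi-square random variable with $d$ degrees of freedom and $\{u\}^+=\max\{0,u\}$. Consider the limit operations $m_0\to\infty$, $m=m_0k+1\to\infty$, $b=O(m^{-r})$, $n^*=O(m^r)$ and $\limsup m/n^*<\rho$, where $r>1$ is a fixed constant. Then for all fixed $\mu,\sigma,k$ and $0<\rho<1$, under these limit operations: (i) $E_{\mu,\sigma}[N/n^*]\to1$; (ii) $\rho^{-1}\eta_2(k)+o(1)\le E_{\mu,\sigma}[N-n^*]\le\rho^{-1}\eta_2(k)+1+o(1)$; (iii) $V_{\mu,\sigma}[Y_{N:1}]=b^2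+o(b^2)$.
   Context: $Y_{N:1}=\min\{Y_1,\dots,Y_N\}$ is the estimator of $\mu$ after sampling stops. $E_{\mu,\sigma}$, $V_{\mu,\sigma}$ denote expectation and variance under the stated distribution. *)

theory Defs
  imports "HOL-Probability.Probability" "HOL-Library.Landau_Symbols"
begin

definition negexp_density :: "real \<Rightarrow> real \<Rightarrow> real \<Rightarrow> real" where
  "negexp_density \<mu> \<sigma> y = (if y > \<mu> then exp (- (y - \<mu>) / \<sigma>) / \<sigma> else 0)"

definition chisq_density :: "nat \<Rightarrow> real \<Rightarrow> real" where
  "chisq_density d x = (if x > 0 then x powr (real d / 2 - 1) * exp (- x / 2)
       / (2 powr (real d / 2) * Gamma (real d / 2)) else 0)"

definition chisq_pos_part_mean :: "nat \<Rightarrow> real \<Rightarrow> real" where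
  "chisq_pos_part_mean d c = (\<integral>x. max 0 (x - c) * chisq_density d x \<partial>lborel)"

definition eta2 :: "nat \<Rightarrow> real" where
  "eta2 k = (real k - 1) / 2 - 1/2 * (\<Sum>n. (1 / real (Suc n)) *
       chisq_pos_part_mean (2 * k * Suc n) (4 * real k * real (Suc n)))"

definition floor_strict :: "real \<Rightarrow> int" where
  "floor_strict u = \<lceil>u\<rceil> - 1"

definition Ymin :: "(nat \<Rightarrow> 'a \<Rightarrow> real) \<Rightarrow> nat \<Rightarrow> 'a \<Rightarrow> real" where
  "Ymin Y n \<omega> = Min ((\<lambda>i. Y i \<omega>) ` {1..n})"

definition Vn :: "(nat \<Rightarrow> 'a \<Rightarrow> real) \<Rightarrow> nat \<Rightarrow> 'a \<Rightarrow> real" where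
  "Vn Y n \<omega> = (1 / (real n - 1)) * (\<Sum>i\<in>{1..n}. (Y i \<omega> - Ymin Y n \<omega>))"

definition stopT :: "(nat \<Rightarrow> 'a \<Rightarrow> real) \<Rightarrow> nat \<Rightarrow> real \<Rightarrow> real \<Rightarrow> nat \<Rightarrow> 'a \<Rightarrow> nat" where
  "stopT Y k \<rho> b m \<omega> = (LEAST n. real (m + k * n) \<ge> \<rho> * Vn Y (m + k * n) \<omega> / b)"

definition stopN :: "(nat \<Rightarrow> 'a \<Rightarrow> real) \<Rightarrow> nat \<Rightarrow> real \<Rightarrow> real \<Rightarrow> nat \<Rightarrow> 'a \<Rightarrow> nat" where
  "stopN Y k \<rho> b m \<omega> =
     nat (floor_strict ((real m + real k * real (stopT Y k \<rho> b m \<omega>)) / \<rho>) + 1)"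

end

theory Submission
  imports Defs "HOL-Real_Asymp.Real_Asymp"
begin

text \<open>
  The normalised spacings of an exponential sample are i.i.d. exponential, and the first \<open>n - 1\<close>
  of them are independent of the minimum of the first \<open>n\<close> observations. With
  \<open>c = \<rho> \<sigma> / b\<close> the rule therefore stops at the first \<open>j \<ge> m\<^sub>0\<close> with \<open>D\<^sub>j \<le> 0\<close>, where
  \<open>D\<^sub>j = \<Gamma>\<^sub>j - n (n + 1) / c\<close>, \<open>n = j k\<close>, and \<open>\<Gamma>\<close> is a random walk with Erlang steps. Given the
  final sample size \<open>N\<close> the standardised minimum is exponential with rate \<open>N\<close>, so (iii) amounts to
  \<open>E (n\<^sup>*/N)\<^sup>p \<rightarrow> 1\<close> for \<open>p = 1, 2\<close>.

  For (i) and (ii), split according to the last \<open>i < j\<close> with \<open>D\<^sub>i \<le> 0\<close>: the probability of no stop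
  up to \<open>j\<close> is \<open>P(D\<^sub>j > 0)\<close> minus the sum over \<open>l \<ge> 1\<close> of
  \<open>P(D\<^bsub>j-l\<^esub> \<le> 0 < D\<^bsub>j-l+1\<^esub>, \<dots>, D\<^sub>j)\<close>. A local limit theorem for gamma densities shows that
  near \<open>n = c\<close> the values \<open>D\<^sub>j\<close>, summed over \<open>j\<close>, have asymptotic density \<open>1/k\<close>. Hence the
  terms of length \<open>l\<close> sum to about \<open>E (min\<^bsub>1\<le>q\<le>l\<^esub> S\<^sub>q)\<^sup>+ / k\<close>, with \<open>S\<^sub>q = \<Gamma>\<^sub>q - 2 k q\<close>, and by the
  cycle lemma this is \<open>E (S\<^sub>l)\<^sup>+ / (k l)\<close>: the series in \<open>\<eta>\<^sub>2\<close>. The sum of \<open>P(D\<^sub>j > 0)\<close> comes from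
  a function of \<open>(j, D\<^sub>j\<^sup>+)\<close> with drift about \<open>-k\<close> on \<open>D\<^sub>j > 0\<close>; the correction incurred when \<open>D\<close>
  crosses zero is again evaluated by the local limit.
\<close>

section \<open>Gamma densities near their mode\<close>

text \<open>The obstacle is the curvature of the boundary: \<open>D\<close> is no random walk, and
  classical renewal theory does not apply to it. The explicit gamma density of \<open>D_j\<close>
  takes its place. Multiplied by sqrt c it tends, at every height x, to the standard normal density
  at z = (j k - c) / sqrt c, and consecutive z are k / sqrt c apart; summation over j becomes
  integration over z and leaves Lebesgue measure in x times 1/k. The further steps are independent
  of \<open>D_j\<close>, so in every mean of a function of \<open>D_j\<close> and the next l steps
  those steps can be held fixed outside while the density is summed over j inside. The sum of
  P(\<open>D_j\<close> > 0) over the window is of order c^(3/5) and is needed up to o(1), more than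
  a local limit theorem delivers. Telescoping a potential reduces it to values at the two edges,
  explicit or negligible up to exponentially small errors, and to a bounded local quantity at level
  zero. Near n = c the boundary has slope 2 in n, so \<open>D\<close> behaves locally like a walk
  with mean step k - 2 k = -k; this is the origin of the 2 k in \<open>S\<close> and of the drift of
  the potential.\<close>

definition entropy_gap :: "real \<Rightarrow> real" where
  "entropy_gap s = s - ln (1 + s)"

text \<open>The gap is the large deviation rate of a mean of unit exponentials at the value 1 + s.
  It grows only linearly at +infinity, which forces the factor max 1 (1 + s); for s <= 0 it
  dominates s^2 / 2. In both ranges the difference of the two sides vanishes at 0 and its derivative
  has the right sign.\<close>

lemma entropy_gap_lower:
  assumes "s > -1"
  shows "s\<^sup>2 / (2 * max 1 (1 + s)) \<le> entropy_gap s"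
proof (cases "s \<ge> 0")
  case True
  define f where "f = (\<lambda>s::real. s - ln (1 + s) - s\<^sup>2 / (2 * (1 + s)))"
  have "f 0 \<le> f s"
  proof (rule DERIV_nonneg_imp_nondecreasing[OF True])
    fix x :: real assume x: "0 \<le> x" "x \<le> s"
    have "(f has_real_derivative (1 - 1 / (1 + x) - (2 * x * (2 * (1 + x)) - x\<^sup>2 * 2) / (2 * (1 + x))\<^sup>2)) (at x)"
      unfolding f_def using x
      by (auto intro!: derivative_eq_intros simp: power2_eq_square)
    moreover have "1 - 1 / (1 + x) - (2 * x * (2 * (1 + x)) - x\<^sup>2 * 2) / (2 * (1 + x))\<^sup>2 = x\<^sup>2 / (2 * (1 + x)\<^sup>2)"
      using x by (simp add: divide_simps) (simp add: algebra_simps power2_eq_square)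
    ultimately show "\<exists>y. (f has_real_derivative y) (at x) \<and> 0 \<le> y"
      by (metis divide_nonneg_nonneg mult_nonneg_nonneg zero_le_numeral zero_le_power2)
  qed
  then show ?thesis using True by (simp add: f_def entropy_gap_def max_def)
next
  case False
  define f where "f = (\<lambda>s::real. s - ln (1 + s) - s\<^sup>2 / 2)"
  have "f s \<ge> f 0"
  proof (rule DERIV_nonpos_imp_nonincreasing[where f=f])
    show "s \<le> 0" using False by simp
    fix x :: real assume x: "s \<le> x" "x \<le> 0"
    then have x1: "x > -1" using assms by simp
    have "(f has_real_derivative (1 - 1 / (1 + x) - x)) (at x)"
      unfolding f_def using x1
      by (auto intro!: derivative_eq_intros)
    moreover have "1 - 1 / (1 + x) - x = - (x\<^sup>2 / (1 + x))"
      using x1 by (simp add: divide_simps) (simp add: algebra_simps power2_eq_square)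
    moreover have "x\<^sup>2 / (1 + x) \<ge> 0" using x1 by simp
    ultimately show "\<exists>y. (f has_real_derivative y) (at x) \<and> y \<le> 0"
      by (metis neg_le_0_iff_le)
  qed
  then show ?thesis using False by (simp add: f_def entropy_gap_def max_def)
qed

lemma entropy_gap_quotient_tendsto:
  assumes "(s \<longlongrightarrow> (0::real)) F" "((\<lambda>c. a c * (s c)\<^sup>2) \<longlongrightarrow> L) F"
  shows "((\<lambda>c. a c * entropy_gap (s c)) \<longlongrightarrow> L / 2) F"
proof -
  \<comment> \<open>The quotient is completed by its limit 1/2 at 0, so that values
    \<open>s c\<close> = 0 need no exclusion along the filter.\<close>
  define q where "q = (\<lambda>s. if s = 0 then 1/2 else entropy_gap s / s\<^sup>2)"
  have "((\<lambda>s::real. (s - ln (1 + s)) / s\<^sup>2) \<longlongrightarrow> 1/2) (at 0)"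
    unfolding filterlim_at_split by (intro conjI) real_asymp+
  then have "(q \<longlongrightarrow> 1/2) (at 0)"
    by (rule Lim_transform_eventually)
       (auto simp: q_def eventually_at_filter entropy_gap_def)
  then have "isCont q 0"
    by (simp add: isCont_def q_def)
  then have "((\<lambda>c. q (s c)) \<longlongrightarrow> q 0) F"
    using assms(1) isCont_tendsto_compose by blast
  then have "((\<lambda>c. (a c * (s c)\<^sup>2) * q (s c)) \<longlongrightarrow> L * (1/2)) F"
    using assms(2) by (intro tendsto_mult) (auto simp: q_def)
  moreover have "(a c * (s c)\<^sup>2) * q (s c) = a c * entropy_gap (s c)" for c
    by (auto simp: q_def entropy_gap_def)
  ultimately show ?thesis by simp
qed

text \<open>The value at the mode N of the Gamma density of shape N + 1, which is the shape of
  \<open>erlang_density N\<close>. Keeping it as a separate factor isolates Stirling's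
  constant.\<close>

definition mode_density :: "nat \<Rightarrow> real" where
  "mode_density N = real N ^ N * exp (- real N) / fact N"

lemma mode_density_pos: "mode_density N > 0"
  by (cases N) (auto simp: mode_density_def)

lemma erlang_density_eq_mode:
  assumes "N \<ge> 1" "t > 0"
  shows "erlang_density N 1 t = mode_density N * exp (- (real N * entropy_gap ((t - N) / N)))"
proof -
  have N: "real N > 0" using assms by simp
  have "1 + (t - N) / N = t / N" using N by (simp add: field_simps)
  then have "real N * entropy_gap ((t - N) / N) = t - N - N * (ln t - ln N)"
    using N assms by (simp add: entropy_gap_def ln_div field_simps)
  then have "exp (- (real N * entropy_gap ((t - N) / N))) = exp (real N) * exp (- t) * exp (N * ln t) / exp (N * ln N)"
    by (simp add: right_diff_distrib flip: exp_add exp_diff)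
  also have "exp (N * ln t) = t ^ N"
    using assms by (simp add: exp_of_nat_mult)
  also have "exp (N * ln N) = real N ^ N"
    using N by (simp add: exp_of_nat_mult)
  finally show ?thesis
    using assms N by (simp add: erlang_density_def mode_density_def exp_minus field_simps)
qed

text \<open>Gaussian decay below and near the mode and exponential decay far to the right are both
  covered by max N t, because 1 + s = t / N for s = (t - N) / N.\<close>

lemma erlang_density_le_mode:
  assumes "N \<ge> 1"
  shows "erlang_density N 1 t \<le> mode_density N * exp (- ((t - N)\<^sup>2 / (2 * max N t)))"
proof (cases "t > 0")
  case True
  have N: "real N > 0" using assms by simp
  have "max 1 (1 + (t - N) / N) = max N t / N"
    using N by (auto simp: max_def field_simps)
  then have "(t - N)\<^sup>2 / (2 * max N t) = N * (((t - N) / N)\<^sup>2 / (2 * max 1 (1 + (t - N) / N)))"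
    using N by (simp add: power2_eq_square field_simps)
  also have "\<dots> \<le> N * entropy_gap ((t - N) / N)"
    using N True by (intro mult_left_mono entropy_gap_lower) (auto simp: field_simps)
  finally show ?thesis
    using mode_density_pos[of N]
    by (simp add: erlang_density_eq_mode[OF assms True])
next
  case False
  then have "erlang_density N 1 t = 0"
    using assms by (auto simp: erlang_density_def)
  then show ?thesis using mode_density_pos[of N] by simp
qed

lemma integrable_inverse_1_plus_square_UNIV:
  "integrable lborel (\<lambda>z::real. 1 / (1 + z\<^sup>2))"
  using integrable_inverse_1_plus_square
  by (simp add: set_integrable_def inverse_eq_divide)

lemma integral_inverse_1_plus_square_UNIV: "(\<integral>(z::real). 1 / (1 + z\<^sup>2) \<partial>lborel) = pi"
  using LBINT_inverse_1_plus_square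
  by (simp add: interval_lebesgue_integral_def set_lebesgue_integral_def inverse_eq_divide)

lemma gauss_integral: "(\<integral>(w::real). exp (- (w\<^sup>2 / 2)) \<partial>lborel) = sqrt (2 * pi)"
proof -
  have "(\<integral>(w::real). std_normal_density w \<partial>lborel) = 1"
    using integral_std_normal_moment_even[of 0] by simp
  moreover have "(\<integral>(w::real). std_normal_density w \<partial>lborel) = (\<integral>(w::real). exp (- (w\<^sup>2 / 2)) \<partial>lborel) / sqrt (2 * pi)"
    by (simp add: std_normal_density_def)
  ultimately show ?thesis
    by (metis div_by_0 nonzero_divide_eq_eq mult_1 zero_neq_one)
qed

text \<open>Provides one integrable majorant, of Cauchy type, for the rescaled gamma densities of
  all N. Beyond |w| = 1 the exponent u is at least |w| / 4, so w^2 <= 16 u^2, and 40 leaves room to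
  absorb this into 1 + u + u^2 / 2.\<close>

lemma exp_neg_le_inverse_square:
  fixes w :: real
  shows "exp (- (w\<^sup>2 / (2 * (1 + \<bar>w\<bar>)))) \<le> 40 / (1 + w\<^sup>2)"
proof -
  define u where "u = w\<^sup>2 / (2 * (1 + \<bar>w\<bar>))"
  have u0: "u \<ge> 0" by (simp add: u_def)
  have "1 + u + u\<^sup>2 / 2 \<le> exp u" using exp_lower_Taylor_quadratic[OF u0] by simp
  moreover have "1 + w\<^sup>2 \<le> 40 * (1 + u + u\<^sup>2 / 2)"
  proof (cases "\<bar>w\<bar> \<le> 1")
    case True
    then have "w\<^sup>2 \<le> 1" by (simp add: abs_square_le_1)
    then show ?thesis using u0 by (simp add: add_nonneg_nonneg) (smt (verit) zero_le_power2)
  next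
    case False
    have "\<bar>w\<bar> / 4 \<le> u"
    proof -
      have "\<bar>w\<bar> * (2 * (1 + \<bar>w\<bar>)) \<le> 4 * (w * w)" using False mult_left_mono[of 1 "\<bar>w\<bar>" "\<bar>w\<bar>"]
        by (simp add: algebra_simps)
      then show ?thesis using False unfolding u_def
        by (simp add: divide_simps power2_eq_square)
    qed
    then have "(\<bar>w\<bar> / 4)\<^sup>2 \<le> u\<^sup>2" by (intro power_mono) auto
    then have "w\<^sup>2 \<le> 16 * u\<^sup>2" by (simp add: power_divide)
    then show ?thesis using u0 by (simp add: field_simps) (smt (verit) zero_le_power2)
  qed
  ultimately have "1 + w\<^sup>2 \<le> 40 * exp u"
    by (meson mult_left_mono order_trans zero_le_numeral)
  moreover have "1 + w\<^sup>2 > 0" by (simp add: add_pos_nonneg)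
  ultimately have "1 / exp u \<le> 40 / (1 + w\<^sup>2)"
    by (simp add: field_simps)
  then show ?thesis by (simp add: u_def exp_minus inverse_eq_divide)
qed

text \<open>The constant in Stirling's formula is read off from the total mass \<open>1\<close> of the gamma density.\<close>

lemma mode_density_asymp: "(\<lambda>N. sqrt (real N) * mode_density N) \<longlonglongrightarrow> 1 / sqrt (2 * pi)"
proof -
  \<comment> \<open>The density at t = N + sqrt N w divided by its value at the mode; the indicator
    encodes t > 0.\<close>
  define f where "f = (\<lambda>N w. indicator {w. N > 0 \<and> w > - sqrt (real N)} w * exp (- (real N * entropy_gap (w / sqrt N))))"
  have f_meas: "f N \<in> borel_measurable borel" for N
    unfolding f_def entropy_gap_def by measurable
  have lim: "(\<lambda>N. \<integral>w. f N w \<partial>lborel) \<longlonglongrightarrow> (\<integral>w. exp (- (w\<^sup>2 / 2)) \<partial>lborel)"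
  proof (rule integral_dominated_convergence)
    show "(\<lambda>w::real. exp (- (w\<^sup>2 / 2))) \<in> borel_measurable lborel" by measurable
    show "f N \<in> borel_measurable lborel" for N using f_meas by simp
    show "integrable lborel (\<lambda>z::real. 40 * (1 / (1 + z\<^sup>2)))"
      by (intro integrable_mult_right integrable_inverse_1_plus_square_UNIV)
    show "AE w in lborel. (\<lambda>N. f N w) \<longlonglongrightarrow> exp (- (w\<^sup>2 / 2))"
    proof (rule AE_I2)
      fix w :: real
      have "(\<lambda>N. real N * entropy_gap (w / sqrt N)) \<longlonglongrightarrow> w\<^sup>2 / 2"
      proof (rule entropy_gap_quotient_tendsto)
        show "(\<lambda>N. w / sqrt (real N)) \<longlonglongrightarrow> 0" by real_asymp
        have "eventually (\<lambda>N. w\<^sup>2 = real N * (w / sqrt (real N))\<^sup>2) sequentially"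
          using eventually_gt_at_top[of 0] by eventually_elim (simp add: power_divide)
        then show "(\<lambda>N. real N * (w / sqrt (real N))\<^sup>2) \<longlonglongrightarrow> w\<^sup>2"
          by (rule Lim_transform_eventually[rotated]) simp
      qed
      then have "(\<lambda>N. exp (- (real N * entropy_gap (w / sqrt N)))) \<longlonglongrightarrow> exp (- (w\<^sup>2 / 2))"
        by (intro tendsto_intros)
      moreover have "eventually (\<lambda>N. exp (- (real N * entropy_gap (w / sqrt N))) = f N w) sequentially"
      proof -
        have "filterlim (\<lambda>N. sqrt (real N)) at_top sequentially" by real_asymp
        then have "eventually (\<lambda>N. sqrt (real N) > - w) sequentially"
          by (simp add: filterlim_at_top_dense)
        then show ?thesis using eventually_gt_at_top[of 0] by eventually_elim (auto simp: f_def)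
      qed
      ultimately show "(\<lambda>N. f N w) \<longlonglongrightarrow> exp (- (w\<^sup>2 / 2))"
        by (rule Lim_transform_eventually)
    qed
    show "AE w in lborel. norm (f N w) \<le> 40 * (1 / (1 + w\<^sup>2))" for N
    proof (rule AE_I2)
      fix w :: real
      show "norm (f N w) \<le> 40 * (1 / (1 + w\<^sup>2))"
      proof (cases "w > - sqrt N \<and> N > 0")
        case True
        then have sN: "sqrt (real N) \<ge> 1" by (simp add: Suc_leI)
        have s: "w / sqrt N > -1" using True sN by (simp add: field_simps)
        have "w\<^sup>2 / (2 * (1 + \<bar>w\<bar>)) \<le> w\<^sup>2 / (2 * max 1 (1 + w / sqrt N))"
        proof (rule divide_left_mono)
          have "w / sqrt N \<le> \<bar>w\<bar> / 1"
            using sN by (intro frac_le) auto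
          then show "2 * max 1 (1 + w / sqrt N) \<le> 2 * (1 + \<bar>w\<bar>)" by (simp add: max_def)
        qed auto
        also have "\<dots> = N * ((w / sqrt N)\<^sup>2 / (2 * max 1 (1 + w / sqrt N)))"
          using True by (simp add: power_divide)
        also have "\<dots> \<le> N * entropy_gap (w / sqrt N)"
          by (intro mult_left_mono entropy_gap_lower s) simp
        finally have "exp (- (N * entropy_gap (w / sqrt N))) \<le> exp (- (w\<^sup>2 / (2 * (1 + \<bar>w\<bar>))))" by simp
        also note exp_neg_le_inverse_square
        finally show ?thesis using True by (simp add: f_def)
      next
        case False
        then show ?thesis by (auto simp: f_def)
      qed
    qed
  qed
  \<comment> \<open>The substitution t = N + sqrt N w in the total mass. The remaining integral has
    a Gaussian limit, so the prefactor must converge to the reciprocal of that limit.\<close>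
  have "sqrt (real N) * mode_density N * (\<integral>w. f N w \<partial>lborel) = 1" if "N > 0" for N
  proof -
    have N: "real N > 0" using that by simp
    have "1 = (\<integral>t. erlang_density N 1 t \<partial>lborel)"
    proof -
      interpret E: prob_space "density lborel (erlang_density N 1)"
        by (rule prob_space_erlang_density) simp
      have "1 = (\<integral>t. (1::real) \<partial>density lborel (erlang_density N 1))" using E.prob_space by simp
      also have "\<dots> = (\<integral>t. erlang_density N 1 t \<partial>lborel)"
        by (subst integral_density) auto
      finally show ?thesis .
    qed
    also have "\<dots> = sqrt N * (\<integral>w. erlang_density N 1 (N + sqrt N * w) \<partial>lborel)"
      using N by (subst lborel_integral_real_affine[where c="sqrt N" and t="N"]) auto
    also have "(\<integral>w. erlang_density N 1 (N + sqrt N * w) \<partial>lborel) = (\<integral>w. mode_density N * f N w \<partial>lborel)"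
    proof (rule Bochner_Integration.integral_cong[OF refl])
      fix w :: real
      have pos: "N + sqrt N * w > 0 \<longleftrightarrow> w > - sqrt N"
      proof -
        have "N + sqrt N * w = sqrt N * (sqrt N + w)" by (simp add: algebra_simps)
        then show ?thesis using N by (simp add: zero_less_mult_iff) linarith
      qed
      have "sqrt N * w / N = w / sqrt N" using N by (simp add: field_simps flip: real_sqrt_mult_self[of N])
      then show "erlang_density N 1 (N + sqrt N * w) = mode_density N * f N w"
      proof (cases "w > - sqrt N")
        case True
        then show ?thesis using pos that \<open>sqrt N * w / N = w / sqrt N\<close>
          by (subst erlang_density_eq_mode) (auto simp: f_def)
      next
        case False
        then have "N + sqrt N * w \<le> 0" using pos by linarith
        then have "erlang_density N 1 (N + sqrt N * w) = 0"
          using that by (auto simp: erlang_density_def)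
        then show ?thesis using False by (simp add: f_def)
      qed
    qed
    finally show ?thesis by simp
  qed
  note norm = this
  have eq: "eventually (\<lambda>N. 1 / (\<integral>w. f N w \<partial>lborel) = sqrt (real N) * mode_density N) sequentially"
    using eventually_gt_at_top[of 0]
    by eventually_elim (metis norm mult_zero_right nonzero_eq_divide_eq zero_neq_one)
  have "(\<lambda>N. 1 / (\<integral>w. f N w \<partial>lborel)) \<longlonglongrightarrow> 1 / sqrt (2 * pi)"
    using lim unfolding gauss_integral by (intro tendsto_intros) auto
  then show ?thesis using eq by (rule Lim_transform_eventually)
qed

text \<open>With s = (t - N) / N the exponent N times \<open>entropy_gap s\<close> tends to w^2 / 2,
  because N s^2 tends to w^2; the prefactor is Stirling's.\<close>

lemma erlang_local_limit:
  assumes N: "filterlim N at_top F"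
    and t: "((\<lambda>c. (t c - real (N c)) / sqrt (real (N c))) \<longlongrightarrow> w) F"
  shows "((\<lambda>c. sqrt (real (N c)) * erlang_density (N c) 1 (t c)) \<longlongrightarrow> exp (- (w\<^sup>2 / 2)) / sqrt (2 * pi)) F"
proof -
  have Nr: "filterlim (\<lambda>c. real (N c)) at_top F"
    using N filterlim_compose filterlim_real_sequentially by blast
  have sN: "filterlim (\<lambda>c. sqrt (real (N c))) at_top F"
    by (rule filterlim_compose[OF sqrt_at_top Nr])
  have ev: "eventually (\<lambda>c. N c \<ge> 1) F" using N by (simp add: filterlim_at_top)
  have s0: "((\<lambda>c. (t c - real (N c)) / real (N c)) \<longlongrightarrow> 0) F"
  proof -
    have "((\<lambda>c. (t c - real (N c)) / sqrt (real (N c)) * inverse (sqrt (real (N c)))) \<longlongrightarrow> w * 0) F"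
      by (intro tendsto_mult t tendsto_inverse_0_at_top sN)
    then show ?thesis
      by (simp add: divide_inverse mult.assoc flip: inverse_mult_distrib)
  qed
  have pos: "eventually (\<lambda>c. t c > 0) F"
    using order_tendstoD(1)[OF s0, of "-1", simplified] ev
    by eventually_elim (auto simp: field_simps)
  have "((\<lambda>c. real (N c) * ((t c - real (N c)) / real (N c))\<^sup>2) \<longlongrightarrow> w\<^sup>2) F"
  proof (rule Lim_transform_eventually)
    show "((\<lambda>c. ((t c - real (N c)) / sqrt (real (N c)))\<^sup>2) \<longlongrightarrow> w\<^sup>2) F"
      by (intro tendsto_intros t)
    show "eventually (\<lambda>c. ((t c - real (N c)) / sqrt (real (N c)))\<^sup>2 = real (N c) * ((t c - real (N c)) / real (N c))\<^sup>2) F"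
      using ev by eventually_elim (simp add: power_divide power2_eq_square field_simps)
  qed
  from entropy_gap_quotient_tendsto[OF s0 this]
  have "((\<lambda>c. exp (- (real (N c) * entropy_gap ((t c - real (N c)) / real (N c))))) \<longlongrightarrow> exp (- (w\<^sup>2 / 2))) F"
    by (intro tendsto_intros)
  moreover have "((\<lambda>c. sqrt (real (N c)) * mode_density (N c)) \<longlongrightarrow> 1 / sqrt (2 * pi)) F"
    by (rule filterlim_compose[OF mode_density_asymp N])
  ultimately have "((\<lambda>c. sqrt (real (N c)) * mode_density (N c) *
      exp (- (real (N c) * entropy_gap ((t c - real (N c)) / real (N c))))) \<longlongrightarrow> 1 / sqrt (2 * pi) * exp (- (w\<^sup>2 / 2))) F"
    by (intro tendsto_mult)
  moreover have "eventually (\<lambda>c. sqrt (real (N c)) * mode_density (N c) *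
      exp (- (real (N c) * entropy_gap ((t c - real (N c)) / real (N c)))) = sqrt (real (N c)) * erlang_density (N c) 1 (t c)) F"
    using ev pos by eventually_elim (simp add: erlang_density_eq_mode)
  ultimately show ?thesis
    by (auto intro: Lim_transform_eventually)
qed

section \<open>A local renewal theorem\<close>

text \<open>With n = j k and sample size n + 1 the rule stops once n + 1 >= c S / n, where S is the
  sum of the first n spacings; this is S <= n (n + 1) / c.\<close>

definition boundary :: "nat \<Rightarrow> real \<Rightarrow> nat \<Rightarrow> real" where
  "boundary k c j = real (j * k) * (real (j * k) + 1) / c"

abbreviation dev_density :: "nat \<Rightarrow> real \<Rightarrow> nat \<Rightarrow> real \<Rightarrow> real" where
  "dev_density k c j x \<equiv> erlang_density (j * k - 1) 1 (x + boundary k c j)"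

text \<open>This is sqrt c (1 + z^2) with z = (j k - c) / sqrt c. Its reciprocal is a Cauchy profile
  in z at mesh of order 1 / sqrt c, so quantities below a multiple of it stay bounded when summed
  over j.\<close>

abbreviation local_scale :: "nat \<Rightarrow> real \<Rightarrow> nat \<Rightarrow> real" where
  "local_scale k c j \<equiv> sqrt c * (1 + (real (j * k) - c)\<^sup>2 / c)"

text \<open>
  The half width \<open>K = c\<^bsup>3/5\<^esup>\<close> of the window exceeds the fluctuations of order \<open>c\<^bsup>1/2\<^esup>\<close>, while
  the accumulated errors of order \<open>K\<^sup>3 / c\<^sup>2\<close> still vanish.
\<close>

definition window_lo :: "nat \<Rightarrow> real \<Rightarrow> nat" where
  "window_lo k c = nat \<lceil>(c - c powr (3/5)) / real k\<rceil>"

definition window_hi :: "nat \<Rightarrow> real \<Rightarrow> nat" where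
  "window_hi k c = nat \<lfloor>(c + c powr (3/5)) / real k\<rfloor>"

abbreviation window :: "nat \<Rightarrow> real \<Rightarrow> nat set" where
  "window k c \<equiv> {window_lo k c..<window_hi k c}"

text \<open>The rounding in \<open>window_lo\<close> and \<open>window_hi\<close> is dealt with
  once, here; later arguments about the window edges use only these linear inequalities, valid for
  large c.\<close>

lemma eventually_window:
  assumes k: "k \<ge> 1"
  shows "eventually (\<lambda>c. c \<ge> 100 \<and> c \<ge> (real k)\<^sup>2 \<and> c powr (3/5) \<le> c / 4 \<and> real k \<le> c / 4 \<and>
     (\<forall>j. window_lo k c \<le> j \<longrightarrow> c - c powr (3/5) \<le> real (j * k)) \<and>
     (\<forall>j. j < window_lo k c \<longrightarrow> real (j * k) < c - c powr (3/5)) \<and>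
     (\<forall>j. j \<le> window_hi k c \<longrightarrow> real (j * k) \<le> c + c powr (3/5)) \<and>
     (\<forall>j. window_hi k c < j \<longrightarrow> c + c powr (3/5) < real (j * k)) \<and>
     window_lo k c < window_hi k c \<and> window_lo k c \<ge> 1) at_top"
proof -
  have k0: "real k > 0" using k by simp
  have "eventually (\<lambda>c::real. c \<ge> 100 \<and> c \<ge> (real k)\<^sup>2 \<and> c powr (3/5) \<le> c / 4 \<and> real k \<le> c / 4 \<and> c powr (3/5) \<ge> 2 * real k) at_top"
    by (intro eventually_conj; real_asymp)
  then show ?thesis
  proof eventually_elim
    case (elim c)
    define K where "K = c powr (3/5)"
    have lo_pos: "(c - K) / k > 0" using elim k0 by (auto simp: K_def)
    have hi_pos: "(c + K) / k \<ge> 0" using elim k0 by (auto simp: K_def)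
    have lo: "window_lo k c \<le> j \<longleftrightarrow> c - K \<le> real (j * k)" for j
    proof -
      have "window_lo k c \<le> j \<longleftrightarrow> (c - K) / k \<le> real j"
        unfolding window_lo_def K_def[symmetric] by (simp add: nat_le_iff ceiling_le_iff)
      also have "\<dots> \<longleftrightarrow> c - K \<le> real (j * k)" using k0 by (simp add: field_simps)
      finally show ?thesis .
    qed
    have hi: "j \<le> window_hi k c \<longleftrightarrow> real (j * k) \<le> c + K" for j
    proof -
      have "j \<le> window_hi k c \<longleftrightarrow> real j \<le> (c + K) / k"
        unfolding window_hi_def K_def[symmetric] using hi_pos
        by (subst le_nat_iff) (auto simp: le_floor_iff)
      also have "\<dots> \<longleftrightarrow> real (j * k) \<le> c + K" using k0 by (simp add: field_simps)
      finally show ?thesis .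
    qed
    have w1: "window_lo k c \<ge> 1" using lo[of 0] elim by (simp add: K_def not_le flip: One_nat_def)
    have w2: "window_lo k c < window_hi k c"
    proof -
      have "real ((window_lo k c - 1) * k) < c - K"
        using lo[of "window_lo k c - 1"] w1 by auto
      moreover have "real ((window_lo k c - 1) * k) = real (window_lo k c * k) - real k"
        using w1 by (simp add: left_diff_distrib of_nat_diff)
      ultimately have "real ((window_lo k c + 1) * k) \<le> c + K"
        using elim by (simp add: K_def algebra_simps)
      then show ?thesis using hi[of "window_lo k c + 1"] by simp
    qed
    show ?case
      unfolding K_def[symmetric] using elim w1 w2 lo hi
      by (intro conjI allI impI) (auto simp: K_def simp flip: not_le)
  qed
qed

text \<open>The exponent e of \<open>erlang_density_le_mode\<close> is quadratic in t - N, and t - N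
  is y = j k - c up to bounded factors and the shift x. Hence y^2 / c is at most a constant times (1
  + x^2) (1 + e), and the weak bound exp (- e) <= 1 / (1 + e) already pays for the weight. The
  growth 1 + x^2 on the right is the cost of allowing any height x.\<close>

lemma erlang_window_bound:
  assumes k: "k \<ge> 1"
  obtains C where "C > 0" "eventually (\<lambda>c. \<forall>j\<in>window k c. \<forall>x.
    local_scale k c j * dev_density k c j x \<le> C * (1 + x\<^sup>2)) at_top"
proof -
  have "convergent (\<lambda>N. sqrt (real N) * mode_density N)"
    using mode_density_asymp by (auto simp: convergent_def)
  then have "Bseq (\<lambda>N. sqrt (real N) * mode_density N)" by (rule convergent_imp_Bseq)
  then obtain B where B: "B > 0" "\<And>N. sqrt (real N) * mode_density N \<le> B"
    by (auto simp: Bseq_def intro: order_trans[OF abs_ge_self])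
  \<comment> \<open>288 = 2 * 144: the 2 comes from sqrt c <= 2 sqrt N inside the window, the 144
    from \<open>key\<close>.\<close>
  have "eventually (\<lambda>c. \<forall>j\<in>window k c. \<forall>x.
    local_scale k c j * dev_density k c j x \<le> 288 * B * (1 + x\<^sup>2)) at_top"
    using eventually_window[OF k]
  proof eventually_elim
    case (elim c)
    show ?case
    proof (intro ballI allI)
      fix j x assume j: "j \<in> window k c"
      define n where "n = real (j * k)"
      define N where "N = j * k - 1"
      define y where "y = n - c"
      define t where "t = x + boundary k c j"
      define E where "E = (t - N)\<^sup>2"
      define m where "m = max N t"
      have n: "c - c powr (3/5) \<le> n" "n \<le> c + c powr (3/5)"
        using elim j by (auto simp: n_def)
      then have n2: "c / 2 \<le> n" "n \<le> 2 * c" "c \<ge> 100" using elim by auto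
      then have "j * k \<ge> 1" unfolding n_def by (cases "j * k = 0") auto
      then have N: "real N = n - 1" by (simp add: N_def n_def of_nat_diff del: of_nat_mult)
      have N1: "N \<ge> 1" using N n2 by (simp flip: of_nat_le_iff[where ?'a=real])
      have m0: "m > 0" using N n2 by (simp add: m_def)
      have tN: "t - N = x + n * (y + 1) / c + 1"
        using n2 unfolding t_def N boundary_def n_def[symmetric] y_def by (simp add: field_simps)
      \<comment> \<open>Solving the previous identity for y + 1 costs the factor c / n, which is at
        most 2 in the window.\<close>
      have y_bd: "\<bar>y\<bar> \<le> 2 * \<bar>t - N\<bar> + 2 * \<bar>x\<bar> + 3"
      proof -
        have "(y + 1) = (c / n) * (t - N - x - 1)"
          using n2 unfolding tN by (simp add: field_simps)
        moreover have "\<bar>c / n\<bar> \<le> 2" using n2 by (simp add: field_simps)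
        ultimately have "\<bar>y + 1\<bar> \<le> 2 * \<bar>t - N - x - 1\<bar>"
          by (metis abs_ge_zero abs_mult mult_right_mono)
        moreover have "\<bar>t - N - x - 1\<bar> \<le> \<bar>t - N\<bar> + \<bar>x\<bar> + 1" by linarith
        moreover have "\<bar>y\<bar> \<le> \<bar>y + 1\<bar> + 1" by linarith
        ultimately have "\<bar>y\<bar> \<le> 2 * (\<bar>t - N\<bar> + \<bar>x\<bar> + 1) + 1"
          by (smt (verit) mult_left_mono)
        then show ?thesis by (simp add: algebra_simps)
      qed
      have "y\<^sup>2 \<le> (2 * \<bar>t - N\<bar> + 2 * \<bar>x\<bar> + 3)\<^sup>2"
        using y_bd by (simp add: abs_le_square_iff[symmetric])
      also have "\<dots> \<le> 3 * (4 * E + 4 * x\<^sup>2 + 9)"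
      proof -
        have "(p + q + r)\<^sup>2 \<le> 3 * (p\<^sup>2 + q\<^sup>2 + r\<^sup>2)" for p q r :: real
          using sum_squares_ge_zero[of "p - q" "q - r"] zero_le_power2[of "p - r"]
          by (simp add: power2_eq_square algebra_simps)
        from this[of "2 * \<bar>t - N\<bar>" "2 * \<bar>x\<bar>" 3] show ?thesis by (simp add: E_def power_mult_distrib)
      qed
      finally have y2: "y\<^sup>2 \<le> 12 * E + 12 * x\<^sup>2 + 27" by simp
      have "boundary k c j \<le> 4 * c + 2"
      proof -
        have "n * (n + 1) \<le> (2 * c) * (2 * c + 1)" using n2 by (intro mult_mono) auto
        then show ?thesis using n2 unfolding boundary_def n_def[symmetric] by (simp add: field_simps)
      qed
      then have "t \<le> \<bar>x\<bar> + 4 * c + 2" unfolding t_def by linarith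
      moreover have "\<bar>x\<bar> \<le> c * \<bar>x\<bar>" using n2 by (intro mult_le_cancel_right1[THEN iffD2]) auto
      ultimately have m_le: "m \<le> c * (5 + \<bar>x\<bar>)" using n2 N by (simp add: m_def algebra_simps)
      have ax: "\<bar>x\<bar> \<le> 1 + x\<^sup>2"
        using zero_le_power2[of "\<bar>x\<bar> - 1"] zero_le_power2[of x] by (simp add: power2_eq_square algebra_simps)
      define e where "e = E / (2 * m)"
      have e0: "e \<ge> 0" using m0 by (simp add: e_def E_def)
      have Ec: "E / c \<le> e * (12 + 2 * x\<^sup>2)"
      proof -
        have "E / c = e * (2 * m / c)" using m0 by (simp add: e_def)
        also have "\<dots> \<le> e * (2 * (5 + \<bar>x\<bar>))"
          using m_le n2 e0 by (intro mult_left_mono) (auto simp: field_simps)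
        also have "\<dots> \<le> e * (12 + 2 * x\<^sup>2)" using ax e0 by (intro mult_left_mono) auto
        finally show ?thesis .
      qed
      have "y\<^sup>2 / c \<le> (12 * E + (12 * x\<^sup>2 + 27)) / c" using y2 n2 by (intro divide_right_mono) auto
      also have "\<dots> = 12 * (E / c) + (12 * x\<^sup>2 + 27) / c" by (simp add: add_divide_distrib)
      also have "(12 * x\<^sup>2 + 27) / c \<le> (12 * x\<^sup>2 + 27) / 1" using n2 by (intro divide_left_mono) (auto intro: add_nonneg_nonneg)
      finally have "1 + y\<^sup>2 / c \<le> 12 * (e * (12 + 2 * x\<^sup>2)) + 12 * x\<^sup>2 + 28" using Ec by simp
      also have "\<dots> \<le> 144 * (1 + x\<^sup>2) * (1 + e)"
      proof -
        have "0 \<le> e * x\<^sup>2" using e0 by simp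
        then show ?thesis using e0 zero_le_power2[of x] by (simp add: algebra_simps)
      qed
      finally have key: "1 + y\<^sup>2 / c \<le> 144 * (1 + x\<^sup>2) * (1 + e)" .
      have "erlang_density N 1 t \<le> mode_density N * exp (- e)"
        using erlang_density_le_mode[OF N1, of t] by (simp add: e_def E_def m_def)
      also have "exp (- e) \<le> 1 / (1 + e)"
        using exp_ge_add_one_self[of e] e0 by (simp add: exp_minus field_simps)
      finally have dens: "erlang_density N 1 t \<le> mode_density N / (1 + e)"
        using mode_density_pos[of N] by (simp add: mult_left_mono)
      have sc: "sqrt c * mode_density N \<le> 2 * B"
      proof -
        have "sqrt c \<le> sqrt (4 * N)" using N n2 by (intro real_sqrt_le_mono) auto
        then have "sqrt c * mode_density N \<le> 2 * sqrt N * mode_density N"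
          using mode_density_pos[of N] by (intro mult_right_mono) (auto simp: real_sqrt_mult)
        then show ?thesis using B(2)[of N] by simp
      qed
      have "sqrt c * (1 + y\<^sup>2 / c) * erlang_density N 1 t \<le> sqrt c * (1 + y\<^sup>2 / c) * (mode_density N / (1 + e))"
        using n2 by (intro mult_left_mono dens) (auto intro!: mult_nonneg_nonneg add_nonneg_nonneg)
      also have "\<dots> = (sqrt c * mode_density N) * ((1 + y\<^sup>2 / c) / (1 + e))" by simp
      also have "\<dots> \<le> (2 * B) * (144 * (1 + x\<^sup>2))"
      proof (rule mult_mono[OF sc])
        show "(1 + y\<^sup>2 / c) / (1 + e) \<le> 144 * (1 + x\<^sup>2)"
          using key e0 by (simp add: pos_divide_le_eq)
        show "0 \<le> (1 + y\<^sup>2 / c) / (1 + e)" using e0 n2 by (simp add: add_nonneg_nonneg)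
      qed (use B in simp)
      finally show "local_scale k c j * dev_density k c j x \<le> 288 * B * (1 + x\<^sup>2)"
        by (simp add: y_def n_def N_def t_def mult_ac)
    qed
  qed
  then show ?thesis using that[of "288 * B"] B by simp
qed

section \<open>Sums over the window as integrals of step functions\<close>

definition window_index :: "nat \<Rightarrow> real \<Rightarrow> real \<Rightarrow> nat" where
  "window_index k c z = nat \<lfloor>(c + sqrt c * z) / real k\<rfloor>"

lemma window_index_measurable [measurable]:
  "window_index k c \<in> measurable borel (count_space UNIV)"
  unfolding window_index_def by measurable

lemma borel_measurable_window_index:
  "(\<lambda>z. F (window_index k c z)) \<in> borel_measurable borel"
  by (rule measurable_compose[OF window_index_measurable]) simp

lemma window_index_eq_iff:
  assumes "c > 0" "k \<ge> 1" "j \<ge> 1"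
  shows "window_index k c z = j \<longleftrightarrow> z \<in> {(real (j * k) - c) / sqrt c..<(real (j * k) + real k - c) / sqrt c}"
proof -
  have "window_index k c z = j \<longleftrightarrow> \<lfloor>(c + sqrt c * z) / real k\<rfloor> = int j"
    using assms unfolding window_index_def by linarith
  also have "\<dots> \<longleftrightarrow> real j \<le> (c + sqrt c * z) / real k \<and> (c + sqrt c * z) / real k < real j + 1"
    by (simp add: floor_eq_iff)
  also have "\<dots> \<longleftrightarrow> z \<in> {(real (j * k) - c) / sqrt c..<(real (j * k) + real k - c) / sqrt c}"
    using assms by (simp add: field_simps)
  finally show ?thesis .
qed

text \<open>Each index owns a cell of length k / sqrt c on the z-axis, whence the prefactor. In this
  form limits of window sums become instances of dominated convergence in z.\<close>

lemma window_sum_as_integral: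
  fixes a :: "nat \<Rightarrow> real"
  assumes c: "c > 0" and k: "k \<ge> 1" and A: "finite A" "A \<subseteq> {1..}"
  shows "(\<Sum>j\<in>A. a j) = sqrt c / k * (\<integral>z. indicator A (window_index k c z) * a (window_index k c z) \<partial>lborel)"
proof -
  define I where "I = (\<lambda>j. {(real (j * k) - c) / sqrt c..<(real (j * k) + real k - c) / sqrt c})"
  have eq: "indicator A (window_index k c z) * a (window_index k c z) = (\<Sum>j\<in>A. a j * indicator (I j) z)" for z
  proof -
    have "(\<Sum>j\<in>A. a j * indicator (I j) z) = (\<Sum>j\<in>A. if window_index k c z = j then a j else 0)"
      using A by (intro sum.cong refl) (auto simp: I_def window_index_eq_iff[OF c k] indicator_def subset_eq)
    then show ?thesis using A by (auto simp: indicator_def)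
  qed
  have em: "emeasure lborel (I j) = ennreal (k / sqrt c)" for j
    unfolding I_def using c by (subst emeasure_lborel_Ico) (auto simp: divide_right_mono simp flip: diff_divide_distrib)
  then have m: "measure lborel (I j) = k / sqrt c" for j
    using c by (simp add: measure_def)
  have Iint: "integrable lborel (indicat_real (I j))" for j
    by (rule integrable_real_indicator) (auto simp: em, auto simp: I_def)
  have "(\<integral>z. indicator A (window_index k c z) * a (window_index k c z) \<partial>lborel) = (\<Sum>j\<in>A. a j * (k / sqrt c))"
    unfolding eq using Iint by (subst Bochner_Integration.integral_sum) (auto simp: m)
  then show ?thesis
    using c k by (simp only: sum_distrib_right[symmetric]) simp
qed

text \<open>Rounding z down to its cell moves sqrt c z by at most k <= sqrt c, so the Cauchy weight
  changes by a bounded factor only.\<close>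

lemma window_index_weight:
  assumes c: "c > 0" "c \<ge> (real k)\<^sup>2" and k: "k \<ge> 1" and j: "window_index k c z \<ge> 1"
  shows "1 + z\<^sup>2 \<le> 3 * (1 + (real (window_index k c z * k) - c)\<^sup>2 / c)"
proof -
  define y where "y = real (window_index k c z * k) - c"
  define d where "d = sqrt c * z - y"
  have "0 \<le> d" "d \<le> k"
    using window_index_eq_iff[OF c(1) k j, of z] c by (auto simp: d_def y_def field_simps)
  then have d2: "d\<^sup>2 \<le> c" using c by (smt (verit) power_mono)
  have "c * z\<^sup>2 = (y + d)\<^sup>2" using c by (simp add: d_def power_mult_distrib)
  also have "\<dots> \<le> 2 * y\<^sup>2 + 2 * d\<^sup>2"
    using zero_le_power2[of "y - d"] by (simp add: power2_eq_square algebra_simps)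
  finally have "c * z\<^sup>2 \<le> 2 * y\<^sup>2 + 2 * c" using d2 by simp
  then have "z\<^sup>2 \<le> 2 * (y\<^sup>2 / c) + 2" using c by (simp add: field_simps)
  moreover have "0 \<le> y\<^sup>2 / c" using c by simp
  ultimately show ?thesis unfolding y_def by simp
qed

text \<open>The constant is 3, from \<open>window_index_weight\<close>, times the total mass pi of 1
  / (1 + z^2).\<close>

lemma window_sum_bound:
  assumes k: "k \<ge> 1"
  shows "eventually (\<lambda>c. \<forall>a B. (\<forall>j\<in>window k c. \<bar>a j\<bar> * (local_scale k c j) \<le> B)
     \<longrightarrow> (\<Sum>j\<in>window k c. \<bar>a j\<bar>) \<le> 3 * pi * B / k) at_top"
  using eventually_window[OF k]
proof eventually_elim
  case (elim c)
  have c0: "c > 0" using elim by auto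
  have A: "finite (window k c)" "window k c \<subseteq> {1..}" using elim by auto
  show ?case
  proof (intro allI impI)
    fix a :: "nat \<Rightarrow> real" and B assume B: "\<forall>j\<in>window k c. \<bar>a j\<bar> * (local_scale k c j) \<le> B"
    have "window_lo k c \<in> window k c" using elim by auto
    moreover have "0 \<le> \<bar>a (window_lo k c)\<bar> * (sqrt c * (1 + (real (window_lo k c * k) - c)\<^sup>2 / c))"
      using c0 by (intro mult_nonneg_nonneg add_nonneg_nonneg) auto
    ultimately have B0: "B \<ge> 0" using B order_trans by blast
    have bd: "indicator (window k c) (window_index k c z) * \<bar>a (window_index k c z)\<bar> \<le> 3 * B / sqrt c * (1 / (1 + z\<^sup>2))" (is "?l \<le> _") for z
    proof (cases "window_index k c z \<in> window k c")
      case True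
      define w where "w = 1 + (real (window_index k c z * k) - c)\<^sup>2 / c"
      have w: "1 + z\<^sup>2 \<le> 3 * w" unfolding w_def
        using True A elim by (intro window_index_weight c0 k) auto
      have z0: "1 + z\<^sup>2 > 0" by (simp add: add_pos_nonneg)
      have "\<bar>a (window_index k c z)\<bar> * (sqrt c * (1 + z\<^sup>2)) \<le> \<bar>a (window_index k c z)\<bar> * (sqrt c * (3 * w))"
        using w c0 by (intro mult_left_mono) auto
      also have "\<dots> = 3 * (\<bar>a (window_index k c z)\<bar> * (sqrt c * w))" by simp
      also have "\<dots> \<le> 3 * B" using B True unfolding w_def by (intro mult_left_mono) auto
      finally have "\<bar>a (window_index k c z)\<bar> \<le> 3 * B / (sqrt c * (1 + z\<^sup>2))"
        using c0 z0 by (subst pos_le_divide_eq) auto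
      then show ?thesis using True by simp
    next
      case False then show ?thesis using B0 c0 by (simp add: add_nonneg_nonneg)
    qed
    have int: "integrable lborel (\<lambda>z::real. 3 * B / sqrt c * (1 / (1 + z\<^sup>2)))"
      by (intro integrable_mult_right integrable_inverse_1_plus_square_UNIV)
    have "(\<Sum>j\<in>window k c. \<bar>a j\<bar>) = sqrt c / k * (\<integral>z. indicator (window k c) (window_index k c z) * \<bar>a (window_index k c z)\<bar> \<partial>lborel)"
      using window_sum_as_integral[OF c0 k A, of "\<lambda>j. \<bar>a j\<bar>"] by simp
    also have "\<dots> \<le> sqrt c / k * (\<integral>z. 3 * B / sqrt c * (1 / (1 + z\<^sup>2)) \<partial>lborel)"
    proof (intro mult_left_mono integral_mono int)
      show "integrable lborel (\<lambda>z. indicator (window k c) (window_index k c z) * \<bar>a (window_index k c z)\<bar>)"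
      proof (rule Bochner_Integration.integrable_bound[OF int])
        show "AE z in lborel. norm (indicator (window k c) (window_index k c z) * \<bar>a (window_index k c z)\<bar>)
            \<le> norm (3 * B / sqrt c * (1 / (1 + z\<^sup>2)))"
        proof (rule AE_I2)
          fix z :: real
          have "norm (indicator (window k c) (window_index k c z) * \<bar>a (window_index k c z)\<bar>) =
             indicator (window k c) (window_index k c z) * \<bar>a (window_index k c z)\<bar>" by (simp add: abs_mult)
          also note bd[of z]
          also note abs_ge_self
          finally show "norm (indicator (window k c) (window_index k c z) * \<bar>a (window_index k c z)\<bar>)
            \<le> norm (3 * B / sqrt c * (1 / (1 + z\<^sup>2)))" by simp
        qed
        show "(\<lambda>z. indicator (window k c) (window_index k c z) * \<bar>a (window_index k c z)\<bar>) \<in> borel_measurable lborel"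
          using borel_measurable_window_index[of "\<lambda>i. indicator (window k c) i * \<bar>a i\<bar>"] by simp
      qed
    qed (use bd c0 in auto)
    also have "\<dots> = 3 * pi * B / k"
      using c0 by (subst integral_mult_right_zero) (simp add: integral_inverse_1_plus_square_UNIV)
    finally show "(\<Sum>j\<in>window k c. \<bar>a j\<bar>) \<le> 3 * pi * B / k" .
  qed
qed

text \<open>Indices at distance of order sqrt c from c / k lie well inside, because c^(3/5) exceeds
  every multiple of sqrt c; the extra l leaves room for the block of steps that follows.\<close>

lemma eventually_in_window:
  assumes k: "k \<ge> 1" and f: "((\<lambda>c. (real (f c * k) - c) / sqrt c) \<longlongrightarrow> z) at_top"
  shows "eventually (\<lambda>c. f c \<in> window k c \<and> f c + l < window_hi k c) at_top"
proof -
  have "eventually (\<lambda>c. \<bar>(real (f c * k) - c) / sqrt c\<bar> < \<bar>z\<bar> + 1) at_top"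
    using tendsto_rabs[OF f] by (rule order_tendstoD) simp
  moreover have "eventually (\<lambda>c::real. c powr (3/5) > (\<bar>z\<bar> + 1) * sqrt c + (real l + 2) * real k) at_top"
    by real_asymp
  ultimately show ?thesis using eventually_window[OF k]
  proof eventually_elim
    case (elim c)
    have c0: "c > 0" using elim by auto
    have "\<bar>real (f c * k) - c\<bar> < (\<bar>z\<bar> + 1) * sqrt c"
      using elim(1) c0 by (simp add: field_simps)
    then have *: "real (f c * k) + (real l + 2) * k < c + c powr (3/5)" "c - c powr (3/5) < real (f c * k)"
      using elim(2) mult_nonneg_nonneg[of "real l + 2" "real k"] by linarith+
    have "f c + l < window_hi k c"
    proof (rule ccontr)
      assume "\<not> f c + l < window_hi k c"
      then have "window_hi k c < f c + l + 1" by simp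
      then have "c + c powr (3/5) < real ((f c + l + 1) * k)" using elim(3) by blast
      also have "\<dots> \<le> real (f c * k) + (real l + 2) * k" by (simp add: algebra_simps)
      finally show False using * by simp
    qed
    moreover have "window_lo k c \<le> f c"
      using elim(3) * by (meson not_le order_less_asym)
    ultimately show ?case by auto
  qed
qed

lemma window_index_tendsto:
  assumes k: "k \<ge> 1"
  shows "((\<lambda>c. (real (window_index k c z * k) - c) / sqrt c) \<longlongrightarrow> z) at_top"
proof (rule tendsto_sandwich)
  have k0: "real k > 0" using k by simp
  have "eventually (\<lambda>c::real. c + sqrt c * z \<ge> real k) at_top" by real_asymp
  then have *: "eventually (\<lambda>c. z - k / sqrt c \<le> (real (window_index k c z * k) - c) / sqrt c
     \<and> (real (window_index k c z * k) - c) / sqrt c \<le> z) at_top"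
    using eventually_gt_at_top[of 0]
  proof eventually_elim
    case (elim c)
    have "(c + sqrt c * z) / real k \<ge> 1" using elim k0 by (simp add: field_simps)
    then have "window_index k c z \<ge> 1" unfolding window_index_def by (simp add: le_nat_iff)
    from window_index_eq_iff[OF elim(2) k this, of z] show ?case
      by (simp add: diff_divide_distrib add_divide_distrib)
  qed
  show "eventually (\<lambda>c. z - k / sqrt c \<le> (real (window_index k c z * k) - c) / sqrt c) at_top"
    using * by eventually_elim auto
  show "eventually (\<lambda>c. (real (window_index k c z * k) - c) / sqrt c \<le> z) at_top"
    using * by eventually_elim auto
  show "((\<lambda>c. z - real k / sqrt c) \<longlongrightarrow> z) at_top" by real_asymp
qed simp

text \<open>Hypothesis \<open>L\<close> asks for the limit along every choice of indices whose
  standardised position tends to z. The proof uses it for the index of the cell containing a fixed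
  z; the Cauchy weight supplies the majorant.\<close>

lemma window_sum_limit:
  fixes a :: "real \<Rightarrow> nat \<Rightarrow> real"
  assumes k: "k \<ge> 1"
    and B: "eventually (\<lambda>c. \<forall>j\<in>window k c. \<bar>a c j\<bar> * (local_scale k c j) \<le> B) at_top"
    and L: "\<And>z f. ((\<lambda>c. (real (f c * k) - c) / sqrt c) \<longlongrightarrow> z) at_top \<Longrightarrow> ((\<lambda>c. sqrt c * a c (f c)) \<longlongrightarrow> L z) at_top"
    and Lm: "L \<in> borel_measurable borel"
  shows "((\<lambda>c. \<Sum>j\<in>window k c. a c j) \<longlongrightarrow> (\<integral>z. L z \<partial>lborel) / k) at_top"
proof -
  define s where "s = (\<lambda>c z. sqrt c * (indicator (window k c) (window_index k c z) * a c (window_index k c z)))"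
  have "((\<lambda>c. \<integral>z. s c z \<partial>lborel) \<longlongrightarrow> (\<integral>z. L z \<partial>lborel)) at_top"
  proof (rule integral_dominated_convergence_at_top[where w = "\<lambda>z. 3 * \<bar>B\<bar> * (1 / (1 + z\<^sup>2))"])
    show "L \<in> borel_measurable lborel" using Lm by simp
    show "s c \<in> borel_measurable lborel" for c
      unfolding s_def using borel_measurable_window_index[of "\<lambda>i. sqrt c * (indicator (window k c) i * a c i)"] by simp
    show "integrable lborel (\<lambda>z::real. 3 * \<bar>B\<bar> * (1 / (1 + z\<^sup>2)))"
      by (intro integrable_mult_right integrable_inverse_1_plus_square_UNIV)
    show "\<forall>\<^sub>F c in at_top. AE z in lborel. norm (s c z) \<le> 3 * \<bar>B\<bar> * (1 / (1 + z\<^sup>2))"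
      using B eventually_window[OF k]
    proof eventually_elim
      case (elim c)
      have c0: "c > 0" using elim by auto
      show ?case
      proof (rule AE_I2)
        fix z :: real
        show "norm (s c z) \<le> 3 * \<bar>B\<bar> * (1 / (1 + z\<^sup>2))"
        proof (cases "window_index k c z \<in> window k c")
          case True
          define w where "w = 1 + (real (window_index k c z * k) - c)\<^sup>2 / c"
          have w: "1 + z\<^sup>2 \<le> 3 * w" unfolding w_def
            using True elim by (intro window_index_weight c0 k) auto
          have z0: "1 + z\<^sup>2 > 0" by (simp add: add_pos_nonneg)
          have "\<bar>a c (window_index k c z)\<bar> * (sqrt c * (1 + z\<^sup>2)) \<le> \<bar>a c (window_index k c z)\<bar> * (sqrt c * (3 * w))"
            using w c0 by (intro mult_left_mono) auto
          also have "\<dots> = 3 * (\<bar>a c (window_index k c z)\<bar> * (sqrt c * w))" by simp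
          also have "\<dots> \<le> 3 * B" using elim(1) True unfolding w_def by (intro mult_left_mono) auto
          also have "\<dots> \<le> 3 * \<bar>B\<bar>" by simp
          finally have "sqrt c * \<bar>a c (window_index k c z)\<bar> \<le> 3 * \<bar>B\<bar> / (1 + z\<^sup>2)"
            using c0 z0 by (subst pos_le_divide_eq) (auto simp: mult_ac)
          then show ?thesis using True c0 by (simp add: s_def abs_mult)
        next
          case False then show ?thesis by (simp add: s_def add_nonneg_nonneg)
        qed
      qed
    qed
    show "AE z in lborel. ((\<lambda>c. s c z) \<longlongrightarrow> L z) at_top"
    proof (rule AE_I2)
      fix z
      note w = window_index_tendsto[OF k, of z]
      show "((\<lambda>c. s c z) \<longlongrightarrow> L z) at_top"
      proof (rule Lim_transform_eventually[OF L[OF w]])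
        show "\<forall>\<^sub>F c in at_top. sqrt c * a c (window_index k c z) = s c z"
          using eventually_in_window[OF k w, of 0] by eventually_elim (auto simp: s_def)
      qed
    qed
  qed
  then have "((\<lambda>c. (\<integral>z. s c z \<partial>lborel) / k) \<longlongrightarrow> (\<integral>z. L z \<partial>lborel) / k) at_top"
    using k by (intro tendsto_intros) auto
  then show ?thesis
  proof (rule Lim_transform_eventually)
    show "\<forall>\<^sub>F c in at_top. (\<integral>z. s c z \<partial>lborel) / k = (\<Sum>j\<in>window k c. a c j)"
      using eventually_window[OF k]
    proof eventually_elim
      case (elim c)
      have "c > 0" "finite (window k c)" "window k c \<subseteq> {1..}" using elim by auto
      from window_sum_as_integral[OF this(1) k this(2,3), of "a c"]
      show ?case by (simp add: s_def)
    qed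
  qed
qed

text \<open>Quantifying over all test functions inside lets a single C and a single threshold for c
  serve all block lengths at once, which the geometric bound on excursions requires.\<close>

abbreviation renewal_bounded :: "nat \<Rightarrow> real \<Rightarrow> real \<Rightarrow> bool" where
  "renewal_bounded k C c \<equiv> \<forall>\<phi> \<Phi>. (\<forall>j\<in>window k c. \<phi> j \<in> borel_measurable borel) \<longrightarrow>
     (\<forall>j\<in>window k c. \<forall>x. \<bar>\<phi> j x\<bar> \<le> \<Phi> x) \<longrightarrow> integrable lborel (\<lambda>x. (1 + x\<^sup>2) * \<Phi> x) \<longrightarrow>
     (\<Sum>j\<in>window k c. \<bar>\<integral>x. \<phi> j x * dev_density k c j x \<partial>lborel\<bar>) \<le> C * (\<integral>x. (1 + x\<^sup>2) * \<Phi> x \<partial>lborel)"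

lemma local_renewal_bound:
  assumes k: "k \<ge> 1"
  obtains C where "C > 0" "eventually (\<lambda>c. renewal_bounded k C c) at_top"
proof -
  obtain C where C: "C > 0" "eventually (\<lambda>c. \<forall>j\<in>window k c. \<forall>x.
    local_scale k c j * dev_density k c j x \<le> C * (1 + x\<^sup>2)) at_top"
    using erlang_window_bound[OF k] .
  have "eventually (\<lambda>c. renewal_bounded k (3 * pi * C / k) c) at_top"
    using C(2) window_sum_bound[OF k] eventually_gt_at_top[of 0]
  proof eventually_elim
    case (elim c)
    show ?case
    proof (intro allI impI)
      fix \<phi> :: "nat \<Rightarrow> real \<Rightarrow> real" and \<Phi>
      assume m: "\<forall>j\<in>window k c. \<phi> j \<in> borel_measurable borel"
        and le: "\<forall>j\<in>window k c. \<forall>x. \<bar>\<phi> j x\<bar> \<le> \<Phi> x" and int: "integrable lborel (\<lambda>x. (1 + x\<^sup>2) * \<Phi> x)"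
      let ?a = "\<lambda>j. \<integral>x. \<phi> j x * dev_density k c j x \<partial>lborel"
      have "\<bar>?a j\<bar> * (local_scale k c j) \<le> C * (\<integral>x. (1 + x\<^sup>2) * \<Phi> x \<partial>lborel)" if j: "j \<in> window k c" for j
      proof -
        define W where "W = local_scale k c j"
        have W: "W > 0" unfolding W_def using elim by (intro mult_pos_pos add_pos_nonneg) auto
        define g where "g = (\<lambda>x. dev_density k c j x)"
        have g0: "g x \<ge> 0" for x by (simp add: g_def)
        have gm: "g \<in> borel_measurable borel" unfolding g_def by measurable
        have Wg: "W * g x \<le> C * (1 + x\<^sup>2)" for x using elim(1) j by (simp add: W_def g_def)
        have bd: "\<bar>\<phi> j x * (W * g x)\<bar> \<le> C * ((1 + x\<^sup>2) * \<Phi> x)" for x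
        proof -
          have "\<bar>\<phi> j x * (W * g x)\<bar> = \<bar>\<phi> j x\<bar> * (W * g x)" using W g0 by (simp add: abs_mult)
          also have "\<dots> \<le> \<Phi> x * (C * (1 + x\<^sup>2))"
            by (rule mult_mono'[OF _ Wg]) (use le j W g0[of x] in auto)
          finally show ?thesis by (simp add: mult_ac)
        qed
        have "\<bar>?a j\<bar> * W = \<bar>\<integral>x. \<phi> j x * (W * g x) \<partial>lborel\<bar>"
        proof -
          have "(\<integral>x. \<phi> j x * (W * g x) \<partial>lborel) = (\<integral>x. W * (\<phi> j x * g x) \<partial>lborel)" by (simp add: mult_ac)
          also have "\<dots> = W * ?a j" by (simp add: g_def)
          finally show ?thesis using W by (simp add: abs_mult mult.commute)
        qed
        also have "\<dots> \<le> (\<integral>x. C * ((1 + x\<^sup>2) * \<Phi> x) \<partial>lborel)"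
        proof (rule order_trans[OF integral_abs_bound integral_mono])
          show "integrable lborel (\<lambda>x. C * ((1 + x\<^sup>2) * \<Phi> x))" using int by simp
          then show "integrable lborel (\<lambda>x. \<bar>\<phi> j x * (W * g x)\<bar>)"
          proof (rule Bochner_Integration.integrable_bound)
            have [measurable]: "\<phi> j \<in> borel_measurable borel" using m j by auto
            note gm [measurable]
            show "(\<lambda>x. \<bar>\<phi> j x * (W * g x)\<bar>) \<in> borel_measurable lborel" by measurable
            show "AE x in lborel. norm \<bar>\<phi> j x * (W * g x)\<bar> \<le> norm (C * ((1 + x\<^sup>2) * \<Phi> x))"
              by (auto intro: order_trans[OF bd abs_ge_self])
          qed
        qed (use bd in auto)
        also have "\<dots> = C * (\<integral>x. (1 + x\<^sup>2) * \<Phi> x \<partial>lborel)" by simp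
        finally show ?thesis by (simp add: W_def)
      qed
      then have "(\<Sum>j\<in>window k c. \<bar>?a j\<bar>) \<le> 3 * pi * (C * (\<integral>x. (1 + x\<^sup>2) * \<Phi> x \<partial>lborel)) / k"
        by (intro elim(2)[rule_format])
      then show "(\<Sum>j\<in>window k c. \<bar>?a j\<bar>) \<le> (3 * pi * C / k) * (\<integral>x. (1 + x\<^sup>2) * \<Phi> x \<partial>lborel)" by (simp add: mult_ac)
    qed
  qed
  then show ?thesis using that[of "3 * pi * C / k"] C k by simp
qed

text \<open>At position z the density times sqrt c converges to the normal density at z, whatever x
  is, so each summand contributes the integral of \<psi> times that density; integrating over z
  removes it. What is left is the uniform density 1/k of the values near the boundary.\<close>

lemma local_renewal_limit:
  fixes \<phi> :: "real \<Rightarrow> nat \<Rightarrow> real \<Rightarrow> real"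
  assumes k: "k \<ge> 1"
    and m: "\<And>c j. \<phi> c j \<in> borel_measurable borel"
    and le: "eventually (\<lambda>c. \<forall>j\<in>window k c. \<forall>x. \<bar>\<phi> c j x\<bar> \<le> \<Phi> x) at_top"
    and int: "integrable lborel (\<lambda>x. (1 + x\<^sup>2) * \<Phi> x)"
    and lim: "\<And>z f. ((\<lambda>c. (real (f c * k) - c) / sqrt c) \<longlongrightarrow> z) at_top \<Longrightarrow>
        AE x in lborel. ((\<lambda>c. \<phi> c (f c) x) \<longlongrightarrow> \<psi> x) at_top"
    and \<psi>: "\<psi> \<in> borel_measurable borel"
  shows "((\<lambda>c. \<Sum>j\<in>window k c. \<integral>x. \<phi> c j x * dev_density k c j x \<partial>lborel)
     \<longlongrightarrow> (\<integral>x. \<psi> x \<partial>lborel) / k) at_top"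
proof -
  obtain C where C: "C > 0" "eventually (\<lambda>c. \<forall>j\<in>window k c. \<forall>x.
    local_scale k c j * dev_density k c j x \<le> C * (1 + x\<^sup>2)) at_top"
    using erlang_window_bound[OF k] .
  let ?a = "\<lambda>c j. \<integral>x. \<phi> c j x * dev_density k c j x \<partial>lborel"
  define B where "B = C * (\<integral>x. (1 + x\<^sup>2) * \<Phi> x \<partial>lborel)"
  define L where "L = (\<lambda>z. (\<integral>x. \<psi> x \<partial>lborel) * (exp (- (z\<^sup>2 / 2)) / sqrt (2 * pi)))"
  have bd: "eventually (\<lambda>c. \<forall>j\<in>window k c. \<forall>x.
      \<bar>\<phi> c j x * (local_scale k c j * dev_density k c j x)\<bar> \<le> C * ((1 + x\<^sup>2) * \<Phi> x)) at_top"
    using C(2) le eventually_gt_at_top[of 0]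
  proof eventually_elim
    case (elim c)
    show ?case
    proof (intro ballI allI)
      fix j x assume j: "j \<in> window k c"
      define W where "W = local_scale k c j * dev_density k c j x"
      have W: "W \<ge> 0" unfolding W_def using elim by (intro mult_nonneg_nonneg add_nonneg_nonneg) auto
      have "\<bar>\<phi> c j x * W\<bar> = \<bar>\<phi> c j x\<bar> * W" using W by (simp add: abs_mult)
      also have "\<dots> \<le> \<Phi> x * (C * (1 + x\<^sup>2))"
        by (rule mult_mono') (use elim j W in \<open>auto simp: W_def\<close>)
      finally show "\<bar>\<phi> c j x * (local_scale k c j * dev_density k c j x)\<bar> \<le> C * ((1 + x\<^sup>2) * \<Phi> x)"
        by (simp add: W_def mult_ac)
    qed
  qed
  have intC: "integrable lborel (\<lambda>x. C * ((1 + x\<^sup>2) * \<Phi> x))" using int by simp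
  have "((\<lambda>c. \<Sum>j\<in>window k c. ?a c j) \<longlongrightarrow> (\<integral>z. L z \<partial>lborel) / k) at_top"
  proof (rule window_sum_limit[OF k])
    show "L \<in> borel_measurable borel" unfolding L_def by measurable
    show "eventually (\<lambda>c. \<forall>j\<in>window k c. \<bar>?a c j\<bar> * (local_scale k c j) \<le> B) at_top"
      using bd eventually_gt_at_top[of 0]
    proof eventually_elim
      case (elim c)
      show ?case
      proof
        fix j assume j: "j \<in> window k c"
        define W where "W = local_scale k c j"
        have W: "W > 0" unfolding W_def using elim by (intro mult_pos_pos add_pos_nonneg) auto
        define g where "g = (\<lambda>x. dev_density k c j x)"
        have gm: "g \<in> borel_measurable borel" unfolding g_def by measurable
        have bd': "\<bar>\<phi> c j x * (W * g x)\<bar> \<le> C * ((1 + x\<^sup>2) * \<Phi> x)" for x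
          using elim(1) j by (simp add: W_def g_def)
        have "\<bar>?a c j\<bar> * W = \<bar>\<integral>x. \<phi> c j x * (W * g x) \<partial>lborel\<bar>"
        proof -
          have "(\<integral>x. \<phi> c j x * (W * g x) \<partial>lborel) = (\<integral>x. W * (\<phi> c j x * g x) \<partial>lborel)" by (simp add: mult_ac)
          also have "\<dots> = W * ?a c j" by (simp add: g_def)
          finally show ?thesis using W by (simp add: abs_mult mult.commute)
        qed
        also have "\<dots> \<le> (\<integral>x. C * ((1 + x\<^sup>2) * \<Phi> x) \<partial>lborel)"
        proof (rule order_trans[OF integral_abs_bound integral_mono])
          show "integrable lborel (\<lambda>x. C * ((1 + x\<^sup>2) * \<Phi> x))" by (rule intC)
          then show "integrable lborel (\<lambda>x. \<bar>\<phi> c j x * (W * g x)\<bar>)"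
          proof (rule Bochner_Integration.integrable_bound)
            have [measurable]: "\<phi> c j \<in> borel_measurable borel" by (rule m)
            note gm [measurable]
            show "(\<lambda>x. \<bar>\<phi> c j x * (W * g x)\<bar>) \<in> borel_measurable lborel" by measurable
            show "AE x in lborel. norm \<bar>\<phi> c j x * (W * g x)\<bar> \<le> norm (C * ((1 + x\<^sup>2) * \<Phi> x))"
              by (auto intro: order_trans[OF bd' abs_ge_self])
          qed
        qed (use bd' in auto)
        finally show "\<bar>?a c j\<bar> * (local_scale k c j) \<le> B"
          by (simp add: W_def B_def)
      qed
    qed
    fix z f assume f: "((\<lambda>c. (real (f c * k) - c) / sqrt c) \<longlongrightarrow> z) at_top"
    \<comment> \<open>With n = \<open>f c * k\<close> the distance of t from the mode is x + (n / c)
      (n - c + 1) + 1; after division by sqrt N only the standardised position survives, since n / c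
      tends to 1.\<close>
    have N: "filterlim (\<lambda>c. f c * k - 1) at_top at_top" and
      ratio: "((\<lambda>c. sqrt c / sqrt (real (f c * k - 1))) \<longlongrightarrow> 1) at_top" and
      st: "((\<lambda>c. (x + boundary k c (f c) - real (f c * k - 1)) / sqrt (real (f c * k - 1))) \<longlongrightarrow> z) at_top" for x
    proof -
      define Y where "Y = (\<lambda>c. (real (f c * k) - c) / sqrt c)"
      have Y: "(Y \<longlongrightarrow> z) at_top" using f by (simp add: Y_def)
      have Yc: "((\<lambda>c. Y c / sqrt c) \<longlongrightarrow> 0) at_top"
      proof -
        have "((\<lambda>c. Y c * (1 / sqrt c)) \<longlongrightarrow> z * 0) at_top"
          by (intro tendsto_mult Y) real_asymp
        then show ?thesis by simp
      qed
      have nc: "((\<lambda>c. real (f c * k) / c) \<longlongrightarrow> 1) at_top"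
      proof (rule Lim_transform_eventually)
        show "((\<lambda>c. 1 + Y c / sqrt c) \<longlongrightarrow> 1) at_top" using Yc tendsto_add[of "\<lambda>_. 1" 1 _ _ 0] by auto
        show "eventually (\<lambda>c. 1 + Y c / sqrt c = real (f c * k) / c) at_top"
          using eventually_gt_at_top[of 0] by eventually_elim (simp add: Y_def field_simps)
      qed
      have ev: "eventually (\<lambda>c. c > 0 \<and> real (f c * k - 1) = real (f c * k) - 1 \<and> real (f c * k) \<ge> 2) at_top"
      proof -
        have "eventually (\<lambda>c. real (f c * k) / c > 1/2) at_top" using nc by (rule order_tendstoD) simp
        then show ?thesis using eventually_ge_at_top[of 4]
        proof eventually_elim
          case (elim c)
          then have "real (f c * k) \<ge> 2" by (simp add: field_simps)
          moreover then have "f c * k \<ge> 1" by (cases "f c * k = 0") auto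
          ultimately show ?case using elim by (simp add: of_nat_diff del: of_nat_mult)
        qed
      qed
      have Nc: "((\<lambda>c. real (f c * k - 1) / c) \<longlongrightarrow> 1) at_top"
      proof (rule Lim_transform_eventually)
        have "((\<lambda>c. real (f c * k) / c - 1 / c) \<longlongrightarrow> 1 - 0) at_top"
          by (intro tendsto_diff nc) real_asymp
        then show "((\<lambda>c. real (f c * k) / c - 1 / c) \<longlongrightarrow> 1) at_top" by simp
        show "eventually (\<lambda>c. real (f c * k) / c - 1 / c = real (f c * k - 1) / c) at_top"
          using ev by eventually_elim (simp add: diff_divide_distrib)
      qed
      have "filterlim (\<lambda>c. real (f c * k - 1) / c * c) at_top at_top"
        by (rule filterlim_tendsto_pos_mult_at_top[OF Nc _ filterlim_ident]) simp
      then have "filterlim (\<lambda>c. real (f c * k - 1)) at_top at_top"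
        by (rule filterlim_mono_eventually[OF _ order_refl order_refl])
           (rule eventually_mono[OF eventually_gt_at_top[of 0]], simp)
      then show "filterlim (\<lambda>c. f c * k - 1) at_top at_top"
        by (simp add: filterlim_sequentially_iff_filterlim_real)
      have "((\<lambda>c. inverse (sqrt (real (f c * k - 1) / c))) \<longlongrightarrow> inverse (sqrt 1)) at_top"
        by (intro tendsto_intros Nc) simp
      then show R: "((\<lambda>c. sqrt c / sqrt (real (f c * k - 1))) \<longlongrightarrow> 1) at_top"
        by (simp add: real_sqrt_divide)
      have "((\<lambda>c. (x / sqrt c + real (f c * k) / c * (Y c + 1 / sqrt c) + 1 / sqrt c) * (sqrt c / sqrt (real (f c * k - 1)))) \<longlongrightarrow> (0 + 1 * (z + 0) + 0) * 1) at_top"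
        by (intro tendsto_mult tendsto_add nc Y R) real_asymp+
      then have "((\<lambda>c. (x / sqrt c + real (f c * k) / c * (Y c + 1 / sqrt c) + 1 / sqrt c) * (sqrt c / sqrt (real (f c * k - 1)))) \<longlongrightarrow> z) at_top"
        by simp
      then show "((\<lambda>c. (x + boundary k c (f c) - real (f c * k - 1)) / sqrt (real (f c * k - 1))) \<longlongrightarrow> z) at_top"
      proof (rule Lim_transform_eventually)
        show "eventually (\<lambda>c. (x / sqrt c + real (f c * k) / c * (Y c + 1 / sqrt c) + 1 / sqrt c) * (sqrt c / sqrt (real (f c * k - 1))) = (x + boundary k c (f c) - real (f c * k - 1)) / sqrt (real (f c * k - 1))) at_top"
          using ev
        proof eventually_elim
          case (elim c)
          define n where "n = real (f c * k)"
          have sc: "sqrt c > 0" "sqrt c * sqrt c = c" using elim by auto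
          have "(x / sqrt c + n / c * (Y c + 1 / sqrt c) + 1 / sqrt c) * sqrt c = x + n / c * (Y c * sqrt c + 1) + 1"
            using sc by (simp add: field_simps)
          also have "Y c * sqrt c = n - c" using sc by (simp add: Y_def n_def)
          also have "x + n / c * (n - c + 1) + 1 = x + boundary k c (f c) - real (f c * k - 1)"
          proof -
            have *: "real (f c * k - 1) = n - 1" using elim unfolding n_def by blast
            show ?thesis
              using elim unfolding boundary_def * n_def[symmetric] by (simp add: field_simps)
          qed
          finally show ?case by (simp add: n_def)
        qed
      qed
    qed
    have dens: "((\<lambda>c. sqrt c * dev_density k c (f c) x) \<longlongrightarrow> exp (- (z\<^sup>2 / 2)) / sqrt (2 * pi)) at_top" for x
    proof -
      have "((\<lambda>c. (sqrt c / sqrt (real (f c * k - 1))) * (sqrt (real (f c * k - 1)) * dev_density k c (f c) x)) \<longlongrightarrow> 1 * (exp (- (z\<^sup>2 / 2)) / sqrt (2 * pi))) at_top"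
        by (intro tendsto_mult ratio erlang_local_limit N st)
      then have "((\<lambda>c. (sqrt c / sqrt (real (f c * k - 1))) * (sqrt (real (f c * k - 1)) * dev_density k c (f c) x)) \<longlongrightarrow> exp (- (z\<^sup>2 / 2)) / sqrt (2 * pi)) at_top"
        by simp
      then show ?thesis
      proof (rule Lim_transform_eventually)
        have "eventually (\<lambda>c. f c * k - 1 \<ge> 1) at_top" using N by (simp add: filterlim_at_top)
        then show "eventually (\<lambda>c. (sqrt c / sqrt (real (f c * k - 1))) * (sqrt (real (f c * k - 1)) * dev_density k c (f c) x) = sqrt c * dev_density k c (f c) x) at_top"
          by eventually_elim simp
      qed
    qed
    have "((\<lambda>c. \<integral>x. \<phi> c (f c) x * (sqrt c * dev_density k c (f c) x) \<partial>lborel) \<longlongrightarrow>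
        (\<integral>x. \<psi> x * (exp (- (z\<^sup>2 / 2)) / sqrt (2 * pi)) \<partial>lborel)) at_top"
    proof (rule integral_dominated_convergence_at_top[OF _ _ intC])
      show "(\<lambda>x. \<psi> x * (exp (- (z\<^sup>2 / 2)) / sqrt (2 * pi))) \<in> borel_measurable lborel"
        using \<psi> by simp
      show "(\<lambda>x. \<phi> c (f c) x * (sqrt c * dev_density k c (f c) x)) \<in> borel_measurable lborel" for c
        using m by measurable
      show "AE x in lborel. ((\<lambda>c. \<phi> c (f c) x * (sqrt c * dev_density k c (f c) x)) \<longlongrightarrow> \<psi> x * (exp (- (z\<^sup>2 / 2)) / sqrt (2 * pi))) at_top"
        using lim[OF f] by eventually_elim (intro tendsto_mult dens)
      show "\<forall>\<^sub>F c in at_top. AE x in lborel. norm (\<phi> c (f c) x * (sqrt c * dev_density k c (f c) x)) \<le> C * ((1 + x\<^sup>2) * \<Phi> x)"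
        using bd eventually_in_window[OF k f, of 0] eventually_gt_at_top[of 0]
      proof eventually_elim
        case (elim c)
        show ?case
        proof (rule AE_I2)
          fix x
          define g where "g = dev_density k c (f c) x"
          define y where "y = (real (f c * k) - c)\<^sup>2 / c"
          have y: "y \<ge> 0" "g \<ge> 0" using elim by (auto simp: y_def g_def)
          have "\<bar>\<phi> c (f c) x * (sqrt c * g)\<bar> * 1 \<le> \<bar>\<phi> c (f c) x * (sqrt c * g)\<bar> * (1 + y)"
            using y by (intro mult_left_mono) auto
          also have "\<dots> = \<bar>\<phi> c (f c) x * (sqrt c * (1 + y) * g)\<bar>" using y elim by (simp add: abs_mult)
          also have "\<dots> \<le> C * ((1 + x\<^sup>2) * \<Phi> x)" using elim by (auto simp: y_def g_def)
          finally show "norm (\<phi> c (f c) x * (sqrt c * dev_density k c (f c) x)) \<le> C * ((1 + x\<^sup>2) * \<Phi> x)"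
            by (simp add: g_def)
        qed
      qed
    qed
    moreover have "(\<integral>x. \<phi> c (f c) x * (sqrt c * dev_density k c (f c) x) \<partial>lborel) = sqrt c * ?a c (f c)" for c
    proof -
      have "(\<integral>x. \<phi> c (f c) x * (sqrt c * dev_density k c (f c) x) \<partial>lborel) =
        (\<integral>x. sqrt c * (\<phi> c (f c) x * dev_density k c (f c) x) \<partial>lborel)" by (simp add: mult_ac)
      then show ?thesis by simp
    qed
    moreover have "(\<integral>x. \<psi> x * (exp (- (z\<^sup>2 / 2)) / sqrt (2 * pi)) \<partial>lborel) = L z"
      unfolding L_def by (rule integral_mult_left_zero)
    ultimately show "((\<lambda>c. sqrt c * ?a c (f c)) \<longlongrightarrow> L z) at_top" by simp
  qed
  moreover have "(\<integral>z. L z \<partial>lborel) = (\<integral>x. \<psi> x \<partial>lborel)"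
  proof -
    have "(\<integral>z. L z \<partial>lborel) = (\<integral>x. \<psi> x \<partial>lborel) * (\<integral>z. exp (- (z\<^sup>2 / 2)) / sqrt (2 * pi) \<partial>lborel)"
      unfolding L_def by (rule integral_mult_right_zero)
    also have "(\<integral>(z::real). exp (- (z\<^sup>2 / 2)) / sqrt (2 * pi) \<partial>lborel) = (\<integral>(z::real). exp (- (z\<^sup>2 / 2)) \<partial>lborel) / sqrt (2 * pi)"
      by (rule integral_divide_zero)
    finally show ?thesis by (simp add: gauss_integral)
  qed
  ultimately show ?thesis by simp
qed

section \<open>Random walks with Erlang steps\<close>

locale erlang_walk = prob_space M for M :: "'a measure" +
  fixes G :: "nat \<Rightarrow> 'a \<Rightarrow> real" and k :: nat
  assumes k_ge_1: "k \<ge> 1"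
    and indep_G: "indep_vars (\<lambda>_. borel) G UNIV"
    and distributed_G: "\<And>i. distributed M lborel (G i) (erlang_density (k - 1) 1)"
begin

definition walk :: "nat \<Rightarrow> 'a \<Rightarrow> real" where
  "walk j \<omega> = (\<Sum>i<j. G i \<omega>)"

definition dev :: "real \<Rightarrow> nat \<Rightarrow> 'a \<Rightarrow> real" where
  "dev c j \<omega> = walk j \<omega> - boundary k c j"

definition future :: "nat \<Rightarrow> nat \<Rightarrow> 'a \<Rightarrow> nat \<Rightarrow> real" where
  "future l j \<omega> = (\<lambda>p\<in>{..<l}. G (j + p) \<omega>)"

definition step_law :: "real measure" where
  "step_law = density lborel (erlang_density (k - 1) 1)"

definition block_law :: "nat \<Rightarrow> (nat \<Rightarrow> real) measure" where
  "block_law l = PiM {..<l} (\<lambda>_. step_law)"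

lemma G_measurable [measurable]: "G i \<in> borel_measurable M"
  using distributed_G[of i] by (simp add: distributed_def)

lemma walk_measurable [measurable]: "walk j \<in> borel_measurable M"
  unfolding walk_def by measurable

lemma dev_measurable [measurable]: "dev c j \<in> borel_measurable M"
  unfolding dev_def by measurable

lemma sets_step_law [measurable_cong]: "sets step_law = sets borel"
  by (simp add: step_law_def)

lemma sets_block_law: "sets (block_law l) = sets (PiM {..<l} (\<lambda>_. borel))"
  unfolding block_law_def by (intro sets_PiM_cong) (auto simp: sets_step_law)

lemma prob_space_step_law: "prob_space step_law"
  unfolding step_law_def by (rule prob_space_erlang_density) simp

lemma prob_space_block_law: "prob_space (block_law l)"
  unfolding block_law_def by (intro prob_space_PiM prob_space_step_law)

lemma future_measurable [measurable]: "future l j \<in> M \<rightarrow>\<^sub>M PiM {..<l} (\<lambda>_. borel)"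
  unfolding future_def by measurable

lemma distr_G: "distr M borel (G i) = step_law"
  using distributed_distr_eq_density[OF distributed_G[of i]]
  by (simp add: step_law_def cong: distr_cong)

lemma indep_shifted: "indep_vars (\<lambda>_. borel) (\<lambda>p. G (j + p)) {..<l}"
proof -
  have "indep_vars (\<lambda>p. PiM {j + p} (\<lambda>_. borel)) (\<lambda>p \<omega>. restrict (\<lambda>i. G i \<omega>) {j + p}) {..<l}"
    by (rule indep_vars_restrict[OF indep_G]) (auto simp: disjoint_family_on_def)
  then have "indep_vars (\<lambda>_. borel) (\<lambda>p \<omega>. (\<lambda>w. w (j + p)) (restrict (\<lambda>i. G i \<omega>) {j + p})) {..<l}"
    by (rule indep_vars_compose2) (auto intro: measurable_component_singleton)
  then show ?thesis by simp
qed

lemma distr_future: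
  assumes "l \<ge> 1"
  shows "distr M (PiM {..<l} (\<lambda>_. borel)) (future l j) = block_law l"
proof -
  have "{..<l} \<noteq> {}" using assms by (auto simp: lessThan_empty_iff)
  from indep_vars_iff_distr_eq_PiM[OF this, where M' = "\<lambda>_. borel" and X = "\<lambda>p. G (j + p)"] indep_shifted[of j l]
  show ?thesis by (simp add: future_def[abs_def] block_law_def distr_G)
qed

lemma walk_distributed:
  assumes "j \<ge> 1"
  shows "distributed M lborel (walk j) (erlang_density (j * k - 1) 1)"
proof -
  have "distributed M lborel (\<lambda>\<omega>. \<Sum>i\<in>{..<j}. G i \<omega>) (erlang_density ((\<Sum>i\<in>{..<j}. Suc (k - 1)) - 1) 1)"
    using assms by (intro erlang_distributed_sum distributed_G indep_vars_subset[OF indep_G])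
      (auto simp: lessThan_empty_iff)
  then show ?thesis using k_ge_1 by (simp add: walk_def[abs_def])
qed

lemma dev_distributed:
  assumes "j \<ge> 1"
  shows "distributed M lborel (dev c j) (\<lambda>x. dev_density k c j x)"
  using distributed_affine[OF walk_distributed[OF assms], of 1 "- boundary k c j"]
  by (simp add: dev_def[abs_def] divide_ennreal_def)

text \<open>\<open>dev c j\<close> uses the steps before j and \<open>future l j\<close> those from
  j on. The law of the block depends on neither j nor c, which permits exchanging the sum over j
  with the integral over blocks.\<close>

lemma distr_future_dev:
  assumes "l \<ge> 1" "j \<ge> 1"
  shows "distr M (PiM {..<l} (\<lambda>_. borel) \<Otimes>\<^sub>M borel) (\<lambda>\<omega>. (future l j \<omega>, dev c j \<omega>)) =
    block_law l \<Otimes>\<^sub>M density lborel (\<lambda>x. dev_density k c j x)"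
proof -
  let ?A = "PiM {j..<j+l} (\<lambda>_. borel :: real measure)" and ?B = "PiM {..<j} (\<lambda>_. borel :: real measure)"
  let ?S = "PiM {..<l} (\<lambda>_. borel :: real measure)"
  define r1 where "r1 = (\<lambda>\<omega>. restrict (\<lambda>i. G i \<omega>) {j..<j+l})"
  define r2 where "r2 = (\<lambda>\<omega>. restrict (\<lambda>i. G i \<omega>) {..<j})"
  define F where "F = (\<lambda>w. \<lambda>p\<in>{..<l}. w (j + p) :: real)"
  define D where "D = (\<lambda>w. (\<Sum>i<j. w i) - boundary k c j)"
  have F: "F \<in> ?A \<rightarrow>\<^sub>M ?S"
    unfolding F_def by (intro measurable_restrict measurable_component_singleton) auto
  have D: "D \<in> ?B \<rightarrow>\<^sub>M borel"
    unfolding D_def by (intro borel_measurable_diff borel_measurable_sum measurable_component_singleton) auto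
  have r1: "r1 \<in> M \<rightarrow>\<^sub>M ?A" and r2: "r2 \<in> M \<rightarrow>\<^sub>M ?B"
    unfolding r1_def r2_def by measurable
  have F_r1: "F (r1 \<omega>) = future l j \<omega>" and D_r2: "D (r2 \<omega>) = dev c j \<omega>" for \<omega>
    by (auto simp: fun_eq_iff future_def F_def r1_def D_def r2_def dev_def walk_def)
  have "indep_var ?A r1 ?B r2"
    unfolding r1_def r2_def by (rule indep_var_restrict[OF indep_G]) auto
  then have eq: "distr M (?A \<Otimes>\<^sub>M ?B) (\<lambda>\<omega>. (r1 \<omega>, r2 \<omega>)) = distr M ?A r1 \<Otimes>\<^sub>M distr M ?B r2"
    by (simp add: indep_var_distribution_eq)
  have future: "distr (distr M ?A r1) ?S F = block_law l"
    using F r1 distr_future[OF assms(1), of j] by (simp add: distr_distr comp_def F_r1)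
  have dev: "distr (distr M ?B r2) borel D = density lborel (\<lambda>x. dev_density k c j x)"
    using D r2 distributed_distr_eq_density[OF dev_distributed[OF assms(2)]]
    by (simp add: distr_distr comp_def D_r2 cong: distr_cong)
  have "prob_space (distr (distr M ?B r2) borel D)"
    using r2 D by (intro prob_space.prob_space_distr prob_space_distr) auto
  then have "sigma_finite_measure (distr (distr M ?B r2) borel D)"
    by (simp add: prob_space_imp_sigma_finite)
  then have "distr (distr M ?A r1) ?S F \<Otimes>\<^sub>M distr (distr M ?B r2) borel D =
      distr (distr M ?A r1 \<Otimes>\<^sub>M distr M ?B r2) (?S \<Otimes>\<^sub>M borel) (\<lambda>(x, y). (F x, D y))"
    using F D by (intro pair_measure_distr) auto
  also have "\<dots> = distr M (?S \<Otimes>\<^sub>M borel) ((\<lambda>(x, y). (F x, D y)) \<circ> (\<lambda>\<omega>. (r1 \<omega>, r2 \<omega>)))"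
    unfolding eq[symmetric]
  proof (rule distr_distr)
    show "(\<lambda>(x, y). (F x, D y)) \<in> ?A \<Otimes>\<^sub>M ?B \<rightarrow>\<^sub>M ?S \<Otimes>\<^sub>M borel"
      using F D by measurable
    show "(\<lambda>\<omega>. (r1 \<omega>, r2 \<omega>)) \<in> M \<rightarrow>\<^sub>M ?A \<Otimes>\<^sub>M ?B"
      using r1 r2 by measurable
  qed
  finally show ?thesis
    unfolding future dev by (simp add: comp_def F_r1 D_r2)
qed

text \<open>Fubini with the block outside: for a fixed block v the inner integral is one against the
  explicit density of \<open>dev c j\<close>, the object of the local renewal theorem.\<close>

lemma
  assumes l: "l \<ge> 1" and j: "j \<ge> 1"
    and H[measurable]: "(\<lambda>(v, x). H v x) \<in> borel_measurable (PiM {..<l} (\<lambda>_. borel) \<Otimes>\<^sub>M borel)"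
    and int: "integrable M (\<lambda>\<omega>. H (future l j \<omega>) (dev c j \<omega>))"
  shows expectation_future_dev: "expectation (\<lambda>\<omega>. H (future l j \<omega>) (dev c j \<omega>)) =
      (\<integral>v. (\<integral>x. H v x * dev_density k c j x \<partial>lborel) \<partial>block_law l)"
    and integrable_future_dev: "integrable (block_law l) (\<lambda>v. \<integral>x. H v x * dev_density k c j x \<partial>lborel)"
proof -
  define \<alpha> where "\<alpha> = density lborel (\<lambda>x. dev_density k c j x)"
  have law: "distr M (PiM {..<l} (\<lambda>_. borel) \<Otimes>\<^sub>M borel) (\<lambda>\<omega>. (future l j \<omega>, dev c j \<omega>)) = block_law l \<Otimes>\<^sub>M \<alpha>"
    unfolding \<alpha>_def by (rule distr_future_dev[OF l j])
  interpret Q: prob_space "block_law l" by (rule prob_space_block_law)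
  have "prob_space \<alpha>"
  proof -
    have "\<alpha> = distr M borel (dev c j)"
      using distributed_distr_eq_density[OF dev_distributed[OF j]] by (simp add: \<alpha>_def cong: distr_cong)
    then show ?thesis by (simp add: prob_space_distr)
  qed
  then interpret A: prob_space \<alpha> .
  interpret P: pair_sigma_finite "block_law l" \<alpha> ..
  have int2: "integrable (block_law l \<Otimes>\<^sub>M \<alpha>) (\<lambda>(v, x). H v x)"
    unfolding law[symmetric] using int by (subst integrable_distr_eq) (auto simp: case_prod_beta)
  have eq: "(\<integral>x. H v x \<partial>\<alpha>) = (\<integral>x. H v x * dev_density k c j x \<partial>lborel)" if v: "v \<in> space (block_law l)" for v
  proof -
    have "v \<in> space (PiM {..<l} (\<lambda>_. borel :: real measure))"
      using v sets_block_law[of l] by (metis sets_eq_imp_space_eq)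
    then have [measurable]: "(\<lambda>x. H v x) \<in> borel_measurable borel"
      using measurable_Pair2[OF H] by simp
    show ?thesis unfolding \<alpha>_def
      by (subst integral_real_density) (auto simp: mult.commute)
  qed
  have "expectation (\<lambda>\<omega>. H (future l j \<omega>) (dev c j \<omega>)) = integral\<^sup>L (block_law l \<Otimes>\<^sub>M \<alpha>) (\<lambda>(v, x). H v x)"
    unfolding law[symmetric] by (subst integral_distr) (auto simp: case_prod_beta)
  also have "\<dots> = (\<integral>v. (\<integral>x. H v x \<partial>\<alpha>) \<partial>block_law l)"
    using P.integral_fst'[OF int2] by simp
  also have "\<dots> = (\<integral>v. (\<integral>x. H v x * dev_density k c j x \<partial>lborel) \<partial>block_law l)"
    by (intro Bochner_Integration.integral_cong refl eq)
  finally show "expectation (\<lambda>\<omega>. H (future l j \<omega>) (dev c j \<omega>)) =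
      (\<integral>v. (\<integral>x. H v x * dev_density k c j x \<partial>lborel) \<partial>block_law l)" .
  have "integrable (block_law l) (\<lambda>v. \<integral>x. H v x \<partial>\<alpha>)"
    using P.integrable_fst'[OF int2] by simp
  then show "integrable (block_law l) (\<lambda>v. \<integral>x. H v x * dev_density k c j x \<partial>lborel)"
    by (subst (asm) Bochner_Integration.integrable_cong[OF refl eq])
qed

lemma integrable_block_law_iff:
  fixes f :: "(nat \<Rightarrow> real) \<Rightarrow> real"
  assumes "l \<ge> 1" "f \<in> borel_measurable (PiM {..<l} (\<lambda>_. borel))"
  shows "integrable (block_law l) f \<longleftrightarrow> integrable M (\<lambda>\<omega>. f (future l j \<omega>))"
  unfolding distr_future[OF assms(1), of j, symmetric] by (rule integrable_distr_eq[OF future_measurable assms(2)])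

lemma integral_block_law:
  fixes f :: "(nat \<Rightarrow> real) \<Rightarrow> real"
  assumes "l \<ge> 1" "f \<in> borel_measurable (PiM {..<l} (\<lambda>_. borel))"
  shows "(\<integral>v. f v \<partial>block_law l) = expectation (\<lambda>\<omega>. f (future l j \<omega>) :: real)"
  unfolding distr_future[OF assms(1), of j, symmetric] by (rule integral_distr[OF future_measurable assms(2)])

lemma AE_G_nonneg: "AE \<omega> in M. \<forall>i. G i \<omega> \<ge> 0"
  unfolding AE_all_countable
proof
  fix i
  show "AE \<omega> in M. G i \<omega> \<ge> 0"
    by (subst distributed_AE2[OF distributed_G]) (auto simp: erlang_density_def)
qed

section \<open>Exponential and polynomial moments of the walk\<close>

lemma has_mgf_walk:
  assumes t: "t < 1"
  shows "has_bochner_integral M (\<lambda>\<omega>. exp (t * walk j \<omega>)) ((1 - t) powr (- real (j * k)))"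
proof (cases "j = 0")
  case True
  then show ?thesis using t by (simp add: walk_def has_bochner_integral_iff prob_space)
next
  case False
  then have jk: "j * k \<ge> 1" using k_ge_1 by simp
  define n where "n = j * k - 1"
  have n: "Suc n = j * k" using jk by (simp add: n_def)
  show ?thesis
  proof (rule has_bochner_integral_nn_integral)
    have "(\<integral>\<^sup>+\<omega>. ennreal (exp (t * walk j \<omega>)) \<partial>M) = (\<integral>\<^sup>+x. ennreal (erlang_density n 1 x) * ennreal (exp (t * x)) \<partial>lborel)"
      using walk_distributed[of j] False
      by (subst distributed_nn_integral[where X="walk j" and M=M]) (auto simp: n_def)
    also have "\<dots> = (\<integral>\<^sup>+x. ennreal ((1 - t) powr (- real (j * k))) * ennreal (erlang_density n (1 - t) x) \<partial>lborel)"
    proof (rule nn_integral_cong)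
      fix x
      \<comment> \<open>Exponential tilting turns the density of rate 1 into a multiple of the one
        of rate 1 - t, with the same shape.\<close>
      have "erlang_density n 1 x * exp (t * x) = (1 - t) powr (- real (j * k)) * erlang_density n (1 - t) x"
      proof -
        have "exp (- (1 - t) * x) = exp (- x) * exp (t * x)" by (simp flip: exp_add add: algebra_simps)
        then show ?thesis
          using t unfolding n[symmetric] erlang_density_def
          by (simp add: powr_minus powr_realpow field_simps del: of_nat_Suc power_Suc)
      qed
      then show "ennreal (erlang_density n 1 x) * ennreal (exp (t * x)) = ennreal ((1 - t) powr (- real (j * k))) * ennreal (erlang_density n (1 - t) x)"
        using t by (simp flip: ennreal_mult')
    qed
    also have "\<dots> = ennreal ((1 - t) powr (- real (j * k))) * (\<integral>\<^sup>+x. ennreal (erlang_density n (1 - t) x) \<partial>lborel)"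
      by (rule nn_integral_cmult) simp
    also have "(\<integral>\<^sup>+x. ennreal (erlang_density n (1 - t) x) \<partial>lborel) = 1"
      using nn_integral_erlang_ith_moment[of "1 - t" n 0] t by simp
    finally show "(\<integral>\<^sup>+\<omega>. ennreal (exp (t * walk j \<omega>)) \<partial>M) = ennreal ((1 - t) powr (- real (j * k)))" by simp
  qed auto
qed

lemma walk_moments:
  shows "integrable M (walk j)" "integrable M (\<lambda>\<omega>. (walk j \<omega>)\<^sup>2)"
    "expectation (walk j) = real (j * k)" "expectation (\<lambda>\<omega>. (walk j \<omega>)\<^sup>2) = real (j * k) * (real (j * k) + 1)"
proof -
  consider "j = 0" | "j \<ge> 1" by linarith
  then have "integrable M (walk j) \<and> integrable M (\<lambda>\<omega>. (walk j \<omega>)\<^sup>2) \<and>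
    expectation (walk j) = real (j * k) \<and> expectation (\<lambda>\<omega>. (walk j \<omega>)\<^sup>2) = real (j * k) * (real (j * k) + 1)"
  proof cases
    case 1 then show ?thesis by (simp add: walk_def[abs_def])
  next
    case 2
    define n where "n = j * k - 1"
    have n: "j * k = Suc n" using 2 k_ge_1 by (simp add: n_def)
    have d: "distributed M lborel (walk j) (erlang_density n 1)"
      using walk_distributed[OF 2] by (simp add: n_def)
    have f1: "fact (n + 1) / (fact n * 1 ^ 1) = real n + 1" by simp
    have "fact (n + 2) = (fact n :: real) * ((real n + 1) * (real n + 2))"
      by (simp add: numeral_2_eq_2 algebra_simps)
    then have f2: "fact (n + 2) / (fact n * 1 ^ 2) = (real n + 1) * (real n + 2)" by simp
    show ?thesis
      using erlang_ith_moment_integrable[OF _ d, of 1] erlang_ith_moment_integrable[OF _ d, of 2]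
        erlang_ith_moment[OF _ d, of 1] erlang_ith_moment[OF _ d, of 2] unfolding n f1 f2
      by (simp add: algebra_simps)
  qed
  then show "integrable M (walk j)" "integrable M (\<lambda>\<omega>. (walk j \<omega>)\<^sup>2)"
    "expectation (walk j) = real (j * k)" "expectation (\<lambda>\<omega>. (walk j \<omega>)\<^sup>2) = real (j * k) * (real (j * k) + 1)"
    by auto
qed

lemma sum_future: "(\<Sum>p<l. future l j \<omega> p) = (\<Sum>p<l. G (j + p) \<omega>)"
  by (simp add: future_def)

lemma walk_add: "walk (j + l) \<omega> = walk j \<omega> + (\<Sum>p<l. G (j + p) \<omega>)"
  unfolding walk_def by (induction l) (auto simp: algebra_simps)

lemma dev_add: "q \<le> l \<Longrightarrow> dev c (j + q) \<omega> = dev c j \<omega> + (\<Sum>p<q. future l j \<omega> p) - (boundary k c (j + q) - boundary k c j)"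
  by (simp add: dev_def walk_add future_def)

lemma block_sum_measurable [measurable]:
  fixes q l :: nat
  shows "q \<le> l \<Longrightarrow> (\<lambda>v. \<Sum>p<q. v p) \<in> borel_measurable (PiM {..<l} (\<lambda>_. borel :: real measure))"
  by (intro borel_measurable_sum measurable_component_singleton) auto

lemma sum_future_0: "(\<Sum>p<l. future l 0 \<omega> p) = walk l \<omega>"
  by (simp add: sum_future walk_def)

section \<open>Integrals over blocks of steps, and the renewal limit for their functionals\<close>

lemma integrable_exp_block:
  assumes "l \<ge> 1" "t < 1"
  shows "integrable (block_law l) (\<lambda>v. exp (t * (\<Sum>p<l. v p)))"
    "(\<integral>v. exp (t * (\<Sum>p<l. v p)) \<partial>block_law l) = (1 - t) powr (- real (l * k))"
proof -
  show "integrable (block_law l) (\<lambda>v. exp (t * (\<Sum>p<l. v p)))"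
    using has_mgf_walk[OF assms(2), of l] assms
    by (subst integrable_block_law_iff[where j=0]) (auto simp: sum_future_0 has_bochner_integral_iff)
  show "(\<integral>v. exp (t * (\<Sum>p<l. v p)) \<partial>block_law l) = (1 - t) powr (- real (l * k))"
    using has_mgf_walk[OF assms(2), of l] assms
    by (subst integral_block_law[where j=0]) (auto simp: sum_future_0 has_bochner_integral_iff)
qed

text \<open>Given the block v, the functionals of interest vanish when the starting height exceeds
  this radius in absolute value. The 4 k bounds one increment of the boundary inside the window; the
  1 makes the radius at least 1, so that its powers are ordered.\<close>

definition block_radius :: "nat \<Rightarrow> (nat \<Rightarrow> real) \<Rightarrow> real" where
  "block_radius l v = (\<Sum>p<l. \<bar>v p\<bar>) + 4 * real k + 1"

lemma block_radius_ge_1: "block_radius l v \<ge> 1"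
  by (simp add: block_radius_def sum_nonneg)

lemma block_radius_measurable [measurable]: "block_radius l \<in> borel_measurable (PiM {..<l} (\<lambda>_. borel))"
  unfolding block_radius_def by (intro borel_measurable_add borel_measurable_sum borel_measurable_abs measurable_component_singleton) auto

text \<open>The fourth power is what the weight 1 + x^2 produces on an interval of half length R for
  a function of height R, see \<open>integral_indicator_weight_le\<close>.\<close>

lemma integrable_block_radius:
  assumes "l \<ge> 1"
  shows "integrable (block_law l) (\<lambda>v. (block_radius l v) ^ 4)"
proof -
  have "integrable M (\<lambda>\<omega>. (block_radius l (future l 0 \<omega>)) ^ 4)"
  proof (rule Bochner_Integration.integrable_bound)
    \<comment> \<open>4096 = 8^4: with y half the radius, (y / 4)^4 <= exp y, and the radius is 8
      times y / 4.\<close>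
    show "integrable M (\<lambda>\<omega>. 4096 * exp ((4 * real k + 1) / 2) * exp (1/2 * walk l \<omega>))"
      using has_mgf_walk[of "1/2" l] by (simp add: has_bochner_integral_iff)
    show "AE \<omega> in M. norm (block_radius l (future l 0 \<omega>) ^ 4) \<le> norm (4096 * exp ((4 * real k + 1) / 2) * exp (1 / 2 * walk l \<omega>))"
      using AE_G_nonneg
    proof eventually_elim
      case (elim \<omega>)
      define y where "y = block_radius l (future l 0 \<omega>) / 2"
      have y0: "y \<ge> 0" using block_radius_ge_1[of l "future l 0 \<omega>"] by (simp add: y_def)
      have "(y / 4) ^ 4 \<le> exp (y / 4) ^ 4"
        using y0 exp_ge_add_one_self[of "y / 4"] by (intro power_mono) linarith+
      also have "\<dots> = exp y" by (simp flip: exp_of_nat_mult)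
      finally have "block_radius l (future l 0 \<omega>) ^ 4 \<le> 4096 * exp y"
        by (simp add: y_def power_divide)
      also have "y = (4 * real k + 1) / 2 + 1/2 * walk l \<omega>"
        using elim by (simp add: y_def block_radius_def walk_def future_def field_simps)
      finally show ?case by (simp add: exp_add)
    qed
  qed measurable
  then show ?thesis using assms by (subst integrable_block_law_iff[where j=0]) auto
qed

lemma integrable_block_radius1:
  assumes "l \<ge> 1"
  shows "integrable (block_law l) (block_radius l)"
proof (rule Bochner_Integration.integrable_bound[OF integrable_block_radius[OF assms]])
  show "block_radius l \<in> borel_measurable (block_law l)"
    using block_radius_measurable by (simp cong: measurable_cong_sets add: sets_block_law)
  show "AE v in block_law l. norm (block_radius l v) \<le> norm (block_radius l v ^ 4)"
    using self_le_power[OF block_radius_ge_1, of 4] block_radius_ge_1[of l]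
    by (intro AE_I2) (simp add: abs_of_nonneg order_trans[OF zero_le_one])
qed

lemma integrable_indicator_weight:
  fixes R :: real
  shows "integrable lborel (\<lambda>x::real. (1 + x\<^sup>2) * (R * indicator {-R..R} x))"
proof -
  have "integrable lborel (\<lambda>x. indicator {-R..R} x *\<^sub>R ((1 + x\<^sup>2) * R))"
    by (rule borel_integrable_compact) (auto intro!: continuous_intros)
  then show ?thesis by (simp add: mult_ac)
qed

lemma integral_indicator_weight_le:
  fixes R :: real
  assumes "R \<ge> 1"
  shows "(\<integral>x. (1 + x\<^sup>2) * (R * indicator {-R..R} x) \<partial>lborel) \<le> 4 * R ^ 4"
proof -
  have "(\<integral>x. (1 + x\<^sup>2) * (R * indicator {-R..R} x) \<partial>lborel) \<le> (\<integral>x. (2 * R ^ 3) * indicator {-R..R} x \<partial>lborel)"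
  proof (rule integral_mono[OF integrable_indicator_weight])
    show "integrable lborel (\<lambda>x. (2 * R ^ 3) * indicator {-R..R} x)"
      by (intro integrable_mult_right integrable_real_indicator) (auto simp: emeasure_lborel_Icc_eq)
    fix x :: real
    show "(1 + x\<^sup>2) * (R * indicator {-R..R} x) \<le> 2 * R ^ 3 * indicator {-R..R} x"
    proof (cases "x \<in> {-R..R}")
      case True
      then have "x\<^sup>2 \<le> R\<^sup>2" using assms by (auto simp: abs_le_iff power2_le_iff_abs_le)
      moreover have "1 \<le> R\<^sup>2" using assms by simp
      ultimately have "1 + x\<^sup>2 \<le> 2 * R\<^sup>2" by linarith
      then have "(1 + x\<^sup>2) * R \<le> (2 * R\<^sup>2) * R" using assms by (intro mult_right_mono) auto
      then show ?thesis using True by (simp add: power2_eq_square power3_eq_cube)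
    qed simp
  qed
  also have "\<dots> = 4 * R ^ 4" using assms by (simp add: eval_nat_numeral)
  finally show ?thesis .
qed

text \<open>For a fixed block the sum over j converges by \<open>local_renewal_limit\<close>; the
  blocks are then integrated by dominated convergence, with a multiple of the fourth power of the
  radius as majorant.\<close>

lemma renewal_sum_limit:
  fixes H :: "real \<Rightarrow> nat \<Rightarrow> (nat \<Rightarrow> real) \<Rightarrow> real \<Rightarrow> real"
  assumes l: "l \<ge> 1"
    and H[measurable]: "\<And>c j. (\<lambda>(v, x). H c j v x) \<in> borel_measurable (PiM {..<l} (\<lambda>_. borel) \<Otimes>\<^sub>M borel)"
    and H0[measurable]: "(\<lambda>(v, x). H0 v x) \<in> borel_measurable (PiM {..<l} (\<lambda>_. borel) \<Otimes>\<^sub>M borel)"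
    and bd: "eventually (\<lambda>c. \<forall>j\<in>window k c. \<forall>v x. \<bar>H c j v x\<bar> \<le> block_radius l v * indicator {- block_radius l v..block_radius l v} x) at_top"
    and lim: "\<And>z f v. ((\<lambda>c. (real (f c * k) - c) / sqrt c) \<longlongrightarrow> z) at_top \<Longrightarrow>
        AE x in lborel. ((\<lambda>c. H c (f c) v x) \<longlongrightarrow> H0 v x) at_top"
  shows "((\<lambda>c. \<Sum>j\<in>window k c. expectation (\<lambda>\<omega>. H c j (future l j \<omega>) (dev c j \<omega>)))
     \<longlongrightarrow> (\<integral>v. (\<integral>x. H0 v x \<partial>lborel) \<partial>block_law l) / k) at_top"
proof -
  interpret Q: prob_space "block_law l" by (rule prob_space_block_law)
  \<comment> \<open>The hypothesis \<open>bd\<close> holds only for large c. Replacing H by 0 where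
    it fails makes every later integral finite for all c without affecting the limit.\<close>
  define Hc where "Hc = (\<lambda>c j v x. if j \<in> window k c \<and> (\<forall>j\<in>window k c. \<forall>v x. \<bar>H c j v x\<bar> \<le> block_radius l v * indicator {- block_radius l v..block_radius l v} x) then H c j v x else 0)"
  have Hcm[measurable]: "(\<lambda>(v, x). Hc c j v x) \<in> borel_measurable (PiM {..<l} (\<lambda>_. borel) \<Otimes>\<^sub>M borel)" for c j
    unfolding Hc_def by (cases "j \<in> window k c \<and> (\<forall>j\<in>window k c. \<forall>v x. \<bar>H c j v x\<bar> \<le> block_radius l v * indicator {- block_radius l v..block_radius l v} x)") (simp_all only: if_True if_False, measurable)
  have Hc_le: "\<bar>Hc c j v x\<bar> \<le> block_radius l v * indicator {- block_radius l v..block_radius l v} x" for c j v x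
    using block_radius_ge_1[of l v] by (auto simp: Hc_def)
  have Hc_le': "\<bar>Hc c j v x\<bar> \<le> block_radius l v" for c j v x
    using Hc_le[of c j v x] block_radius_ge_1[of l v]
    by (cases "x \<in> {- block_radius l v..block_radius l v}") simp_all
  have R_int: "integrable (block_law l) (\<lambda>v. block_radius l v)"
    using integrable_block_radius1[OF l] .
  define g where "g = (\<lambda>c j x. dev_density k c j x)"
  define B where "B = (\<lambda>c v. \<Sum>j\<in>window k c. \<integral>x. Hc c j v x * g c j x \<partial>lborel)"
  have Hc_int: "integrable M (\<lambda>\<omega>. Hc c j (future l j \<omega>) (dev c j \<omega>))" for c j
  proof (rule Bochner_Integration.integrable_bound)
    show "integrable M (\<lambda>\<omega>. block_radius l (future l j \<omega>))"
      using R_int l by (subst (asm) integrable_block_law_iff) auto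
    show "(\<lambda>\<omega>. Hc c j (future l j \<omega>) (dev c j \<omega>)) \<in> borel_measurable M"
      using measurable_compose[OF _ Hcm, of "\<lambda>\<omega>. (future l j \<omega>, dev c j \<omega>)" M c j] by simp
    show "AE \<omega> in M. norm (Hc c j (future l j \<omega>) (dev c j \<omega>)) \<le> norm (block_radius l (future l j \<omega>))"
      using Hc_le' block_radius_ge_1 by (auto intro!: AE_I2 order_trans[OF Hc_le' abs_ge_self])
  qed
  have Q_int: "integrable (block_law l) (\<lambda>v. \<integral>x. Hc c j v x * g c j x \<partial>lborel)" if "j \<ge> 1" for c j
    unfolding g_def by (rule integrable_future_dev[OF l that Hcm Hc_int])
  have wge: "eventually (\<lambda>c. \<forall>j\<in>window k c. j \<ge> 1) at_top"
    using eventually_window[OF k_ge_1] by eventually_elim auto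
  obtain C where C: "C > 0" "eventually (\<lambda>c. renewal_bounded k C c) at_top"
    using local_renewal_bound[OF k_ge_1] .
  have spQ: "space (block_law l) = space (PiM {..<l} (\<lambda>_. borel))"
    by (rule sets_eq_imp_space_eq[OF sets_block_law])
  have Hc_sec: "Hc c j v \<in> borel_measurable borel" if "v \<in> space (block_law l)" for c j v
    using measurable_Pair2[OF Hcm, of v c j] that by (simp add: spQ)
  have H0_sec: "H0 v \<in> borel_measurable borel" if "v \<in> space (block_law l)" for v
    using measurable_Pair2[OF H0, of v] that by (simp add: spQ)
  \<comment> \<open>For j = 0 the deviation has no density. The default 0 for windows that reach
    index 0 keeps the integrand measurable for every c.\<close>
  have "((\<lambda>c. \<integral>v. (if \<forall>j\<in>window k c. j \<ge> 1 then B c v else 0) \<partial>block_law l) \<longlongrightarrow> (\<integral>v. (\<integral>x. H0 v x \<partial>lborel) / k \<partial>block_law l)) at_top"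
  proof (rule integral_dominated_convergence_at_top[where w = "\<lambda>v. C * (4 * block_radius l v ^ 4)"])
    show "integrable (block_law l) (\<lambda>v. C * (4 * block_radius l v ^ 4))"
      using integrable_block_radius[OF l] by simp
    show "(\<lambda>v. (if \<forall>j\<in>window k c. j \<ge> 1 then B c v else 0)) \<in> borel_measurable (block_law l)" for c
    proof (cases "\<forall>j\<in>window k c. j \<ge> 1")
      case True
      then have "(\<lambda>v. B c v) \<in> borel_measurable (block_law l)"
        unfolding B_def by (intro borel_measurable_sum borel_measurable_integrable Q_int) auto
      then show ?thesis using True by simp
    next
      case False
      then show ?thesis by (simp only: if_False) simp
    qed
    have "(\<lambda>(v, x). H0 v x) \<in> borel_measurable (block_law l \<Otimes>\<^sub>M lborel)"
      using H0 by (subst measurable_cong_sets[OF sets_pair_measure_cong[OF sets_block_law sets_lborel] refl])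
    then have "(\<lambda>v. \<integral>x. H0 v x \<partial>lborel) \<in> borel_measurable (block_law l)"
      by (rule lborel.borel_measurable_lebesgue_integral)
    then show "(\<lambda>v. (\<integral>x. H0 v x \<partial>lborel) / k) \<in> borel_measurable (block_law l)" by simp
    show "\<forall>\<^sub>F c in at_top. AE v in block_law l. norm (if \<forall>j\<in>window k c. j \<ge> 1 then B c v else 0) \<le> C * (4 * block_radius l v ^ 4)"
      using C(2)
    proof eventually_elim
      case (elim c)
      show ?case
      proof (rule AE_I2)
        fix v assume v: "v \<in> space (block_law l)"
        have "\<bar>B c v\<bar> \<le> (\<Sum>j\<in>window k c. \<bar>\<integral>x. Hc c j v x * g c j x \<partial>lborel\<bar>)"
          unfolding B_def by (rule sum_abs)
        also have "\<dots> \<le> C * (\<integral>x. (1 + x\<^sup>2) * (block_radius l v * indicator {- block_radius l v..block_radius l v} x) \<partial>lborel)"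
          unfolding g_def
          by (rule elim[rule_format]) (use v Hc_sec Hc_le integrable_indicator_weight in auto)
        also have "\<dots> \<le> C * (4 * block_radius l v ^ 4)"
          using C(1) by (intro mult_left_mono integral_indicator_weight_le block_radius_ge_1) auto
        finally have "\<bar>B c v\<bar> \<le> C * (4 * block_radius l v ^ 4)" .
        then show "norm (if \<forall>j\<in>window k c. j \<ge> 1 then B c v else 0) \<le> C * (4 * block_radius l v ^ 4)"
          using C(1) by auto
      qed
    qed
    show "AE v in block_law l. ((\<lambda>c. if \<forall>j\<in>window k c. j \<ge> 1 then B c v else 0) \<longlongrightarrow> (\<integral>x. H0 v x \<partial>lborel) / k) at_top"
    proof (rule AE_I2)
      fix v assume v: "v \<in> space (block_law l)"
      have "((\<lambda>c. B c v) \<longlongrightarrow> (\<integral>x. H0 v x \<partial>lborel) / k) at_top"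
        unfolding B_def g_def
      proof (rule local_renewal_limit[OF k_ge_1 Hc_sec[OF v] _ integrable_indicator_weight[of "block_radius l v"] _ H0_sec[OF v]])
        show "\<forall>\<^sub>F c in at_top. \<forall>j\<in>window k c. \<forall>x. \<bar>Hc c j v x\<bar> \<le> block_radius l v * indicator {- block_radius l v..block_radius l v} x"
          using Hc_le by simp
        fix z f assume f: "((\<lambda>c. (real (f c * k) - c) / sqrt c) \<longlongrightarrow> z) at_top"
        show "AE x in lborel. ((\<lambda>c. Hc c (f c) v x) \<longlongrightarrow> H0 v x) at_top"
          using lim[OF f, of v]
        proof eventually_elim
          case (elim x)
          show ?case
          proof (rule Lim_transform_eventually[OF elim])
            show "\<forall>\<^sub>F c in at_top. H c (f c) v x = Hc c (f c) v x"
              using bd eventually_in_window[OF k_ge_1 f, of 0] by eventually_elim (auto simp: Hc_def)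
          qed
        qed
      qed
      then show "((\<lambda>c. if \<forall>j\<in>window k c. j \<ge> 1 then B c v else 0) \<longlongrightarrow> (\<integral>x. H0 v x \<partial>lborel) / k) at_top"
        by (rule Lim_transform_eventually) (use wge in eventually_elim, auto)
    qed
  qed
  moreover have "(\<integral>v. (\<integral>x. H0 v x \<partial>lborel) / k \<partial>block_law l) = (\<integral>v. (\<integral>x. H0 v x \<partial>lborel) \<partial>block_law l) / k"
    by (rule integral_divide_zero)
  moreover have "\<forall>\<^sub>F c in at_top. (\<integral>v. (if \<forall>j\<in>window k c. j \<ge> 1 then B c v else 0) \<partial>block_law l) =
      (\<Sum>j\<in>window k c. expectation (\<lambda>\<omega>. H c j (future l j \<omega>) (dev c j \<omega>)))"
    using bd wge
  proof eventually_elim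
    case (elim c)
    have "(\<Sum>j\<in>window k c. expectation (\<lambda>\<omega>. H c j (future l j \<omega>) (dev c j \<omega>))) =
      (\<Sum>j\<in>window k c. expectation (\<lambda>\<omega>. Hc c j (future l j \<omega>) (dev c j \<omega>)))"
      using elim(1) by (intro sum.cong refl) (simp add: Hc_def)
    also have "\<dots> = (\<Sum>j\<in>window k c. \<integral>v. (\<integral>x. Hc c j v x * g c j x \<partial>lborel) \<partial>block_law l)"
      unfolding g_def using elim(2) by (intro sum.cong refl expectation_future_dev[OF l _ Hcm Hc_int]) auto
    also have "\<dots> = (\<integral>v. B c v \<partial>block_law l)"
      unfolding B_def using elim(2) by (intro Bochner_Integration.integral_sum[symmetric] Q_int) auto
    finally show ?case using elim(2) by simp
  qed
  ultimately show ?thesis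
    using Lim_transform_eventually by fastforce
qed

end

section \<open>Excursions above the boundary\<close>

text \<open>
  If \<open>S l > 0\<close>, the summands telescope: extended periodically, \<open>S\<close> has the infima
  \<open>I r = inf {S i | i \<ge> r}\<close>, and the \<open>r\<close>-th summand is \<open>I (r + 1) - I r\<close>.
\<close>

lemma cycle_sum_positive_minima:
  fixes w :: "nat \<Rightarrow> real"
  assumes l: "l \<ge> 1" and per: "\<And>i. w (i + l) = w i"
  defines "S \<equiv> (\<lambda>i. \<Sum>p<i. w p)"
  shows "(\<Sum>r<l. max 0 (Min ((\<lambda>q. S (r + q) - S r) ` {1..l}))) = max 0 (S l)"
proof -
  have S_per: "S (i + l) = S i + S l" for i
  proof -
    have "S (i + l) = S l + (\<Sum>p<i. w (p + l))"
      unfolding S_def by (induction i) (auto simp: algebra_simps)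
    then show ?thesis by (simp add: per S_def)
  qed
  have ne: "{1..l} \<noteq> {}" using l by simp
  define I where "I = (\<lambda>r. Min (S ` {r..<r + l}))"
  have inner: "Min ((\<lambda>q. S (r + q) - S r) ` {1..l}) = I (Suc r) - S r" for r
  proof -
    have "Min ((\<lambda>q. S (r + q) + (- S r)) ` {1..l}) = Min ((\<lambda>q. S (r + q)) ` {1..l}) + (- S r)"
      using ne by (intro Min_add_commute) auto
    also have "(\<lambda>q. S (r + q)) ` {1..l} = S ` {Suc r..<Suc r + l}"
    proof -
      have "(\<lambda>q. r + q) ` {1..l} = {Suc r..<Suc r + l}"
        using image_add_atLeastAtMost[of r 1 l] by (auto simp: atLeastLessThanSuc_atLeastAtMost)
      then show ?thesis by (metis image_image)
    qed
    finally show ?thesis by (simp add: I_def)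
  qed
  show ?thesis
  proof (cases "S l > 0")
    case True
    \<comment> \<open>S gains the positive amount \<open>S l\<close> over a period, so the value at
      r + l exceeds the one at r, and the minimum over the period starting at r is the minimum over
      all later indices.\<close>
    have I_rec: "I r = min (S r) (I (Suc r))" for r
    proof -
      have ner: "S ` {r..<r + l} \<noteq> {}" "S ` {Suc r..<Suc r + l} \<noteq> {}" using l by auto
      have "{r..r+l} = insert (r + l) {r..<r + l}" "{r..r+l} = insert r {Suc r..<Suc r + l}" by auto
      then have "insert (S (r + l)) (S ` {r..<r + l}) = insert (S r) (S ` {Suc r..<Suc r + l})"
        by (metis image_insert)
      then have "min (S (r + l)) (I r) = min (S r) (I (Suc r))"
        unfolding I_def using ner by (metis Min_insert finite_atLeastLessThan finite_imageI)
      moreover have "I r \<le> S r" unfolding I_def using l by (intro Min_le) auto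
      moreover have "S r < S (r + l)" using True S_per by simp
      ultimately show ?thesis by (simp add: min_def split: if_splits)
    qed
    have "(\<Sum>r<l. max 0 (Min ((\<lambda>q. S (r + q) - S r) ` {1..l}))) = (\<Sum>r<l. I (Suc r) - I r)"
      unfolding inner by (intro sum.cong refl) (subst (2) I_rec, auto)
    also have "\<dots> = I l - I 0" by (rule sum_lessThan_telescope)
    also have "I l = I 0 + S l"
    proof -
      have *: "{l..<l + l} = (\<lambda>i. i + l) ` {0..<l}" using image_add_atLeastLessThan'[of l 0 l] by simp
      have "I l = Min ((\<lambda>i. S i + S l) ` {0..<l})"
        unfolding I_def * by (simp only: image_image S_per)
      then show ?thesis using l by (simp add: Min_add_commute I_def)
    qed
    finally show ?thesis using True by simp
  next
    case False
    \<comment> \<open>The candidate q = l alone shows that no minimum over a full period is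
      positive.\<close>
    have "max 0 (Min ((\<lambda>q. S (r + q) - S r) ` {1..l})) = 0" for r
    proof -
      have "Min ((\<lambda>q. S (r + q) - S r) ` {1..l}) \<le> S (r + l) - S r"
        using l by (intro Min_le) auto
      then show ?thesis using False S_per by simp
    qed
    then show ?thesis using False by simp
  qed
qed

context erlang_walk
begin

abbreviation excess :: "nat \<Rightarrow> real" where
  "excess l \<equiv> expectation (\<lambda>\<omega>. max 0 (walk l \<omega> - 2 * real k * real l))"

definition min_prefix :: "nat \<Rightarrow> (nat \<Rightarrow> real) \<Rightarrow> real" where
  "min_prefix l v = Min ((\<lambda>q. (\<Sum>p<q. v p) - 2 * real k * real q) ` {1..l})"

lemma min_prefix_le:
  assumes "q \<in> {1..l}"
  shows "min_prefix l v \<le> (\<Sum>p<q. v p) - 2 * real k * real q"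
  unfolding min_prefix_def using assms by (intro Min_le) auto

lemma less_min_prefix_iff:
  assumes "l \<ge> 1"
  shows "y < min_prefix l v \<longleftrightarrow> (\<forall>q\<in>{1..l}. y < (\<Sum>p<q. v p) - 2 * real k * real q)"
  unfolding min_prefix_def using assms by (subst Min_gr_iff) auto

lemma min_prefix_measurable [measurable]:
  assumes "l \<ge> 1"
  shows "min_prefix l \<in> borel_measurable (PiM {..<l} (\<lambda>_. borel))"
proof -
  have "(\<lambda>v. Min ((\<lambda>q. (\<Sum>p<q. v p) - 2 * real k * real q) ` {1..l})) \<in> borel_measurable (PiM {..<l} (\<lambda>_. borel))"
    by (intro borel_measurable_Min borel_measurable_diff borel_measurable_sum measurable_component_singleton) auto
  then show ?thesis by (simp add: min_prefix_def[abs_def])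
qed

lemma max_min_prefix_le: "l \<ge> 1 \<Longrightarrow> max 0 (min_prefix l v) \<le> block_radius l v"
proof -
  assume l: "l \<ge> 1"
  have "min_prefix l v \<le> v 0 - 2 * real k" using min_prefix_le[of 1 l v] l by simp
  also have "v 0 \<le> (\<Sum>p<l. \<bar>v p\<bar>)"
    using l member_le_sum[of 0 "{..<l}" "\<lambda>p. \<bar>v p\<bar>"] by auto
  finally show ?thesis by (auto simp: block_radius_def intro!: add_nonneg_nonneg sum_nonneg)
qed

text \<open>The block law is invariant under cyclic rotation, so the l rotated blocks have the same
  mean of the positive part of the minimum, and the cycle lemma evaluates the sum over the rotations
  path by path.\<close>

lemma integral_min_prefix:
  assumes l: "l \<ge> 1"
  shows "real l * (\<integral>v. max 0 (min_prefix l v) \<partial>block_law l) = excess l"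
proof -
  let ?P = "PiM {..<l} (\<lambda>_. borel :: real measure)"
  have [measurable_cong]: "sets (block_law l) = sets ?P" by (rule sets_block_law)
  define rot where "rot = (\<lambda>r v. \<lambda>p\<in>{..<l}. v ((p + r) mod l) :: real)"
  have inj: "inj_on (\<lambda>p. (p + r) mod l) {..<l}" for r
  proof (rule inj_onI)
    have *: "x = y" if "x \<le> y" "y < l" "(y + r) mod l = (x + r) mod l" for x y
    proof -
      have "l dvd (y + r) - (x + r)" using that by (subst mod_eq_dvd_iff_nat[symmetric]) auto
      then have "l dvd y - x" by simp
      then show ?thesis using that by (metis diff_is_0_eq dvd_imp_le less_imp_diff_less not_gr0 le_antisym not_le)
    qed
    fix x y assume xy: "x \<in> {..<l}" "y \<in> {..<l}" "(x + r) mod l = (y + r) mod l"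
    then show "x = y" using *[of x y] *[of y x] by (cases "x \<le> y") auto
  qed
  have rot_law: "distr (block_law l) ?P (rot r) = block_law l" for r
  proof -
    have "distr (Pi\<^sub>M {..<l} (\<lambda>_. step_law)) (\<Pi>\<^sub>M i\<in>{..<l}. step_law) (\<lambda>\<omega>. \<lambda>n\<in>{..<l}. \<omega> ((n + r) mod l)) = (\<Pi>\<^sub>M i\<in>{..<l}. step_law)"
      by (rule distr_PiM_reindex[OF prob_space_step_law inj]) (use l in auto)
    moreover have "distr (block_law l) ?P (rot r) = distr (block_law l) (block_law l) (rot r)"
      by (intro distr_cong) (auto simp: sets_block_law)
    ultimately show ?thesis by (simp add: block_law_def rot_def)
  qed
  have rot_meas[measurable]: "rot r \<in> ?P \<rightarrow>\<^sub>M ?P" for r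
    unfolding rot_def using l by (intro measurable_restrict measurable_component_singleton) auto
  have a_meas[measurable]: "(\<lambda>v. max 0 (min_prefix l v)) \<in> borel_measurable ?P"
    using min_prefix_measurable[OF l] by measurable
  have a_int: "integrable (block_law l) (\<lambda>v. max 0 (min_prefix l v))"
  proof (rule Bochner_Integration.integrable_bound[OF integrable_block_radius1[OF l]])
    show "AE v in block_law l. norm (max 0 (min_prefix l v)) \<le> norm (block_radius l v)"
      using max_min_prefix_le[OF l] by (intro AE_I2) (simp add: order_trans[OF _ abs_ge_self])
  qed measurable
  have rot_eq: "(\<integral>v. max 0 (min_prefix l (rot r v)) \<partial>block_law l) = (\<integral>v. max 0 (min_prefix l v) \<partial>block_law l)" for r
  proof -
    have "(\<integral>v. max 0 (min_prefix l v) \<partial>block_law l) = (\<integral>v. max 0 (min_prefix l v) \<partial>distr (block_law l) ?P (rot r))"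
      by (simp add: rot_law)
    then show ?thesis by (simp add: integral_distr)
  qed
  have rot_int: "integrable (block_law l) (\<lambda>v. max 0 (min_prefix l (rot r v)))" for r
  proof -
    have "integrable (distr (block_law l) ?P (rot r)) (\<lambda>v. max 0 (min_prefix l v))"
      using a_int by (simp only: rot_law)
    then show ?thesis by (subst (asm) integrable_distr_eq) auto
  qed
  have cyc: "(\<Sum>r<l. max 0 (min_prefix l (rot r v))) = max 0 ((\<Sum>p<l. v p) - 2 * real k * real l)" for v
  proof -
    \<comment> \<open>The centred steps, extended periodically: the partial sums of a rotated block
      are increments of the partial sums of w.\<close>
    define w where "w = (\<lambda>i. v (i mod l) - 2 * real k)"
    have wsum: "(\<Sum>p<q. w (p + r)) = (\<Sum>p<r + q. w p) - (\<Sum>p<r. w p)" for r q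
      by (induction q) (auto simp: add.commute)
    have pre: "min_prefix l (rot r v) = Min ((\<lambda>q. (\<Sum>p<r + q. w p) - (\<Sum>p<r. w p)) ` {1..l})" for r
    proof -
      have "(\<Sum>p<q. rot r v p) - 2 * real k * real q = (\<Sum>p<q. w (p + r))" if "q \<in> {1..l}" for q
      proof -
        have "(\<Sum>p<q. rot r v p) = (\<Sum>p<q. v ((p + r) mod l))"
          using that by (intro sum.cong) (auto simp: rot_def)
        then show ?thesis by (simp add: w_def sum_subtractf)
      qed
      then show ?thesis unfolding min_prefix_def wsum by (intro arg_cong[where f=Min] image_cong refl) auto
    qed
    have "(\<Sum>r<l. max 0 (min_prefix l (rot r v))) = max 0 (\<Sum>p<l. w p)"
      unfolding pre by (rule cycle_sum_positive_minima[OF l]) (simp add: w_def)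
    also have "(\<Sum>p<l. w p) = (\<Sum>p<l. v p) - 2 * real k * real l"
      by (simp add: w_def sum_subtractf)
    finally show ?thesis .
  qed
  have "real l * (\<integral>v. max 0 (min_prefix l v) \<partial>block_law l) = (\<Sum>r<l. \<integral>v. max 0 (min_prefix l (rot r v)) \<partial>block_law l)"
    by (simp add: rot_eq)
  also have "\<dots> = (\<integral>v. (\<Sum>r<l. max 0 (min_prefix l (rot r v))) \<partial>block_law l)"
    by (rule Bochner_Integration.integral_sum[symmetric]) (rule rot_int)
  also have "\<dots> = (\<integral>v. max 0 ((\<Sum>p<l. v p) - 2 * real k * real l) \<partial>block_law l)"
    unfolding cyc ..
  also have "\<dots> = expectation (\<lambda>\<omega>. max 0 ((\<Sum>p<l. future l 0 \<omega> p) - 2 * real k * real l))"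
    by (rule integral_block_law[OF l]) measurable
  finally show ?thesis by (simp add: sum_future_0)
qed

lemma boundary_diff: "boundary k c (j + q) - boundary k c j = real (q * k) * (2 * real (j * k) + real (q * k) + 1) / c"
  unfolding boundary_def diff_divide_distrib[symmetric] by (simp add: algebra_simps)

text \<open>The boundary n (n + 1) / c has slope about 2 n / c, which is 2 near n = c, and each step
  covers k observations.\<close>

lemma boundary_diff_tendsto:
  assumes f: "((\<lambda>c. (real (f c * k) - c) / sqrt c) \<longlongrightarrow> z) at_top"
  shows "((\<lambda>c. boundary k c (f c + q) - boundary k c (f c)) \<longlongrightarrow> 2 * real k * real q) at_top"
proof -
  have nc: "((\<lambda>c. real (f c * k) / c) \<longlongrightarrow> 1) at_top"
  proof (rule Lim_transform_eventually)
    have "((\<lambda>c. 1 + (real (f c * k) - c) / sqrt c * (1 / sqrt c)) \<longlongrightarrow> 1 + z * 0) at_top"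
      by (intro tendsto_intros f) real_asymp
    then show "((\<lambda>c. 1 + (real (f c * k) - c) / sqrt c * (1 / sqrt c)) \<longlongrightarrow> 1) at_top" by simp
    show "eventually (\<lambda>c. 1 + (real (f c * k) - c) / sqrt c * (1 / sqrt c) = real (f c * k) / c) at_top"
      using eventually_gt_at_top[of 0] by eventually_elim (simp add: field_simps)
  qed
  have "((\<lambda>c. real (q * k) * (2 * (real (f c * k) / c) + (real (q * k) + 1) / c)) \<longlongrightarrow> real (q * k) * (2 * 1 + 0)) at_top"
    by (intro tendsto_intros nc) real_asymp
  moreover have "real (q * k) * (2 * (real (f c * k) / c) + (real (q * k) + 1) / c) = boundary k c (f c + q) - boundary k c (f c)" for c
    unfolding boundary_diff by (simp only: times_divide_eq_right add_divide_distrib[symmetric] add.assoc)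
  ultimately show ?thesis by (simp add: mult_ac)
qed

text \<open>The terms of lag l in the decomposition by the last visit below the boundary. The test j
  + l < \<open>window_hi k c\<close> keeps both ends of the pair in the window, so that summing over
  l reproduces the decomposition exactly.\<close>

definition excursion :: "nat \<Rightarrow> real \<Rightarrow> real" where
  "excursion l c = (\<Sum>j\<in>window k c. if j + l < window_hi k c then
      prob {\<omega>\<in>space M. dev c j \<omega> \<le> 0 \<and> (\<forall>q\<in>{1..l}. dev c (j + q) \<omega> > 0)} else 0)"

lemma excursion_limit:
  assumes l: "l \<ge> 1"
  shows "((\<lambda>c. excursion l c) \<longlongrightarrow> excess l / (real k * real l)) at_top"
proof -
  let ?P = "PiM {..<l} (\<lambda>_. borel :: real measure)"
  define H where "H = (\<lambda>c j v x. if j + l < window_hi k c \<and> x \<le> 0 \<and>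
      (\<forall>q\<in>{1..l}. x + (\<Sum>p<q. v p) - (boundary k c (j + q) - boundary k c j) > 0) then 1 else 0 :: real)"
  define H0 where "H0 = (\<lambda>v x. if x \<le> 0 \<and> (\<forall>q\<in>{1..l}. x + (\<Sum>p<q. v p) - 2 * real k * real q > 0) then 1 else 0 :: real)"
  have pm: "(\<lambda>(v, x). x + (\<Sum>p<q. v p) - a) \<in> borel_measurable (?P \<Otimes>\<^sub>M borel)" if "q \<in> {1..l}" for q a
  proof -
    have "(\<lambda>y. snd y + (\<Sum>p<q. fst y p) - a) \<in> borel_measurable (?P \<Otimes>\<^sub>M borel)"
      using that by (intro borel_measurable_diff borel_measurable_add borel_measurable_sum measurable_snd
        measurable_compose[OF measurable_fst] measurable_component_singleton) auto
    then show ?thesis by (simp add: case_prod_beta)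
  qed
  have pred: "Measurable.pred (?P \<Otimes>\<^sub>M borel) (\<lambda>(v, x). x \<le> 0 \<and> (\<forall>q\<in>{1..l}. x + (\<Sum>p<q. v p) - a q > 0))" for a
  proof -
    have "Measurable.pred (?P \<Otimes>\<^sub>M borel) (\<lambda>y. snd y \<le> 0 \<and> (\<forall>q\<in>{1..l}. 0 < snd y + (\<Sum>p<q. fst y p) - a q))"
    proof (rule pred_intros_logic(3)[OF _ pred_intros_finite(3)])
      fix q assume "q \<in> {1..l}"
      from pm[OF this, of "a q"] have [measurable]: "(\<lambda>y. snd y + (\<Sum>p<q. fst y p) - a q) \<in> borel_measurable (?P \<Otimes>\<^sub>M borel)"
        by (simp add: case_prod_beta)
      show "Measurable.pred (?P \<Otimes>\<^sub>M borel) (\<lambda>y. 0 < snd y + (\<Sum>p<q. fst y p) - a q)" by measurable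
    next
      show "Measurable.pred (?P \<Otimes>\<^sub>M borel) (\<lambda>y. snd y \<le> (0 :: real))" by measurable
    qed simp
    then show ?thesis by (simp add: case_prod_beta)
  qed
  have Hm: "(\<lambda>(v, x). H c j v x) \<in> borel_measurable (?P \<Otimes>\<^sub>M borel)" for c j
    unfolding H_def using pred[of "\<lambda>q. boundary k c (j + q) - boundary k c j"]
    by (cases "j + l < window_hi k c") (simp_all add: case_prod_beta)
  have H0m: "(\<lambda>(v, x). H0 v x) \<in> borel_measurable (?P \<Otimes>\<^sub>M borel)"
    unfolding H0_def using pred[of "\<lambda>q. 2 * real k * real q"] by (simp add: case_prod_beta)
  have lim: "((\<lambda>c. \<Sum>j\<in>window k c. expectation (\<lambda>\<omega>. H c j (future l j \<omega>) (dev c j \<omega>)))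
     \<longlongrightarrow> (\<integral>v. (\<integral>x. H0 v x \<partial>lborel) \<partial>block_law l) / k) at_top"
  proof (rule renewal_sum_limit[OF l Hm H0m])
    show "\<forall>\<^sub>F c in at_top. \<forall>j\<in>window k c. \<forall>v x. \<bar>H c j v x\<bar> \<le> block_radius l v * indicator {- block_radius l v..block_radius l v} x"
      using eventually_gt_at_top[of 0]
    proof eventually_elim
      case (elim c)
      show ?case
      proof (intro ballI allI)
        fix j v x
        show "\<bar>H c j v x\<bar> \<le> block_radius l v * indicator {- block_radius l v..block_radius l v} x"
        proof (cases "H c j v x = 0")
          case True
          then show ?thesis using block_radius_ge_1[of l v] by simp
        next
          case False
          then have x: "x \<le> 0" "x + (\<Sum>p<l. v p) - (boundary k c (j + l) - boundary k c j) > 0" and H1: "H c j v x = 1"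
            using l by (auto simp: H_def split: if_splits)
          have "boundary k c (j + l) - boundary k c j \<ge> 0"
            unfolding boundary_diff using elim by simp
          moreover have "(\<Sum>p<l. v p) \<le> (\<Sum>p<l. \<bar>v p\<bar>)" by (intro sum_mono) auto
          ultimately have "- block_radius l v \<le> x" using x by (simp add: block_radius_def)
          then show ?thesis using x H1 block_radius_ge_1[of l v] by simp
        qed
      qed
    qed
    fix z f v assume f: "((\<lambda>c. (real (f c * k) - c) / sqrt c) \<longlongrightarrow> z) at_top"
    \<comment> \<open>The finitely many heights at which a limiting inequality holds with equality
      are excluded; elsewhere the indicator is eventually constant in c.\<close>
    have "AE x in lborel. \<forall>q\<in>{1..l}. x \<noteq> - ((\<Sum>p<q. v p) - 2 * real k * real q)"
      by (intro AE_finite_allI AE_lborel_singleton) auto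
    then show "AE x in lborel. ((\<lambda>c. H c (f c) v x) \<longlongrightarrow> H0 v x) at_top"
    proof eventually_elim
      case (elim x)
      have "eventually (\<lambda>c. (x + (\<Sum>p<q. v p) - (boundary k c (f c + q) - boundary k c (f c)) > 0) = (x + (\<Sum>p<q. v p) - 2 * real k * real q > 0)) at_top" if q: "q \<in> {1..l}" for q
      proof -
        have t: "((\<lambda>c. x + (\<Sum>p<q. v p) - (boundary k c (f c + q) - boundary k c (f c))) \<longlongrightarrow> x + (\<Sum>p<q. v p) - 2 * real k * real q) at_top"
          by (intro tendsto_intros boundary_diff_tendsto[OF f])
        have "x + (\<Sum>p<q. v p) - 2 * real k * real q \<noteq> 0" using elim q by force
        then consider "x + (\<Sum>p<q. v p) - 2 * real k * real q > 0" | "x + (\<Sum>p<q. v p) - 2 * real k * real q < 0" by linarith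
        then show ?thesis
        proof cases
          case 1 then show ?thesis using order_tendstoD(1)[OF t 1] by (auto elim: eventually_mono)
        next
          case 2 then show ?thesis using order_tendstoD(2)[OF t 2] by (auto elim!: eventually_mono)
        qed
      qed
      then have "eventually (\<lambda>c. \<forall>q\<in>{1..l}. (x + (\<Sum>p<q. v p) - (boundary k c (f c + q) - boundary k c (f c)) > 0) = (x + (\<Sum>p<q. v p) - 2 * real k * real q > 0)) at_top"
        by (intro eventually_ball_finite) auto
      then have "eventually (\<lambda>c. H c (f c) v x = H0 v x) at_top"
        using eventually_in_window[OF k_ge_1 f, of l]
        by eventually_elim (simp add: H_def H0_def)
      then show ?case by (rule tendsto_eventually)
    qed
  qed
  have "expectation (\<lambda>\<omega>. H c j (future l j \<omega>) (dev c j \<omega>)) =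
     (if j + l < window_hi k c then prob {\<omega>\<in>space M. dev c j \<omega> \<le> 0 \<and> (\<forall>q\<in>{1..l}. dev c (j + q) \<omega> > 0)} else 0)" for c j
  proof (cases "j + l < window_hi k c")
    case True
    have "H c j (future l j \<omega>) (dev c j \<omega>) = indicator {\<omega>\<in>space M. dev c j \<omega> \<le> 0 \<and> (\<forall>q\<in>{1..l}. dev c (j + q) \<omega> > 0)} \<omega>" if "\<omega> \<in> space M" for \<omega>
      using True that by (auto simp: H_def indicator_def dev_add[of _ l])
    then have "expectation (\<lambda>\<omega>. H c j (future l j \<omega>) (dev c j \<omega>)) = expectation (indicator {\<omega>\<in>space M. dev c j \<omega> \<le> 0 \<and> (\<forall>q\<in>{1..l}. dev c (j + q) \<omega> > 0)})"
      by (intro Bochner_Integration.integral_cong refl)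
    then show ?thesis using True by simp
  qed (simp add: H_def)
  with lim have "((\<lambda>c. excursion l c) \<longlongrightarrow> (\<integral>v. (\<integral>x. H0 v x \<partial>lborel) \<partial>block_law l) / k) at_top"
    by (simp add: excursion_def)
  \<comment> \<open>In the limit the admissible starting heights form the interval from minus
    \<open>min_prefix l v\<close>, excluded, up to 0.\<close>
  moreover have "(\<integral>x. H0 v x \<partial>lborel) = max 0 (min_prefix l v)" for v
  proof -
    have "H0 v x = indicator {- min_prefix l v<..0} x" for x
    proof -
      have "(\<forall>q\<in>{1..l}. x + (\<Sum>p<q. v p) - 2 * real k * real q > 0) \<longleftrightarrow> - x < min_prefix l v"
        unfolding less_min_prefix_iff[OF l] by (intro ball_cong refl) linarith
      then show ?thesis by (auto simp: H0_def indicator_def)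
    qed
    then show ?thesis by (cases "min_prefix l v \<ge> 0") (auto simp: max_def)
  qed
  moreover have "(\<integral>v. max 0 (min_prefix l v) \<partial>block_law l) = excess l / real l"
    using integral_min_prefix[OF l] l by (subst eq_divide_eq) (auto simp: mult.commute)
  ultimately show ?thesis by (simp add: mult.commute)
qed

text \<open>A Chernoff factor at exponent 1/4: 1 / (1 - 1/4) = 4/3 is the exponential moment of a
  unit exponential variable, and exp (- 3/8) accounts for a boundary of slope 3/2 per
  observation.\<close>

definition excursion_ratio :: real where
  "excursion_ratio = (4 / 3) * exp (- 3 / 8)"

lemma excursion_ratio: "0 < excursion_ratio" "excursion_ratio < 1"
proof -
  have "1 + 3 / 8 \<le> exp (3 / 8 :: real)" by (rule exp_ge_add_one_self)
  then have "4 / 3 < exp (3 / 8 :: real)" by linarith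
  then show "excursion_ratio < 1" by (simp add: excursion_ratio_def exp_minus field_simps)
qed (simp add: excursion_ratio_def)

text \<open>Trades the polynomial weight for an exponential that can be averaged over blocks: for u
  >= 0, u + u^3 <= (4 + 12^3) exp (u / 4), and 2000 exceeds 1732.\<close>

lemma integral_interval_weight_le:
  fixes u :: real
  shows "integrable lborel (\<lambda>x. (1 + x\<^sup>2) * indicator {-u<..0} x)"
    "(\<integral>x. (1 + x\<^sup>2) * indicator {-u<..0} x \<partial>lborel) \<le> 2000 * exp (u / 4)"
proof -
  have bd: "(1 + x\<^sup>2) * indicator {-u<..0} x \<le> (1 + u\<^sup>2) * indicator {-u<..0} x" for x
    by (auto simp: indicator_def power2_le_iff_abs_le)
  have int: "integrable lborel (\<lambda>x. (1 + u\<^sup>2) * indicator {-u<..0} x)"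
  proof -
    have "emeasure lborel {-u<..0} < \<infinity>" by (cases "0 \<le> u") auto
    then show ?thesis by (intro integrable_mult_right integrable_real_indicator) auto
  qed
  show int2: "integrable lborel (\<lambda>x. (1 + x\<^sup>2) * indicator {-u<..0} x)"
    by (rule Bochner_Integration.integrable_bound[OF int]) (use bd in \<open>auto intro!: AE_I2 simp: indicator_def power2_le_iff_abs_le\<close>)
  have "(\<integral>x. (1 + x\<^sup>2) * indicator {-u<..0} x \<partial>lborel) \<le> (\<integral>x. (1 + u\<^sup>2) * indicator {-u<..0} x \<partial>lborel)"
    by (intro integral_mono int int2 bd)
  also have "\<dots> \<le> 2000 * exp (u / 4)"
  proof (cases "u \<ge> 0")
    case True
    have eq: "(\<integral>x. (1 + u\<^sup>2) * indicator {-u<..0} x \<partial>lborel) = (1 + u\<^sup>2) * u" using True by simp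
    also have "\<dots> = u + u ^ 3" by (simp add: algebra_simps power2_eq_square power3_eq_cube)
    finally have eq: "(\<integral>x. (1 + u\<^sup>2) * indicator {-u<..0} x \<partial>lborel) = u + u ^ 3" .
    have "u \<le> 4 * exp (u / 4)" using exp_ge_add_one_self[of "u / 4"] by linarith
    moreover have "u ^ 3 \<le> 1728 * exp (u / 4)"
    proof -
      have "(u / 12) ^ 3 \<le> (exp (u / 12)) ^ 3"
        using True exp_ge_add_one_self[of "u / 12"] by (intro power_mono) linarith+
      also have "\<dots> = exp (u / 4)" by (simp flip: exp_of_nat_mult)
      finally show ?thesis by (simp add: power_divide)
    qed
    ultimately show ?thesis using exp_ge_zero[of "u / 4"] unfolding eq by linarith
  qed simp
  finally show "(\<integral>x. (1 + x\<^sup>2) * indicator {-u<..0} x \<partial>lborel) \<le> 2000 * exp (u / 4)" .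
qed

text \<open>Supplies the majorant for Tannery's theorem. Of an excursion only \<open>dev\<close> <=
  0 at its start and \<open>dev\<close> > 0 after l steps are kept. Inside the window n >= 3 c / 4,
  so the boundary rises by at least 3/2 k l over these steps, and the start is confined to the
  interval between \<open>- U v\<close> and 0. The renewal bound and the exponential moment of
  \<open>U v / 4\<close> give the geometric decay.\<close>

lemma excursion_bound:
  obtains C where "eventually (\<lambda>c. \<forall>l\<ge>1. excursion l c \<le> C * excursion_ratio ^ l) at_top"
proof -
  obtain C where C: "C > 0" "eventually (\<lambda>c. renewal_bounded k C c) at_top"
    using local_renewal_bound[OF k_ge_1] .
  have "eventually (\<lambda>c. \<forall>l\<ge>1. excursion l c \<le> (C * 2000) * excursion_ratio ^ l) at_top"
    using C(2) eventually_window[OF k_ge_1]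
  proof eventually_elim
    case (elim c)
    have c0: "c > 0" and lo1: "window_lo k c \<ge> 1" using elim(2) by auto
    show ?case
    proof (intro allI impI)
      fix l :: nat assume l: "l \<ge> 1"
      interpret Q: prob_space "block_law l" by (rule prob_space_block_law)
      let ?P = "PiM {..<l} (\<lambda>_. borel :: real measure)"
      have [measurable_cong]: "sets (block_law l) = sets ?P" by (rule sets_block_law)
      define U where "U = (\<lambda>v. (\<Sum>p<l. v p) - 3/2 * real k * real l)"
      define H where "H = (\<lambda>v x. indicator {- U v<..0} x :: real)"
      have Um[measurable]: "U \<in> borel_measurable ?P" unfolding U_def by measurable
      have Hm: "(\<lambda>(v, x). H v x) \<in> borel_measurable (?P \<Otimes>\<^sub>M borel)"
      proof -
        have "(\<lambda>y. indicator {y. - U (fst y) < snd y \<and> snd y \<le> 0} y :: real) \<in> borel_measurable (?P \<Otimes>\<^sub>M borel)"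
          by measurable
        then show ?thesis by (simp add: H_def case_prod_beta indicator_def of_bool_def)
      qed
      have Hint: "integrable M (\<lambda>\<omega>. H (future l j \<omega>) (dev c j \<omega>))" for j
      proof (rule Bochner_Integration.integrable_bound[of M "\<lambda>_. 1 :: real"])
        show "(\<lambda>\<omega>. H (future l j \<omega>) (dev c j \<omega>)) \<in> borel_measurable M"
          using measurable_compose[OF _ Hm, of "\<lambda>\<omega>. (future l j \<omega>, dev c j \<omega>)" M] by simp
      qed (auto simp: H_def indicator_def)
      have prob_le: "prob {\<omega>\<in>space M. dev c j \<omega> \<le> 0 \<and> (\<forall>q\<in>{1..l}. dev c (j + q) \<omega> > 0)} \<le> expectation (\<lambda>\<omega>. H (future l j \<omega>) (dev c j \<omega>))" if j: "j \<in> window k c" for j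
      proof -
        have n: "real (j * k) \<ge> 3/4 * c" using elim(2) j by fastforce
        have "3/2 * real k * real l * c \<le> real (l * k) * (2 * real (j * k) + real (l * k) + 1)"
        proof -
          have "real (l * k) * (3/2 * c) \<le> real (l * k) * (2 * real (j * k) + real (l * k) + 1)"
            using n of_nat_0_le_iff[of "l * k", where 'a=real] by (intro mult_left_mono; linarith)
          then show ?thesis by (simp add: mult_ac)
        qed
        then have bd: "boundary k c (j + l) - boundary k c j \<ge> 3/2 * real k * real l"
          unfolding boundary_diff using c0 by (simp add: field_simps)
        have "prob {\<omega>\<in>space M. dev c j \<omega> \<le> 0 \<and> (\<forall>q\<in>{1..l}. dev c (j + q) \<omega> > 0)} = expectation (indicator {\<omega>\<in>space M. dev c j \<omega> \<le> 0 \<and> (\<forall>q\<in>{1..l}. dev c (j + q) \<omega> > 0)})"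
          by simp
        also have "\<dots> \<le> expectation (\<lambda>\<omega>. H (future l j \<omega>) (dev c j \<omega>))"
        proof (rule integral_mono[OF _ Hint])
          show "integrable M (indicator {\<omega>\<in>space M. dev c j \<omega> \<le> 0 \<and> (\<forall>q\<in>{1..l}. dev c (j + q) \<omega> > 0)} :: 'a \<Rightarrow> real)"
            by (intro integrable_real_indicator) (auto simp: emeasure_eq_measure)
          fix \<omega>
          show "indicator {\<omega>\<in>space M. dev c j \<omega> \<le> 0 \<and> (\<forall>q\<in>{1..l}. dev c (j + q) \<omega> > 0)} \<omega> \<le> H (future l j \<omega>) (dev c j \<omega>)"
          proof (cases "dev c j \<omega> \<le> 0 \<and> dev c (j + l) \<omega> > 0")
            case True
            then have "- U (future l j \<omega>) < dev c j \<omega>"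
              using bd dev_add[of l l c j \<omega>] by (simp add: U_def)
            then show ?thesis using True by (simp add: H_def indicator_def)
          qed (use l in \<open>auto simp: H_def indicator_def\<close>)
        qed
        finally show ?thesis .
      qed
      define I where "I = (\<lambda>j v. \<integral>x. H v x * dev_density k c j x \<partial>lborel)"
      have I_int: "integrable (block_law l) (I j)" if "j \<in> window k c" for j
        unfolding I_def using that lo1 by (intro integrable_future_dev[OF l _ Hm Hint]) auto
      have exp_int: "integrable (block_law l) (\<lambda>v. exp (1/4 * (\<Sum>p<l. v p)))"
        by (rule integrable_exp_block[OF l]) simp
      have U_exp: "exp (U v / 4) = exp (- (3/8 * real k * real l)) * exp (1/4 * (\<Sum>p<l. v p))" for v
        by (simp add: U_def diff_divide_distrib flip: exp_add)
      have "excursion l c \<le> (\<Sum>j\<in>window k c. expectation (\<lambda>\<omega>. H (future l j \<omega>) (dev c j \<omega>)))"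
        unfolding excursion_def
      proof (rule sum_mono)
        fix j assume j: "j \<in> window k c"
        have "0 \<le> expectation (\<lambda>\<omega>. H (future l j \<omega>) (dev c j \<omega>))" by (intro integral_nonneg_AE) (simp add: H_def)
        then show "(if j + l < window_hi k c then prob {\<omega>\<in>space M. dev c j \<omega> \<le> 0 \<and> (\<forall>q\<in>{1..l}. dev c (j + q) \<omega> > 0)} else 0) \<le> expectation (\<lambda>\<omega>. H (future l j \<omega>) (dev c j \<omega>))"
          using prob_le[OF j] by simp
      qed
      also have "\<dots> = (\<Sum>j\<in>window k c. \<integral>v. I j v \<partial>block_law l)"
        unfolding I_def using lo1 by (intro sum.cong refl expectation_future_dev[OF l _ Hm Hint]) auto
      also have "\<dots> = (\<integral>v. (\<Sum>j\<in>window k c. I j v) \<partial>block_law l)"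
        by (intro Bochner_Integration.integral_sum[symmetric] I_int)
      also have "\<dots> \<le> (\<integral>v. C * (2000 * exp (U v / 4)) \<partial>block_law l)"
      proof (rule integral_mono)
        show "integrable (block_law l) (\<lambda>v. \<Sum>j\<in>window k c. I j v)" by (intro Bochner_Integration.integrable_sum I_int)
        show "integrable (block_law l) (\<lambda>v. C * (2000 * exp (U v / 4)))"
          unfolding U_exp by (intro integrable_mult_right exp_int)
        fix v
        have "(\<Sum>j\<in>window k c. I j v) \<le> (\<Sum>j\<in>window k c. \<bar>I j v\<bar>)" by (intro sum_mono) auto
        also have "\<dots> \<le> C * (\<integral>x. (1 + x\<^sup>2) * indicator {- U v<..0} x \<partial>lborel)"
          unfolding I_def H_def
          by (rule elim(1)[rule_format]) (use integral_interval_weight_le(1) in auto)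
        also have "\<dots> \<le> C * (2000 * exp (U v / 4))"
          using C(1) by (intro mult_left_mono integral_interval_weight_le) auto
        finally show "(\<Sum>j\<in>window k c. I j v) \<le> C * (2000 * exp (U v / 4))" .
      qed
      also have "\<dots> = C * 2000 * (exp (- (3/8 * real k * real l)) * (\<integral>v. exp (1/4 * (\<Sum>p<l. v p)) \<partial>block_law l))"
        unfolding U_exp by simp
      also have "exp (- (3/8 * real k * real l)) * (\<integral>v. exp (1/4 * (\<Sum>p<l. v p)) \<partial>block_law l) = excursion_ratio ^ (l * k)"
      proof -
        have "(1 - 1/4 :: real) powr (- real (l * k)) = (4/3) ^ (l * k)"
          by (simp add: powr_minus powr_realpow del: of_nat_mult flip: power_inverse)
        moreover have "exp (- (3/8 * real k * real l)) = exp (- 3 / 8) ^ (l * k)"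
          by (simp flip: exp_of_nat_mult add: mult_ac)
        moreover have "(\<integral>v. exp (1/4 * (\<Sum>p<l. v p)) \<partial>block_law l) = (1 - 1/4) powr (- real (l * k))"
          by (rule integrable_exp_block(2)[OF l]) simp
        ultimately show ?thesis
          by (simp only: excursion_ratio_def power_mult_distrib mult.commute)
      qed
      also have "excursion_ratio ^ (l * k) \<le> excursion_ratio ^ l"
        using excursion_ratio k_ge_1 l by (intro power_decreasing) auto
      finally show "excursion l c \<le> (C * 2000) * excursion_ratio ^ l"
        using C(1) by simp
    qed
  qed
  then show ?thesis using that by blast
qed

lemma excursion_nonneg: "excursion l c \<ge> 0"
  unfolding excursion_def by (intro sum_nonneg) auto

lemma excursion_series_limit:
  shows "summable (\<lambda>l. excess (Suc l) / (real k * real (Suc l)))"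
    and "((\<lambda>c. \<Sum>l. excursion (Suc l) c) \<longlongrightarrow> (\<Sum>l. excess (Suc l) / (real k * real (Suc l)))) at_top"
proof -
  obtain C where C: "eventually (\<lambda>c. \<forall>l\<ge>1. excursion l c \<le> C * excursion_ratio ^ l) at_top"
    using excursion_bound .
  have "eventually (\<lambda>(l, c). norm (excursion (Suc l) c) \<le> C * excursion_ratio ^ Suc l) (at_top \<times>\<^sub>F at_top)"
    unfolding case_prod_beta
  proof (rule eventually_prodI[OF eventually_True[of at_top] C, THEN eventually_mono])
    fix x :: "nat \<times> real" assume "True \<and> (\<forall>l\<ge>1. excursion l (snd x) \<le> C * excursion_ratio ^ l)"
    then have "excursion (Suc (fst x)) (snd x) \<le> C * excursion_ratio ^ Suc (fst x)" by (metis One_nat_def Suc_le_mono zero_le)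
    then show "norm (excursion (Suc (fst x)) (snd x)) \<le> C * excursion_ratio ^ Suc (fst x)"
      using excursion_nonneg by simp
  qed
  moreover have "summable (\<lambda>l. C * excursion_ratio ^ Suc l)"
    using excursion_ratio by (intro summable_mult) (simp add: summable_geometric)
  moreover have "((\<lambda>c. excursion (Suc l) c) \<longlongrightarrow> excess (Suc l) / (real k * real (Suc l))) at_top" for l
    by (rule excursion_limit) simp
  ultimately have "summable (\<lambda>l. norm (excess (Suc l) / (real k * real (Suc l)))) \<and>
    ((\<lambda>c. \<Sum>l. excursion (Suc l) c) \<longlongrightarrow> (\<Sum>l. excess (Suc l) / (real k * real (Suc l)))) at_top"
    using tannerys_theorem[of "\<lambda>l c. excursion (Suc l) c" "\<lambda>l. excess (Suc l) / (real k * real (Suc l))" at_top "\<lambda>l. C * excursion_ratio ^ Suc l"]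
    by (simp only: trivial_limit_at_top_linorder not_False_eq_True)
  then show "summable (\<lambda>l. excess (Suc l) / (real k * real (Suc l)))"
    and "((\<lambda>c. \<Sum>l. excursion (Suc l) c) \<longlongrightarrow> (\<Sum>l. excess (Suc l) / (real k * real (Suc l)))) at_top"
    by (auto intro: summable_norm_cancel)
qed

end

section \<open>The sum of the probabilities of lying above the boundary\<close>

text \<open>The defect of linearity of \<open>d \<mapsto> d\<^sup>+\<close> under a step \<open>\<xi>\<close>; it vanishes unless the step changes the sign.\<close>

definition kink :: "real \<Rightarrow> real \<Rightarrow> real" where
  "kink d \<xi> = (if d > 0 then max 0 (- (d + \<xi>)) else max 0 (d + \<xi>))"

lemma kink_nonneg: "kink d \<xi> \<ge> 0"
  by (simp add: kink_def)

lemma kink_le: "kink d \<xi> \<le> \<bar>\<xi>\<bar>"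
  by (auto simp: kink_def)

lemma kink_eq_0: "\<bar>\<xi>\<bar> < \<bar>d\<bar> \<Longrightarrow> kink d \<xi> = 0"
  by (auto simp: kink_def)

lemma pos_part_add: "max 0 (d + \<xi>) = max 0 d + \<xi> * of_bool (d > 0) + kink d \<xi>" for d \<xi> :: real
  by (auto simp: kink_def)

lemma pos_part_square_add:
  fixes d \<xi> :: real
  shows "\<bar>(max 0 (d + \<xi>))\<^sup>2 - (max 0 d)\<^sup>2 - 2 * \<xi> * max 0 d\<bar> \<le> \<xi>\<^sup>2"
proof (cases "d > 0")
  case True
  show ?thesis
  proof (cases "d + \<xi> > 0")
    case True
    then show ?thesis using \<open>d > 0\<close> by (simp add: power2_eq_square algebra_simps)
  next
    case False
    then have "(- \<xi> - d)\<^sup>2 \<le> (- \<xi>)\<^sup>2" using True by (intro power_mono) auto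
    moreover have "(max 0 (d + \<xi>))\<^sup>2 - (max 0 d)\<^sup>2 - 2 * \<xi> * max 0 d = \<xi>\<^sup>2 - (- \<xi> - d)\<^sup>2"
      using False True by (simp add: power2_eq_square algebra_simps)
    ultimately show ?thesis using zero_le_power2[of "- \<xi> - d"] by simp
  qed
next
  case False
  then have "(max 0 (d + \<xi>))\<^sup>2 \<le> \<bar>\<xi>\<bar>\<^sup>2" by (intro power_mono) auto
  then show ?thesis using False by simp
qed

lemma kink_measurable [measurable]: "(\<lambda>y. kink (f y) (g y)) \<in> borel_measurable N"
  if [measurable]: "f \<in> borel_measurable N" "g \<in> borel_measurable N"
  unfolding kink_def by measurable

text \<open>The graph is a right triangle with both legs of length |\<xi>|, adjacent to 0 on the
  side from which the step crosses.\<close>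

lemma integral_kink: "(\<integral>x. kink x \<xi> \<partial>lborel) = \<xi>\<^sup>2 / 2"
proof (cases "\<xi> \<ge> 0")
  case True
  have "kink x \<xi> = (x + \<xi>) * indicator {-\<xi>..0} x" for x
    using True by (auto simp: kink_def indicator_def)
  moreover have "(\<integral>x. (x + \<xi>) * indicator {-\<xi>..0} x \<partial>lborel) = (0 + \<xi>)\<^sup>2 / 2 - (- \<xi> + \<xi>)\<^sup>2 / 2"
    using True by (intro integral_FTC_Icc_real) (auto intro!: derivative_eq_intros continuous_intros)
  ultimately show ?thesis by simp
next
  case False
  have "(\<integral>x. kink x \<xi> \<partial>lborel) = (\<integral>x. (- \<xi> - x) * indicator {0..-\<xi>} x \<partial>lborel)"
  proof (rule integral_cong_AE)
    have "AE x in lborel. x \<noteq> (0::real)" by (rule AE_lborel_singleton)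
    then show "AE x in lborel. kink x \<xi> = (- \<xi> - x) * indicator {0..-\<xi>} x"
      by eventually_elim (use False in \<open>auto simp: kink_def indicator_def\<close>)
  qed measurable
  also have "\<dots> = (- ((- \<xi> - (- \<xi>))\<^sup>2 / 2)) - (- ((- \<xi> - 0)\<^sup>2 / 2))"
    using False by (intro integral_FTC_Icc_real) (auto intro!: derivative_eq_intros continuous_intros simp: field_simps)
  finally show ?thesis by simp
qed

section \<open>Drift of the positive part of the deviation, and a potential function\<close>

context erlang_walk
begin

lemma dev_moments:
  shows "integrable M (dev c j)" "integrable M (\<lambda>\<omega>. (dev c j \<omega>)\<^sup>2)"
    "expectation (dev c j) = real (j * k) - boundary k c j"
    "expectation (\<lambda>\<omega>. (dev c j \<omega>)\<^sup>2) = real (j * k) + (real (j * k) - boundary k c j)\<^sup>2"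
proof -
  have e: "(dev c j \<omega>)\<^sup>2 = (walk j \<omega>)\<^sup>2 - 2 * boundary k c j * walk j \<omega> + (boundary k c j)\<^sup>2" for \<omega>
    by (simp add: dev_def power2_eq_square algebra_simps)
  note m = walk_moments[of j]
  show "integrable M (dev c j)" unfolding dev_def[abs_def] using m by simp
  show "integrable M (\<lambda>\<omega>. (dev c j \<omega>)\<^sup>2)" unfolding e using m by simp
  show "expectation (dev c j) = real (j * k) - boundary k c j"
    unfolding dev_def[abs_def] using m by (simp add: prob_space)
  show "expectation (\<lambda>\<omega>. (dev c j \<omega>)\<^sup>2) = real (j * k) + (real (j * k) - boundary k c j)\<^sup>2"
    unfolding e using m by (simp add: prob_space) (simp add: power2_eq_square algebra_simps)
qed

lemma step_moments:
  shows "integrable M (G j)" "integrable M (\<lambda>\<omega>. (G j \<omega>)\<^sup>2)"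
    "expectation (G j) = real k" "expectation (\<lambda>\<omega>. (G j \<omega>)\<^sup>2) = real k * (real k + 1)"
proof -
  define n where "n = k - 1"
  have n: "k = Suc n" using k_ge_1 by (simp add: n_def)
  have d: "distributed M lborel (G j) (erlang_density n 1)"
    using distributed_G by (simp add: n_def)
  have f1: "fact (n + 1) / (fact n * 1 ^ 1) = real n + 1" by simp
  have "fact (n + 2) = (fact n :: real) * ((real n + 1) * (real n + 2))"
    by (simp add: numeral_2_eq_2 algebra_simps)
  then have f2: "fact (n + 2) / (fact n * 1 ^ 2) = (real n + 1) * (real n + 2)" by simp
  show "integrable M (G j)" "integrable M (\<lambda>\<omega>. (G j \<omega>)\<^sup>2)"
    "expectation (G j) = real k" "expectation (\<lambda>\<omega>. (G j \<omega>)\<^sup>2) = real k * (real k + 1)"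
    using erlang_ith_moment_integrable[OF _ d, of 1] erlang_ith_moment_integrable[OF _ d, of 2]
      erlang_ith_moment[OF _ d, of 1] erlang_ith_moment[OF _ d, of 2] unfolding n f1 f2
    by (simp_all add: algebra_simps)
qed

text \<open>Step j belongs to the block after j and is therefore independent of
  \<open>dev c j\<close>; integrability of the product comes from |a b| <= a^2 + b^2.\<close>

lemma expectation_step_mult:
  assumes j: "j \<ge> 1" and f[measurable]: "f \<in> borel_measurable borel"
    and int: "integrable M (\<lambda>\<omega>. (f (dev c j \<omega>))\<^sup>2)"
  shows "expectation (\<lambda>\<omega>. G j \<omega> * f (dev c j \<omega>)) = real k * expectation (\<lambda>\<omega>. f (dev c j \<omega>))"
    "integrable M (\<lambda>\<omega>. G j \<omega> * f (dev c j \<omega>))"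
proof -
  let ?P = "PiM {..<1::nat} (\<lambda>_. borel :: real measure)"
  show int2: "integrable M (\<lambda>\<omega>. G j \<omega> * f (dev c j \<omega>))"
  proof (rule Bochner_Integration.integrable_bound)
    show "integrable M (\<lambda>\<omega>. (G j \<omega>)\<^sup>2 + (f (dev c j \<omega>))\<^sup>2)"
      using step_moments[of j] int by simp
    have "\<bar>a * b\<bar> \<le> a\<^sup>2 + b\<^sup>2" for a b :: real
    proof -
      have "2 * (\<bar>a\<bar> * \<bar>b\<bar>) \<le> a\<^sup>2 + b\<^sup>2"
        using zero_le_power2[of "\<bar>a\<bar> - \<bar>b\<bar>"] by (simp add: power2_diff)
      then have "\<bar>a\<bar> * \<bar>b\<bar> \<le> a\<^sup>2 + b\<^sup>2"
        using mult_nonneg_nonneg[OF abs_ge_zero abs_ge_zero, of a b] by linarith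
      then show ?thesis by (simp add: abs_mult)
    qed
    then show "AE \<omega> in M. norm (G j \<omega> * f (dev c j \<omega>)) \<le> norm ((G j \<omega>)\<^sup>2 + (f (dev c j \<omega>))\<^sup>2)"
      by (intro AE_I2) simp
  qed measurable
  define H where "H = (\<lambda>(v :: nat \<Rightarrow> real) x. v 0 * f x)"
  have v0: "(\<lambda>v. v 0) \<in> borel_measurable ?P" by (rule measurable_component_singleton) simp
  have Hm: "(\<lambda>(v, x). H v x) \<in> borel_measurable (?P \<Otimes>\<^sub>M borel)"
    unfolding H_def case_prod_beta
    by (intro borel_measurable_times measurable_compose[OF measurable_fst v0] measurable_compose[OF measurable_snd f])
  have H_eq: "H (future 1 j \<omega>) (dev c j \<omega>) = G j \<omega> * f (dev c j \<omega>)" for \<omega>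
    by (simp add: H_def future_def)
  define E where "E = (\<integral>x. f x * dev_density k c j x \<partial>lborel)"
  have E: "expectation (\<lambda>\<omega>. f (dev c j \<omega>)) = E"
    unfolding E_def using distributed_integral[OF dev_distributed[OF j], of f c]
    by (simp add: mult.commute)
  have "expectation (\<lambda>\<omega>. G j \<omega> * f (dev c j \<omega>)) = expectation (\<lambda>\<omega>. H (future 1 j \<omega>) (dev c j \<omega>))"
    unfolding H_eq ..
  also have "\<dots> = (\<integral>v. (\<integral>x. H v x * dev_density k c j x \<partial>lborel) \<partial>block_law 1)"
  proof (rule expectation_future_dev[OF _ j Hm])
    show "integrable M (\<lambda>\<omega>. H (future 1 j \<omega>) (dev c j \<omega>))" unfolding H_eq by (rule int2)
  qed simp
  also have "\<dots> = (\<integral>v. v 0 * E \<partial>block_law 1)"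
    by (simp add: H_def E_def mult.assoc)
  also have "\<dots> = (\<integral>v. v 0 \<partial>block_law 1) * E" by simp
  also have "(\<integral>v. v 0 \<partial>block_law 1) = expectation (\<lambda>\<omega>. future 1 0 \<omega> 0)"
    by (rule integral_block_law[OF _ v0]) simp
  also have "\<dots> = real k" using step_moments(3)[of 0] by (simp add: future_def)
  finally show "expectation (\<lambda>\<omega>. G j \<omega> * f (dev c j \<omega>)) = real k * expectation (\<lambda>\<omega>. f (dev c j \<omega>))"
    by (simp add: E)
qed

definition step_shift :: "real \<Rightarrow> nat \<Rightarrow> real" where
  "step_shift c j = boundary k c (Suc j) - boundary k c j"

definition pos_prob :: "real \<Rightarrow> nat \<Rightarrow> real" where
  "pos_prob c j = prob {\<omega>\<in>space M. dev c j \<omega> > 0}"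

definition pos_mean :: "real \<Rightarrow> nat \<Rightarrow> real" where
  "pos_mean c j = expectation (\<lambda>\<omega>. max 0 (dev c j \<omega>))"

definition pos_square :: "real \<Rightarrow> nat \<Rightarrow> real" where
  "pos_square c j = expectation (\<lambda>\<omega>. (max 0 (dev c j \<omega>))\<^sup>2)"

definition kink_mean :: "real \<Rightarrow> nat \<Rightarrow> real" where
  "kink_mean c j = expectation (\<lambda>\<omega>. kink (dev c j \<omega>) (G j \<omega> - step_shift c j))"

lemma step_shift_eq: "step_shift c j = real k * (2 * real (j * k) + real k + 1) / c"
  using boundary_diff[of c j 1] by (simp add: step_shift_def)

lemma dev_Suc: "dev c (Suc j) \<omega> = dev c j \<omega> + (G j \<omega> - step_shift c j)"
  by (simp add: dev_def walk_def step_shift_def)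

lemma pos_integrable:
  "integrable M (\<lambda>\<omega>. max 0 (dev c j \<omega>))" "integrable M (\<lambda>\<omega>. (max 0 (dev c j \<omega>))\<^sup>2)"
proof -
  show "integrable M (\<lambda>\<omega>. max 0 (dev c j \<omega>))" using dev_moments(1) by auto
  show "integrable M (\<lambda>\<omega>. (max 0 (dev c j \<omega>))\<^sup>2)"
    by (rule Bochner_Integration.integrable_bound[OF dev_moments(2)[of c j]]) (auto simp: max_def)
qed

lemma kink_integrable: "integrable M (\<lambda>\<omega>. kink (dev c j \<omega>) (G j \<omega> - step_shift c j))"
proof (rule Bochner_Integration.integrable_bound)
  show "integrable M (\<lambda>\<omega>. G j \<omega> - step_shift c j)" using step_moments(1)[of j] by simp
qed (use kink_le kink_nonneg in \<open>auto simp: abs_of_nonneg\<close>)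

lemma kink_mean_nonneg: "kink_mean c j \<ge> 0"
  unfolding kink_mean_def by (intro integral_nonneg_AE) (simp add: kink_nonneg)

lemma pos_prob_eq: "pos_prob c j = expectation (\<lambda>\<omega>. of_bool (dev c j \<omega> > 0))"
proof -
  have "expectation (\<lambda>\<omega>. of_bool (dev c j \<omega> > 0)) = expectation (indicator {\<omega>\<in>space M. dev c j \<omega> > 0})"
    by (intro Bochner_Integration.integral_cong) (auto simp: indicator_def)
  also have "\<dots> = pos_prob c j" by (simp add: pos_prob_def)
  finally show ?thesis by simp
qed

text \<open>The mean of \<open>pos_part_add\<close>: the next step is independent of
  \<open>dev c j\<close>, so only its mean k - \<open>step_shift c j\<close> meets the indicator of
  \<open>dev c j\<close> > 0.\<close>

lemma pos_mean_Suc: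
  assumes j: "j \<ge> 1"
  shows "pos_mean c (Suc j) = pos_mean c j + (real k - step_shift c j) * pos_prob c j + kink_mean c j"
proof -
  define f where "f = (\<lambda>d::real. of_bool (d > 0) :: real)"
  have f: "f \<in> borel_measurable borel" unfolding f_def of_bool_def by measurable
  have fi: "integrable M (\<lambda>\<omega>. f (dev c j \<omega>))" "integrable M (\<lambda>\<omega>. (f (dev c j \<omega>))\<^sup>2)"
    by (rule Bochner_Integration.integrable_bound[of M "\<lambda>_. 1::real"]; use f in \<open>auto simp: f_def intro: measurable_compose[of "dev c j"]\<close>)+
  note m = expectation_step_mult[OF j f fi(2)]
  have "pos_mean c (Suc j) = expectation (\<lambda>\<omega>. max 0 (dev c j \<omega>) + (G j \<omega> * f (dev c j \<omega>) - step_shift c j * f (dev c j \<omega>)) + kink (dev c j \<omega>) (G j \<omega> - step_shift c j))"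
    unfolding pos_mean_def dev_Suc pos_part_add f_def by (simp add: algebra_simps)
  also have "\<dots> = pos_mean c j + (real k * expectation (\<lambda>\<omega>. f (dev c j \<omega>)) - step_shift c j * expectation (\<lambda>\<omega>. f (dev c j \<omega>))) + kink_mean c j"
    using m fi pos_integrable(1)[of c j] kink_integrable[of c j]
    by (simp add: pos_mean_def kink_mean_def)
  also have "expectation (\<lambda>\<omega>. f (dev c j \<omega>)) = pos_prob c j"
    by (simp add: pos_prob_eq f_def)
  finally show ?thesis by (simp add: algebra_simps)
qed

text \<open>The bound is the second moment of \<open>G j\<close> - \<open>step_shift c j\<close>, a
  variable of variance k. The square enters the potential divided by c, so a bounded error is
  harmless.\<close>

lemma pos_square_Suc:
  assumes j: "j \<ge> 1"
  shows "\<bar>pos_square c (Suc j) - pos_square c j - 2 * (real k - step_shift c j) * pos_mean c j\<bar> \<le> real k + (real k - step_shift c j)\<^sup>2"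
proof -
  define f where "f = (\<lambda>d::real. max 0 d)"
  have f: "f \<in> borel_measurable borel" unfolding f_def by measurable
  have fi: "integrable M (\<lambda>\<omega>. f (dev c j \<omega>))" "integrable M (\<lambda>\<omega>. (f (dev c j \<omega>))\<^sup>2)"
    using pos_integrable by (auto simp: f_def)
  note m = expectation_step_mult[OF j f fi(2)]
  define h where "h = (\<lambda>\<omega>. (max 0 (dev c (Suc j) \<omega>))\<^sup>2 - (f (dev c j \<omega>))\<^sup>2 - 2 * (G j \<omega> * f (dev c j \<omega>) - step_shift c j * f (dev c j \<omega>)))"
  have hi: "integrable M h"
    unfolding h_def using m fi pos_integrable by simp
  have "expectation h = pos_square c (Suc j) - pos_square c j - 2 * (real k * pos_mean c j - step_shift c j * pos_mean c j)"
    unfolding h_def using m fi pos_integrable(2)[of c "Suc j"] by (simp add: pos_square_def pos_mean_def f_def)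
  then have eq: "pos_square c (Suc j) - pos_square c j - 2 * (real k - step_shift c j) * pos_mean c j = expectation h"
    by (simp add: algebra_simps)
  have si: "integrable M (\<lambda>\<omega>. (G j \<omega> - step_shift c j)\<^sup>2)"
    unfolding power2_diff using step_moments[of j] by simp
  have "\<bar>expectation h\<bar> \<le> expectation (\<lambda>\<omega>. \<bar>h \<omega>\<bar>)" by (rule integral_abs_bound)
  also have "\<dots> \<le> expectation (\<lambda>\<omega>. (G j \<omega> - step_shift c j)\<^sup>2)"
  proof (rule integral_mono)
    show "\<bar>h \<omega>\<bar> \<le> (G j \<omega> - step_shift c j)\<^sup>2" for \<omega>
      using pos_part_square_add[of "dev c j \<omega>" "G j \<omega> - step_shift c j"]
      by (simp add: h_def f_def dev_Suc algebra_simps)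
  qed (use hi si in auto)
  also have "\<dots> = real k + (real k - step_shift c j)\<^sup>2"
    unfolding power2_diff using step_moments[of j]
    by (simp add: prob_space) (simp add: power2_eq_square algebra_simps)
  finally show ?thesis unfolding eq .
qed

text \<open>\<open>kink\<close> has integral \<xi>^2 / 2 over the starting height, and near the
  boundary the step is G - 2 k, with second moment k (k + 1). Half of this, divided by k, is the
  limit.\<close>

lemma kink_sum_limit: "((\<lambda>c. \<Sum>j\<in>window k c. kink_mean c j) \<longlongrightarrow> (real k + 1) / 2) at_top"
proof -
  let ?P = "PiM {..<1::nat} (\<lambda>_. borel :: real measure)"
  define H where "H = (\<lambda>c j (v :: nat \<Rightarrow> real) x. kink x (v 0 - step_shift c j))"
  define H0 where "H0 = (\<lambda>(v :: nat \<Rightarrow> real) x. kink x (v 0 - 2 * real k))"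
  have v0: "(\<lambda>v. v 0) \<in> borel_measurable ?P" by (rule measurable_component_singleton) simp
  have v0': "(\<lambda>y. fst y 0) \<in> borel_measurable (?P \<Otimes>\<^sub>M borel)" by (rule measurable_compose[OF measurable_fst v0])
  have Hm: "(\<lambda>(v, x). H c j v x) \<in> borel_measurable (?P \<Otimes>\<^sub>M borel)" for c j
    unfolding H_def case_prod_beta by (intro kink_measurable borel_measurable_diff v0') auto
  have H0m: "(\<lambda>(v, x). H0 v x) \<in> borel_measurable (?P \<Otimes>\<^sub>M borel)"
    unfolding H0_def case_prod_beta by (intro kink_measurable borel_measurable_diff v0') auto
  have "((\<lambda>c. \<Sum>j\<in>window k c. expectation (\<lambda>\<omega>. H c j (future 1 j \<omega>) (dev c j \<omega>)))
     \<longlongrightarrow> (\<integral>v. (\<integral>x. H0 v x \<partial>lborel) \<partial>block_law 1) / k) at_top"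
  proof (rule renewal_sum_limit[OF _ Hm H0m])
    show "\<forall>\<^sub>F c in at_top. \<forall>j\<in>window k c. \<forall>v x. \<bar>H c j v x\<bar> \<le> block_radius 1 v * indicator {- block_radius 1 v..block_radius 1 v} x"
      using eventually_window[OF k_ge_1]
    proof eventually_elim
      case (elim c)
      show ?case
      proof (intro ballI allI)
        fix j v x assume j: "j \<in> window k c"
        have n: "real (j * k) \<le> c + c powr (3/5)" using elim j by auto
        have "2 * real (j * k) + real k + 1 \<le> 4 * c" using n elim by linarith
        then have "real k * (2 * real (j * k) + real k + 1) \<le> real k * (4 * c)" by (intro mult_left_mono) auto
        then have "step_shift c j \<le> 4 * real k" "0 \<le> step_shift c j" unfolding step_shift_eq using elim by (auto simp: field_simps)
        then have *: "\<bar>v 0 - step_shift c j\<bar> \<le> block_radius 1 v" by (simp add: block_radius_def)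
        show "\<bar>H c j v x\<bar> \<le> block_radius 1 v * indicator {- block_radius 1 v..block_radius 1 v} x"
        proof (cases "\<bar>x\<bar> \<le> block_radius 1 v")
          case True
          then have "indicator {- block_radius 1 v..block_radius 1 v} x = (1::real)" by (simp add: abs_le_iff indicator_def)
          then show ?thesis using kink_le[of x "v 0 - step_shift c j"] kink_nonneg[of x "v 0 - step_shift c j"] * by (simp add: H_def)
        next
          case False
          then have "H c j v x = 0" unfolding H_def using * by (intro kink_eq_0) linarith
          then show ?thesis using block_radius_ge_1[of 1 v] by simp
        qed
      qed
    qed
    fix z f v assume f: "((\<lambda>c. (real (f c * k) - c) / sqrt c) \<longlongrightarrow> z) at_top"
    have d: "((\<lambda>c. step_shift c (f c)) \<longlongrightarrow> 2 * real k) at_top"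
      using boundary_diff_tendsto[OF f, of 1] by (simp add: step_shift_def)
    have "((\<lambda>c. H c (f c) v x) \<longlongrightarrow> H0 v x) at_top" for x
      unfolding H_def H0_def kink_def by (cases "x > 0") (auto intro!: tendsto_max tendsto_minus tendsto_intros d)
    then show "AE x in lborel. ((\<lambda>c. H c (f c) v x) \<longlongrightarrow> H0 v x) at_top" by simp
  qed simp
  moreover have "expectation (\<lambda>\<omega>. H c j (future 1 j \<omega>) (dev c j \<omega>)) = kink_mean c j" for c j
    by (simp add: H_def kink_mean_def future_def)
  moreover have "(\<integral>v. (\<integral>x. H0 v x \<partial>lborel) \<partial>block_law 1) / k = (real k + 1) / 2"
  proof -
    have "(\<integral>v. (\<integral>x. H0 v x \<partial>lborel) \<partial>block_law 1) = (\<integral>v. (v 0 - 2 * real k)\<^sup>2 / 2 \<partial>block_law 1)"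
      by (simp add: H0_def integral_kink)
    also have "\<dots> = expectation (\<lambda>\<omega>. (future 1 0 \<omega> 0 - 2 * real k)\<^sup>2 / 2)"
      by (rule integral_block_law) (use v0 in auto)
    also have "\<dots> = expectation (\<lambda>\<omega>. (G 0 \<omega> - 2 * real k)\<^sup>2) / 2"
      by (simp add: future_def)
    also have "expectation (\<lambda>\<omega>. (G 0 \<omega> - 2 * real k)\<^sup>2) = real k * (real k + 1)"
      unfolding power2_diff using step_moments[of 0]
      by (simp add: prob_space) (simp add: power2_eq_square algebra_simps)
    finally show ?thesis using k_ge_1 by simp
  qed
  ultimately show ?thesis by (simp only:)
qed

text \<open>
  With \<open>D\<close> for \<open>dev\<close> and \<open>n = j k\<close>, this is the mean of \<open>(1 - 2 (n - c) / c) D\<^sup>+ - (D\<^sup>+)\<^sup>2 / c\<close>.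
  The coefficients are those for which the linear terms in \<open>(n - c) / c\<close> and \<open>D / c\<close> of the drift
  on \<open>D > 0\<close> cancel, leaving \<open>-k\<close>.
\<close>

definition potential :: "real \<Rightarrow> nat \<Rightarrow> real" where
  "potential c j = (3 - 2 * real (j * k) / c) * pos_mean c j - pos_square c j / c"

text \<open>With u = 2 (n - c) / c and t = (k + 1) / c the mean step is - k (1 + u + t). The
  coefficient 1 - u compensates the factor 1 + u up to u^2, and its decrease by 2 k / c per step
  compensates the leading drift of the squared term. Apart from a multiple of
  \<open>kink_mean\<close> of order K / c, with K = c^(3/5), the errors are of order K^2 / c^2 per
  step, and there are O(K) steps.\<close>

lemma potential_step:
  "eventually (\<lambda>c. \<forall>j\<in>window k c. \<bar>potential c (Suc j) - potential c j + real k * pos_prob c j - kink_mean c j\<bar>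
    \<le> 104 * (real k)\<^sup>2 * ((c powr (3/5))\<^sup>2 / c\<^sup>2) + 4 * (c powr (3/5) / c) * kink_mean c j) at_top"
proof -
  have "eventually (\<lambda>c::real. c powr (3/5) \<ge> sqrt c \<and> c powr (3/5) \<ge> 1 + real k) at_top"
    by (intro eventually_conj; real_asymp)
  with eventually_window[OF k_ge_1] show ?thesis
  proof eventually_elim
    case (elim c)
    define K where "K = c powr (3/5)"
    have c: "c \<ge> 100" and kc: "real k \<le> c / 4" and Kc: "K \<le> c / 4" and Ks: "sqrt c \<le> K" and Kk: "1 + real k \<le> K"
      using elim by (auto simp: K_def)
    have K1: "K \<ge> 1" using Kk by simp
    have cK: "c \<le> K\<^sup>2" using Ks c by (metis real_sqrt_le_iff real_sqrt_abs abs_of_nonneg order_trans K1 zero_le_one)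
    have k1: "real k \<ge> 1" using k_ge_1 by simp
    show ?case
    proof
      fix j assume j: "j \<in> window k c"
      define n where "n = real (j * k)"
      define y where "y = n - c"
      have j1: "j \<ge> 1" using elim j by auto
      have "c - K \<le> n" "n \<le> c + K"
        using elim(1) j unfolding n_def K_def by (meson atLeastLessThan_iff less_imp_le)+
      then have y: "\<bar>y\<bar> \<le> K" by (simp add: y_def abs_le_iff)
      have n2: "n \<le> 2 * c" "n \<ge> 0" using y Kc c by (auto simp: y_def)
      define p where "p = pos_prob c j"
      define \<kappa> where "\<kappa> = kink_mean c j"
      define a where "a = pos_mean c j"
      define e where "e = pos_square c (Suc j) - pos_square c j - 2 * (real k - step_shift c j) * a"
      define \<delta> where "\<delta> = real k - step_shift c j"
      define u where "u = 2 * y / c"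
      define v where "v = 2 * real k / c"
      define t where "t = (real k + 1) / c"
      have p: "0 \<le> p" "p \<le> 1" by (auto simp: p_def pos_prob_def)
      have \<kappa>: "0 \<le> \<kappa>" by (simp add: \<kappa>_def kink_mean_nonneg)
      have a0: "0 \<le> a" unfolding a_def pos_mean_def by (intro integral_nonneg_AE) auto
      have \<delta>: "\<delta> = - real k * (1 + u + t)"
        unfolding \<delta>_def step_shift_eq n_def[symmetric] u_def t_def y_def using c by (simp add: field_simps)
      have w: "3 - 2 * real (Suc j * k) / c = 1 - u - v"
        unfolding u_def v_def y_def n_def using c by (simp add: field_simps)
      have w0: "3 - 2 * real (j * k) / c = 1 - u"
        unfolding u_def y_def n_def using c by (simp add: field_simps)
      have "potential c (Suc j) - potential c j + real k * p - \<kappa> =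
          (1 - u - v) * (a + \<delta> * p + \<kappa>) - (1 - u) * a - (e + 2 * \<delta> * a) / c + real k * p - \<kappa>"
        unfolding potential_def w w0 pos_mean_Suc[OF j1] a_def[symmetric] \<delta>_def[symmetric] p_def[symmetric] \<kappa>_def[symmetric] e_def
        by (simp add: diff_divide_distrib add_divide_distrib)
      also have "\<dots> = p * ((1 - u - v) * \<delta> + real k) - \<kappa> * (u + v) - (2 / c) * (real k + \<delta>) * a - e / c"
        using c by (simp add: v_def field_simps)
      finally have err: "potential c (Suc j) - potential c j + real k * p - \<kappa> =
          p * ((1 - u - v) * \<delta> + real k) - \<kappa> * (u + v) - (2 / c) * (real k + \<delta>) * a - e / c" .
      \<comment> \<open>All errors are measured in Q. The total 104 = 14 + 80 + 10 comes from
        \<open>T1\<close>, \<open>T3\<close> and \<open>T4\<close>; \<open>T2\<close> is the term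
        with \<kappa>.\<close>
      define Q where "Q = K\<^sup>2 / c\<^sup>2"
      have Qc: "1 / c \<le> Q"
      proof -
        have "1 / c = c / c\<^sup>2" using c by (simp add: power2_eq_square)
        also have "\<dots> \<le> Q" unfolding Q_def using cK by (intro divide_right_mono) auto
        finally show ?thesis .
      qed
      have kk: "real k \<le> (real k)\<^sup>2" using k1 by (simp add: self_le_power)
      have u: "\<bar>u\<bar> \<le> 2 * (K / c)" "\<bar>u\<bar> \<le> 1"
        using y c Kc by (auto simp: u_def field_simps)
      have v: "0 \<le> v" "v \<le> 1" "v \<le> 2 * real k * Q" "v \<le> 2 * (K / c)"
        using c kc k1 Kk mult_left_mono[OF Qc, of "2 * real k"] by (auto simp: v_def field_simps)
      have "(real k + 1) * (1 / c) \<le> (2 * real k) * Q"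
        using Qc c k1 by (intro mult_mono) auto
      then have t: "0 \<le> t" "t \<le> 1" "t \<le> 2 * real k * Q"
        using c kc k1 by (auto simp: t_def)
      have u2: "u\<^sup>2 \<le> 4 * Q"
      proof -
        have "\<bar>u\<bar>\<^sup>2 \<le> (2 * (K / c))\<^sup>2" using u by (intro power_mono) auto
        then show ?thesis by (simp add: Q_def power_mult_distrib power_divide)
      qed
      have T1: "\<bar>p * ((1 - u - v) * \<delta> + real k)\<bar> \<le> 14 * (real k)\<^sup>2 * Q"
      proof -
        \<comment> \<open>The term linear in u drops out. The six that remain are together at most
          (2 + 4 + 2 + 2 + 2 + 2) k Q.\<close>
        have "(1 - u - v) * \<delta> + real k = - real k * (t - u\<^sup>2 - u * t - v - v * u - v * t)"
          unfolding \<delta> by (simp add: power2_eq_square algebra_simps)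
        also have "\<bar>\<dots>\<bar> = real k * \<bar>t - u\<^sup>2 - u * t - v - v * u - v * t\<bar>" by (simp add: abs_mult)
        also have "\<dots> \<le> real k * (14 * real k * Q)"
        proof (rule mult_left_mono)
          have "\<bar>u * t\<bar> \<le> t" "\<bar>v * u\<bar> \<le> v" "\<bar>v * t\<bar> \<le> t"
            using u t v by (auto simp: abs_mult mult_left_le_one_le mult_left_le mult_right_le_one_le)
          moreover have "Q \<le> real k * Q" using k1 mult_right_mono[of 1 "real k" Q] by (simp add: Q_def)
          ultimately show "\<bar>t - u\<^sup>2 - u * t - v - v * u - v * t\<bar> \<le> 14 * real k * Q"
            using u2 t v zero_le_power2[of u] by linarith
        qed simp
        finally have "\<bar>(1 - u - v) * \<delta> + real k\<bar> \<le> 14 * (real k)\<^sup>2 * Q" by (simp add: power2_eq_square mult_ac)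
        moreover have "\<bar>p * ((1 - u - v) * \<delta> + real k)\<bar> \<le> \<bar>(1 - u - v) * \<delta> + real k\<bar>"
          using p by (simp add: abs_mult mult_left_le_one_le)
        ultimately show ?thesis by linarith
      qed
      have T2: "\<bar>\<kappa> * (u + v)\<bar> \<le> 4 * (K / c) * \<kappa>"
      proof -
        have "\<bar>u + v\<bar> \<le> 4 * (K / c)" using u v by linarith
        from mult_left_mono[OF this \<kappa>] show ?thesis using \<kappa> by (simp add: abs_mult mult_ac)
      qed
      \<comment> \<open>From d <= d^2 / (2 K) + K / 2: the second moment of \<open>dev\<close> is of
        order K^2 in the window, since both its variance n and its squared mean are at most of that
        order.\<close>
      have a_le: "a \<le> 10 * K"
      proof -
        have "a \<le> expectation (\<lambda>\<omega>. (dev c j \<omega>)\<^sup>2 / (2 * K) + K / 2)"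
          unfolding a_def pos_mean_def
        proof (rule integral_mono[OF pos_integrable(1)])
          show "integrable M (\<lambda>\<omega>. (dev c j \<omega>)\<^sup>2 / (2 * K) + K / 2)" using dev_moments(2) by simp
          fix \<omega>
          have "0 \<le> (dev c j \<omega> - K)\<^sup>2" by simp
          then have "2 * K * dev c j \<omega> \<le> (dev c j \<omega>)\<^sup>2 + K\<^sup>2" by (simp add: power2_diff algebra_simps)
          then show "max 0 (dev c j \<omega>) \<le> (dev c j \<omega>)\<^sup>2 / (2 * K) + K / 2"
            using K1 by (auto simp: field_simps power2_eq_square)
        qed
        also have "\<dots> = (n + (n - boundary k c j)\<^sup>2) / (2 * K) + K / 2"
          using dev_moments(2)[of c j] dev_moments(4)[of c j] by (simp add: prob_space n_def)
        also have "(n - boundary k c j)\<^sup>2 \<le> 16 * K\<^sup>2"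
        proof -
          have "n - boundary k c j = - ((n / c) * (y + 1))"
            unfolding boundary_def n_def[symmetric] y_def using c by (simp add: field_simps)
          then have "\<bar>n - boundary k c j\<bar> = (n / c) * \<bar>y + 1\<bar>" using n2 c by (simp add: abs_mult)
          also have "\<dots> \<le> 2 * (2 * K)"
            using n2 c y K1 by (intro mult_mono) (auto simp: field_simps)
          finally have "\<bar>n - boundary k c j\<bar>\<^sup>2 \<le> (4 * K)\<^sup>2" by (intro power_mono) auto
          then show ?thesis by (simp add: power_mult_distrib)
        qed
        also have "n \<le> 2 * K\<^sup>2" using n2 cK by simp
        finally have "a \<le> (2 * K\<^sup>2 + 16 * K\<^sup>2) / (2 * K) + K / 2" using K1 by (simp add: divide_right_mono)
        also have "\<dots> = 19 / 2 * K" using K1 by (simp add: power2_eq_square field_simps)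
        finally show ?thesis using K1 by simp
      qed
      have T3: "\<bar>(2 / c) * (real k + \<delta>) * a\<bar> \<le> 80 * (real k)\<^sup>2 * Q"
      proof -
        have "real k + 1 \<le> 2 * real k * K" using k1 K1 mult_mono[of "real k + 1" "2 * real k" 1 K] by simp
        then have "t \<le> (2 * real k * K) / c" unfolding t_def using c by (intro divide_right_mono) auto
        then have "t \<le> 2 * real k * (K / c)" by simp
        then have "\<bar>u + t\<bar> \<le> 4 * real k * (K / c)" using u t k1 K1 c mult_right_mono[of 1 "real k" "K / c"] by (auto simp: abs_le_iff)
        then have "real k * \<bar>u + t\<bar> \<le> real k * (4 * real k * (K / c))" by (intro mult_left_mono) auto
        moreover have "real k + \<delta> = - real k * (u + t)" unfolding \<delta> by (simp add: algebra_simps)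
        then have "\<bar>real k + \<delta>\<bar> = real k * \<bar>u + t\<bar>" by (simp add: abs_mult)
        moreover have "real k * (4 * real k * (K / c)) = 4 * (real k)\<^sup>2 * (K / c)" by (simp add: power2_eq_square)
        ultimately have *: "\<bar>real k + \<delta>\<bar> \<le> 4 * (real k)\<^sup>2 * (K / c)" by linarith
        have "\<bar>(2 / c) * (real k + \<delta>) * a\<bar> = (2 / c) * (\<bar>real k + \<delta>\<bar> * a)" unfolding abs_mult using c a0 by simp
        also have "\<dots> \<le> (2 / c) * ((4 * (real k)\<^sup>2 * (K / c)) * (10 * K))"
          using c a0 a_le * by (intro mult_left_mono mult_mono) auto
        also have "\<dots> = 80 * (real k)\<^sup>2 * Q" by (simp add: Q_def power2_eq_square)
        finally show ?thesis .
      qed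
      have T4: "\<bar>e / c\<bar> \<le> 10 * (real k)\<^sup>2 * Q"
      proof -
        have "\<bar>1 + u + t\<bar> \<le> 3" using u t by linarith
        then have "\<bar>\<delta>\<bar> \<le> real k * 3" unfolding \<delta> abs_mult by (simp add: mult_left_mono)
        then have "\<bar>\<delta>\<bar>\<^sup>2 \<le> (real k * 3)\<^sup>2" by (intro power_mono) auto
        then have "\<bar>e\<bar> \<le> real k + 9 * (real k)\<^sup>2"
          using pos_square_Suc[OF j1, of c] unfolding e_def a_def \<delta>_def by (simp add: power_mult_distrib)
        then have "\<bar>e\<bar> \<le> 10 * (real k)\<^sup>2" using kk by linarith
        then have "\<bar>e\<bar> * (1 / c) \<le> (10 * (real k)\<^sup>2) * Q" using Qc c by (intro mult_mono) auto
        then show ?thesis using c by simp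
      qed
      have "\<bar>potential c (Suc j) - potential c j + real k * p - \<kappa>\<bar> \<le> 104 * (real k)\<^sup>2 * Q + 4 * (K / c) * \<kappa>"
      proof -
        have tri: "\<bar>x1 - x2 - x3 - x4\<bar> \<le> b1 + b2 + b3 + b4" if "\<bar>x1\<bar> \<le> b1" "\<bar>x2\<bar> \<le> b2" "\<bar>x3\<bar> \<le> b3" "\<bar>x4\<bar> \<le> b4"
          for x1 x2 x3 x4 b1 b2 b3 b4 :: real
          using that by linarith
        show ?thesis unfolding err by (rule order_trans[OF tri[OF T1 T2 T3 T4]]) simp
      qed
      then show "\<bar>potential c (Suc j) - potential c j + real k * pos_prob c j - kink_mean c j\<bar>
         \<le> 104 * (real k)\<^sup>2 * ((c powr (3/5))\<^sup>2 / c\<^sup>2) + 4 * (c powr (3/5) / c) * kink_mean c j"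
        by (simp add: p_def \<kappa>_def Q_def K_def)
    qed
  qed
qed

end

section \<open>Exponential tails of the deviation outside the window\<close>

context erlang_walk
begin

lemma has_mgf_dev:
  assumes "t < 1"
  shows "integrable M (\<lambda>\<omega>. exp (t * dev c j \<omega>))"
    "expectation (\<lambda>\<omega>. exp (t * dev c j \<omega>)) = (1 - t) powr (- real (j * k)) * exp (- t * boundary k c j)"
proof -
  have e: "exp (t * dev c j \<omega>) = exp (t * walk j \<omega>) * exp (- t * boundary k c j)" for \<omega>
    by (simp add: dev_def algebra_simps flip: exp_add)
  show "integrable M (\<lambda>\<omega>. exp (t * dev c j \<omega>))"
    unfolding e using has_mgf_walk[OF assms, of j] by (simp add: has_bochner_integral_iff)
  show "expectation (\<lambda>\<omega>. exp (t * dev c j \<omega>)) = (1 - t) powr (- real (j * k)) * exp (- t * boundary k c j)"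
    unfolding e using has_mgf_walk[OF assms, of j] by (simp add: has_bochner_integral_iff)
qed

text \<open>From - ln (1 - t) <= t + t^2 for |t| <= 1/2. With n = j k the exponent is negative
  exactly when t lies strictly between 0 and (n + 1 - c) / c, for n > 0; this governs the choice of
  \<open>tilt\<close>.\<close>

lemma mgf_dev_le:
  assumes t: "\<bar>t\<bar> \<le> 1 / 2" and c: "c > 0"
  shows "expectation (\<lambda>\<omega>. exp (t * dev c j \<omega>)) \<le> exp (real (j * k) * t * (t - (real (j * k) + 1 - c) / c))"
proof -
  have "- t - t\<^sup>2 \<le> ln (1 - t)"
  proof (cases "t \<ge> 0")
    case True
    define f where "f = (\<lambda>x::real. ln (1 - x) + x + x\<^sup>2)"
    have "f 0 \<le> f t"
    proof (rule DERIV_nonneg_imp_nondecreasing[OF True])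
      fix x :: real assume x: "0 \<le> x" "x \<le> t"
      then have x2: "x \<le> 1 / 2" using t by simp
      have "(f has_real_derivative (- 1 / (1 - x) + 1 + 2 * x)) (at x)"
        unfolding f_def using x2 by (auto intro!: derivative_eq_intros)
      moreover have "- 1 / (1 - x) + 1 + 2 * x = x * (1 - 2 * x) / (1 - x)"
        using x2 by (simp add: field_simps)
      moreover have "0 \<le> x * (1 - 2 * x) / (1 - x)" using x x2 by simp
      ultimately show "\<exists>d. (f has_real_derivative d) (at x) \<and> 0 \<le> d" by metis
    qed
    then show ?thesis by (simp add: f_def)
  next
    case False then show ?thesis using ln_one_plus_pos_lower_bound[of "- t"] t by simp
  qed
  then have "real (j * k) * (- ln (1 - t)) \<le> real (j * k) * (t + t\<^sup>2)" by (intro mult_left_mono) auto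
  moreover have "(1 - t) powr (- real (j * k)) = exp (real (j * k) * (- ln (1 - t)))"
    using t by (simp add: powr_def mult.commute)
  ultimately have "(1 - t) powr (- real (j * k)) \<le> exp (real (j * k) * (t + t\<^sup>2))" by simp
  then have "(1 - t) powr (- real (j * k)) * exp (- t * boundary k c j) \<le> exp (real (j * k) * (t + t\<^sup>2)) * exp (- t * boundary k c j)"
    by (intro mult_right_mono) auto
  also have "\<dots> = exp (real (j * k) * (t + t\<^sup>2) - t * boundary k c j)" by (simp flip: exp_add)
  also have "real (j * k) * (t + t\<^sup>2) - t * boundary k c j = real (j * k) * t * (t - (real (j * k) + 1 - c) / c)"
    using c by (simp add: boundary_def field_simps power2_eq_square)
  finally show ?thesis using has_mgf_dev(2)[of t] t by simp
qed

lemma pos_part_tail: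
  assumes t: "0 < t" "t \<le> 1 / 2"
  shows "pos_prob c j \<le> expectation (\<lambda>\<omega>. exp (t * dev c j \<omega>))"
    "pos_mean c j \<le> (1 / t) * expectation (\<lambda>\<omega>. exp (t * dev c j \<omega>))"
    "pos_square c j \<le> (2 / t\<^sup>2) * expectation (\<lambda>\<omega>. exp (t * dev c j \<omega>))"
proof -
  have int: "integrable M (\<lambda>\<omega>. exp (t * dev c j \<omega>))" using t by (intro has_mgf_dev) auto
  show "pos_prob c j \<le> expectation (\<lambda>\<omega>. exp (t * dev c j \<omega>))"
    unfolding pos_prob_eq
  proof (rule integral_mono[OF _ int])
    show "integrable M (\<lambda>\<omega>. of_bool (dev c j \<omega> > 0) :: real)"
    proof (rule Bochner_Integration.integrable_bound[of M "\<lambda>_. 1::real"])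
      show "(\<lambda>\<omega>. of_bool (dev c j \<omega> > 0) :: real) \<in> borel_measurable M" unfolding of_bool_def by measurable
    qed auto
    show "of_bool (0 < dev c j \<omega>) \<le> exp (t * dev c j \<omega>)" for \<omega>
      using t by (auto simp: of_bool_def)
  qed
  have "pos_mean c j \<le> expectation (\<lambda>\<omega>. (1 / t) * exp (t * dev c j \<omega>))"
    unfolding pos_mean_def
  proof (rule integral_mono[OF pos_integrable(1)])
    show "max 0 (dev c j \<omega>) \<le> (1 / t) * exp (t * dev c j \<omega>)" for \<omega>
    proof -
      have "t * dev c j \<omega> \<le> exp (t * dev c j \<omega>)" using exp_ge_add_one_self[of "t * dev c j \<omega>"] by linarith
      then show ?thesis using t by (auto simp: field_simps)
    qed
  qed (use int in simp)
  then show "pos_mean c j \<le> (1 / t) * expectation (\<lambda>\<omega>. exp (t * dev c j \<omega>))" by simp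
  have "pos_square c j \<le> expectation (\<lambda>\<omega>. (2 / t\<^sup>2) * exp (t * dev c j \<omega>))"
    unfolding pos_square_def
  proof (rule integral_mono[OF pos_integrable(2)])
    show "(max 0 (dev c j \<omega>))\<^sup>2 \<le> (2 / t\<^sup>2) * exp (t * dev c j \<omega>)" for \<omega>
    proof (cases "dev c j \<omega> > 0")
      case True
      then have "1 + t * dev c j \<omega> + (t * dev c j \<omega>)\<^sup>2 / 2 \<le> exp (t * dev c j \<omega>)"
        using t by (intro exp_lower_Taylor_quadratic) auto
      moreover have "t * dev c j \<omega> > 0" using True t by simp
      ultimately have "(t * dev c j \<omega>)\<^sup>2 \<le> 2 * exp (t * dev c j \<omega>)" by linarith
      then show ?thesis using t True by (simp add: field_simps power_mult_distrib)
    qed simp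
  qed (use int in simp)
  then show "pos_square c j \<le> (2 / t\<^sup>2) * expectation (\<lambda>\<omega>. exp (t * dev c j \<omega>))" by simp
qed

text \<open>For use below the window, where \<open>dev\<close> is rarely negative: at the lower edge
  the truncated moments may be replaced by the explicit moments of \<open>dev\<close>
  itself.\<close>

lemma neg_part_tail:
  assumes t: "0 < t" "t \<le> 1 / 2"
  shows "prob {\<omega>\<in>space M. dev c j \<omega> \<le> 0} \<le> expectation (\<lambda>\<omega>. exp (- t * dev c j \<omega>))"
    "\<bar>pos_mean c j - expectation (dev c j)\<bar> \<le> (1 / t) * expectation (\<lambda>\<omega>. exp (- t * dev c j \<omega>))"
    "\<bar>pos_square c j - expectation (\<lambda>\<omega>. (dev c j \<omega>)\<^sup>2)\<bar> \<le> (2 / t\<^sup>2) * expectation (\<lambda>\<omega>. exp (- t * dev c j \<omega>))"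
proof -
  have int: "integrable M (\<lambda>\<omega>. exp (- t * dev c j \<omega>))" using t by (intro has_mgf_dev) auto
  have "prob {\<omega>\<in>space M. dev c j \<omega> \<le> 0} = expectation (indicator {\<omega>\<in>space M. dev c j \<omega> \<le> 0})" by simp
  also have "\<dots> \<le> expectation (\<lambda>\<omega>. exp (- t * dev c j \<omega>))"
  proof (rule integral_mono[OF _ int])
    show "integrable M (indicator {\<omega>\<in>space M. dev c j \<omega> \<le> 0} :: 'a \<Rightarrow> real)"
      by (intro integrable_real_indicator) (auto simp: emeasure_eq_measure)
    show "indicator {\<omega>\<in>space M. dev c j \<omega> \<le> 0} \<omega> \<le> exp (- t * dev c j \<omega>)" for \<omega>
      using t by (auto simp: indicator_def mult_nonneg_nonpos)
  qed
  finally show "prob {\<omega>\<in>space M. dev c j \<omega> \<le> 0} \<le> expectation (\<lambda>\<omega>. exp (- t * dev c j \<omega>))" .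
  have "\<bar>expectation (\<lambda>\<omega>. max 0 (dev c j \<omega>) - dev c j \<omega>)\<bar> \<le> expectation (\<lambda>\<omega>. \<bar>max 0 (dev c j \<omega>) - dev c j \<omega>\<bar>)"
    by (rule integral_abs_bound)
  also have "\<dots> \<le> expectation (\<lambda>\<omega>. (1 / t) * exp (- t * dev c j \<omega>))"
  proof (rule integral_mono)
    show "\<bar>max 0 (dev c j \<omega>) - dev c j \<omega>\<bar> \<le> (1 / t) * exp (- t * dev c j \<omega>)" for \<omega>
    proof -
      have "- t * dev c j \<omega> \<le> exp (- t * dev c j \<omega>)" using exp_ge_add_one_self[of "- t * dev c j \<omega>"] by linarith
      then show ?thesis using t by (auto simp: field_simps max_def)
    qed
  qed (use int pos_integrable(1) dev_moments(1) in simp_all)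
  finally show "\<bar>pos_mean c j - expectation (dev c j)\<bar> \<le> (1 / t) * expectation (\<lambda>\<omega>. exp (- t * dev c j \<omega>))"
    using pos_integrable(1)[of c j] dev_moments(1)[of c j] by (simp add: pos_mean_def)
  have "\<bar>expectation (\<lambda>\<omega>. (max 0 (dev c j \<omega>))\<^sup>2 - (dev c j \<omega>)\<^sup>2)\<bar> \<le> expectation (\<lambda>\<omega>. \<bar>(max 0 (dev c j \<omega>))\<^sup>2 - (dev c j \<omega>)\<^sup>2\<bar>)"
    by (rule integral_abs_bound)
  also have "\<dots> \<le> expectation (\<lambda>\<omega>. (2 / t\<^sup>2) * exp (- t * dev c j \<omega>))"
  proof (rule integral_mono)
    show "\<bar>(max 0 (dev c j \<omega>))\<^sup>2 - (dev c j \<omega>)\<^sup>2\<bar> \<le> (2 / t\<^sup>2) * exp (- t * dev c j \<omega>)" for \<omega>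
    proof (cases "dev c j \<omega> < 0")
      case True
      then have nn: "- t * dev c j \<omega> > 0" using t by (simp add: mult_pos_neg)
      then have "1 + (- t * dev c j \<omega>) + (- t * dev c j \<omega>)\<^sup>2 / 2 \<le> exp (- t * dev c j \<omega>)"
        by (intro exp_lower_Taylor_quadratic) auto
      with nn have "(- t * dev c j \<omega>)\<^sup>2 \<le> 2 * exp (- t * dev c j \<omega>)" by linarith
      then show ?thesis using t True by (simp add: field_simps power_mult_distrib)
    qed simp
  qed (use int pos_integrable(2) dev_moments(2) in simp_all)
  finally show "\<bar>pos_square c j - expectation (\<lambda>\<omega>. (dev c j \<omega>)\<^sup>2)\<bar> \<le> (2 / t\<^sup>2) * expectation (\<lambda>\<omega>. exp (- t * dev c j \<omega>))"
    using pos_integrable(2)[of c j] dev_moments(2)[of c j] by (simp add: pos_square_def)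
qed

text \<open>A quarter of the relative half width c^(3/5) / c of the window; the slack absorbs the
  rounding of the edges. Since c times its square is c^(1/5) / 16, the bound exp (- c (tilt c)^2)
  beats every power of c.\<close>

definition tilt :: "real \<Rightarrow> real" where
  "tilt c = c powr (3/5) / (4 * c)"

lemma eventually_tilt:
  "eventually (\<lambda>c. 0 < tilt c \<and> tilt c \<le> 1 / 2 \<and> tilt c \<le> 1 / (8 * real k) \<and> c > 0 \<and> real k + 1 \<le> c powr (3/5) / 2) at_top"
proof -
  have k0: "real k > 0" using k_ge_1 by simp
  have "eventually (\<lambda>c. 0 < tilt c) at_top" "eventually (\<lambda>c. tilt c \<le> 1 / 2) at_top"
    "eventually (\<lambda>c. tilt c \<le> 1 / (8 * real k)) at_top" "eventually (\<lambda>c. real k + 1 \<le> c powr (3/5) / 2) at_top"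
    unfolding tilt_def using k0 by real_asymp+
  then show ?thesis using eventually_gt_at_top[of 0] by eventually_elim auto
qed

text \<open>From the upper edge on, (n + 1 - c) / c is at least twice the tilt even after rounding,
  so the exponent in \<open>mgf_dev_le\<close> is at most - n times the squared tilt.\<close>

lemma upper_mgf:
  "eventually (\<lambda>c. \<forall>j\<ge>window_hi k c. expectation (\<lambda>\<omega>. exp (tilt c * dev c j \<omega>)) \<le> exp (- real (j * k) * (tilt c)\<^sup>2)
     \<and> c \<le> real (j * k)) at_top"
  using eventually_window[OF k_ge_1] eventually_tilt
proof eventually_elim
  case (elim c)
  define K where "K = c powr (3/5)"
  have c: "c > 0" using elim by simp
  show ?case
  proof (intro allI impI)
    fix j assume j: "window_hi k c \<le> j"
    have "c + K < real ((window_hi k c + 1) * k)" using elim(1) unfolding K_def by (meson less_add_one)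
    also have "\<dots> \<le> real (j * k) + real k"
    proof -
      have "(window_hi k c + 1) * k \<le> j * k + k" using j by simp
      then show ?thesis by (metis of_nat_add of_nat_le_iff)
    qed
    finally have n: "c + K - real k < real (j * k)" by simp
    have K: "real k + 1 \<le> K / 2" using elim(2) by (simp add: K_def)
    have "2 * tilt c = (K / 2) / c" by (simp add: tilt_def K_def)
    also have "\<dots> \<le> (real (j * k) + 1 - c) / c" using n K c by (intro divide_right_mono) auto
    finally have "tilt c - (real (j * k) + 1 - c) / c \<le> - tilt c" by simp
    then have "real (j * k) * tilt c * (tilt c - (real (j * k) + 1 - c) / c) \<le> real (j * k) * tilt c * (- tilt c)"
      using elim by (intro mult_left_mono) auto
    also have "\<dots> = - real (j * k) * (tilt c)\<^sup>2" by (simp add: power2_eq_square)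
    finally have "exp (real (j * k) * tilt c * (tilt c - (real (j * k) + 1 - c) / c)) \<le> exp (- real (j * k) * (tilt c)\<^sup>2)" by simp
    moreover have "expectation (\<lambda>\<omega>. exp (tilt c * dev c j \<omega>)) \<le> exp (real (j * k) * tilt c * (tilt c - (real (j * k) + 1 - c) / c))"
      using elim by (intro mgf_dev_le) auto
    ultimately show "expectation (\<lambda>\<omega>. exp (tilt c * dev c j \<omega>)) \<le> exp (- real (j * k) * (tilt c)\<^sup>2) \<and> c \<le> real (j * k)"
      using n K by (intro conjI, meson order_trans, linarith)
  qed
qed

lemma lower_mgf:
  "eventually (\<lambda>c. \<forall>j\<le>window_lo k c. expectation (\<lambda>\<omega>. exp (- tilt c * dev c j \<omega>)) \<le> exp (- real (j * k) * (tilt c)\<^sup>2)) at_top"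
  using eventually_window[OF k_ge_1] eventually_tilt
proof eventually_elim
  case (elim c)
  define K where "K = c powr (3/5)"
  have c: "c > 0" using elim by simp
  show ?case
  proof (intro allI impI)
    fix j assume j: "j \<le> window_lo k c"
    have lo1: "window_lo k c \<ge> 1" using elim by auto
    then have "real ((window_lo k c - 1) * k) < c - K" using elim(1) unfolding K_def by (meson diff_less zero_less_one less_le_trans)
    moreover have "real ((window_lo k c - 1) * k) = real (window_lo k c * k) - real k"
      using lo1 by (simp add: left_diff_distrib of_nat_diff)
    moreover have "real (j * k) \<le> real (window_lo k c * k)" using j by (simp add: mult_right_mono)
    ultimately have n: "real (j * k) < c - K + real k" by linarith
    have K: "real k + 1 \<le> K / 2" using elim(2) by (simp add: K_def)
    have "(real (j * k) + 1 - c) / c \<le> (- K / 2) / c" using n K c by (intro divide_right_mono) auto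
    also have "(- K / 2) / c = - 2 * tilt c" by (simp add: tilt_def K_def)
    finally have "tilt c \<le> - tilt c - (real (j * k) + 1 - c) / c" by simp
    then have "real (j * k) * (- tilt c) * (- tilt c - (real (j * k) + 1 - c) / c) \<le> real (j * k) * (- tilt c) * tilt c"
      using elim by (intro mult_left_mono_neg) (auto simp: mult_nonneg_nonpos)
    also have "\<dots> = - real (j * k) * (tilt c)\<^sup>2" by (simp add: power2_eq_square)
    finally have "exp (real (j * k) * (- tilt c) * (- tilt c - (real (j * k) + 1 - c) / c)) \<le> exp (- real (j * k) * (tilt c)\<^sup>2)" by simp
    moreover have "expectation (\<lambda>\<omega>. exp (- tilt c * dev c j \<omega>)) \<le> exp (real (j * k) * (- tilt c) * (- tilt c - (real (j * k) + 1 - c) / c))"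
      using elim by (intro mgf_dev_le) auto
    ultimately show "expectation (\<lambda>\<omega>. exp (- tilt c * dev c j \<omega>)) \<le> exp (- real (j * k) * (tilt c)\<^sup>2)" by linarith
  qed
qed

text \<open>For small n the product of n and the squared tilt is no longer large. Up to n = c / 2,
  however, the relative gap (c - n - 1) / c is at least 3/8, and the fixed exponent -1/8 yields the
  rate (1/8) (3/8 - 1/8) = 1/32 in n.\<close>

lemma early_tail:
  "eventually (\<lambda>c. \<forall>j\<le>window_lo k c. prob {\<omega>\<in>space M. dev c j \<omega> \<le> 0} \<le> exp (- real (j * k) / 32) + exp (- (c * (tilt c)\<^sup>2) / 2)) at_top"
  using eventually_tilt lower_mgf eventually_ge_at_top[of 8]
proof eventually_elim
  case (elim c)
  show ?case
  proof (intro allI impI)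
    fix j assume j: "j \<le> window_lo k c"
    show "prob {\<omega>\<in>space M. dev c j \<omega> \<le> 0} \<le> exp (- real (j * k) / 32) + exp (- (c * (tilt c)\<^sup>2) / 2)"
    proof (cases "real (j * k) \<le> c / 2")
      case True
      have "prob {\<omega>\<in>space M. dev c j \<omega> \<le> 0} \<le> expectation (\<lambda>\<omega>. exp (- (1/8) * dev c j \<omega>))"
        using neg_part_tail(1)[of "1/8"] by simp
      also have "\<dots> \<le> exp (real (j * k) * (- (1/8)) * (- (1/8) - (real (j * k) + 1 - c) / c))"
        using elim by (intro mgf_dev_le) auto
      also have "\<dots> \<le> exp (- real (j * k) / 32)"
      proof -
        have "(real (j * k) + 1 - c) / c \<le> - 3 / 8"
          using True elim by (simp add: field_simps)
        then have "1/4 \<le> - (1/8) - (real (j * k) + 1 - c) / c" by linarith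
        then have "real (j * k) * (- (1/8)) * (- (1/8) - (real (j * k) + 1 - c) / c) \<le> real (j * k) * (- (1/8)) * (1/4)"
          by (rule mult_left_mono_neg) auto
        then show ?thesis by simp
      qed
      finally show ?thesis using exp_gt_zero[of "- (c * (tilt c)\<^sup>2) / 2"] by linarith
    next
      case False
      have "prob {\<omega>\<in>space M. dev c j \<omega> \<le> 0} \<le> expectation (\<lambda>\<omega>. exp (- tilt c * dev c j \<omega>))"
        using elim by (intro neg_part_tail(1)) auto
      also have "\<dots> \<le> exp (- real (j * k) * (tilt c)\<^sup>2)" using elim j by blast
      also have "\<dots> \<le> exp (- (c * (tilt c)\<^sup>2) / 2)"
      proof -
        have "c / 2 * (tilt c)\<^sup>2 \<le> real (j * k) * (tilt c)\<^sup>2" using False by (intro mult_right_mono) auto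
        then show ?thesis by simp
      qed
      finally show ?thesis using exp_gt_zero[of "- real (j * k) / 32"] by linarith
    qed
  qed
qed

text \<open>Geometric in i because n grows by k with each step. This gives summable survival
  probabilities, hence an integrable stopping time.\<close>

lemma late_tail:
  "eventually (\<lambda>c. \<forall>i. pos_prob c (window_hi k c + i) \<le> exp (- (c * (tilt c)\<^sup>2)) * exp (- real k * (tilt c)\<^sup>2) ^ i) at_top"
  using eventually_tilt upper_mgf
proof eventually_elim
  case (elim c)
  show ?case
  proof
    fix i
    have "pos_prob c (window_hi k c + i) \<le> expectation (\<lambda>\<omega>. exp (tilt c * dev c (window_hi k c + i) \<omega>))"
      using elim by (intro pos_part_tail(1)) auto
    also have "\<dots> \<le> exp (- real ((window_hi k c + i) * k) * (tilt c)\<^sup>2)" using elim by (meson le_add1)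
    also have "\<dots> = exp (- real (window_hi k c * k) * (tilt c)\<^sup>2) * exp (- real k * (tilt c)\<^sup>2) ^ i"
      by (simp add: algebra_simps flip: exp_add exp_of_nat_mult)
    also have "\<dots> \<le> exp (- (c * (tilt c)\<^sup>2)) * exp (- real k * (tilt c)\<^sup>2) ^ i"
    proof -
      have "c * (tilt c)\<^sup>2 \<le> real (window_hi k c * k) * (tilt c)\<^sup>2" using elim by (intro mult_right_mono) auto
      then show ?thesis by (intro mult_right_mono) auto
    qed
    finally show "pos_prob c (window_hi k c + i) \<le> exp (- (c * (tilt c)\<^sup>2)) * exp (- real k * (tilt c)\<^sup>2) ^ i" .
  qed
qed

lemma pos_prob_nonneg: "pos_prob c j \<ge> 0"
  by (simp add: pos_prob_def)

lemma late_sum_limit: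
  "eventually (\<lambda>c. summable (\<lambda>i. pos_prob c (window_hi k c + i))) at_top"
  "((\<lambda>c. \<Sum>i. pos_prob c (window_hi k c + i)) \<longlongrightarrow> 0) at_top"
proof -
  have k0: "real k > 0" using k_ge_1 by simp
  have ev: "eventually (\<lambda>c. summable (\<lambda>i. pos_prob c (window_hi k c + i)) \<and> (\<Sum>i. pos_prob c (window_hi k c + i)) \<le> exp (- (c * (tilt c)\<^sup>2)) * (1 / (1 - exp (- real k * (tilt c)\<^sup>2)))) at_top"
    using late_tail eventually_tilt
  proof eventually_elim
    case (elim c)
    define q where "q = exp (- real k * (tilt c)\<^sup>2)"
    have q: "0 < q" "q < 1" using elim k0 by (auto simp: q_def)
    have s: "(\<lambda>i. exp (- (c * (tilt c)\<^sup>2)) * q ^ i) sums (exp (- (c * (tilt c)\<^sup>2)) * (1 / (1 - q)))"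
      using q by (intro sums_mult geometric_sums) auto
    have "summable (\<lambda>i. pos_prob c (window_hi k c + i))"
      by (rule summable_comparison_test'[OF sums_summable[OF s], of 0]) (use elim pos_prob_nonneg in \<open>auto simp: q_def\<close>)
    moreover then have "(\<Sum>i. pos_prob c (window_hi k c + i)) \<le> (\<Sum>i. exp (- (c * (tilt c)\<^sup>2)) * q ^ i)"
      by (intro suminf_le sums_summable[OF s]) (use elim in \<open>auto simp: q_def\<close>)
    ultimately show ?case using sums_unique[OF s] by (simp add: q_def)
  qed
  then show "eventually (\<lambda>c. summable (\<lambda>i. pos_prob c (window_hi k c + i))) at_top"
    by eventually_elim simp
  show "((\<lambda>c. \<Sum>i. pos_prob c (window_hi k c + i)) \<longlongrightarrow> 0) at_top"
  proof (rule tendsto_sandwich)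
    show "eventually (\<lambda>c. 0 \<le> (\<Sum>i. pos_prob c (window_hi k c + i))) at_top"
      using ev by eventually_elim (intro suminf_nonneg pos_prob_nonneg, simp)
    show "eventually (\<lambda>c. (\<Sum>i. pos_prob c (window_hi k c + i)) \<le> exp (- (c * (tilt c)\<^sup>2)) * (1 / (1 - exp (- real k * (tilt c)\<^sup>2)))) at_top"
      using ev by eventually_elim simp
    show "((\<lambda>c. exp (- (c * (tilt c)\<^sup>2)) * (1 / (1 - exp (- real k * (tilt c)\<^sup>2)))) \<longlongrightarrow> 0) at_top"
      unfolding tilt_def using k0 by real_asymp
  qed simp
qed

text \<open>The truncated moments at the upper edge are at most powers of 1 / \<open>tilt c\<close>
  times an exponential that beats all powers of c.\<close>

lemma potential_hi_limit: "((\<lambda>c. potential c (window_hi k c)) \<longlongrightarrow> 0) at_top"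
proof (rule Lim_null_comparison)
  show "eventually (\<lambda>c. norm (potential c (window_hi k c)) \<le> 3 * ((1 / tilt c) * exp (- (c * (tilt c)\<^sup>2))) + (2 / (tilt c)\<^sup>2) * exp (- (c * (tilt c)\<^sup>2)) / c) at_top"
    using eventually_tilt upper_mgf eventually_window[OF k_ge_1]
  proof eventually_elim
    case (elim c)
    define j where "j = window_hi k c"
    define E where "E = expectation (\<lambda>\<omega>. exp (tilt c * dev c j \<omega>))"
    have c: "c > 0" using elim by simp
    have t: "0 < tilt c" "tilt c \<le> 1 / 2" using elim by auto
    have n: "c \<le> real (j * k)" using elim by (auto simp: j_def)
    have n2: "real (j * k) \<le> 2 * c"
    proof -
      have "real (j * k) \<le> c + c powr (3/5)" "c powr (3/5) \<le> c / 4" using elim(3) unfolding j_def by blast+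
      then show ?thesis using c by linarith
    qed
    have "E \<le> exp (- real (j * k) * (tilt c)\<^sup>2)" using elim by (auto simp: j_def E_def)
    also have "\<dots> \<le> exp (- (c * (tilt c)\<^sup>2))" using mult_right_mono[OF n, of "(tilt c)\<^sup>2"] by simp
    finally have E: "E \<le> exp (- (c * (tilt c)\<^sup>2))" .
    have a: "0 \<le> pos_mean c j" unfolding pos_mean_def by (intro integral_nonneg_AE) auto
    have q: "0 \<le> pos_square c j" unfolding pos_square_def by (intro integral_nonneg_AE) auto
    have "pos_mean c j \<le> (1 / tilt c) * E" unfolding E_def by (rule pos_part_tail[OF t])
    also have "\<dots> \<le> (1 / tilt c) * exp (- (c * (tilt c)\<^sup>2))" using E t by (intro mult_left_mono) auto
    finally have a': "pos_mean c j \<le> (1 / tilt c) * exp (- (c * (tilt c)\<^sup>2))" .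
    have "pos_square c j \<le> (2 / (tilt c)\<^sup>2) * E" unfolding E_def by (rule pos_part_tail[OF t])
    also have "\<dots> \<le> (2 / (tilt c)\<^sup>2) * exp (- (c * (tilt c)\<^sup>2))" using E t by (intro mult_left_mono) auto
    finally have "pos_square c j / c \<le> (2 / (tilt c)\<^sup>2) * exp (- (c * (tilt c)\<^sup>2)) / c" using c by (intro divide_right_mono) auto
    moreover have "\<bar>3 - 2 * real (j * k) / c\<bar> \<le> 3" using n n2 c by (auto simp: abs_le_iff field_simps)
    then have "\<bar>(3 - 2 * real (j * k) / c) * pos_mean c j\<bar> \<le> 3 * ((1 / tilt c) * exp (- (c * (tilt c)\<^sup>2)))"
      unfolding abs_mult using a a' by (intro mult_mono) auto
    moreover have "0 \<le> pos_square c j / c" using q c by simp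
    ultimately show ?case unfolding potential_def j_def[symmetric] real_norm_def by linarith
  qed
  show "((\<lambda>c. 3 * ((1 / tilt c) * exp (- (c * (tilt c)\<^sup>2))) + (2 / (tilt c)\<^sup>2) * exp (- (c * (tilt c)\<^sup>2)) / c) \<longlongrightarrow> 0) at_top"
    unfolding tilt_def by real_asymp
qed

text \<open>At the lower edge the truncated moments are replaced by the exact ones, and
  \<open>P0\<close> is the resulting rational function of n and c. With y = n - c, its terms y^2 /
  c, of diverging order c^(1/5), cancel; those in y^3 / c^2 and beyond vanish. In the constant -2
  one unit comes from the + 1 in n (n + 1) / c and one from the variance n of the walk.\<close>

lemma potential_lo_limit: "((\<lambda>c. potential c (window_lo k c) - (c - real (window_lo k c * k) - 2)) \<longlongrightarrow> 0) at_top"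
proof -
  define n where "n = (\<lambda>c. real (window_lo k c * k))"
  define y where "y = (\<lambda>c. n c - c)"
  define m where "m = (\<lambda>c. n c - boundary k c (window_lo k c))"
  define P0 where "P0 = (\<lambda>c. (3 - 2 * n c / c) * m c - (n c + (m c)\<^sup>2) / c)"
  have y_bd: "eventually (\<lambda>c. \<bar>y c\<bar> \<le> c powr (3/5)) at_top"
    using eventually_window[OF k_ge_1]
  proof eventually_elim
    case (elim c)
    have "c - c powr (3/5) \<le> n c" "n c \<le> c + c powr (3/5)"
      using elim unfolding n_def by (meson order_refl less_imp_le)+
    then show ?case by (simp add: y_def abs_le_iff)
  qed
  have z1: "((\<lambda>c. y c / c) \<longlongrightarrow> 0) at_top"
  proof (rule Lim_null_comparison)
    show "eventually (\<lambda>c. norm (y c / c) \<le> c powr (3/5) / c) at_top"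
      using y_bd eventually_gt_at_top[of 0] by eventually_elim (simp add: divide_right_mono)
    show "((\<lambda>c::real. c powr (3/5) / c) \<longlongrightarrow> 0) at_top" by real_asymp
  qed
  have z2: "((\<lambda>c. (y c) ^ 3 / c\<^sup>2) \<longlongrightarrow> 0) at_top"
  proof (rule Lim_null_comparison)
    show "eventually (\<lambda>c. norm ((y c) ^ 3 / c\<^sup>2) \<le> (c powr (3/5)) ^ 3 / c\<^sup>2) at_top"
      using y_bd by eventually_elim (simp add: divide_right_mono power_abs power_mono)
    show "((\<lambda>c::real. (c powr (3/5)) ^ 3 / c\<^sup>2) \<longlongrightarrow> 0) at_top" by real_asymp
  qed
  have z3: "((\<lambda>c::real. 1 / c) \<longlongrightarrow> 0) at_top" by real_asymp
  have "((\<lambda>c. - 2 * (y c / c) - 1 / c + 2 * ((y c) ^ 3 / c\<^sup>2) + 2 * (y c / c)\<^sup>2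
      - (2 * ((y c) ^ 3 / c\<^sup>2) + 4 * (y c / c)\<^sup>2 + 2 * (y c / c) * (1 / c) + (y c / c) * ((y c) ^ 3 / c\<^sup>2) + 2 * (y c / c) ^ 3 + (y c / c)\<^sup>2 * (1 / c)))
      \<longlongrightarrow> - 2 * 0 - 0 + 2 * 0 + 2 * 0\<^sup>2 - (2 * 0 + 4 * 0\<^sup>2 + 2 * 0 * 0 + 0 * 0 + 2 * 0 ^ 3 + 0\<^sup>2 * 0)) at_top"
    by (intro tendsto_intros z1 z2 z3)
  moreover have "eventually (\<lambda>c. - 2 * (y c / c) - 1 / c + 2 * ((y c) ^ 3 / c\<^sup>2) + 2 * (y c / c)\<^sup>2
      - (2 * ((y c) ^ 3 / c\<^sup>2) + 4 * (y c / c)\<^sup>2 + 2 * (y c / c) * (1 / c) + (y c / c) * ((y c) ^ 3 / c\<^sup>2) + 2 * (y c / c) ^ 3 + (y c / c)\<^sup>2 * (1 / c)) = P0 c - (c - n c - 2)) at_top"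
    using eventually_gt_at_top[of 0]
  proof eventually_elim
    case (elim c)
    define h where "h = y c / c"
    have yc: "y c = h * c" using elim by (simp add: h_def)
    have nc: "n c = c * (1 + h)" using elim yc by (simp add: y_def algebra_simps)
    have nlo: "real (window_lo k c * k) = n c" by (simp add: n_def)
    have mc: "m c = - (1 + h) * (h * c + 1)"
      unfolding m_def boundary_def nlo nc using elim by (simp add: field_simps)
    show ?case
      unfolding P0_def mc nc yc using elim
      by (simp add: field_simps power2_eq_square power3_eq_cube)
  qed
  ultimately have P0: "((\<lambda>c. P0 c - (c - n c - 2)) \<longlongrightarrow> 0) at_top"
    by (simp add: tendsto_cong)
  have "((\<lambda>c. potential c (window_lo k c) - P0 c) \<longlongrightarrow> 0) at_top"
  proof (rule Lim_null_comparison)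
    show "eventually (\<lambda>c. norm (potential c (window_lo k c) - P0 c) \<le> 3 * ((1 / tilt c) * exp (- (c * (tilt c)\<^sup>2) / 2)) + (2 / (tilt c)\<^sup>2) * exp (- (c * (tilt c)\<^sup>2) / 2) / c) at_top"
      using eventually_tilt lower_mgf eventually_window[OF k_ge_1] y_bd
    proof eventually_elim
      case (elim c)
      define j where "j = window_lo k c"
      define E where "E = expectation (\<lambda>\<omega>. exp (- tilt c * dev c j \<omega>))"
      have c: "c > 0" using elim by simp
      have t: "0 < tilt c" "tilt c \<le> 1 / 2" using elim by auto
      have nj: "n c = real (j * k)" by (simp add: n_def j_def)
      have K: "c powr (3/5) \<le> c / 4" using elim by simp
      have n: "c / 2 \<le> real (j * k)" "real (j * k) \<le> 2 * c"
        using elim(4) K c unfolding y_def nj by (auto simp: abs_le_iff)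
      have "E \<le> exp (- real (j * k) * (tilt c)\<^sup>2)" using elim by (auto simp: j_def E_def)
      also have "\<dots> \<le> exp (- (c * (tilt c)\<^sup>2) / 2)" using mult_right_mono[OF n(1), of "(tilt c)\<^sup>2"] by simp
      finally have E: "E \<le> exp (- (c * (tilt c)\<^sup>2) / 2)" .
      have e1: "expectation (dev c j) = m c" and e2: "expectation (\<lambda>\<omega>. (dev c j \<omega>)\<^sup>2) = n c + (m c)\<^sup>2"
        using dev_moments(3,4)[of c j] by (simp_all add: m_def n_def j_def)
      have "\<bar>pos_mean c j - m c\<bar> \<le> (1 / tilt c) * E" unfolding E_def e1[symmetric] by (rule neg_part_tail[OF t])
      also have "\<dots> \<le> (1 / tilt c) * exp (- (c * (tilt c)\<^sup>2) / 2)" using E t by (intro mult_left_mono) auto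
      finally have a': "\<bar>pos_mean c j - m c\<bar> \<le> (1 / tilt c) * exp (- (c * (tilt c)\<^sup>2) / 2)" .
      have "\<bar>pos_square c j - (n c + (m c)\<^sup>2)\<bar> \<le> (2 / (tilt c)\<^sup>2) * E" unfolding E_def e2[symmetric] by (rule neg_part_tail[OF t])
      also have "\<dots> \<le> (2 / (tilt c)\<^sup>2) * exp (- (c * (tilt c)\<^sup>2) / 2)" using E t by (intro mult_left_mono) auto
      finally have "\<bar>pos_square c j - (n c + (m c)\<^sup>2)\<bar> / c \<le> (2 / (tilt c)\<^sup>2) * exp (- (c * (tilt c)\<^sup>2) / 2) / c" using c by (intro divide_right_mono) auto
      then have q': "\<bar>(pos_square c j - (n c + (m c)\<^sup>2)) / c\<bar> \<le> (2 / (tilt c)\<^sup>2) * exp (- (c * (tilt c)\<^sup>2) / 2) / c" using c by simp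
      have "\<bar>3 - 2 * n c / c\<bar> \<le> 3" using n c nj by (auto simp: abs_le_iff field_simps)
      then have a'': "\<bar>(3 - 2 * n c / c) * (pos_mean c j - m c)\<bar> \<le> 3 * ((1 / tilt c) * exp (- (c * (tilt c)\<^sup>2) / 2))"
        unfolding abs_mult using a' by (intro mult_mono) auto
      have "potential c j - P0 c = (3 - 2 * n c / c) * (pos_mean c j - m c) - (pos_square c j - (n c + (m c)\<^sup>2)) / c"
        unfolding potential_def P0_def nj by (simp add: right_diff_distrib diff_divide_distrib)
      then show ?case using a'' q' unfolding j_def[symmetric] real_norm_def by linarith
    qed
    show "((\<lambda>c. 3 * ((1 / tilt c) * exp (- (c * (tilt c)\<^sup>2) / 2)) + (2 / (tilt c)\<^sup>2) * exp (- (c * (tilt c)\<^sup>2) / 2) / c) \<longlongrightarrow> 0) at_top"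
      unfolding tilt_def by real_asymp
  qed
  from tendsto_add[OF this P0] show ?thesis by (simp add: n_def algebra_simps)
qed

text \<open>The potential is telescoped over the window: its value at the upper edge vanishes, the
  lower edge contributes c - n - 2, the kinks contribute (k + 1) / 2, and the accumulated error is
  of order K^3 / c^2 + K / c with K = c^(3/5).\<close>

lemma window_prob_sum:
  "((\<lambda>c. real k * (\<Sum>j\<in>window k c. pos_prob c j) - (c - real (window_lo k c * k) - 2 + (real k + 1) / 2)) \<longlongrightarrow> 0) at_top"
proof -
  define S where "S = (\<lambda>c. \<Sum>j\<in>window k c. pos_prob c j)"
  define X where "X = (\<lambda>c. \<Sum>j\<in>window k c. kink_mean c j)"
  define err where "err = (\<lambda>c. real k * S c - (potential c (window_lo k c) - potential c (window_hi k c)) - X c)"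
  have X: "(X \<longlongrightarrow> (real k + 1) / 2) at_top" unfolding X_def by (rule kink_sum_limit)
  have "(err \<longlongrightarrow> 0) at_top"
  proof (rule Lim_null_comparison)
    show "eventually (\<lambda>c. norm (err c) \<le> (3 * c powr (3/5)) * (104 * (real k)\<^sup>2 * ((c powr (3/5))\<^sup>2 / c\<^sup>2)) + 4 * (c powr (3/5) / c) * X c) at_top"
      using potential_step eventually_window[OF k_ge_1]
    proof eventually_elim
      case (elim c)
      define B where "B = 104 * (real k)\<^sup>2 * ((c powr (3/5))\<^sup>2 / c\<^sup>2)"
      have B0: "B \<ge> 0" by (simp add: B_def)
      have le: "window_lo k c \<le> window_hi k c" using elim by auto
      have "(\<Sum>j\<in>window k c. potential c (Suc j) - potential c j) = potential c (window_hi k c) - potential c (window_lo k c)"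
        by (rule sum_Suc_diff'[OF le])
      then have "err c = (\<Sum>j\<in>window k c. potential c (Suc j) - potential c j + real k * pos_prob c j - kink_mean c j)"
        by (simp add: err_def S_def X_def sum.distrib sum_subtractf sum_distrib_left)
      also have "\<bar>\<dots>\<bar> \<le> (\<Sum>j\<in>window k c. B + 4 * (c powr (3/5) / c) * kink_mean c j)"
        using elim(1) by (intro order_trans[OF sum_abs] sum_mono) (auto simp: B_def)
      also have "\<dots> = real (card (window k c)) * B + 4 * (c powr (3/5) / c) * X c"
        by (simp add: sum.distrib X_def sum_distrib_left)
      also have "\<dots> \<le> (3 * c powr (3/5)) * B + 4 * (c powr (3/5) / c) * X c"
      proof -
        have "real (window_hi k c * k) \<le> c + c powr (3/5)" "c - c powr (3/5) \<le> real (window_lo k c * k)"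
          using elim(2) by blast+
        then have "real (card (window k c)) * real k \<le> 2 * c powr (3/5)"
          using le by (simp add: of_nat_diff left_diff_distrib)
        moreover have "real (card (window k c)) * 1 \<le> real (card (window k c)) * real k"
          using k_ge_1 by (intro mult_left_mono) auto
        moreover have "0 \<le> c powr (3/5)" by simp
        ultimately have "real (card (window k c)) \<le> 3 * c powr (3/5)" by linarith
        then show ?thesis using B0 by (simp add: mult_right_mono)
      qed
      finally show ?case by (simp add: B_def)
    qed
    have "((\<lambda>c. (3 * c powr (3/5)) * (104 * (real k)\<^sup>2 * ((c powr (3/5))\<^sup>2 / c\<^sup>2)) + 4 * (c powr (3/5) / c) * X c) \<longlongrightarrow> 0 + 4 * 0 * ((real k + 1) / 2)) at_top"
    proof (intro tendsto_add tendsto_mult[of "\<lambda>c. 4 * (c powr (3/5) / c)"] X)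
      have k0: "real k > 0" using k_ge_1 by simp
      show "((\<lambda>c. (3 * c powr (3/5)) * (104 * (real k)\<^sup>2 * ((c powr (3/5))\<^sup>2 / c\<^sup>2))) \<longlongrightarrow> 0) at_top" using k0 by real_asymp
      show "((\<lambda>c::real. 4 * (c powr (3/5) / c)) \<longlongrightarrow> 4 * 0) at_top" by (simp, real_asymp)
    qed
    then show "((\<lambda>c. (3 * c powr (3/5)) * (104 * (real k)\<^sup>2 * ((c powr (3/5))\<^sup>2 / c\<^sup>2)) + 4 * (c powr (3/5) / c) * X c) \<longlongrightarrow> 0) at_top" by simp
  qed
  then have "((\<lambda>c. err c + (potential c (window_lo k c) - (c - real (window_lo k c * k) - 2)) - potential c (window_hi k c) + (X c - (real k + 1) / 2)) \<longlongrightarrow> 0 + 0 - 0 + ((real k + 1) / 2 - (real k + 1) / 2)) at_top"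
    by (intro tendsto_intros potential_lo_limit potential_hi_limit X)
  then show ?thesis by (simp add: err_def S_def algebra_simps)
qed

end

context erlang_walk
begin

section \<open>The expected stopping time\<close>

text \<open>As a \<open>LEAST\<close>, \<open>tau\<close> is arbitrary on the null event that the boundary is never crossed.\<close>

definition tau :: "nat \<Rightarrow> real \<Rightarrow> 'a \<Rightarrow> nat" where
  "tau m0 c \<omega> = (LEAST n. dev c (m0 + n) \<omega> \<le> 0)"

definition early :: "nat \<Rightarrow> real \<Rightarrow> real" where
  "early m0 c = prob {\<omega>\<in>space M. \<exists>i\<in>{m0..<window_lo k c}. dev c i \<omega> \<le> 0}"

definition survival :: "nat \<Rightarrow> real \<Rightarrow> nat \<Rightarrow> real" where
  "survival m0 c j = prob {\<omega>\<in>space M. \<forall>i\<in>{m0..j}. dev c i \<omega> > 0}"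

lemma tau_measurable [measurable]: "tau m0 c \<in> M \<rightarrow>\<^sub>M count_space UNIV"
  unfolding tau_def by measurable

lemma less_tau_iff:
  assumes "\<exists>n. dev c (m0 + n) \<omega> \<le> 0"
  shows "n < tau m0 c \<omega> \<longleftrightarrow> (\<forall>i\<in>{m0..m0 + n}. dev c i \<omega> > 0)"
proof
  assume n: "n < tau m0 c \<omega>"
  show "\<forall>i\<in>{m0..m0 + n}. dev c i \<omega> > 0"
  proof
    fix i assume i: "i \<in> {m0..m0 + n}"
    then have "\<not> dev c (m0 + (i - m0)) \<omega> \<le> 0"
      using n unfolding tau_def by (intro not_less_Least) auto
    then show "dev c i \<omega> > 0" using i by simp
  qed
next
  assume a: "\<forall>i\<in>{m0..m0 + n}. dev c i \<omega> > 0"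
  have "dev c (m0 + tau m0 c \<omega>) \<omega> \<le> 0"
    unfolding tau_def using assms by (rule LeastI_ex)
  moreover have "0 < dev c (m0 + tau m0 c \<omega>) \<omega>" if "\<not> n < tau m0 c \<omega>"
    using that by (intro a[rule_format]) auto
  ultimately show "n < tau m0 c \<omega>" by fastforce
qed

lemma early_nonneg: "early m0 c \<ge> 0"
  by (simp add: early_def)

text \<open>A union bound over at most 2 c indices. The first exponential involves the pilot index
  because n may be as small as m0 k at the first inspection.\<close>

lemma early_bound:
  "eventually (\<lambda>c. \<forall>m0. early m0 c \<le> 2 * c * (exp (- real (m0 * k) / 32) + exp (- (c * (tilt c)\<^sup>2) / 2))) at_top"
  using early_tail eventually_window[OF k_ge_1]
proof eventually_elim
  case (elim c)
  show ?case
  proof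
    fix m0
    define B where "B = exp (- real (m0 * k) / 32) + exp (- (c * (tilt c)\<^sup>2) / 2)"
    have "early m0 c = prob (\<Union>i\<in>{m0..<window_lo k c}. {\<omega>\<in>space M. dev c i \<omega> \<le> 0})"
      unfolding early_def by (rule arg_cong[where f=prob]) auto
    also have "\<dots> \<le> (\<Sum>i\<in>{m0..<window_lo k c}. prob {\<omega>\<in>space M. dev c i \<omega> \<le> 0})"
      by (rule finite_measure_subadditive_finite) auto
    also have "\<dots> \<le> (\<Sum>i\<in>{m0..<window_lo k c}. B)"
    proof (rule sum_mono)
      fix i assume i: "i \<in> {m0..<window_lo k c}"
      have "prob {\<omega>\<in>space M. dev c i \<omega> \<le> 0} \<le> exp (- real (i * k) / 32) + exp (- (c * (tilt c)\<^sup>2) / 2)"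
        using elim(1) i by simp
      moreover have "real (m0 * k) \<le> real (i * k)" using i by (simp add: mult_right_mono)
      then have "exp (- real (i * k) / 32) \<le> exp (- real (m0 * k) / 32)" by simp
      ultimately show "prob {\<omega>\<in>space M. dev c i \<omega> \<le> 0} \<le> B" unfolding B_def by linarith
    qed
    also have "\<dots> = real (window_lo k c - m0) * B" by simp
    also have "\<dots> \<le> 2 * c * B"
    proof (rule mult_right_mono)
      have "window_lo k c \<le> window_hi k c" using elim by auto
      then have "real (window_lo k c * k) \<le> c + c powr (3/5)" using elim(2) by blast
      then have "real (window_lo k c * k) \<le> 2 * c" using elim(2) by linarith
      moreover have "window_lo k c * 1 \<le> window_lo k c * k" using k_ge_1 by (intro mult_le_mono2)
      then have "window_lo k c - m0 \<le> window_lo k c * k" by linarith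
      then have "real (window_lo k c - m0) \<le> real (window_lo k c * k)" by (simp only: of_nat_le_iff)
      ultimately show "real (window_lo k c - m0) \<le> 2 * c" by linarith
    qed (simp add: B_def)
    finally show "early m0 c \<le> 2 * c * (exp (- real (m0 * k) / 32) + exp (- (c * (tilt c)\<^sup>2) / 2))"
      by (simp add: B_def)
  qed
qed

lemma survival_le_pos_prob: "m0 \<le> j \<Longrightarrow> survival m0 c j \<le> pos_prob c j"
  unfolding survival_def pos_prob_def by (intro finite_measure_mono) auto

lemma survival_nonneg: "survival m0 c j \<ge> 0"
  by (simp add: survival_def)

text \<open>Never crossing implies a positive deviation at each late index, and the probabilities of
  these events tend to 0.\<close>

lemma AE_tau_exists:
  assumes s: "summable (\<lambda>i. pos_prob c (window_hi k c + i))"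
  shows "AE \<omega> in M. \<exists>n. dev c (m0 + n) \<omega> \<le> 0"
proof -
  define A where "A = {\<omega>\<in>space M. \<forall>n. dev c (m0 + n) \<omega> > 0}"
  have A: "A \<in> sets M" unfolding A_def by measurable
  have lim: "(\<lambda>i. pos_prob c (window_hi k c + m0 + i)) \<longlonglongrightarrow> 0"
    using LIMSEQ_ignore_initial_segment[OF summable_LIMSEQ_zero[OF s], of m0] by (simp add: ac_simps)
  have "prob A \<le> 0"
  proof (rule LIMSEQ_le_const[OF lim], intro exI allI impI)
    fix i
    have "prob A \<le> prob {\<omega>\<in>space M. dev c (window_hi k c + m0 + i) \<omega> > 0}"
    proof (rule finite_measure_mono)
      show "A \<subseteq> {\<omega>\<in>space M. dev c (window_hi k c + m0 + i) \<omega> > 0}"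
        unfolding A_def by (auto dest: spec[of _ "window_hi k c + i"] simp: ac_simps)
    qed measurable
    then show "prob A \<le> pos_prob c (window_hi k c + m0 + i)" by (simp add: pos_prob_def)
  qed
  then have "prob A = 0" by (simp add: measure_le_0_iff)
  then have "AE \<omega> in M. \<omega> \<notin> A" using A by (simp add: prob_eq_0)
  then show ?thesis
    by (rule AE_mp, intro AE_I2) (auto simp: A_def not_less)
qed

lemma summable_survival:
  assumes s: "summable (\<lambda>i. pos_prob c (window_hi k c + i))"
  shows "summable (\<lambda>n. survival m0 c (m0 + n))"
proof -
  have "summable (\<lambda>i. pos_prob c (m0 + (i + window_hi k c)))"
    using summable_ignore_initial_segment[OF s, of m0] by (simp add: ac_simps)
  then have "summable (\<lambda>n. pos_prob c (m0 + n))" by (subst (asm) summable_iff_shift)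
  then show ?thesis
    by (rule summable_comparison_test'[of _ 0]) (simp add: survival_nonneg survival_le_pos_prob)
qed

lemma expectation_tau:
  assumes s: "summable (\<lambda>i. pos_prob c (window_hi k c + i))"
  shows "integrable M (\<lambda>\<omega>. real (tau m0 c \<omega>))"
    "expectation (\<lambda>\<omega>. real (tau m0 c \<omega>)) = (\<Sum>n. survival m0 c (m0 + n))"
proof -
  have "(\<integral>\<^sup>+\<omega>. ennreal (real (tau m0 c \<omega>)) \<partial>M) = (\<Sum>t. emeasure M {\<omega>\<in>space M. t < tau m0 c \<omega>})"
    by (subst nn_integral_nat_function[symmetric]) (auto simp: ennreal_of_nat_eq_real_of_nat)
  also have "\<dots> = (\<Sum>t. ennreal (survival m0 c (m0 + t)))"
  proof (rule suminf_cong)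
    fix t
    have "emeasure M {\<omega>\<in>space M. t < tau m0 c \<omega>} = emeasure M {\<omega>\<in>space M. \<forall>i\<in>{m0..m0 + t}. dev c i \<omega> > 0}"
    proof (rule emeasure_eq_AE)
      show "AE \<omega> in M. (\<omega> \<in> {\<omega>\<in>space M. t < tau m0 c \<omega>}) = (\<omega> \<in> {\<omega>\<in>space M. \<forall>i\<in>{m0..m0 + t}. dev c i \<omega> > 0})"
        using AE_tau_exists[OF s, of m0] by eventually_elim (simp add: less_tau_iff)
    qed measurable
    then show "emeasure M {\<omega>\<in>space M. t < tau m0 c \<omega>} = ennreal (survival m0 c (m0 + t))"
      by (simp add: survival_def emeasure_eq_measure)
  qed
  also have "\<dots> = ennreal (\<Sum>n. survival m0 c (m0 + n))"
    by (rule suminf_ennreal2[OF survival_nonneg summable_survival[OF s]])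
  finally have eq: "(\<integral>\<^sup>+\<omega>. ennreal (real (tau m0 c \<omega>)) \<partial>M) = ennreal (\<Sum>n. survival m0 c (m0 + n))" .
  have "has_bochner_integral M (\<lambda>\<omega>. real (tau m0 c \<omega>)) (\<Sum>n. survival m0 c (m0 + n))"
    by (rule has_bochner_integral_nn_integral[OF _ _ _ eq])
       (auto intro: suminf_nonneg summable_survival[OF s] survival_nonneg)
  then show "integrable M (\<lambda>\<omega>. real (tau m0 c \<omega>))"
    "expectation (\<lambda>\<omega>. real (tau m0 c \<omega>)) = (\<Sum>n. survival m0 c (m0 + n))"
    by (auto simp: has_bochner_integral_iff)
qed

lemma survival_window_start:
  assumes "lo \<le> j"
  shows "survival lo c j = pos_prob c j - (\<Sum>i\<in>{lo..<j}. prob {\<omega>\<in>space M. dev c i \<omega> \<le> 0 \<and> (\<forall>q\<in>{1..j - i}. dev c (i + q) \<omega> > 0)})"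
proof -
  define B where "B = (\<lambda>i. {\<omega>\<in>space M. dev c i \<omega> \<le> 0 \<and> (\<forall>q\<in>{1..j - i}. dev c (i + q) \<omega> > 0)})"
  have [measurable]: "B i \<in> sets M" for i unfolding B_def by measurable
  have disj: "disjoint_family_on B {lo..<j}"
  proof -
    have "B i \<inter> B i' = {}" if "i < i'" "i' < j" for i i'
    proof -
      have *: "i' - i \<in> {1..j - i}" "i + (i' - i) = i'" using that by auto
      show ?thesis
      proof (rule equals0I)
        fix \<omega> assume \<omega>: "\<omega> \<in> B i \<inter> B i'"
        then have "0 < dev c (i + (i' - i)) \<omega>" unfolding B_def using *(1) by blast
        then show False using \<omega> *(2) by (simp add: B_def)
      qed
    qed
    then show ?thesis unfolding disjoint_family_on_def by (metis Int_commute atLeastLessThan_iff linorder_neqE_nat)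
  qed
  have split: "{\<omega>\<in>space M. dev c j \<omega> > 0} = {\<omega>\<in>space M. \<forall>i\<in>{lo..j}. dev c i \<omega> > 0} \<union> (\<Union>i\<in>{lo..<j}. B i)"
  proof (intro equalityI subsetI)
    fix \<omega> assume \<omega>: "\<omega> \<in> {\<omega>\<in>space M. dev c j \<omega> > 0}"
    show "\<omega> \<in> {\<omega>\<in>space M. \<forall>i\<in>{lo..j}. dev c i \<omega> > 0} \<union> (\<Union>i\<in>{lo..<j}. B i)"
    proof (cases "\<forall>i\<in>{lo..j}. dev c i \<omega> > 0")
      case False
      define I where "I = {i\<in>{lo..j}. dev c i \<omega> \<le> 0}"
      have I: "finite I" "I \<noteq> {}" using False by (auto simp: I_def not_less)
      define i where "i = Max I"
      have iI: "i \<in> I" unfolding i_def using I by (rule Max_in)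
      then have "i \<noteq> j" using \<omega> by (auto simp: I_def)
      with iI have "i \<in> {lo..<j}" by (auto simp: I_def)
      moreover have "\<omega> \<in> B i"
      proof -
        have "dev c (i + q) \<omega> > 0" if "q \<in> {1..j - i}" for q
        proof (rule ccontr)
          assume "\<not> dev c (i + q) \<omega> > 0"
          then have "i + q \<in> I" using that iI by (auto simp: I_def)
          then have "i + q \<le> i" unfolding i_def using I by (intro Max_ge)
          then show False using that by simp
        qed
        then show ?thesis using \<omega> iI by (auto simp: B_def I_def)
      qed
      ultimately show ?thesis by blast
    qed (use \<omega> in auto)
  next
    fix \<omega> assume "\<omega> \<in> {\<omega>\<in>space M. \<forall>i\<in>{lo..j}. dev c i \<omega> > 0} \<union> (\<Union>i\<in>{lo..<j}. B i)"
    then consider "\<omega> \<in> {\<omega>\<in>space M. \<forall>i\<in>{lo..j}. dev c i \<omega> > 0}" | i where "i \<in> {lo..<j}" "\<omega> \<in> B i" by blast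
    then show "\<omega> \<in> {\<omega>\<in>space M. dev c j \<omega> > 0}"
    proof cases
      case 1 then show ?thesis using assms by auto
    next
      case 2
      then have "j - i \<in> {1..j - i}" "i + (j - i) = j" by auto
      with 2 show ?thesis unfolding B_def by (auto dest!: bspec[of _ _ "j - i"])
    qed
  qed
  have "pos_prob c j = prob {\<omega>\<in>space M. \<forall>i\<in>{lo..j}. dev c i \<omega> > 0} + prob (\<Union>i\<in>{lo..<j}. B i)"
    unfolding pos_prob_def split
  proof (rule finite_measure_Union)
    show "{\<omega>\<in>space M. \<forall>i\<in>{lo..j}. dev c i \<omega> > 0} \<inter> (\<Union>i\<in>{lo..<j}. B i) = {}"
      by (force simp: B_def)
  qed auto
  also have "prob (\<Union>i\<in>{lo..<j}. B i) = (\<Sum>i\<in>{lo..<j}. prob (B i))"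
    by (rule finite_measure_finite_Union) (use disj in auto)
  finally show ?thesis by (simp add: survival_def B_def)
qed

lemma sum_survival_window:
  "(\<Sum>j\<in>window k c. survival (window_lo k c) c j) = (\<Sum>j\<in>window k c. pos_prob c j) - (\<Sum>l. excursion (Suc l) c)"
proof -
  define lo where "lo = window_lo k c"
  define hi where "hi = window_hi k c"
  define Q where "Q = (\<lambda>i j. prob {\<omega>\<in>space M. dev c i \<omega> \<le> 0 \<and> (\<forall>q\<in>{1..j - i}. dev c (i + q) \<omega> > 0)})"
  \<comment> \<open>For l >= hi no i satisfies i + Suc l < hi, so the series is a finite sum, which
    can then be regrouped by the pairs i < j.\<close>
  have "(\<Sum>l. excursion (Suc l) c) = (\<Sum>l<hi. excursion (Suc l) c)"
    by (rule suminf_finite) (auto simp: excursion_def hi_def)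
  also have "\<dots> = (\<Sum>l<hi. \<Sum>i\<in>{lo..<hi}. if i + Suc l < hi then Q i (i + Suc l) else 0)"
    unfolding excursion_def lo_def hi_def Q_def add_diff_cancel_left' ..
  also have "\<dots> = (\<Sum>i\<in>{lo..<hi}. \<Sum>l<hi. if i + Suc l < hi then Q i (i + Suc l) else 0)"
    by (rule sum.swap)
  also have "\<dots> = (\<Sum>i\<in>{lo..<hi}. \<Sum>j\<in>{lo..<hi}. if i < j then Q i j else 0)"
  proof (rule sum.cong[OF refl])
    fix i assume i: "i \<in> {lo..<hi}"
    have "(\<Sum>l<hi. if i + Suc l < hi then Q i (i + Suc l) else 0) = (\<Sum>l\<in>{l. l < hi \<and> i + Suc l < hi}. Q i (i + Suc l))"
      by (simp add: sum.If_cases Int_def lessThan_def)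
    also have "\<dots> = (\<Sum>j\<in>{j\<in>{lo..<hi}. i < j}. Q i j)"
      by (rule sum.reindex_bij_witness[of _ "\<lambda>j. j - Suc i" "\<lambda>l. i + Suc l"]) (use i in auto)
    also have "\<dots> = (\<Sum>j\<in>{lo..<hi}. if i < j then Q i j else 0)"
      by (simp add: sum.If_cases Int_def)
    finally show "(\<Sum>l<hi. if i + Suc l < hi then Q i (i + Suc l) else 0) = (\<Sum>j\<in>{lo..<hi}. if i < j then Q i j else 0)" .
  qed
  also have "\<dots> = (\<Sum>j\<in>{lo..<hi}. \<Sum>i\<in>{lo..<hi}. if i < j then Q i j else 0)"
    by (rule sum.swap)
  also have "\<dots> = (\<Sum>j\<in>{lo..<hi}. \<Sum>i\<in>{lo..<j}. Q i j)"
  proof (rule sum.cong[OF refl])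
    fix j assume j: "j \<in> {lo..<hi}"
    have "{i. lo \<le> i \<and> i < hi \<and> i < j} = {lo..<j}" using j by auto
    then show "(\<Sum>i\<in>{lo..<hi}. if i < j then Q i j else 0) = (\<Sum>i\<in>{lo..<j}. Q i j)"
      by (simp add: sum.If_cases Int_def conj_assoc)
  qed
  finally have "(\<Sum>l. excursion (Suc l) c) = (\<Sum>j\<in>{lo..<hi}. \<Sum>i\<in>{lo..<j}. Q i j)" .
  then show ?thesis
    by (simp add: survival_window_start sum_subtractf lo_def hi_def Q_def)
qed

text \<open>Starting the inspection at the pilot or at the lower edge of the window makes a
  difference only on the event measured by \<open>early\<close>.\<close>

lemma survival_diff:
  assumes "m0 \<le> window_lo k c"
  shows "survival m0 c j \<ge> survival (window_lo k c) c j - early m0 c"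
    "j \<ge> window_lo k c \<Longrightarrow> survival m0 c j \<le> survival (window_lo k c) c j"
    "j < window_lo k c \<Longrightarrow> survival m0 c j \<ge> 1 - early m0 c"
proof -
  have "survival (window_lo k c) c j \<le> prob ({\<omega>\<in>space M. \<forall>i\<in>{m0..j}. dev c i \<omega> > 0} \<union> {\<omega>\<in>space M. \<exists>i\<in>{m0..<window_lo k c}. dev c i \<omega> \<le> 0})"
    unfolding survival_def
  proof (rule finite_measure_mono)
    show "{\<omega>\<in>space M. \<forall>i\<in>{window_lo k c..j}. dev c i \<omega> > 0} \<subseteq> {\<omega>\<in>space M. \<forall>i\<in>{m0..j}. dev c i \<omega> > 0} \<union> {\<omega>\<in>space M. \<exists>i\<in>{m0..<window_lo k c}. dev c i \<omega> \<le> 0}"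
    proof
      fix \<omega> assume \<omega>: "\<omega> \<in> {\<omega>\<in>space M. \<forall>i\<in>{window_lo k c..j}. dev c i \<omega> > 0}"
      have "dev c i \<omega> > 0" if "\<not> (\<exists>i\<in>{m0..<window_lo k c}. dev c i \<omega> \<le> 0)" "i \<in> {m0..j}" for i
        using that \<omega> by (cases "i < window_lo k c") (auto simp: not_le)
      then show "\<omega> \<in> {\<omega>\<in>space M. \<forall>i\<in>{m0..j}. dev c i \<omega> > 0} \<union> {\<omega>\<in>space M. \<exists>i\<in>{m0..<window_lo k c}. dev c i \<omega> \<le> 0}"
        using \<omega> by blast
    qed
  qed measurable
  also have "\<dots> \<le> survival m0 c j + early m0 c"
    unfolding survival_def early_def by (intro measure_Un_le) auto
  finally show "survival m0 c j \<ge> survival (window_lo k c) c j - early m0 c" by simp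
  show "survival m0 c j \<le> survival (window_lo k c) c j" if "j \<ge> window_lo k c"
    unfolding survival_def using assms by (intro finite_measure_mono) auto
  show "survival m0 c j \<ge> 1 - early m0 c" if j: "j < window_lo k c"
  proof -
    have "1 = prob (space M)" by (simp add: prob_space)
    also have "\<dots> \<le> prob ({\<omega>\<in>space M. \<forall>i\<in>{m0..j}. dev c i \<omega> > 0} \<union> {\<omega>\<in>space M. \<exists>i\<in>{m0..<window_lo k c}. dev c i \<omega> \<le> 0})"
      using j by (intro finite_measure_mono) (auto simp: not_less intro: order_le_less_trans)
    also have "\<dots> \<le> survival m0 c j + early m0 c"
      unfolding survival_def early_def by (intro measure_Un_le) auto
    finally show ?thesis by simp
  qed
qed

lemma survival_le_1: "survival m0 c j \<le> 1"
  by (simp add: survival_def)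

text \<open>The mean is the sum of the survival probabilities. Below the window each is 1 up to
  \<open>early\<close>, inside it the decomposition by last visits applies, and above it they are
  dominated by the tail series; the right-hand side collects the three errors.\<close>

lemma expectation_tau_approx:
  assumes s: "summable (\<lambda>i. pos_prob c (window_hi k c + i))" and m0: "m0 \<le> window_lo k c" and lh: "window_lo k c \<le> window_hi k c"
  shows "\<bar>real m0 + expectation (\<lambda>\<omega>. real (tau m0 c \<omega>)) - (real (window_lo k c) + (\<Sum>j\<in>window k c. pos_prob c j) - (\<Sum>l. excursion (Suc l) c))\<bar>
     \<le> real (window_hi k c) * early m0 c + (\<Sum>i. pos_prob c (window_hi k c + i))"
proof -
  define lo where "lo = window_lo k c"
  define hi where "hi = window_hi k c"
  define e where "e = early m0 c"
  define L where "L = (\<Sum>i. pos_prob c (hi + i))"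
  have lh': "m0 \<le> lo" "lo \<le> hi" using m0 lh by (auto simp: lo_def hi_def)
  have e0: "e \<ge> 0" by (simp add: e_def early_nonneg)
  have s': "summable (\<lambda>i. pos_prob c (hi + i))" using s by (simp add: hi_def)
  have sl: "summable (\<lambda>i. survival m0 c (hi + i))"
    by (rule summable_comparison_test'[OF s', of 0]) (use lh' in \<open>simp add: survival_nonneg survival_le_pos_prob\<close>)
  define L' where "L' = (\<Sum>i. survival m0 c (hi + i))"
  have L': "0 \<le> L'" "L' \<le> L"
    unfolding L'_def L_def using lh' by (auto intro!: suminf_nonneg suminf_le sl s' survival_nonneg survival_le_pos_prob)
  have "expectation (\<lambda>\<omega>. real (tau m0 c \<omega>)) = (\<Sum>n. survival m0 c (m0 + n))"
    by (rule expectation_tau(2)[OF s])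
  also have "\<dots> = (\<Sum>n. survival m0 c (m0 + (n + (hi - m0)))) + (\<Sum>n<hi - m0. survival m0 c (m0 + n))"
    by (rule suminf_split_initial_segment[OF summable_survival[OF s]])
  also have "(\<Sum>n. survival m0 c (m0 + (n + (hi - m0)))) = L'"
  proof -
    have "m0 + (n + (hi - m0)) = hi + n" for n using lh' by simp
    then show ?thesis by (simp add: L'_def add.commute)
  qed
  also have "(\<Sum>n<hi - m0. survival m0 c (m0 + n)) = (\<Sum>j\<in>{m0..<hi}. survival m0 c j)"
    by (rule sum.reindex_bij_witness[of _ "\<lambda>j. j - m0" "\<lambda>n. m0 + n"]) auto
  also have "\<dots> = (\<Sum>j\<in>{m0..<lo}. survival m0 c j) + (\<Sum>j\<in>{lo..<hi}. survival m0 c j)"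
    using lh' by (simp add: sum.atLeastLessThan_concat)
  finally have E: "expectation (\<lambda>\<omega>. real (tau m0 c \<omega>)) = L' + ((\<Sum>j\<in>{m0..<lo}. survival m0 c j) + (\<Sum>j\<in>{lo..<hi}. survival m0 c j))" .
  have A1: "(\<Sum>j\<in>{m0..<lo}. survival m0 c j) \<le> real (lo - m0)"
    using sum_mono[of "{m0..<lo}" "\<lambda>j. survival m0 c j" "\<lambda>_. 1"] survival_le_1 by simp
  have A2: "real (lo - m0) * (1 - e) \<le> (\<Sum>j\<in>{m0..<lo}. survival m0 c j)"
    using sum_mono[of "{m0..<lo}" "\<lambda>_. 1 - e" "\<lambda>j. survival m0 c j"] survival_diff(3)[OF m0] by (simp add: lo_def e_def)
  have B: "(\<Sum>j\<in>{lo..<hi}. survival lo c j) = (\<Sum>j\<in>window k c. pos_prob c j) - (\<Sum>l. excursion (Suc l) c)"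
    unfolding lo_def hi_def by (rule sum_survival_window)
  have B1: "(\<Sum>j\<in>{lo..<hi}. survival m0 c j) \<le> (\<Sum>j\<in>{lo..<hi}. survival lo c j)"
    using survival_diff(2)[OF m0] by (intro sum_mono) (auto simp: lo_def)
  have B2: "(\<Sum>j\<in>{lo..<hi}. survival lo c j) - real (hi - lo) * e \<le> (\<Sum>j\<in>{lo..<hi}. survival m0 c j)"
    using sum_mono[of "{lo..<hi}" "\<lambda>j. survival lo c j - e" "\<lambda>j. survival m0 c j"] survival_diff(1)[OF m0]
    by (simp add: lo_def e_def sum_subtractf)
  have "real (lo - m0) * e + real (hi - lo) * e \<le> real hi * e"
    using lh' e0 by (simp add: of_nat_diff mult_right_mono flip: distrib_right)
  then show ?thesis
    unfolding E B[unfolded lo_def, symmetric] lo_def[symmetric] hi_def[symmetric] e_def[symmetric] L_def[symmetric]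
    using A1 A2 B B1 B2 L' lh' by (simp add: of_nat_diff algebra_simps abs_le_iff lo_def hi_def)
qed

lemma c_tilt_decay: "((\<lambda>c. c ^ 3 * exp (- (c * (tilt c)\<^sup>2) / 2)) \<longlongrightarrow> 0) at_top"
  unfolding tilt_def by real_asymp

text \<open>In the constant, -2 stems from the potential at the lower edge, (k + 1) / 2 from the
  kinks, and the series from the excursions. In \<open>small\<close>, one power of c is spent by the
  union bound of \<open>early_bound\<close>; the other two serve the second claim, where c^2
  multiplies the probability of stopping early.\<close>

lemma expectation_tau_limit:
  assumes c: "filterlim c at_top F" and m0: "eventually (\<lambda>s. m0 s \<le> window_lo k (c s)) F"
    and small: "((\<lambda>s. (c s) ^ 3 * exp (- real (m0 s * k) / 32)) \<longlongrightarrow> 0) F"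
  shows "((\<lambda>s. real k * (real (m0 s) + expectation (\<lambda>\<omega>. real (tau (m0 s) (c s) \<omega>))) - c s) \<longlongrightarrow>
      - 2 + (real k + 1) / 2 - (\<Sum>l. excess (Suc l) / real (Suc l))) F"
    and "((\<lambda>s. (c s)\<^sup>2 * early (m0 s) (c s)) \<longlongrightarrow> 0) F"
proof -
  have k0: "real k > 0" using k_ge_1 by simp
  note at = eventually_compose_filterlim[OF _ c]
  show ear: "((\<lambda>s. (c s)\<^sup>2 * early (m0 s) (c s)) \<longlongrightarrow> 0) F"
  proof (rule Lim_null_comparison)
    show "eventually (\<lambda>s. norm ((c s)\<^sup>2 * early (m0 s) (c s)) \<le> 2 * ((c s) ^ 3 * exp (- real (m0 s * k) / 32) + (c s) ^ 3 * exp (- (c s * (tilt (c s))\<^sup>2) / 2))) F"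
      using at[OF early_bound]
    proof eventually_elim
      case (elim s)
      have "(c s)\<^sup>2 * early (m0 s) (c s) \<le> (c s)\<^sup>2 * (2 * c s * (exp (- real (m0 s * k) / 32) + exp (- (c s * (tilt (c s))\<^sup>2) / 2)))"
        using elim by (intro mult_left_mono) auto
      moreover have "0 \<le> (c s)\<^sup>2 * early (m0 s) (c s)" using early_nonneg by simp
      ultimately show ?case by (simp add: power2_eq_square power3_eq_cube algebra_simps)
    qed
    have "((\<lambda>s. 2 * ((c s) ^ 3 * exp (- real (m0 s * k) / 32) + (c s) ^ 3 * exp (- (c s * (tilt (c s))\<^sup>2) / 2))) \<longlongrightarrow> 2 * (0 + 0)) F"
      by (intro tendsto_intros small filterlim_compose[OF c_tilt_decay c])
    then show "((\<lambda>s. 2 * ((c s) ^ 3 * exp (- real (m0 s * k) / 32) + (c s) ^ 3 * exp (- (c s * (tilt (c s))\<^sup>2) / 2))) \<longlongrightarrow> 0) F" by simp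
  qed
  define A where "A = (\<lambda>c. real (window_lo k c) + (\<Sum>j\<in>window k c. pos_prob c j) - (\<Sum>l. excursion (Suc l) c))"
  define X where "X = (\<Sum>l. excess (Suc l) / (real k * real (Suc l)))"
  have kX: "real k * X = (\<Sum>l. excess (Suc l) / real (Suc l))"
  proof -
    have "real k * X = (\<Sum>l. real k * (excess (Suc l) / (real k * real (Suc l))))"
      unfolding X_def by (rule suminf_mult[symmetric, OF excursion_series_limit(1)])
    then show ?thesis using k0 by simp
  qed
  have "((\<lambda>c. (real k * (\<Sum>j\<in>window k c. pos_prob c j) - (c - real (window_lo k c * k) - 2 + (real k + 1) / 2))
     - real k * (\<Sum>l. excursion (Suc l) c)) \<longlongrightarrow> 0 - real k * X) at_top"
    unfolding X_def by (intro tendsto_intros window_prob_sum excursion_series_limit(2))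
  then have "((\<lambda>c. real k * A c - c + 2 - (real k + 1) / 2) \<longlongrightarrow> 0 - real k * X) at_top"
    by (simp add: A_def algebra_simps)
  then have "((\<lambda>s. real k * A (c s) - c s + 2 - (real k + 1) / 2) \<longlongrightarrow> 0 - real k * X) F"
    by (rule filterlim_compose[OF _ c])
  then have A_lim: "((\<lambda>s. (real k * A (c s) - c s + 2 - (real k + 1) / 2) - 2 + (real k + 1) / 2) \<longlongrightarrow> (0 - real k * X) - 2 + (real k + 1) / 2) F"
    by (intro tendsto_add[OF tendsto_diff[OF _ tendsto_const] tendsto_const])
  have diff: "((\<lambda>s. real (m0 s) + expectation (\<lambda>\<omega>. real (tau (m0 s) (c s) \<omega>)) - A (c s)) \<longlongrightarrow> 0) F"
  proof (rule Lim_null_comparison)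
    show "eventually (\<lambda>s. norm (real (m0 s) + expectation (\<lambda>\<omega>. real (tau (m0 s) (c s) \<omega>)) - A (c s)) \<le> (c s)\<^sup>2 * early (m0 s) (c s) + (\<Sum>i. pos_prob (c s) (window_hi k (c s) + i))) F"
      using at[OF late_sum_limit(1)] m0 at[OF eventually_window[OF k_ge_1]]
    proof eventually_elim
      case (elim s)
      have lh: "window_lo k (c s) \<le> window_hi k (c s)" using elim by auto
      have "real (window_hi k (c s) * k) \<le> c s + c s powr (3/5)" using elim(3) by blast
      then have "real (window_hi k (c s) * k) \<le> 2 * c s" using elim(3) by linarith
      moreover have "window_hi k (c s) \<le> window_hi k (c s) * k" using k_ge_1 by simp
      then have "real (window_hi k (c s)) \<le> real (window_hi k (c s) * k)" by (simp only: of_nat_le_iff)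
      moreover have "2 * c s \<le> (c s)\<^sup>2" using elim(3) by (simp add: power2_eq_square mult_right_mono)
      ultimately have "real (window_hi k (c s)) \<le> (c s)\<^sup>2" by linarith
      then have "real (window_hi k (c s)) * early (m0 s) (c s) \<le> (c s)\<^sup>2 * early (m0 s) (c s)"
        using early_nonneg by (rule mult_right_mono)
      then show ?case
        using expectation_tau_approx[OF elim(1,2) lh] by (simp add: A_def)
    qed
    have "((\<lambda>s. (c s)\<^sup>2 * early (m0 s) (c s) + (\<Sum>i. pos_prob (c s) (window_hi k (c s) + i))) \<longlongrightarrow> 0 + 0) F"
      by (intro tendsto_add ear filterlim_compose[OF late_sum_limit(2) c])
    then show "((\<lambda>s. (c s)\<^sup>2 * early (m0 s) (c s) + (\<Sum>i. pos_prob (c s) (window_hi k (c s) + i))) \<longlongrightarrow> 0) F" by simp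
  qed
  have "((\<lambda>s. real k * (real (m0 s) + expectation (\<lambda>\<omega>. real (tau (m0 s) (c s) \<omega>)) - A (c s)) + ((real k * A (c s) - c s + 2 - (real k + 1) / 2) - 2 + (real k + 1) / 2)) \<longlongrightarrow> real k * 0 + ((0 - real k * X) - 2 + (real k + 1) / 2)) F"
    by (intro tendsto_intros diff A_lim)
  then show "((\<lambda>s. real k * (real (m0 s) + expectation (\<lambda>\<omega>. real (tau (m0 s) (c s) \<omega>))) - c s) \<longlongrightarrow>
      - 2 + (real k + 1) / 2 - (\<Sum>l. excess (Suc l) / real (Suc l))) F"
    unfolding kX[symmetric] by (simp add: algebra_simps)
qed

lemma walk_pos_part_integral:
  assumes "j \<ge> 1"
  shows "expectation (\<lambda>\<omega>. max 0 (walk j \<omega> - a)) = (\<integral>x. max 0 (x - a) * erlang_density (j * k - 1) 1 x \<partial>lborel)"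
  using distributed_integral[OF walk_distributed[OF assms], of "\<lambda>x. max 0 (x - a)"] by (simp add: mult.commute)

end

section \<open>Normalised spacings of an exponential sample\<close>

definition Xmin :: "(nat \<Rightarrow> 'a \<Rightarrow> real) \<Rightarrow> nat \<Rightarrow> 'a \<Rightarrow> real" where
  "Xmin X n \<omega> = Min ((\<lambda>i. X i \<omega>) ` {1..n})"

definition spacing_sum :: "(nat \<Rightarrow> 'a \<Rightarrow> real) \<Rightarrow> nat \<Rightarrow> 'a \<Rightarrow> real" where
  "spacing_sum X n \<omega> = (\<Sum>i\<in>{1..n}. (X i \<omega> - Xmin X n \<omega>))"

text \<open>A sequential form of the normalised spacings: they are not read off one ordered sample
  but are the increments caused by each new observation, so that a single sequence describes all
  sample sizes.\<close>

definition spacing :: "(nat \<Rightarrow> 'a \<Rightarrow> real) \<Rightarrow> nat \<Rightarrow> 'a \<Rightarrow> real" where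
  "spacing X n \<omega> = spacing_sum X (Suc n) \<omega> - spacing_sum X n \<omega>"

lemma Xmin_Suc:
  assumes "n \<ge> 1"
  shows "Xmin X (Suc n) \<omega> = min (Xmin X n \<omega>) (X (Suc n) \<omega>)"
proof -
  have "{1..Suc n} = insert (Suc n) {1..n}" by auto
  then show ?thesis using assms by (simp add: Xmin_def min.commute)
qed

text \<open>A new observation x below the current minimum m of n values raises each of the n old
  excesses by m - x and has excess 0 itself; otherwise it only adds its own excess.\<close>

definition spacing_fun :: "nat \<Rightarrow> real \<Rightarrow> real \<Rightarrow> real" where
  "spacing_fun n m x = (if x < m then real n * (m - x) else x - m)"

lemma spacing_eq:
  assumes "n \<ge> 1"
  shows "spacing X n \<omega> = spacing_fun n (Xmin X n \<omega>) (X (Suc n) \<omega>)"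
proof -
  have "spacing_sum X (Suc n) \<omega> = (\<Sum>i\<in>{1..n}. X i \<omega>) + X (Suc n) \<omega> - real (Suc n) * Xmin X (Suc n) \<omega>"
    by (simp add: spacing_sum_def sum_subtractf)
  moreover have "spacing_sum X n \<omega> = (\<Sum>i\<in>{1..n}. X i \<omega>) - real n * Xmin X n \<omega>"
    by (simp add: spacing_sum_def sum_subtractf)
  ultimately have "spacing X n \<omega> = X (Suc n) \<omega> - real (Suc n) * Xmin X (Suc n) \<omega> + real n * Xmin X n \<omega>"
    by (simp add: spacing_def)
  then show ?thesis
    unfolding Xmin_Suc[OF assms] spacing_fun_def by (auto simp: min_def algebra_simps)
qed

lemma sum_spacing:
  assumes "n \<ge> 1"
  shows "(\<Sum>i\<in>{1..<n}. spacing X i \<omega>) = spacing_sum X n \<omega>"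
proof -
  have "(\<Sum>i\<in>{1..<n}. spacing X i \<omega>) = spacing_sum X n \<omega> - spacing_sum X 1 \<omega>"
    unfolding spacing_def using assms by (rule sum_Suc_diff')
  then show ?thesis by (simp add: spacing_sum_def Xmin_def)
qed

abbreviation exp_law :: "real \<Rightarrow> real measure" where
  "exp_law l \<equiv> density lborel (exponential_density l)"

lemma nn_integral_exp_law:
  "f \<in> borel_measurable borel \<Longrightarrow> (\<integral>\<^sup>+x. f x \<partial>exp_law l) = (\<integral>\<^sup>+x. ennreal (exponential_density l x) * f x \<partial>lborel)"
  by (subst nn_integral_density) auto

text \<open>Memorylessness. If m is the smaller value, x - m is a unit exponential; if x is the
  smaller, m - x is exponential of rate n, and multiplication by n restores rate 1. In both cases
  the smaller value is independent of it and exponential of rate n + 1. The weights n / (n + 1) and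
  1 / (n + 1) in \<open>part1\<close> and \<open>part2\<close> are the probabilities of the two
  cases.\<close>

lemma min_spacing_transform:
  fixes K :: "real \<Rightarrow> real \<Rightarrow> ennreal"
  assumes n: "n \<ge> 1" and K[measurable]: "(\<lambda>(d, y). K d y) \<in> borel_measurable (borel \<Otimes>\<^sub>M borel)"
  shows "(\<integral>\<^sup>+m. (\<integral>\<^sup>+x. K (spacing_fun n m x) (min m x) \<partial>exp_law 1) \<partial>exp_law (real n)) =
    (\<integral>\<^sup>+y. (\<integral>\<^sup>+d. K d y \<partial>exp_law 1) \<partial>exp_law (real (Suc n)))"
proof -
  have n0: "real n > 0" using n by simp
  have [measurable]: "(\<lambda>z. K (f z) (g z)) \<in> borel_measurable N" if [measurable]: "f \<in> borel_measurable N" "g \<in> borel_measurable N" for f g and N :: "'z measure"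
    using measurable_compose[OF _ K, of "\<lambda>z. (f z, g z)" N] by simp
  have [measurable]: "(\<lambda>z. spacing_fun n (f z) (g z)) \<in> borel_measurable N" if [measurable]: "f \<in> borel_measurable N" "g \<in> borel_measurable N" for f g and N :: "'z measure"
    unfolding spacing_fun_def by measurable
  define e where "e = (\<lambda>l x. ennreal (exponential_density l x))"
  have e_meas[measurable]: "e l \<in> borel_measurable borel" for l unfolding e_def by measurable
  define J where "J = (\<integral>\<^sup>+y. (\<integral>\<^sup>+d. e (real (Suc n)) y * e 1 d * K d y \<partial>lborel) \<partial>lborel)"
  have rhs: "(\<integral>\<^sup>+y. (\<integral>\<^sup>+d. K d y \<partial>exp_law 1) \<partial>exp_law (real (Suc n))) = J"
    unfolding J_def
    by (subst nn_integral_exp_law) (auto simp: nn_integral_exp_law e_def mult.assoc nn_integral_cmult)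
  have lhs: "(\<integral>\<^sup>+m. (\<integral>\<^sup>+x. K (spacing_fun n m x) (min m x) \<partial>exp_law 1) \<partial>exp_law (real n)) =
    (\<integral>\<^sup>+m. (\<integral>\<^sup>+x. e (real n) m * e 1 x * K (spacing_fun n m x) (min m x) \<partial>lborel) \<partial>lborel)"
    by (subst nn_integral_exp_law) (auto simp: nn_integral_exp_law e_def mult.assoc nn_integral_cmult)
  have split: "e (real n) m * e 1 x * K (spacing_fun n m x) (min m x) =
      e (real n) m * e 1 x * K (x - m) m * indicator {m..} x + e (real n) m * e 1 x * K (real n * (m - x)) x * indicator {x<..} m" for m x
    by (auto simp: spacing_fun_def indicator_def min_def not_less)
  have part1: "(\<integral>\<^sup>+m. (\<integral>\<^sup>+x. e (real n) m * e 1 x * K (x - m) m * indicator {m..} x \<partial>lborel) \<partial>lborel) = ennreal (real n / real (Suc n)) * J"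
  proof -
    have "(\<integral>\<^sup>+x. e (real n) m * e 1 x * K (x - m) m * indicator {m..} x \<partial>lborel) =
      (\<integral>\<^sup>+d. ennreal (real n / real (Suc n)) * (e (real (Suc n)) m * e 1 d * K d m) \<partial>lborel)" for m
    proof -
      have "(\<integral>\<^sup>+x. e (real n) m * e 1 x * K (x - m) m * indicator {m..} x \<partial>lborel) =
        (\<integral>\<^sup>+d. e (real n) m * e 1 (m + 1 * d) * K (m + 1 * d - m) m * indicator {m..} (m + 1 * d) \<partial>lborel)"
        by (subst nn_integral_real_affine[where c=1 and t=m]) auto
      also have "\<dots> = (\<integral>\<^sup>+d. ennreal (real n / real (Suc n)) * (e (real (Suc n)) m * e 1 d * K d m) \<partial>lborel)"
      proof (rule nn_integral_cong)
        fix d :: real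
        have "e (real n) m * e 1 (m + d) * indicator {m..} (m + d) = ennreal (real n / real (Suc n)) * (e (real (Suc n)) m * e 1 d)"
        proof (cases "0 \<le> d \<and> 0 \<le> m")
          case True
          have "(real n * exp (- m * real n)) * exp (- (m + d)) = (real n / real (Suc n)) * ((real (Suc n) * exp (- m * real (Suc n))) * exp (- d))"
            by (simp add: field_simps flip: exp_add)
          then show ?thesis
            using True n0 by (simp add: e_def exponential_density_def flip: ennreal_mult')
        next
          case False
          then show ?thesis by (auto simp: e_def exponential_density_def indicator_def)
        qed
        then show "e (real n) m * e 1 (m + 1 * d) * K (m + 1 * d - m) m * indicator {m..} (m + 1 * d) = ennreal (real n / real (Suc n)) * (e (real (Suc n)) m * e 1 d * K d m)"
          by (simp add: mult_ac)
      qed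
      finally show ?thesis .
    qed
    then show ?thesis unfolding J_def by (simp add: nn_integral_cmult)
  qed
  have part2: "(\<integral>\<^sup>+m. (\<integral>\<^sup>+x. e (real n) m * e 1 x * K (real n * (m - x)) x * indicator {x<..} m \<partial>lborel) \<partial>lborel) = ennreal (1 / real (Suc n)) * J"
  proof -
    have "(\<integral>\<^sup>+m. (\<integral>\<^sup>+x. e (real n) m * e 1 x * K (real n * (m - x)) x * indicator {x<..} m \<partial>lborel) \<partial>lborel) =
      (\<integral>\<^sup>+x. (\<integral>\<^sup>+m. e (real n) m * e 1 x * K (real n * (m - x)) x * indicator {x<..} m \<partial>lborel) \<partial>lborel)"
    proof -
      have "(\<lambda>(m, x). e (real n) m * e 1 x * K (real n * (m - x)) x * indicator {y. snd y < fst y} (m, x)) \<in> borel_measurable (lborel \<Otimes>\<^sub>M lborel)"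
        by measurable
      then have "(\<lambda>(m, x). e (real n) m * e 1 x * K (real n * (m - x)) x * indicator {x<..} m) \<in> borel_measurable (lborel \<Otimes>\<^sub>M lborel)"
        by (simp add: indicator_def)
      then show ?thesis by (rule lborel_pair.Fubini'[symmetric])
    qed
    also have "\<dots> = (\<integral>\<^sup>+x. (\<integral>\<^sup>+d. ennreal (1 / real (Suc n)) * (e (real (Suc n)) x * e 1 d * K d x) \<partial>lborel) \<partial>lborel)"
    proof (rule nn_integral_cong)
      fix x :: real
      have "(\<integral>\<^sup>+m. e (real n) m * e 1 x * K (real n * (m - x)) x * indicator {x<..} m \<partial>lborel) =
        ennreal (1 / real n) * (\<integral>\<^sup>+d. e (real n) (x + 1 / real n * d) * e 1 x * K (real n * (x + 1 / real n * d - x)) x * indicator {x<..} (x + 1 / real n * d) \<partial>lborel)"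
        using n0 by (subst nn_integral_real_affine[where c="1 / real n" and t=x]) auto
      also have "\<dots> = (\<integral>\<^sup>+d. ennreal (1 / real n) * (e (real n) (x + 1 / real n * d) * e 1 x * K d x * indicator {0<..} d) \<partial>lborel)"
        using n0 by (subst nn_integral_cmult[symmetric]) (auto simp: indicator_def zero_less_divide_iff intro!: nn_integral_cong)
      also have "\<dots> = (\<integral>\<^sup>+d. ennreal (1 / real (Suc n)) * (e (real (Suc n)) x * e 1 d * K d x) \<partial>lborel)"
      proof (rule nn_integral_cong_AE)
        \<comment> \<open>At d = 0 the exponential density is positive while the strict indicator is
          0.\<close>
        have "AE d in lborel. d \<noteq> (0::real)" by (rule AE_lborel_singleton)
        then show "AE d in lborel. ennreal (1 / real n) * (e (real n) (x + 1 / real n * d) * e 1 x * K d x * indicator {0<..} d) = ennreal (1 / real (Suc n)) * (e (real (Suc n)) x * e 1 d * K d x)"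
        proof eventually_elim
          case (elim d)
          have "ennreal (1 / real n) * (e (real n) (x + 1 / real n * d) * e 1 x * indicator {0<..} d) = ennreal (1 / real (Suc n)) * (e (real (Suc n)) x * e 1 d)"
          proof (cases "0 < d \<and> 0 \<le> x")
            case True
            have "- (x + 1 / real n * d) * real n = - (x * real n) - d" using n0 by (simp add: field_simps)
            moreover have "- x * real (Suc n) = - (x * real n) - x" by (simp add: algebra_simps)
            ultimately have "(1 / real n) * (real n * exp (- (x + 1 / real n * d) * real n) * exp (- x)) = (1 / real (Suc n)) * ((real (Suc n) * exp (- x * real (Suc n))) * exp (- d))"
              using n0 by (simp only:) (simp flip: exp_add)
            moreover have "\<not> x + d / real n < 0" using True n0 by (simp add: not_less)
            ultimately show ?thesis
              using True n0 by (simp add: e_def exponential_density_def flip: ennreal_mult')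
          next
            case False
            then show ?thesis using elim by (auto simp: e_def exponential_density_def indicator_def)
          qed
          then show ?case by (simp add: mult_ac)
        qed
      qed
      finally show "(\<integral>\<^sup>+m. e (real n) m * e 1 x * K (real n * (m - x)) x * indicator {x<..} m \<partial>lborel) = (\<integral>\<^sup>+d. ennreal (1 / real (Suc n)) * (e (real (Suc n)) x * e 1 d * K d x) \<partial>lborel)" .
    qed
    also have "\<dots> = ennreal (1 / real (Suc n)) * J"
      unfolding J_def by (simp add: nn_integral_cmult)
    finally show ?thesis .
  qed
  have m1: "(\<lambda>(m, x). e (real n) m * e 1 x * K (x - m) m * indicator {m..} x) \<in> borel_measurable (lborel \<Otimes>\<^sub>M lborel)"
  proof -
    have "(\<lambda>(m, x). e (real n) m * e 1 x * K (x - m) m * indicator {y. fst y \<le> snd y} (m, x)) \<in> borel_measurable (lborel \<Otimes>\<^sub>M lborel)"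
      by measurable
    then show ?thesis by (simp add: indicator_def)
  qed
  have m2: "(\<lambda>(m, x). e (real n) m * e 1 x * K (real n * (m - x)) x * indicator {x<..} m) \<in> borel_measurable (lborel \<Otimes>\<^sub>M lborel)"
  proof -
    have "(\<lambda>(m, x). e (real n) m * e 1 x * K (real n * (m - x)) x * indicator {y. snd y < fst y} (m, x)) \<in> borel_measurable (lborel \<Otimes>\<^sub>M lborel)"
      by measurable
    then show ?thesis by (simp add: indicator_def)
  qed
  have "(\<integral>\<^sup>+m. (\<integral>\<^sup>+x. e (real n) m * e 1 x * K (spacing_fun n m x) (min m x) \<partial>lborel) \<partial>lborel) =
    (\<integral>\<^sup>+m. ((\<integral>\<^sup>+x. e (real n) m * e 1 x * K (x - m) m * indicator {m..} x \<partial>lborel) +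
      (\<integral>\<^sup>+x. e (real n) m * e 1 x * K (real n * (m - x)) x * indicator {x<..} m \<partial>lborel)) \<partial>lborel)"
  proof (rule nn_integral_cong)
    fix m :: real
    have a: "(\<lambda>x. e (real n) m * e 1 x * K (x - m) m * indicator {m..} x) \<in> borel_measurable lborel"
      using measurable_Pair2[OF m1, of m] by simp
    have b: "(\<lambda>x. e (real n) m * e 1 x * K (real n * (m - x)) x * indicator {x<..} m) \<in> borel_measurable lborel"
      using measurable_Pair2[OF m2, of m] by simp
    show "(\<integral>\<^sup>+x. e (real n) m * e 1 x * K (spacing_fun n m x) (min m x) \<partial>lborel) = (\<integral>\<^sup>+x. e (real n) m * e 1 x * K (x - m) m * indicator {m..} x \<partial>lborel) +
      (\<integral>\<^sup>+x. e (real n) m * e 1 x * K (real n * (m - x)) x * indicator {x<..} m \<partial>lborel)"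
      unfolding split by (rule nn_integral_add[OF a b])
  qed
  also have "\<dots> = (\<integral>\<^sup>+m. (\<integral>\<^sup>+x. e (real n) m * e 1 x * K (x - m) m * indicator {m..} x \<partial>lborel) \<partial>lborel) +
      (\<integral>\<^sup>+m. (\<integral>\<^sup>+x. e (real n) m * e 1 x * K (real n * (m - x)) x * indicator {x<..} m \<partial>lborel) \<partial>lborel)"
    using lborel.borel_measurable_nn_integral_fst[OF m1] lborel.borel_measurable_nn_integral_fst[OF m2]
    by (intro nn_integral_add) simp_all
  also have "\<dots> = (ennreal (real n / real (Suc n)) + ennreal (1 / real (Suc n))) * J"
    unfolding part1 part2 by (simp add: distrib_right)
  also have "ennreal (real n / real (Suc n)) + ennreal (1 / real (Suc n)) = 1"
  proof -
    have "real n / real (Suc n) + 1 / real (Suc n) = 1" by (simp add: field_simps)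
    then show ?thesis by (subst ennreal_plus[symmetric]) auto
  qed
  finally show ?thesis unfolding lhs rhs by simp
qed

locale exponential_sample = prob_space M for M :: "'a measure" +
  fixes X :: "nat \<Rightarrow> 'a \<Rightarrow> real"
  assumes indep_X: "indep_vars (\<lambda>_. borel) X {1..}"
    and distributed_X: "\<And>i. i \<ge> 1 \<Longrightarrow> distributed M lborel (X i) (exponential_density 1)"
begin

lemma X_measurable: "i \<ge> 1 \<Longrightarrow> X i \<in> borel_measurable M"
  using distributed_X[of i] by (simp add: distributed_def)

lemma X_law: "i \<ge> 1 \<Longrightarrow> distr M borel (X i) = exp_law 1"
  using distributed_distr_eq_density[OF distributed_X[of i]] by (simp cong: distr_cong)

lemma Xmin_measurable: "Xmin X n \<in> borel_measurable M"
proof -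
  have "(\<lambda>\<omega>. Min ((\<lambda>i. X i \<omega>) ` {1..n})) \<in> borel_measurable M"
    by (intro borel_measurable_Min) (auto intro: X_measurable)
  then show ?thesis by (simp add: Xmin_def[abs_def])
qed

lemma spacing_measurable: "spacing X n \<in> borel_measurable M"
  unfolding spacing_def[abs_def] spacing_sum_def
  by (intro borel_measurable_diff borel_measurable_sum X_measurable Xmin_measurable) auto

definition spacings :: "nat \<Rightarrow> 'a \<Rightarrow> nat \<Rightarrow> real" where
  "spacings n \<omega> = (\<lambda>i\<in>{1..<n}. spacing X i \<omega>)"

definition spacings_law :: "nat \<Rightarrow> (nat \<Rightarrow> real) measure" where
  "spacings_law n = PiM {1..<n} (\<lambda>_. exp_law 1)"

lemma sets_spacings_law [measurable_cong]: "sets (spacings_law n) = sets (PiM {1..<n} (\<lambda>_. borel))"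
  unfolding spacings_law_def by (intro sets_PiM_cong) auto

lemma spacings_measurable: "spacings n \<in> M \<rightarrow>\<^sub>M PiM {1..<n} (\<lambda>_. borel)"
  unfolding spacings_def[abs_def] by (intro measurable_restrict spacing_measurable)

lemma spacings_Suc: "n \<ge> 1 \<Longrightarrow> spacings (Suc n) \<omega> = (spacings n \<omega>)(n := spacing X n \<omega>)"
  by (auto simp: spacings_def fun_eq_iff)

definition sample_prefix :: "nat \<Rightarrow> 'a \<Rightarrow> nat \<Rightarrow> real" where
  "sample_prefix n \<omega> = (\<lambda>i\<in>{1..n}. X i \<omega>)"

text \<open>Exhibits the minimum and the spacings as functions of the first n observations, so that
  they are independent of the next one.\<close>

lemma prefix_factor:
  "Xmin X n \<omega> = Xmin (\<lambda>i w. w i) n (sample_prefix n \<omega>)"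
  "spacings n \<omega> = (\<lambda>i\<in>{1..<n}. spacing (\<lambda>i w. w i) i (sample_prefix n \<omega>))"
proof -
  have min: "Xmin X j \<omega> = Xmin (\<lambda>i w. w i) j (sample_prefix n \<omega>)" if "j \<le> n" for j
    unfolding Xmin_def using that by (intro arg_cong[where f=Min] image_cong) (auto simp: sample_prefix_def)
  show "Xmin X n \<omega> = Xmin (\<lambda>i w. w i) n (sample_prefix n \<omega>)" by (rule min) simp
  have sum: "spacing_sum X j \<omega> = spacing_sum (\<lambda>i w. w i) j (sample_prefix n \<omega>)" if "j \<le> n" for j
    unfolding spacing_sum_def min[OF that] using that by (intro sum.cong) (auto simp: sample_prefix_def)
  show "spacings n \<omega> = (\<lambda>i\<in>{1..<n}. spacing (\<lambda>i w. w i) i (sample_prefix n \<omega>))"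
    unfolding spacings_def spacing_def by (intro restrict_ext) (simp add: sum)
qed

lemma indep_next:
  assumes n: "n \<ge> 1"
  shows "distr M (PiM {1..n} (\<lambda>_. borel) \<Otimes>\<^sub>M borel) (\<lambda>\<omega>. (sample_prefix n \<omega>, X (Suc n) \<omega>)) =
    distr M (PiM {1..n} (\<lambda>_. borel)) (sample_prefix n) \<Otimes>\<^sub>M exp_law 1"
proof -
  let ?A = "PiM {1..n} (\<lambda>_. borel :: real measure)" and ?B = "PiM {Suc n} (\<lambda>_. borel :: real measure)"
  define r where "r = (\<lambda>\<omega>. restrict (\<lambda>i. X i \<omega>) {Suc n})"
  have pm: "sample_prefix n \<in> M \<rightarrow>\<^sub>M ?A" unfolding sample_prefix_def[abs_def] by (intro measurable_restrict X_measurable) auto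
  have rm: "r \<in> M \<rightarrow>\<^sub>M ?B" unfolding r_def by (intro measurable_restrict X_measurable) auto
  have cm: "(\<lambda>w. w (Suc n)) \<in> ?B \<rightarrow>\<^sub>M borel" by (rule measurable_component_singleton) simp
  have "indep_var ?A (sample_prefix n) ?B r"
    unfolding sample_prefix_def[abs_def] r_def by (rule indep_var_restrict[OF indep_X]) auto
  then have eq: "distr M (?A \<Otimes>\<^sub>M ?B) (\<lambda>\<omega>. (sample_prefix n \<omega>, r \<omega>)) = distr M ?A (sample_prefix n) \<Otimes>\<^sub>M distr M ?B r"
    by (simp add: indep_var_distribution_eq)
  have c: "distr (distr M ?B r) borel (\<lambda>w. w (Suc n)) = exp_law 1"
    using X_law[of "Suc n"] by (subst distr_distr[OF cm rm]) (simp add: comp_def r_def)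
  interpret E: prob_space "exp_law 1" by (rule prob_space_exponential_density) simp
  have "distr (distr M ?A (sample_prefix n)) ?A id \<Otimes>\<^sub>M distr (distr M ?B r) borel (\<lambda>w. w (Suc n)) =
      distr (distr M ?A (sample_prefix n) \<Otimes>\<^sub>M distr M ?B r) (?A \<Otimes>\<^sub>M borel) (\<lambda>(x, y). (id x, y (Suc n)))"
    using cm by (intro pair_measure_distr) (auto simp: c intro: E.sigma_finite_measure_axioms)
  also have "\<dots> = distr M (?A \<Otimes>\<^sub>M borel) ((\<lambda>(x, y). (id x, y (Suc n))) \<circ> (\<lambda>\<omega>. (sample_prefix n \<omega>, r \<omega>)))"
    unfolding eq[symmetric]
  proof (rule distr_distr)
    show "(\<lambda>(x, y). (id x, y (Suc n))) \<in> ?A \<Otimes>\<^sub>M ?B \<rightarrow>\<^sub>M ?A \<Otimes>\<^sub>M borel"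
      unfolding case_prod_beta id_def by (intro measurable_Pair measurable_fst measurable_compose[OF measurable_snd cm])
    show "(\<lambda>\<omega>. (sample_prefix n \<omega>, r \<omega>)) \<in> M \<rightarrow>\<^sub>M ?A \<Otimes>\<^sub>M ?B"
      using pm rm by measurable
  qed
  finally show ?thesis
    unfolding c by (simp add: comp_def r_def distr_id2 id_def)
qed

text \<open>The joint law is stated through arbitrary kernels K because the induction step
  integrates out the next observation and applies the hypothesis to the resulting kernel h.
  \<open>min_spacing_transform\<close> then replaces the old minimum and the new observation by the
  new spacing and the new minimum.\<close>

lemma nn_integral_spacings_Xmin:
  assumes n: "n \<ge> 1" and K: "(\<lambda>(v, y). K v y) \<in> borel_measurable (PiM {1..<n} (\<lambda>_. borel) \<Otimes>\<^sub>M borel)"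
  shows "(\<integral>\<^sup>+\<omega>. K (spacings n \<omega>) (Xmin X n \<omega>) \<partial>M) = (\<integral>\<^sup>+v. (\<integral>\<^sup>+y. K v y \<partial>exp_law (real n)) \<partial>spacings_law n)"
  using n K
proof (induction n arbitrary: K rule: dec_induct)
  \<comment> \<open>There is no spacing yet: the vector is the everywhere undefined function, the
    only point of the empty product space.\<close>
  case base
  have "(\<integral>\<^sup>+\<omega>. K (spacings 1 \<omega>) (Xmin X 1 \<omega>) \<partial>M) = (\<integral>\<^sup>+\<omega>. K (\<lambda>_. undefined) (X 1 \<omega>) \<partial>M)"
    by (simp add: spacings_def Xmin_def restrict_def)
  also have "\<dots> = (\<integral>\<^sup>+y. K (\<lambda>_. undefined) y \<partial>distr M borel (X 1))"
  proof -
    have "(\<lambda>_. undefined) \<in> space (PiM {1..<1::nat} (\<lambda>_. borel :: real measure))" by (simp add: space_PiM)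
    from measurable_Pair2[OF base this] have "K (\<lambda>_. undefined) \<in> borel_measurable borel" by simp
    then show ?thesis using X_measurable[of 1] by (subst nn_integral_distr) auto
  qed
  also have "\<dots> = (\<integral>\<^sup>+v. (\<integral>\<^sup>+y. K v y \<partial>exp_law (real 1)) \<partial>spacings_law 1)"
    by (simp add: spacings_law_def PiM_empty nn_integral_count_space_finite X_law)
  finally show ?case .
next
  case (step n)
  have n: "n \<ge> 1" using step by simp
  let ?A = "PiM {1..n} (\<lambda>_. borel :: real measure)"
  let ?V = "PiM {1..<n} (\<lambda>_. borel :: real measure)"
  let ?V' = "PiM {1..<Suc n} (\<lambda>_. borel :: real measure)"
  interpret E: prob_space "exp_law 1" by (rule prob_space_exponential_density) simp
  interpret En: prob_space "exp_law (real n)" by (rule prob_space_exponential_density) (use n in simp)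
  interpret En': prob_space "exp_law (real (Suc n))" by (rule prob_space_exponential_density) simp
  interpret P: product_sigma_finite "\<lambda>_::nat. exp_law 1" ..
  have K: "(\<lambda>(v, y). K v y) \<in> borel_measurable (?V' \<Otimes>\<^sub>M borel)" by (rule step.prems)
  have set: "{1..<Suc n} = insert n {1..<n}" using n by auto
  have upd: "(\<lambda>\<omega>. (f \<omega>)(n := g \<omega>)) \<in> N \<rightarrow>\<^sub>M ?V'" if "f \<in> N \<rightarrow>\<^sub>M ?V" "g \<in> borel_measurable N" for f g and N :: "'z measure"
    unfolding set using that by (intro measurable_fun_upd[where J="{1..<n}"]) auto
  have KK: "(\<lambda>\<omega>. K ((f \<omega>)(n := g \<omega>)) (h \<omega>)) \<in> borel_measurable N" if "f \<in> N \<rightarrow>\<^sub>M ?V" "g \<in> borel_measurable N" "h \<in> borel_measurable N" for f g h and N :: "'z measure"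
    using measurable_compose[OF measurable_Pair[OF upd[OF that(1,2)] that(3)] K] by simp
  have sf: "(\<lambda>z. spacing_fun n (f z) (g z)) \<in> borel_measurable N" if [measurable]: "f \<in> borel_measurable N" "g \<in> borel_measurable N" for f g and N :: "'z measure"
    unfolding spacing_fun_def by measurable
  define H where "H = (\<lambda>v m x. K (v(n := spacing_fun n m x)) (min m x))"
  define xm where "xm = (\<lambda>w :: nat \<Rightarrow> real. Xmin (\<lambda>i w. w i) n w)"
  define sp where "sp = (\<lambda>w :: nat \<Rightarrow> real. \<lambda>i\<in>{1..<n}. spacing (\<lambda>i w. w i) i w)"
  have Xmin_m: "(\<lambda>w :: nat \<Rightarrow> real. Xmin (\<lambda>i w. w i) j w) \<in> borel_measurable ?A" if "j \<le> n" for j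
    unfolding Xmin_def using that by (intro borel_measurable_Min measurable_component_singleton) auto
  have xm: "xm \<in> borel_measurable ?A" unfolding xm_def by (rule Xmin_m) simp
  have sp: "sp \<in> ?A \<rightarrow>\<^sub>M ?V"
    unfolding sp_def spacing_def spacing_sum_def
    by (intro measurable_restrict borel_measurable_diff borel_measurable_sum measurable_component_singleton Xmin_m) auto
  have pm: "sample_prefix n \<in> M \<rightarrow>\<^sub>M ?A" unfolding sample_prefix_def[abs_def] by (intro measurable_restrict X_measurable) auto
  have sp_prefix: "sp (sample_prefix n \<omega>) = spacings n \<omega>" and xm_prefix: "xm (sample_prefix n \<omega>) = Xmin X n \<omega>" for \<omega>
    unfolding sp_def xm_def by (rule prefix_factor[symmetric])+
  have Hm: "(\<lambda>z. H (sp (fst z)) (xm (fst z)) (snd z)) \<in> borel_measurable (?A \<Otimes>\<^sub>M borel)"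
    unfolding H_def
    by (intro KK sf measurable_compose[OF measurable_fst sp] measurable_compose[OF measurable_fst xm] measurable_snd borel_measurable_min)
  have Hm2: "(\<lambda>z. H (fst (fst z)) (snd (fst z)) (snd z)) \<in> borel_measurable ((?V \<Otimes>\<^sub>M borel) \<Otimes>\<^sub>M borel)"
    unfolding H_def
    by (intro KK sf borel_measurable_min measurable_compose[OF measurable_fst measurable_fst] measurable_compose[OF measurable_fst measurable_snd] measurable_snd)
  define h where "h = (\<lambda>v m. \<integral>\<^sup>+x. H v m x \<partial>exp_law 1)"
  have hm: "(\<lambda>(v, m). h v m) \<in> borel_measurable (?V \<Otimes>\<^sub>M borel)"
  proof -
    have "(\<lambda>z. \<integral>\<^sup>+x. (\<lambda>z. H (fst (fst z)) (snd (fst z)) (snd z)) (z, x) \<partial>exp_law 1) \<in> borel_measurable (?V \<Otimes>\<^sub>M borel)"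
      by (rule E.borel_measurable_nn_integral_fst) (use Hm2 in \<open>simp cong: measurable_cong_sets\<close>)
    then show ?thesis by (simp add: h_def case_prod_beta)
  qed
  have "(\<integral>\<^sup>+\<omega>. K (spacings (Suc n) \<omega>) (Xmin X (Suc n) \<omega>) \<partial>M) = (\<integral>\<^sup>+\<omega>. H (sp (sample_prefix n \<omega>)) (xm (sample_prefix n \<omega>)) (X (Suc n) \<omega>) \<partial>M)"
    by (simp add: H_def sp_prefix xm_prefix spacings_Suc[OF n] Xmin_Suc[OF n] spacing_eq[OF n])
  also have "\<dots> = (\<integral>\<^sup>+z. H (sp (fst z)) (xm (fst z)) (snd z) \<partial>distr M (?A \<Otimes>\<^sub>M borel) (\<lambda>\<omega>. (sample_prefix n \<omega>, X (Suc n) \<omega>)))"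
    using Hm pm X_measurable[of "Suc n"] by (subst nn_integral_distr) auto
  also have "\<dots> = (\<integral>\<^sup>+w. (\<integral>\<^sup>+x. H (sp w) (xm w) x \<partial>exp_law 1) \<partial>distr M ?A (sample_prefix n))"
    unfolding indep_next[OF n] using Hm
    by (subst E.nn_integral_fst[symmetric]) (simp_all cong: measurable_cong_sets)
  also have "\<dots> = (\<integral>\<^sup>+w. h (sp w) (xm w) \<partial>distr M ?A (sample_prefix n))"
    by (simp add: h_def)
  also have "\<dots> = (\<integral>\<^sup>+\<omega>. h (sp (sample_prefix n \<omega>)) (xm (sample_prefix n \<omega>)) \<partial>M)"
    using measurable_compose[OF measurable_Pair[OF sp xm] hm] pm by (subst nn_integral_distr) simp_all
  also have "\<dots> = (\<integral>\<^sup>+\<omega>. h (spacings n \<omega>) (Xmin X n \<omega>) \<partial>M)"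
    by (simp add: sp_prefix xm_prefix)
  also have "\<dots> = (\<integral>\<^sup>+v. (\<integral>\<^sup>+m. h v m \<partial>exp_law (real n)) \<partial>spacings_law n)"
    by (rule step.IH[OF hm])
  also have "\<dots> = (\<integral>\<^sup>+v. (\<integral>\<^sup>+y. (\<integral>\<^sup>+d. K (v(n := d)) y \<partial>exp_law 1) \<partial>exp_law (real (Suc n))) \<partial>spacings_law n)"
  proof (rule nn_integral_cong)
    fix v assume "v \<in> space (spacings_law n)"
    then have v: "v \<in> space ?V" using sets_eq_imp_space_eq[OF sets_spacings_law[of n]] by simp
    have "(\<lambda>z. K (v(n := fst z)) (snd z)) \<in> borel_measurable (borel \<Otimes>\<^sub>M borel)"
      by (rule KK) (use v in auto)
    then have "(\<lambda>(d, y). K (v(n := d)) y) \<in> borel_measurable (borel \<Otimes>\<^sub>M borel)" by (simp add: case_prod_beta)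
    from min_spacing_transform[OF n this]
    show "(\<integral>\<^sup>+m. h v m \<partial>exp_law (real n)) = (\<integral>\<^sup>+y. (\<integral>\<^sup>+d. K (v(n := d)) y \<partial>exp_law 1) \<partial>exp_law (real (Suc n)))"
      by (simp add: h_def H_def)
  qed
  also have "\<dots> = (\<integral>\<^sup>+v. (\<integral>\<^sup>+d. (\<integral>\<^sup>+y. K (v(n := d)) y \<partial>exp_law (real (Suc n))) \<partial>exp_law 1) \<partial>spacings_law n)"
  proof (rule nn_integral_cong)
    fix v assume "v \<in> space (spacings_law n)"
    then have v: "v \<in> space ?V" using sets_eq_imp_space_eq[OF sets_spacings_law[of n]] by simp
    interpret PP: pair_sigma_finite "exp_law (real (Suc n))" "exp_law 1" ..
    have "(\<lambda>z. K (v(n := snd z)) (fst z)) \<in> borel_measurable (borel \<Otimes>\<^sub>M borel)"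
      by (rule KK) (use v in auto)
    then have "(\<lambda>(y, d). K (v(n := d)) y) \<in> borel_measurable (exp_law (real (Suc n)) \<Otimes>\<^sub>M exp_law 1)"
      by (simp add: case_prod_beta cong: measurable_cong_sets)
    then show "(\<integral>\<^sup>+y. (\<integral>\<^sup>+d. K (v(n := d)) y \<partial>exp_law 1) \<partial>exp_law (real (Suc n))) = (\<integral>\<^sup>+d. (\<integral>\<^sup>+y. K (v(n := d)) y \<partial>exp_law (real (Suc n))) \<partial>exp_law 1)"
      by (rule PP.Fubini'[symmetric])
  qed
  also have "\<dots> = (\<integral>\<^sup>+v. (\<integral>\<^sup>+y. K v y \<partial>exp_law (real (Suc n))) \<partial>spacings_law (Suc n))"
  proof -
    have "(\<lambda>v. \<integral>\<^sup>+y. K v y \<partial>exp_law (real (Suc n))) \<in> borel_measurable ?V'"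
      using En'.borel_measurable_nn_integral_fst[of "\<lambda>(v, y). K v y" ?V'] K by (simp cong: measurable_cong_sets)
    then have "(\<lambda>v. \<integral>\<^sup>+y. K v y \<partial>exp_law (real (Suc n))) \<in> borel_measurable (Pi\<^sub>M (insert n {1..<n}) (\<lambda>_. exp_law 1))"
      unfolding set[symmetric] using sets_spacings_law[of "Suc n"] by (simp add: spacings_law_def cong: measurable_cong_sets)
    from P.product_nn_integral_insert[OF _ _ this] show ?thesis
      unfolding spacings_law_def set by simp
  qed
  finally show ?case .
qed

lemma distr_spacings:
  assumes n: "n \<ge> 1"
  shows "distr M (PiM {1..<n} (\<lambda>_. borel)) (spacings n) = spacings_law n"
proof (rule measure_eqI)
  show "sets (distr M (PiM {1..<n} (\<lambda>_. borel)) (spacings n)) = sets (spacings_law n)"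
    by (simp add: sets_spacings_law)
  fix A assume "A \<in> sets (distr M (PiM {1..<n} (\<lambda>_. borel)) (spacings n))"
  then have A: "A \<in> sets (PiM {1..<n} (\<lambda>_. borel :: real measure))" by simp
  interpret En: prob_space "exp_law (real n)" by (rule prob_space_exponential_density) (use n in simp)
  have "emeasure (distr M (PiM {1..<n} (\<lambda>_. borel)) (spacings n)) A = (\<integral>\<^sup>+\<omega>. indicator A (spacings n \<omega>) \<partial>M)"
  proof -
    have "emeasure (distr M (PiM {1..<n} (\<lambda>_. borel)) (spacings n)) A = (\<integral>\<^sup>+v. indicator A v \<partial>distr M (PiM {1..<n} (\<lambda>_. borel)) (spacings n))"
      using A by simp
    then show ?thesis using A spacings_measurable[of n] by (subst (asm) nn_integral_distr) auto
  qed
  also have "\<dots> = (\<integral>\<^sup>+v. (\<integral>\<^sup>+y. indicator A v \<partial>exp_law (real n)) \<partial>spacings_law n)"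
    using A by (intro nn_integral_spacings_Xmin[OF n]) (simp add: case_prod_beta measurable_compose[OF measurable_fst])
  also have "\<dots> = (\<integral>\<^sup>+v. indicator A v \<partial>spacings_law n)"
    using En.emeasure_space_1 by simp
  also have "\<dots> = emeasure (spacings_law n) A"
    using A by (simp add: sets_spacings_law)
  finally show "emeasure (distr M (PiM {1..<n} (\<lambda>_. borel)) (spacings n)) A = emeasure (spacings_law n) A" .
qed

lemma spacing_law:
  assumes i: "i \<ge> 1"
  shows "distr M borel (spacing X i) = exp_law 1"
proof -
  interpret E: prob_space "exp_law 1" by (rule prob_space_exponential_density) simp
  interpret P: product_prob_space "\<lambda>_::nat. exp_law 1" "{1..<Suc i}" ..
  have c: "(\<lambda>v. v i) \<in> PiM {1..<Suc i} (\<lambda>_. borel) \<rightarrow>\<^sub>M borel"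
    using i by (intro measurable_component_singleton) simp
  have "distr M borel (spacing X i) = distr (distr M (PiM {1..<Suc i} (\<lambda>_. borel)) (spacings (Suc i))) borel (\<lambda>v. v i)"
    using i by (subst distr_distr[OF c spacings_measurable]) (simp add: comp_def spacings_def)
  also have "\<dots> = distr (PiM {1..<Suc i} (\<lambda>_. exp_law 1)) (exp_law 1) (\<lambda>v. v i)"
    using distr_spacings[of "Suc i"] i by (simp add: spacings_law_def cong: distr_cong)
  also have "\<dots> = exp_law 1" using i by (intro P.PiM_component) simp
  finally show ?thesis .
qed

lemma distributed_spacing:
  assumes "i \<ge> 1"
  shows "distributed M lborel (spacing X i) (exponential_density 1)"
  unfolding distributed_def using spacing_law[OF assms] spacing_measurable[of i]
  by (simp cong: distr_cong)

text \<open>Independence concerns finite subfamilies only, and each of them lies in an initial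
  segment, where \<open>distr_spacings\<close> gives a product law.\<close>

lemma indep_spacing: "indep_vars (\<lambda>_. borel) (spacing X) {1..}"
proof -
  have fin: "indep_vars (\<lambda>_. borel) (spacing X) {1..<n}" if n: "n \<ge> 2" for n
  proof -
    have "{1..<n} \<noteq> {}" using n by auto
    from indep_vars_iff_distr_eq_PiM'[OF this, where M'="\<lambda>_. borel" and X="spacing X"]
    have "indep_vars (\<lambda>_. borel) (spacing X) {1..<n} \<longleftrightarrow> distr M (PiM {1..<n} (\<lambda>_. borel)) (spacings n) = PiM {1..<n} (\<lambda>i. distr M borel (spacing X i))"
      using spacing_measurable by (simp add: spacings_def[abs_def])
    moreover have "PiM {1..<n} (\<lambda>i. distr M borel (spacing X i)) = spacings_law n"
      unfolding spacings_law_def by (intro PiM_cong refl spacing_law) auto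
    ultimately show ?thesis using distr_spacings[of n] n by simp
  qed
  show ?thesis
    unfolding indep_vars_def2
  proof (intro conjI ballI)
    show "random_variable borel (spacing X i)" for i by (rule spacing_measurable)
    show "indep_sets (\<lambda>i. {spacing X i -` A \<inter> space M |A. A \<in> sets borel}) {1..}"
      unfolding indep_sets_finite_index_sets[of _ "{1..}"]
    proof (intro allI impI)
      fix J :: "nat set" assume J: "J \<subseteq> {1..}" "J \<noteq> {}" "finite J"
      have "J \<subseteq> {1..<Max J + 2}" using J Max_ge[OF J(3)] by (fastforce intro: le_imp_less_Suc)
      moreover have "indep_sets (\<lambda>i. {spacing X i -` A \<inter> space M |A. A \<in> sets borel}) {1..<Max J + 2}"
        using fin[of "Max J + 2"] unfolding indep_vars_def2 by simp
      ultimately show "indep_sets (\<lambda>i. {spacing X i -` A \<inter> space M |A. A \<in> sets borel}) J"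
        by (rule indep_sets_mono_index)
    qed
  qed
qed

text \<open>The form used at the stopping time: f will be the indicator that sampling stops at a
  given index, g a power of the minimum.\<close>

lemma nn_integral_spacings_mult_Xmin:
  assumes n: "n \<ge> 1" and f: "f \<in> borel_measurable (PiM {1..<n} (\<lambda>_. borel))" and g: "g \<in> borel_measurable borel"
  shows "(\<integral>\<^sup>+\<omega>. f (spacings n \<omega>) * g (Xmin X n \<omega>) \<partial>M) = (\<integral>\<^sup>+\<omega>. f (spacings n \<omega>) \<partial>M) * (\<integral>\<^sup>+y. g y \<partial>exp_law (real n))"
proof -
  have "(\<integral>\<^sup>+\<omega>. f (spacings n \<omega>) * g (Xmin X n \<omega>) \<partial>M) = (\<integral>\<^sup>+v. (\<integral>\<^sup>+y. f v * g y \<partial>exp_law (real n)) \<partial>spacings_law n)"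
    using f g by (intro nn_integral_spacings_Xmin[OF n])
      (simp add: case_prod_beta measurable_compose[OF measurable_fst] measurable_compose[OF measurable_snd])
  also have "\<dots> = (\<integral>\<^sup>+v. f v * (\<integral>\<^sup>+y. g y \<partial>exp_law (real n)) \<partial>spacings_law n)"
    using g by (simp add: nn_integral_cmult)
  also have "\<dots> = (\<integral>\<^sup>+v. f v \<partial>spacings_law n) * (\<integral>\<^sup>+y. g y \<partial>exp_law (real n))"
    using f by (intro nn_integral_multc) (simp cong: measurable_cong_sets add: sets_spacings_law)
  also have "(\<integral>\<^sup>+v. f v \<partial>spacings_law n) = (\<integral>\<^sup>+\<omega>. f (spacings n \<omega>) \<partial>M)"
    unfolding distr_spacings[OF n, symmetric] using f spacings_measurable[of n] by (subst nn_integral_distr) auto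
  finally show ?thesis .
qed

lemma AE_Xmin_nonneg: "AE \<omega> in M. \<forall>n\<ge>1. Xmin X n \<omega> \<ge> 0"
proof -
  have "AE \<omega> in M. \<forall>i. i \<ge> 1 \<longrightarrow> X i \<omega> \<ge> 0"
    unfolding AE_all_countable
  proof
    fix i
    show "AE \<omega> in M. i \<ge> 1 \<longrightarrow> X i \<omega> \<ge> 0"
    proof (cases "i \<ge> 1")
      case True
      have "AE \<omega> in M. X i \<omega> \<ge> 0"
        by (subst distributed_AE2[OF distributed_X[OF True]]) (auto simp: exponential_density_def)
      then show ?thesis by eventually_elim simp
    qed simp
  qed
  then show ?thesis by eventually_elim (auto simp: Xmin_def)
qed

lemma nn_integral_exp_law_power:
  assumes "n \<ge> 1"
  shows "(\<integral>\<^sup>+y. ennreal (y ^ p) \<partial>exp_law (real n)) = ennreal (fact p / real n ^ p)"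
proof -
  have "(\<integral>\<^sup>+y. ennreal (y ^ p) \<partial>exp_law (real n)) = (\<integral>\<^sup>+y. ennreal (exponential_density (real n) y * y ^ p) \<partial>lborel)"
  proof (subst nn_integral_exp_law)
    show "(\<integral>\<^sup>+y. ennreal (exponential_density (real n) y) * ennreal (y ^ p) \<partial>lborel) = (\<integral>\<^sup>+y. ennreal (exponential_density (real n) y * y ^ p) \<partial>lborel)"
      by (intro nn_integral_cong) (auto simp: exponential_density_def simp flip: ennreal_mult'')
  qed auto
  also have "\<dots> = ennreal (fact p / real n ^ p)"
    using nn_integral_erlang_ith_moment[of "real n" 0 p] assms by simp
  finally show ?thesis .
qed

end

section \<open>Sample size and stopped minimum\<close>

text \<open>\<open>floor_strict u + 1\<close> is the ceiling of u; this is the final sample size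
  when sampling by blocks ends with j k + 1 observations.\<close>

definition sample_size :: "real \<Rightarrow> nat \<Rightarrow> nat \<Rightarrow> nat" where
  "sample_size \<rho> k j = nat \<lceil>(real (j * k) + 1) / \<rho>\<rceil>"

lemma sample_size_bounds:
  assumes "0 < \<rho>"
  shows "(real (j * k) + 1) / \<rho> \<le> real (sample_size \<rho> k j)" "real (sample_size \<rho> k j) \<le> (real (j * k) + 1) / \<rho> + 1"
    "sample_size \<rho> k j \<ge> 1"
proof -
  have pos: "(real (j * k) + 1) / \<rho> > 0" using assms by (simp add: add_nonneg_pos)
  then have "real (sample_size \<rho> k j) = real_of_int \<lceil>(real (j * k) + 1) / \<rho>\<rceil>"
    unfolding sample_size_def by (intro of_nat_nat) linarith
  then show 1: "(real (j * k) + 1) / \<rho> \<le> real (sample_size \<rho> k j)" "real (sample_size \<rho> k j) \<le> (real (j * k) + 1) / \<rho> + 1"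
    by linarith+
  then have "real (sample_size \<rho> k j) > 0" using pos by linarith
  then show "sample_size \<rho> k j \<ge> 1" by simp
qed

text \<open>Stopping is decided by the first j k spacings. They are among those independent of the
  minimum of the final sample, because that sample has at least j k + 1 members.\<close>

lemma sample_size_gt:
  assumes "0 < \<rho>" "\<rho> < 1"
  shows "j * k + 1 \<le> sample_size \<rho> k j"
proof -
  have "real (j * k) + 1 \<le> (real (j * k) + 1) / \<rho>"
    using assms mult_left_mono[of \<rho> 1 "real (j * k) + 1"] by (subst pos_le_divide_eq) auto
  then have "real (j * k) + 1 \<le> real (sample_size \<rho> k j)"
    using sample_size_bounds(1)[OF assms(1), of j k] by linarith
  then have "real (j * k + 1) \<le> real (sample_size \<rho> k j)" by simp
  then show ?thesis by (simp only: of_nat_le_iff)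
qed

context erlang_walk
begin

lemma expectation_indicator:
  assumes "A \<in> sets M"
  shows "integrable M (indicator A :: 'a \<Rightarrow> real)" "expectation (indicator A) = prob A"
  using assms by (auto simp: emeasure_eq_measure intro!: integrable_real_indicator)

text \<open>A sandwich. Outside the event A the rule has stopped by the upper edge of the window,
  outside B it has not stopped before the lower edge, and the ratio then lies near 1. On B the crude
  bound (c / \<rho>)^2 is affordable because c^2 times \<open>early\<close> vanishes, which limits p
  to 2.\<close>

lemma inverse_moment_limit:
  assumes c: "filterlim c at_top F" and m0: "eventually (\<lambda>s. m0 s \<le> window_lo k (c s)) F"
    and small: "((\<lambda>s. (c s) ^ 3 * exp (- real (m0 s * k) / 32)) \<longlongrightarrow> 0) F"
    and \<rho>: "0 < \<rho>" "\<rho> < 1" and p: "p \<le> 2"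
  shows "((\<lambda>s. expectation (\<lambda>\<omega>. (c s / \<rho> / real (sample_size \<rho> k (m0 s + tau (m0 s) (c s) \<omega>))) ^ p)) \<longlongrightarrow> 1) F"
proof -
  define \<alpha> where "\<alpha> = (\<lambda>c::real. c / (c + c powr (3/5) + 2))"
  define \<beta> where "\<beta> = (\<lambda>c::real. c / (c - c powr (3/5)))"
  define g where "g = (\<lambda>s \<omega>. (c s / \<rho> / real (sample_size \<rho> k (m0 s + tau (m0 s) (c s) \<omega>))) ^ p)"
  note at = eventually_compose_filterlim[OF _ c]
  have ear: "((\<lambda>s. (c s)\<^sup>2 * early (m0 s) (c s)) \<longlongrightarrow> 0) F"
    by (rule expectation_tau_limit(2)[OF c m0 small])
  have late: "((\<lambda>c. pos_prob c (window_hi k c)) \<longlongrightarrow> 0) at_top"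
  proof (rule tendsto_sandwich)
    show "eventually (\<lambda>c. pos_prob c (window_hi k c) \<le> (\<Sum>i. pos_prob c (window_hi k c + i))) at_top"
      using late_sum_limit(1)
    proof eventually_elim
      case (elim c)
      then show ?case using sum_le_suminf[OF elim, of "{0}"] by (simp add: pos_prob_nonneg)
    qed
    show "eventually (\<lambda>c. 0 \<le> pos_prob c (window_hi k c)) at_top" by (simp add: pos_prob_nonneg)
  qed (rule tendsto_const, rule late_sum_limit(2))
  have bounds: "eventually (\<lambda>s. \<alpha> (c s) ^ p * (1 - pos_prob (c s) (window_hi k (c s))) \<le> expectation (g s) \<and>
      expectation (g s) \<le> \<beta> (c s) ^ p + (1 / \<rho>\<^sup>2) * ((c s)\<^sup>2 * early (m0 s) (c s))) F"
    using at[OF late_sum_limit(1)] m0 at[OF eventually_window[OF k_ge_1]]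
  proof eventually_elim
    case (elim s)
    define C where "C = c s"
    define m where "m = m0 s"
    define lo where "lo = window_lo k C"
    define hi where "hi = window_hi k C"
    define J where "J = (\<lambda>\<omega>. m + tau m C \<omega>)"
    have C: "C \<ge> 100" "C powr (3/5) \<le> C / 4" using elim(3) by (auto simp: C_def)
    have ex: "AE \<omega> in M. \<exists>n. dev C (m + n) \<omega> \<le> 0"
      by (rule AE_tau_exists) (use elim in \<open>simp add: C_def\<close>)
    have mlo: "m \<le> lo" "lo \<le> hi" using elim by (auto simp: m_def lo_def hi_def C_def)
    have g_eq: "g s \<omega> = (C / \<rho> / real (sample_size \<rho> k (J \<omega>))) ^ p" for \<omega>
      by (simp add: g_def C_def m_def J_def)
    have J_meas: "J \<in> M \<rightarrow>\<^sub>M count_space UNIV" unfolding J_def by measurable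
    have g_meas: "g s \<in> borel_measurable M"
      unfolding g_eq[abs_def] by (rule measurable_compose[OF J_meas]) simp
    have N1: "real (sample_size \<rho> k (J \<omega>)) \<ge> 1" for \<omega> using sample_size_bounds(3)[OF \<rho>(1), of k "J \<omega>"] by simp
    have q0: "0 \<le> C / \<rho> / real (sample_size \<rho> k (J \<omega>))" for \<omega> using C \<rho> by simp
    have g0: "0 \<le> g s \<omega>" for \<omega> unfolding g_eq using q0 by simp
    have Crho: "1 \<le> C / \<rho>" using C \<rho> by (simp add: field_simps)
    have g_le: "g s \<omega> \<le> (C / \<rho>)\<^sup>2" for \<omega>
    proof -
      have "C / \<rho> / real (sample_size \<rho> k (J \<omega>)) \<le> C / \<rho> / 1" using C \<rho> N1[of \<omega>] by (intro divide_left_mono) auto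
      then have "g s \<omega> \<le> (C / \<rho>) ^ p" unfolding g_eq using q0[of \<omega>] by (intro power_mono) auto
      also have "\<dots> \<le> (C / \<rho>)\<^sup>2" using Crho p by (intro power_increasing)
      finally show ?thesis .
    qed
    have g_int: "integrable M (g s)"
      by (rule Bochner_Integration.integrable_bound[of M "\<lambda>_. (C / \<rho>)\<^sup>2"]) (use g_meas g0 g_le in auto)
    define A where "A = {\<omega>\<in>space M. dev C hi \<omega> > 0}"
    define B where "B = {\<omega>\<in>space M. \<exists>i\<in>{m..<lo}. dev C i \<omega> \<le> 0}"
    have [measurable]: "A \<in> sets M" "B \<in> sets M" unfolding A_def B_def by measurable
    have hi_le: "real (hi * k) \<le> C + C powr (3/5)" using elim(3) unfolding hi_def C_def by blast
    have lo_ge: "C - C powr (3/5) \<le> real (lo * k)" using elim(3) unfolding lo_def C_def by blast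
    have lower: "AE \<omega> in M. \<alpha> C ^ p * (1 - indicator A \<omega>) \<le> g s \<omega>"
      using ex AE_space
    proof eventually_elim
      case (elim \<omega>)
      show ?case
      proof (cases "\<omega> \<in> A")
        case True then show ?thesis using g0 by simp
      next
        case False
        then have "\<not> hi - m < tau m C \<omega>"
          using less_tau_iff[OF elim(1), of "hi - m"] elim(2) mlo by (auto simp: A_def)
        then have "J \<omega> \<le> hi" using mlo by (simp add: J_def)
        then have "real (J \<omega> * k) \<le> real (hi * k)" by (simp add: mult_right_mono)
        then have "(real (J \<omega> * k) + 1) / \<rho> + 1 \<le> (C + C powr (3/5) + 1) / \<rho> + 1"
          using hi_le \<rho> by (intro add_right_mono divide_right_mono) auto
        also have "\<dots> \<le> (C + C powr (3/5) + 2) / \<rho>" using \<rho> by (simp add: field_simps)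
        finally have "real (sample_size \<rho> k (J \<omega>)) \<le> (C + C powr (3/5) + 2) / \<rho>"
          using sample_size_bounds(2)[OF \<rho>(1), of k "J \<omega>"] by linarith
        then have "(C / \<rho>) / ((C + C powr (3/5) + 2) / \<rho>) \<le> C / \<rho> / real (sample_size \<rho> k (J \<omega>))"
          using C \<rho> N1[of \<omega>] by (intro divide_left_mono) (auto intro!: mult_pos_pos divide_pos_pos add_pos_nonneg)
        then have "\<alpha> C \<le> C / \<rho> / real (sample_size \<rho> k (J \<omega>))" using \<rho> by (simp add: \<alpha>_def)
        moreover have "0 \<le> \<alpha> C" using C by (simp add: \<alpha>_def)
        ultimately have "\<alpha> C ^ p \<le> g s \<omega>" unfolding g_eq by (intro power_mono) auto
        then show ?thesis using False by simp
      qed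
    qed
    have upper: "AE \<omega> in M. g s \<omega> \<le> \<beta> C ^ p + (C / \<rho>)\<^sup>2 * indicator B \<omega>"
      using ex AE_space
    proof eventually_elim
      case (elim \<omega>)
      have b0: "0 < C - C powr (3/5)" using C by linarith
      then have \<beta>0: "0 \<le> \<beta> C" using C by (simp add: \<beta>_def)
      show ?case
      proof (cases "\<omega> \<in> B")
        case True then show ?thesis using g_le[of \<omega>] \<beta>0 by (simp add: add_increasing)
      next
        case False
        have "lo \<le> J \<omega>"
        proof (rule ccontr)
          assume "\<not> lo \<le> J \<omega>"
          moreover have "dev C (J \<omega>) \<omega> \<le> 0"
            unfolding J_def tau_def using elim(1) by (rule LeastI_ex)
          ultimately show False using False elim(2) by (auto simp: B_def J_def)
        qed
        then have "real (lo * k) \<le> real (J \<omega> * k)" by (simp add: mult_right_mono)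
        then have "(C - C powr (3/5)) / \<rho> \<le> (real (J \<omega> * k) + 1) / \<rho>"
          using lo_ge \<rho> by (intro divide_right_mono) auto
        then have "(C - C powr (3/5)) / \<rho> \<le> real (sample_size \<rho> k (J \<omega>))"
          using sample_size_bounds(1)[OF \<rho>(1), where j="J \<omega>" and k=k] by linarith
        then have "C / \<rho> / real (sample_size \<rho> k (J \<omega>)) \<le> (C / \<rho>) / ((C - C powr (3/5)) / \<rho>)"
          using C \<rho> b0 N1[of \<omega>] by (intro divide_left_mono) auto
        then have "C / \<rho> / real (sample_size \<rho> k (J \<omega>)) \<le> \<beta> C" using \<rho> by (simp add: \<beta>_def)
        then have "g s \<omega> \<le> \<beta> C ^ p" unfolding g_eq using q0 by (intro power_mono) auto
        then show ?thesis using False by simp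
      qed
    qed
    have "\<alpha> C ^ p * (1 - prob A) = expectation (\<lambda>\<omega>. \<alpha> C ^ p * (1 - indicator A \<omega>))"
      using expectation_indicator[of A] by (simp add: prob_space)
    also have "\<dots> \<le> expectation (g s)"
      using lower by (intro integral_mono_AE g_int) (use expectation_indicator[of A] in auto)
    finally have 1: "\<alpha> C ^ p * (1 - prob A) \<le> expectation (g s)" .
    have "expectation (g s) \<le> expectation (\<lambda>\<omega>. \<beta> C ^ p + (C / \<rho>)\<^sup>2 * indicator B \<omega>)"
      using upper by (intro integral_mono_AE g_int) (use expectation_indicator[of B] in auto)
    also have "\<dots> = \<beta> C ^ p + (C / \<rho>)\<^sup>2 * prob B"
      using expectation_indicator[of B] by (simp add: prob_space)
    finally have 2: "expectation (g s) \<le> \<beta> C ^ p + (C / \<rho>)\<^sup>2 * prob B" .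
    have "prob A = pos_prob C hi" "prob B = early m C" by (simp_all add: A_def B_def pos_prob_def early_def lo_def)
    then show ?case using 1 2 by (simp add: C_def m_def hi_def power_divide)
  qed
  have "(\<alpha> \<longlongrightarrow> 1) at_top" unfolding \<alpha>_def by real_asymp
  then have a: "((\<lambda>s. \<alpha> (c s)) \<longlongrightarrow> 1) F" by (rule filterlim_compose[OF _ c])
  have "(\<beta> \<longlongrightarrow> 1) at_top" unfolding \<beta>_def by real_asymp
  then have b: "((\<lambda>s. \<beta> (c s)) \<longlongrightarrow> 1) F" by (rule filterlim_compose[OF _ c])
  have "((\<lambda>s. \<alpha> (c s) ^ p * (1 - pos_prob (c s) (window_hi k (c s)))) \<longlongrightarrow> 1 ^ p * (1 - 0)) F"
    by (intro tendsto_intros a filterlim_compose[OF late c])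
  moreover have "((\<lambda>s. \<beta> (c s) ^ p + (1 / \<rho>\<^sup>2) * ((c s)\<^sup>2 * early (m0 s) (c s))) \<longlongrightarrow> 1 ^ p + (1 / \<rho>\<^sup>2) * 0) F"
    by (intro tendsto_add tendsto_mult tendsto_power b ear tendsto_const)
  ultimately have "((\<lambda>s. expectation (g s)) \<longlongrightarrow> 1) F"
    using tendsto_sandwich[OF eventually_mono[OF bounds conjunct1] eventually_mono[OF bounds conjunct2]] by simp
  then show ?thesis by (simp add: g_def[abs_def])
qed

end

text \<open>A chi-square variable with 2 j degrees of freedom is twice a Gamma variable of shape
  j.\<close>

lemma chisq_pos_part_mean_even:
  assumes "j \<ge> 1"
  shows "chisq_pos_part_mean (2 * j) (2 * a) = 2 * (\<integral>x. max 0 (x - a) * erlang_density (j - 1) 1 x \<partial>lborel)"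
proof -
  have "chisq_pos_part_mean (2 * j) (2 * a) = 2 * (\<integral>x. max 0 (2 * x - 2 * a) * chisq_density (2 * j) (2 * x) \<partial>lborel)"
    unfolding chisq_pos_part_mean_def by (subst lborel_integral_real_affine[where c=2 and t=0]) auto
  also have "(\<integral>x. max 0 (2 * x - 2 * a) * chisq_density (2 * j) (2 * x) \<partial>lborel) = (\<integral>x. max 0 (x - a) * erlang_density (j - 1) 1 x \<partial>lborel)"
  proof (rule integral_cong_AE)
    have "AE x in lborel. x \<noteq> (0::real)" by (rule AE_lborel_singleton)
    then show "AE x in lborel. max 0 (2 * x - 2 * a) * chisq_density (2 * j) (2 * x) = max 0 (x - a) * erlang_density (j - 1) 1 x"
    proof eventually_elim
      case (elim x)
      show ?case
      proof (cases "x > 0")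
        case True
        have j: "real j - 1 = real (j - 1)" using assms by (simp add: of_nat_diff)
        have G: "Gamma (real j) = fact (j - 1)"
          using Gamma_fact[of "j - 1", where 'a=real] assms by (simp add: of_nat_diff)
        have p2: "2 powr real j = 2 * 2 ^ (j - 1)"
          using assms by (simp add: powr_realpow power_eq_if)
        have "(2 * x) powr (real j - 1) = 2 ^ (j - 1) * x ^ (j - 1)"
          unfolding j using True by (simp add: powr_realpow power_mult_distrib)
        then have "chisq_density (2 * j) (2 * x) = erlang_density (j - 1) 1 x / 2"
          using True by (simp add: chisq_density_def erlang_density_def G p2)
        moreover have "max 0 (2 * x - 2 * a) = 2 * max 0 (x - a)" by (simp add: max_def)
        ultimately show ?thesis by simp
      next
        case False
        then show ?thesis using elim by (simp add: chisq_density_def erlang_density_def)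
      qed
    qed
  qed (unfold chisq_density_def, measurable)
  finally show ?thesis .
qed

text \<open>The factor 2 from the chi-square scaling cancels the prefactor 1/2; the truncation level
  4 k n becomes 2 k n, the drift of the local walk after n steps.\<close>

lemma (in erlang_walk) eta2_eq:
  "eta2 k = (real k - 1) / 2 - (\<Sum>l. excess (Suc l) / real (Suc l))"
proof -
  have t: "(1 / real (Suc l)) * chisq_pos_part_mean (2 * k * Suc l) (4 * real k * real (Suc l)) =
      2 * (real k * (excess (Suc l) / (real k * real (Suc l))))" for l
  proof -
    have "Suc l * k \<ge> 1" using k_ge_1 by simp
    note even = chisq_pos_part_mean_even[OF this, of "2 * real k * real (Suc l)"]
    have "chisq_pos_part_mean (2 * k * Suc l) (4 * real k * real (Suc l)) = chisq_pos_part_mean (2 * (Suc l * k)) (2 * (2 * real k * real (Suc l)))"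
      by (simp add: mult_ac)
    also note even
    also have "(\<integral>x. max 0 (x - 2 * real k * real (Suc l)) * erlang_density (Suc l * k - 1) 1 x \<partial>lborel) = excess (Suc l)"
      by (rule walk_pos_part_integral[symmetric]) simp
    finally show ?thesis using k_ge_1 by simp
  qed
  have s: "summable (\<lambda>l. real k * (excess (Suc l) / (real k * real (Suc l))))"
    by (rule summable_mult[OF excursion_series_limit(1)])
  have "(\<Sum>l. (1 / real (Suc l)) * chisq_pos_part_mean (2 * k * Suc l) (4 * real k * real (Suc l))) =
    2 * (\<Sum>l. real k * (excess (Suc l) / (real k * real (Suc l))))"
    unfolding t by (rule suminf_mult[OF s])
  also have "(\<Sum>l. real k * (excess (Suc l) / (real k * real (Suc l)))) =
     (\<Sum>l. excess (Suc l) / real (Suc l))"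
    using k_ge_1 by simp
  finally show ?thesis unfolding eta2_def by simp
qed

section \<open>Blocks of spacings as an Erlang walk, and moments of the stopped minimum\<close>

context exponential_sample
begin

definition blocks :: "nat \<Rightarrow> nat \<Rightarrow> 'a \<Rightarrow> real" where
  "blocks k j \<omega> = (\<Sum>i\<in>{j * k + 1..<Suc j * k + 1}. spacing X i \<omega>)"

lemma erlang_walk_blocks:
  assumes k: "k \<ge> 1"
  shows "erlang_walk M (blocks k) k"
proof
  show "k \<ge> 1" by fact
  define I where "I = (\<lambda>j. {j * k + 1..<Suc j * k + 1})"
  have disj: "I i \<inter> I j = {}" if "i < j" for i j
  proof -
    have "Suc i * k \<le> j * k" using that by (intro mult_le_mono1) simp
    then show ?thesis by (auto simp: I_def)
  qed
  have "indep_vars (\<lambda>j. PiM (I j) (\<lambda>_. borel)) (\<lambda>j \<omega>. restrict (\<lambda>i. spacing X i \<omega>) (I j)) UNIV"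
  proof (rule indep_vars_restrict[OF indep_spacing])
    show "disjoint_family_on I UNIV"
      unfolding disjoint_family_on_def using disj by (metis Int_commute linorder_neqE_nat)
  qed (auto simp: I_def)
  then have "indep_vars (\<lambda>_. borel) (\<lambda>j \<omega>. (\<lambda>w. \<Sum>i\<in>I j. w i) (restrict (\<lambda>i. spacing X i \<omega>) (I j))) UNIV"
    by (rule indep_vars_compose2) (intro borel_measurable_sum measurable_component_singleton)
  then show "indep_vars (\<lambda>_. borel) (blocks k) UNIV"
    by (simp add: blocks_def[abs_def] I_def)
  fix j
  have "distributed M lborel (\<lambda>\<omega>. \<Sum>i\<in>I j. spacing X i \<omega>) (erlang_density (card (I j) - 1) 1)"
    by (rule exponential_distributed_sum)
       (use k in \<open>auto simp: I_def intro!: distributed_spacing indep_vars_subset[OF indep_spacing]\<close>)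
  then show "distributed M lborel (blocks k j) (erlang_density (k - 1) 1)"
    by (simp add: blocks_def[abs_def] I_def)
qed

lemma sum_blocks:
  "(\<Sum>i<j. blocks k i \<omega>) = (\<Sum>i\<in>{1..<j * k + 1}. spacing X i \<omega>)"
proof (induction j)
  case (Suc j)
  have "(\<Sum>i\<in>{1..<Suc j * k + 1}. spacing X i \<omega>) = (\<Sum>i\<in>{1..<j * k + 1}. spacing X i \<omega>) + blocks k j \<omega>"
    unfolding blocks_def by (rule sum.atLeastLessThan_concat[symmetric]) auto
  then show ?case using Suc by simp
qed simp

context
  fixes k :: nat
  assumes k: "k \<ge> 1"
begin

interpretation W: erlang_walk M "blocks k" k
  by (rule erlang_walk_blocks[OF k])

lemma walk_eq_spacing_sum: "W.walk j \<omega> = spacing_sum X (j * k + 1) \<omega>"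
  unfolding W.walk_def sum_blocks by (rule sum_spacing) simp

text \<open>Decomposed by the value t of the stopping time. The event that it equals t is a
  function, \<open>f t\<close>, of the first (m0 + t) k spacings; by the hypothesis on L these are
  independent of the minimum of L t observations, which is exponential of rate L t with p-th moment
  p! / (L t)^p.\<close>

lemma nn_integral_stopped_min:
  assumes L: "\<And>t. (m0 + t) * k + 1 \<le> L t" and ex: "AE \<omega> in M. \<exists>n. W.dev c (m0 + n) \<omega> \<le> 0"
  shows "(\<integral>\<^sup>+\<omega>. ennreal (Xmin X (L (W.tau m0 c \<omega>)) \<omega> ^ p) \<partial>M) = (\<integral>\<^sup>+\<omega>. ennreal (fact p / real (L (W.tau m0 c \<omega>)) ^ p) \<partial>M)"
proof -
  have L1: "L t \<ge> 1" for t using L[of t] by simp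
  define D where "D = (\<lambda>v j. (\<Sum>i\<in>{1..<j * k + 1}. v i) - boundary k c j)"
  define f where "f = (\<lambda>t v. if (\<forall>i\<in>{..<t}. 0 < D v (m0 + i)) \<and> D v (m0 + t) \<le> 0 then 1 else 0 :: ennreal)"
  have D_eq: "D (spacings n \<omega>) j = W.dev c j \<omega>" if "j * k + 1 \<le> n" for n j \<omega>
  proof -
    have "(\<Sum>i\<in>{1..<j * k + 1}. spacings n \<omega> i) = (\<Sum>i\<in>{1..<j * k + 1}. spacing X i \<omega>)"
      using that by (intro sum.cong) (auto simp: spacings_def)
    then show ?thesis by (simp add: D_def W.dev_def W.walk_def sum_blocks)
  qed
  have le: "(m0 + i) * k + 1 \<le> L t" if "i \<le> t" for i t
  proof -
    have "(m0 + i) * k + 1 \<le> (m0 + t) * k + 1" using that by simp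
    then show ?thesis using L[of t] by linarith
  qed
  have Dm: "(\<lambda>v. D v (m0 + i)) \<in> borel_measurable (PiM {1..<L t} (\<lambda>_. borel))" if "i \<le> t" for i t
    unfolding D_def using le[OF that]
    by (intro borel_measurable_diff borel_measurable_sum measurable_component_singleton) auto
  have fm: "f t \<in> borel_measurable (PiM {1..<L t} (\<lambda>_. borel))" for t
  proof -
    have "Measurable.pred (PiM {1..<L t} (\<lambda>_. borel :: real measure)) (\<lambda>v. (\<forall>i\<in>{..<t}. 0 < D v (m0 + i)) \<and> D v (m0 + t) \<le> 0)"
    proof (rule pred_intros_logic(3)[OF pred_intros_finite(3)])
      fix i assume "i \<in> {..<t}"
      then have [measurable]: "(\<lambda>v. D v (m0 + i)) \<in> borel_measurable (PiM {1..<L t} (\<lambda>_. borel))" by (intro Dm) simp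
      show "Measurable.pred (PiM {1..<L t} (\<lambda>_. borel :: real measure)) (\<lambda>v. 0 < D v (m0 + i))" by measurable
    next
      have [measurable]: "(\<lambda>v. D v (m0 + t)) \<in> borel_measurable (PiM {1..<L t} (\<lambda>_. borel))" by (intro Dm) simp
      show "Measurable.pred (PiM {1..<L t} (\<lambda>_. borel :: real measure)) (\<lambda>v. D v (m0 + t) \<le> 0)" by measurable
    qed simp
    then show ?thesis unfolding f_def pred_def by (intro measurable_If) auto
  qed
  \<comment> \<open>Only almost everywhere: where no crossing occurs \<open>tau\<close> is an
    arbitrary number, while \<open>f t\<close> vanishes for all t.\<close>
  have f_eq: "AE \<omega> in M. \<forall>t. f t (spacings (L t) \<omega>) = indicator {t} (W.tau m0 c \<omega>)"
    using ex
  proof eventually_elim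
    case (elim \<omega>)
    show ?case
    proof
      fix t
      have "f t (spacings (L t) \<omega>) = of_bool ((\<forall>i<t. 0 < W.dev c (m0 + i) \<omega>) \<and> W.dev c (m0 + t) \<omega> \<le> 0)"
      proof -
        have "D (spacings (L t) \<omega>) (m0 + i) = W.dev c (m0 + i) \<omega>" if "i \<le> t" for i
          by (rule D_eq[OF le[OF that]])
        then show ?thesis unfolding f_def by (auto simp: less_imp_le)
      qed
      also have "(\<forall>i<t. 0 < W.dev c (m0 + i) \<omega>) \<and> W.dev c (m0 + t) \<omega> \<le> 0 \<longleftrightarrow> W.tau m0 c \<omega> = t"
      proof
        assume t: "(\<forall>i<t. 0 < W.dev c (m0 + i) \<omega>) \<and> W.dev c (m0 + t) \<omega> \<le> 0"
        show "W.tau m0 c \<omega> = t"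
          unfolding W.tau_def
        proof (rule Least_equality)
          fix y assume "W.dev c (m0 + y) \<omega> \<le> 0"
          then show "t \<le> y" using t by (meson not_le)
        qed (use t in simp)
      next
        assume t: "W.tau m0 c \<omega> = t"
        have "W.dev c (m0 + t) \<omega> \<le> 0" unfolding t[symmetric] W.tau_def using elim by (rule LeastI_ex)
        moreover have "0 < W.dev c (m0 + i) \<omega>" if "i < t" for i
          using not_less_Least[of i "\<lambda>n. W.dev c (m0 + n) \<omega> \<le> 0"] that t unfolding W.tau_def by auto
        ultimately show "(\<forall>i<t. 0 < W.dev c (m0 + i) \<omega>) \<and> W.dev c (m0 + t) \<omega> \<le> 0" by simp
      qed
      finally show "f t (spacings (L t) \<omega>) = indicator {t} (W.tau m0 c \<omega>)" by (auto simp: indicator_def)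
    qed
  qed
  have single: "(\<Sum>t. indicator {t} i * h t) = h i" for i :: nat and h :: "nat \<Rightarrow> ennreal"
  proof -
    have "(\<Sum>t. indicator {t} i * h t) = (\<Sum>t\<in>{i}. indicator {t} i * h t)"
      by (rule suminf_finite) auto
    then show ?thesis by simp
  qed
  have fs_meas: "(\<lambda>\<omega>. f t (spacings (L t) \<omega>)) \<in> borel_measurable M" for t
    by (rule measurable_compose[OF spacings_measurable fm])
  have xp_meas: "(\<lambda>\<omega>. ennreal (Xmin X (L t) \<omega> ^ p)) \<in> borel_measurable M" for t
    by (rule measurable_compose[OF Xmin_measurable]) measurable
  have "(\<integral>\<^sup>+\<omega>. ennreal (Xmin X (L (W.tau m0 c \<omega>)) \<omega> ^ p) \<partial>M) = (\<integral>\<^sup>+\<omega>. (\<Sum>t. f t (spacings (L t) \<omega>) * ennreal (Xmin X (L t) \<omega> ^ p)) \<partial>M)"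
    using f_eq by (intro nn_integral_cong_AE) (auto elim!: eventually_mono simp only: single simp_thms)
  also have "\<dots> = (\<Sum>t. \<integral>\<^sup>+\<omega>. f t (spacings (L t) \<omega>) * ennreal (Xmin X (L t) \<omega> ^ p) \<partial>M)"
    by (intro nn_integral_suminf borel_measurable_times_ennreal fs_meas xp_meas)
  also have "\<dots> = (\<Sum>t. \<integral>\<^sup>+\<omega>. f t (spacings (L t) \<omega>) * ennreal (fact p / real (L t) ^ p) \<partial>M)"
  proof (rule suminf_cong)
    fix t
    have "(\<integral>\<^sup>+\<omega>. f t (spacings (L t) \<omega>) * ennreal (Xmin X (L t) \<omega> ^ p) \<partial>M) =
      (\<integral>\<^sup>+\<omega>. f t (spacings (L t) \<omega>) \<partial>M) * (\<integral>\<^sup>+y. ennreal (y ^ p) \<partial>exp_law (real (L t)))"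
      by (rule nn_integral_spacings_mult_Xmin[OF L1 fm, of "\<lambda>y. ennreal (y ^ p)"]) measurable
    also have "\<dots> = (\<integral>\<^sup>+\<omega>. f t (spacings (L t) \<omega>) * ennreal (fact p / real (L t) ^ p) \<partial>M)"
      unfolding nn_integral_exp_law_power[OF L1] by (rule nn_integral_multc[symmetric, OF fs_meas])
    finally show "(\<integral>\<^sup>+\<omega>. f t (spacings (L t) \<omega>) * ennreal (Xmin X (L t) \<omega> ^ p) \<partial>M) = (\<integral>\<^sup>+\<omega>. f t (spacings (L t) \<omega>) * ennreal (fact p / real (L t) ^ p) \<partial>M)" .
  qed
  also have "\<dots> = (\<integral>\<^sup>+\<omega>. (\<Sum>t. f t (spacings (L t) \<omega>) * ennreal (fact p / real (L t) ^ p)) \<partial>M)"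
    by (intro nn_integral_suminf[symmetric] borel_measurable_times_ennreal fs_meas measurable_const) simp
  also have "\<dots> = (\<integral>\<^sup>+\<omega>. ennreal (fact p / real (L (W.tau m0 c \<omega>)) ^ p) \<partial>M)"
    using f_eq by (intro nn_integral_cong_AE) (auto elim!: eventually_mono simp only: single simp_thms)
  finally show ?thesis .
qed

lemma stopped_min_moment:
  assumes L: "\<And>t. (m0 + t) * k + 1 \<le> L t" and ex: "AE \<omega> in M. \<exists>n. W.dev c (m0 + n) \<omega> \<le> 0"
  shows "integrable M (\<lambda>\<omega>. Xmin X (L (W.tau m0 c \<omega>)) \<omega> ^ p)"
    "expectation (\<lambda>\<omega>. Xmin X (L (W.tau m0 c \<omega>)) \<omega> ^ p) = expectation (\<lambda>\<omega>. fact p / real (L (W.tau m0 c \<omega>)) ^ p)"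
proof -
  have L1: "L t \<ge> 1" for t using L[of t] by simp
  have Lm: "(\<lambda>\<omega>. fact p / real (L (W.tau m0 c \<omega>)) ^ p) \<in> borel_measurable M"
    by (rule measurable_compose[OF W.tau_measurable]) simp
  have Li: "integrable M (\<lambda>\<omega>. fact p / real (L (W.tau m0 c \<omega>)) ^ p)"
  proof (rule Bochner_Integration.integrable_bound[of M "\<lambda>_. fact p :: real"])
    show "AE \<omega> in M. norm (fact p / real (L (W.tau m0 c \<omega>)) ^ p) \<le> norm (fact p :: real)"
    proof (rule AE_I2)
      fix \<omega>
      have "1 \<le> real (L (W.tau m0 c \<omega>)) ^ p" using L1[of "W.tau m0 c \<omega>"] by (intro one_le_power) simp
      then have "fact p / real (L (W.tau m0 c \<omega>)) ^ p \<le> fact p / 1" using L1[of "W.tau m0 c \<omega>"] by (intro divide_left_mono) auto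
      then show "norm (fact p / real (L (W.tau m0 c \<omega>)) ^ p) \<le> norm (fact p :: real)" by simp
    qed
  qed (use Lm in auto)
  have Xm: "(\<lambda>\<omega>. Xmin X (L (W.tau m0 c \<omega>)) \<omega> ^ p) \<in> borel_measurable M"
    by (rule measurable_compose_countable[OF _ W.tau_measurable]) (intro borel_measurable_power Xmin_measurable)
  have "has_bochner_integral M (\<lambda>\<omega>. Xmin X (L (W.tau m0 c \<omega>)) \<omega> ^ p) (expectation (\<lambda>\<omega>. fact p / real (L (W.tau m0 c \<omega>)) ^ p))"
  proof (rule has_bochner_integral_nn_integral[OF Xm])
    show "AE \<omega> in M. 0 \<le> Xmin X (L (W.tau m0 c \<omega>)) \<omega> ^ p"
      using AE_Xmin_nonneg by eventually_elim (use L1 in simp)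
    show "(\<integral>\<^sup>+\<omega>. ennreal (Xmin X (L (W.tau m0 c \<omega>)) \<omega> ^ p) \<partial>M) = ennreal (expectation (\<lambda>\<omega>. fact p / real (L (W.tau m0 c \<omega>)) ^ p))"
      unfolding nn_integral_stopped_min[OF L ex] by (rule nn_integral_eq_integral[OF Li]) simp
  qed simp
  then show "integrable M (\<lambda>\<omega>. Xmin X (L (W.tau m0 c \<omega>)) \<omega> ^ p)"
    "expectation (\<lambda>\<omega>. Xmin X (L (W.tau m0 c \<omega>)) \<omega> ^ p) = expectation (\<lambda>\<omega>. fact p / real (L (W.tau m0 c \<omega>)) ^ p)"
    by (auto simp: has_bochner_integral_iff)
qed

end

end

section \<open>The theorem\<close>

lemma exponential_sample_standardize:
  fixes M :: "'a measure" and Y :: "nat \<Rightarrow> 'a \<Rightarrow> real"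
  assumes "prob_space M" and \<sigma>: "\<sigma> > 0"
    and indep: "prob_space.indep_vars M (\<lambda>_. borel) Y {1..}"
    and distr: "\<And>i. i \<ge> 1 \<Longrightarrow> distributed M lborel (Y i) (\<lambda>y. ennreal (negexp_density \<mu> \<sigma> y))"
  shows "exponential_sample M (\<lambda>i \<omega>. (Y i \<omega> - \<mu>) / \<sigma>)"
proof -
  interpret prob_space M by fact
  show ?thesis
  proof
    show "indep_vars (\<lambda>_. borel) (\<lambda>i \<omega>. (Y i \<omega> - \<mu>) / \<sigma>) {1..}"
      using indep_vars_compose2[OF indep, of "\<lambda>_ y. (y - \<mu>) / \<sigma>" "\<lambda>_. borel"] by simp
    fix i :: nat assume i: "i \<ge> 1"
    have "distributed M lborel (\<lambda>\<omega>. - \<mu> / \<sigma> + 1 / \<sigma> * Y i \<omega>)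
        (\<lambda>x. ennreal (negexp_density \<mu> \<sigma> ((x - - \<mu> / \<sigma>) / (1 / \<sigma>))) / ennreal \<bar>1 / \<sigma>\<bar>)"
      using \<sigma> by (intro distributed_affine distr i) simp
    moreover have "(\<lambda>\<omega>. - \<mu> / \<sigma> + 1 / \<sigma> * Y i \<omega>) = (\<lambda>\<omega>. (Y i \<omega> - \<mu>) / \<sigma>)"
      by (simp add: diff_divide_distrib)
    ultimately have d: "distributed M lborel (\<lambda>\<omega>. (Y i \<omega> - \<mu>) / \<sigma>)
        (\<lambda>x. ennreal (negexp_density \<mu> \<sigma> ((x - - \<mu> / \<sigma>) / (1 / \<sigma>))) / ennreal \<bar>1 / \<sigma>\<bar>)"
      by simp
    have eq: "AE x in lborel. ennreal (negexp_density \<mu> \<sigma> ((x - - \<mu> / \<sigma>) / (1 / \<sigma>))) / ennreal \<bar>1 / \<sigma>\<bar> = ennreal (exponential_density 1 x)"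
    proof -
      \<comment> \<open>At x = 0 the densities differ: one is defined by y > \<mu>, the other is
        positive at its left end point.\<close>
      have "AE x in lborel. x \<noteq> (0::real)" by (rule AE_lborel_singleton)
      then show ?thesis
      proof eventually_elim
        case (elim x)
        have arg: "(x - - \<mu> / \<sigma>) / (1 / \<sigma>) = \<sigma> * x + \<mu>" using \<sigma> by (simp add: field_simps)
        have nn: "0 \<le> negexp_density \<mu> \<sigma> (\<sigma> * x + \<mu>)" using \<sigma> by (simp add: negexp_density_def)
        have "negexp_density \<mu> \<sigma> (\<sigma> * x + \<mu>) / (1 / \<sigma>) = exponential_density 1 x"
          using \<sigma> elim by (simp add: negexp_density_def exponential_density_def zero_less_mult_iff)
        then show ?case unfolding arg using \<sigma> nn by (simp add: divide_ennreal)
      qed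
    qed
    have m1: "(\<lambda>x. ennreal (negexp_density \<mu> \<sigma> ((x - - \<mu> / \<sigma>) / (1 / \<sigma>))) / ennreal \<bar>1 / \<sigma>\<bar>) \<in> borel_measurable lborel"
      unfolding negexp_density_def by measurable
    have m2: "(\<lambda>x. ennreal (exponential_density 1 x)) \<in> borel_measurable lborel" by measurable
    show "distributed M lborel (\<lambda>\<omega>. (Y i \<omega> - \<mu>) / \<sigma>) (\<lambda>x. ennreal (exponential_density 1 x))"
      by (rule distributed_cong_density[OF eq m2 m1, THEN iffD1, OF d])
  qed
qed

lemma Ymin_eq:
  assumes "\<sigma> > 0" "n \<ge> 1"
  shows "Ymin Y n \<omega> = \<mu> + \<sigma> * Xmin (\<lambda>i \<omega>. (Y i \<omega> - \<mu>) / \<sigma>) n \<omega>"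
proof -
  let ?S = "(\<lambda>i. (Y i \<omega> - \<mu>) / \<sigma>) ` {1..n}"
  have "mono (\<lambda>x. \<mu> + \<sigma> * x)" using assms by (intro monoI) simp
  then have "\<mu> + \<sigma> * Min ?S = Min ((\<lambda>x. \<mu> + \<sigma> * x) ` ?S)"
    using assms by (intro mono_Min_commute) auto
  also have "(\<lambda>x. \<mu> + \<sigma> * x) ` ?S = (\<lambda>i. Y i \<omega>) ` {1..n}"
    using assms by (simp add: image_image)
  finally show ?thesis by (simp add: Ymin_def Xmin_def)
qed

lemma Vn_eq:
  assumes "\<sigma> > 0" "n \<ge> 1"
  shows "Vn Y n \<omega> = \<sigma> * spacing_sum (\<lambda>i \<omega>. (Y i \<omega> - \<mu>) / \<sigma>) n \<omega> / (real n - 1)"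
proof -
  have "(\<Sum>i\<in>{1..n}. (Y i \<omega> - Ymin Y n \<omega>)) = \<sigma> * spacing_sum (\<lambda>i \<omega>. (Y i \<omega> - \<mu>) / \<sigma>) n \<omega>"
    unfolding Ymin_eq[OF assms, of Y \<omega> \<mu>] spacing_sum_def sum_distrib_left
    using assms by (intro sum.cong) (auto simp: field_simps)
  then show ?thesis by (simp add: Vn_def)
qed

theorem theorem4p1:
  fixes M :: "'a measure" and Y :: "nat \<Rightarrow> 'a \<Rightarrow> real"
    and \<mu> \<sigma> \<rho> r :: real and k :: nat
    and m0 :: "nat \<Rightarrow> nat" and b :: "nat \<Rightarrow> real"
  assumes "prob_space M"
    and "\<sigma> > 0"
    and "prob_space.indep_vars M (\<lambda>_. borel) Y {1..}"
    and "\<And>i. i \<ge> 1 \<Longrightarrow> distributed M lborel (Y i) (\<lambda>y. ennreal (negexp_density \<mu> \<sigma> y))"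
    and "k \<ge> 1" and "0 < \<rho>" and "\<rho> < 1" and "r > 1"
    and "\<And>j. m0 j \<ge> 1"
    and "filterlim m0 at_top sequentially"
    and "\<And>j. b j > 0"
    and "b \<in> O(\<lambda>j. real (m0 j * k + 1) powr (- r))"
    and "(\<lambda>j. \<sigma> / b j) \<in> O(\<lambda>j. real (m0 j * k + 1) powr r)"
    and "limsup (\<lambda>j. ereal (real (m0 j * k + 1) / (\<sigma> / b j))) < ereal \<rho>"
  shows
    "((\<lambda>j. prob_space.expectation M
         (\<lambda>\<omega>. real (stopN Y k \<rho> (b j) (m0 j * k + 1) \<omega>) / (\<sigma> / b j)))
       \<longlongrightarrow> 1) sequentially
     \<and> (\<exists>e1 e2 :: nat \<Rightarrow> real. (e1 \<longlongrightarrow> 0) sequentially \<and> (e2 \<longlongrightarrow> 0) sequentially \<and>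
         (\<forall>j. eta2 k / \<rho> + e1 j
                \<le> prob_space.expectation M
                     (\<lambda>\<omega>. real (stopN Y k \<rho> (b j) (m0 j * k + 1) \<omega>) - \<sigma> / b j)
              \<and> prob_space.expectation M
                     (\<lambda>\<omega>. real (stopN Y k \<rho> (b j) (m0 j * k + 1) \<omega>) - \<sigma> / b j)
                \<le> eta2 k / \<rho> + 1 + e2 j))
     \<and> (\<lambda>j. prob_space.variance M
            (\<lambda>\<omega>. Ymin Y (stopN Y k \<rho> (b j) (m0 j * k + 1) \<omega>) \<omega>) - (b j)\<^sup>2)
         \<in> o(\<lambda>j. (b j)\<^sup>2)"
proof -
  note \<sigma> = assms(2) and k = assms(5) and \<rho> = assms(6,7)
  interpret prob_space M by (rule assms(1))
  define X where "X = (\<lambda>i \<omega>. (Y i \<omega> - \<mu>) / \<sigma>)"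
  interpret X: exponential_sample M X
    unfolding X_def by (rule exponential_sample_standardize[OF assms(1-4)])
  interpret W: erlang_walk M "X.blocks k" k by (rule X.erlang_walk_blocks[OF k])
  define c where "c = (\<lambda>j. \<rho> * \<sigma> / b j)"
  define L where "L = (\<lambda>j t. sample_size \<rho> k (m0 j + t))"
  define N where "N = (\<lambda>j \<omega>. L j (W.tau (m0 j) (c j) \<omega>))"
  have c_pos: "c j > 0" for j using \<rho> \<sigma> assms(11)[of j] by (simp add: c_def)
  have c_eq: "\<sigma> / b j = c j / \<rho>" for j using \<rho> by (simp add: c_def)

  have stopT: "stopT Y k \<rho> (b j) (m0 j * k + 1) \<omega> = W.tau (m0 j) (c j) \<omega>" for j \<omega>
  proof -
    have "real (m0 j * k + 1 + k * n) \<ge> \<rho> * Vn Y (m0 j * k + 1 + k * n) \<omega> / b j \<longleftrightarrow> W.dev (c j) (m0 j + n) \<omega> \<le> 0" for n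
    proof -
      define i where "i = m0 j + n"
      define x where "x = real (i * k)"
      define S where "S = spacing_sum X (i * k + 1) \<omega>"
      have "i * k \<ge> 1" using assms(9)[of j] k by (simp add: i_def)
      then have x: "x \<ge> 1" unfolding x_def using of_nat_mono[of 1 "i * k", where 'a=real] by (simp only: of_nat_1)
      have size: "m0 j * k + 1 + k * n = i * k + 1" by (simp add: i_def algebra_simps)
      have V: "Vn Y (i * k + 1) \<omega> = \<sigma> * S / x"
        using Vn_eq[OF \<sigma>, of "i * k + 1" Y \<omega> \<mu>] by (simp add: S_def X_def x_def)
      have "\<rho> * Vn Y (i * k + 1) \<omega> / b j = c j * S / x" unfolding V by (simp add: c_def mult_ac)
      moreover have "real (i * k + 1) = x + 1" by (simp add: x_def)
      moreover have "W.dev (c j) i \<omega> = S - x * (x + 1) / c j"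
        by (simp add: W.dev_def X.walk_eq_spacing_sum[OF k] boundary_def S_def x_def)
      moreover have "c j * S / x \<le> x + 1 \<longleftrightarrow> S - x * (x + 1) / c j \<le> 0"
        using x c_pos[of j] by (simp add: field_simps)
      ultimately show ?thesis unfolding size i_def[symmetric] by (simp add: add.commute)
    qed
    then show ?thesis unfolding stopT_def W.tau_def by simp
  qed
  have stopN: "stopN Y k \<rho> (b j) (m0 j * k + 1) \<omega> = N j \<omega>" for j \<omega>
    unfolding stopN_def stopT N_def L_def sample_size_def floor_strict_def by (simp add: algebra_simps)
  have L_bounds: "(real ((m0 j + t) * k) + 1) / \<rho> \<le> real (L j t)" "real (L j t) \<le> (real ((m0 j + t) * k) + 1) / \<rho> + 1"
    "(m0 j + t) * k + 1 \<le> L j t" "L j t \<ge> 1" for j t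
    unfolding L_def by (rule sample_size_bounds[OF \<rho>(1)] sample_size_gt[OF \<rho>])+

  define m where "m = (\<lambda>j. real (m0 j * k + 1))"
  have m: "filterlim m at_top sequentially"
  proof (rule filterlim_at_top_mono)
    show "filterlim (\<lambda>j. real (m0 j)) at_top sequentially"
      using assms(10) filterlim_compose filterlim_real_sequentially by blast
    have "m0 j * 1 \<le> m0 j * k" for j using k by (intro mult_le_mono2)
    then have "m0 j \<le> m0 j * k + 1" for j by (simp add: le_SucI)
    then show "eventually (\<lambda>j. real (m0 j) \<le> m j) sequentially" unfolding m_def by (simp only: of_nat_le_iff eventually_True)
  qed
  have m1: "m j \<ge> 1" for j by (simp add: m_def)
  obtain C1 where C1: "C1 > 0" "eventually (\<lambda>j. b j \<le> C1 * m j powr (- r)) sequentially"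
  proof -
    from assms(12) obtain C where C: "C > 0" "eventually (\<lambda>j. norm (b j) \<le> C * norm (real (m0 j * k + 1) powr (- r))) sequentially"
      by (elim landau_o.bigE)
    from C(2) have "eventually (\<lambda>j. b j \<le> C * m j powr (- r)) sequentially"
      by eventually_elim (use assms(11) in \<open>simp add: m_def abs_of_pos\<close>)
    then show ?thesis using that C(1) by blast
  qed
  obtain C2 where C2: "C2 > 0" "eventually (\<lambda>j. c j \<le> C2 * m j powr r) sequentially"
  proof -
    from assms(13) obtain C where C: "C > 0" "eventually (\<lambda>j. norm (\<sigma> / b j) \<le> C * norm (real (m0 j * k + 1) powr r)) sequentially"
      by (elim landau_o.bigE)
    have "eventually (\<lambda>j. c j \<le> (\<rho> * C) * m j powr r) sequentially"
      using C(2)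
    proof eventually_elim
      case (elim j)
      have "\<sigma> / b j \<le> C * m j powr r" using elim \<sigma> assms(11)[of j] by (simp add: m_def)
      then have "\<rho> * (\<sigma> / b j) \<le> \<rho> * (C * m j powr r)" using \<rho> by (intro mult_left_mono) auto
      then show ?case by (simp add: c_def)
    qed
    then show ?thesis using that[of "\<rho> * C"] C \<rho> by simp
  qed
  \<comment> \<open>The bound on b becomes a lower bound on c. As r > 1, c outgrows m, which places
    the pilot index below the window.\<close>
  define A where "A = \<rho> * \<sigma> / C1"
  have A: "A > 0" using \<rho> \<sigma> C1 by (simp add: A_def)
  have c_lower: "eventually (\<lambda>j. A * m j powr r \<le> c j) sequentially"
    using C1(2)
  proof eventually_elim
    case (elim j)
    have "m j powr r * b j \<le> m j powr r * (C1 * m j powr (- r))" using elim by (intro mult_left_mono) auto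
    also have "\<dots> = C1" using m1[of j] by (simp add: powr_minus field_simps)
    finally have "m j powr r * b j \<le> C1" .
    then show ?case using C1(1) \<rho> \<sigma> assms(11)[of j]
      by (simp add: c_def A_def field_simps)
  qed
  have c_top: "filterlim c at_top sequentially"
  proof (rule filterlim_at_top_mono[OF _ c_lower])
    have "filterlim (\<lambda>x::real. A * x powr r) at_top at_top" using A assms(8) by real_asymp
    then show "filterlim (\<lambda>j. A * m j powr r) at_top sequentially" by (rule filterlim_compose[OF _ m])
  qed
  have pilot: "eventually (\<lambda>j. m0 j \<le> window_lo k (c j)) sequentially"
  proof -
    have "eventually (\<lambda>x::real. 2 * x \<le> A * x powr r) at_top" using A assms(8) by real_asymp
    then have "eventually (\<lambda>j. 2 * m j \<le> A * m j powr r) sequentially" by (rule eventually_compose_filterlim[OF _ m])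
    then show ?thesis
      using c_lower eventually_compose_filterlim[OF eventually_window[OF k] c_top]
    proof eventually_elim
      case (elim j)
      show ?case
      proof (rule ccontr)
        assume "\<not> m0 j \<le> window_lo k (c j)"
        then have "c j - c j powr (3/5) \<le> real (m0 j * k)" using elim(3) by simp
        moreover have "real (m0 j * k) < m j" by (simp add: m_def)
        moreover have "c j powr (3/5) \<le> c j / 4" "c j \<ge> 100" using elim(3) by auto
        ultimately show False using elim(1,2) by linarith
      qed
    qed
  qed
  \<comment> \<open>The upper bound on c makes it polynomial in m, while the other factor decays
    exponentially in m.\<close>
  have small: "((\<lambda>j. (c j) ^ 3 * exp (- real (m0 j * k) / 32)) \<longlongrightarrow> 0) sequentially"
  proof (rule Lim_null_comparison)
    show "eventually (\<lambda>j. norm ((c j) ^ 3 * exp (- real (m0 j * k) / 32)) \<le> (C2 * m j powr r) ^ 3 * exp (- (m j - 1) / 32)) sequentially"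
      using C2(2)
    proof eventually_elim
      case (elim j)
      have "(c j) ^ 3 \<le> (C2 * m j powr r) ^ 3" using elim c_pos[of j] by (intro power_mono) auto
      moreover have "real (m0 j * k) = m j - 1" by (simp add: m_def)
      ultimately show ?case using c_pos[of j] by (simp add: mult_right_mono)
    qed
    have "((\<lambda>x::real. (C2 * x powr r) ^ 3 * exp (- (x - 1) / 32)) \<longlongrightarrow> 0) at_top" using C2(1) assms(8) by real_asymp
    then show "((\<lambda>j. (C2 * m j powr r) ^ 3 * exp (- (m j - 1) / 32)) \<longlongrightarrow> 0) sequentially" by (rule filterlim_compose[OF _ m])
  qed

  define ET where "ET = (\<lambda>j. expectation (\<lambda>\<omega>. real (W.tau (m0 j) (c j) \<omega>)))"
  define e where "e = (\<lambda>j. (real k * (real (m0 j) + ET j) + 1 - c j - eta2 k) / \<rho>)"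
  define EN where "EN = (\<lambda>j. expectation (\<lambda>\<omega>. real (N j \<omega>)))"
  have e_lim: "(e \<longlongrightarrow> 0) sequentially"
  proof -
    have "((\<lambda>j. (real k * (real (m0 j) + ET j) - c j + (1 - eta2 k)) / \<rho>) \<longlongrightarrow> ((- 2 + (real k + 1) / 2 - (\<Sum>l. W.excess (Suc l) / real (Suc l))) + (1 - eta2 k)) / \<rho>) sequentially"
      unfolding ET_def
      by (rule tendsto_divide[OF tendsto_add[OF W.expectation_tau_limit(1)[OF c_top pilot small] tendsto_const] tendsto_const]) (use \<rho> in simp)
    \<comment> \<open>The 1 is the observation by which j k + 1 exceeds j k; - 2 + (k + 1) / 2 + 1 =
      (k - 1) / 2 is the constant term of \<open>eta2\<close>.\<close>
    moreover have "(- 2 + (real k + 1) / 2 - (\<Sum>l. W.excess (Suc l) / real (Suc l))) + (1 - eta2 k) = 0"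
      unfolding W.eta2_eq by (simp add: field_simps)
    moreover have "(\<lambda>j. (real k * (real (m0 j) + ET j) - c j + (1 - eta2 k)) / \<rho>) = e"
      by (simp add: e_def algebra_simps)
    ultimately show ?thesis by simp
  qed
  define good where "good = (\<lambda>j. summable (\<lambda>i. W.pos_prob (c j) (window_hi k (c j) + i)))"
  have good: "eventually good sequentially"
    unfolding good_def by (rule eventually_compose_filterlim[OF W.late_sum_limit(1) c_top])
  have N_int: "integrable M (\<lambda>\<omega>. real (N j \<omega>))" and EN_bounds: "eta2 k / \<rho> + e j \<le> EN j - \<sigma> / b j" "EN j - \<sigma> / b j \<le> eta2 k / \<rho> + 1 + e j" if g: "good j" for j
  proof -
    note tau = W.expectation_tau[OF g[unfolded good_def], of "m0 j"]
    \<comment> \<open>The sample size before rounding. N exceeds it by at most 1, hence one error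
      term e serves both bounds of (ii) and the gap between them is 1.\<close>
    define R where "R = (\<lambda>\<omega>. (real k * (real (m0 j) + real (W.tau (m0 j) (c j) \<omega>)) + 1) / \<rho>)"
    have R_int: "integrable M R" unfolding R_def using tau(1) by simp
    have R: "R \<omega> \<le> real (N j \<omega>)" "real (N j \<omega>) \<le> R \<omega> + 1" for \<omega>
      unfolding R_def N_def using L_bounds(1,2)[of j "W.tau (m0 j) (c j) \<omega>"] by (simp_all add: algebra_simps)
    have Nm: "(\<lambda>\<omega>. real (N j \<omega>)) \<in> borel_measurable M"
      unfolding N_def by (rule measurable_compose[OF W.tau_measurable]) simp
    show int: "integrable M (\<lambda>\<omega>. real (N j \<omega>))"
    proof (rule Bochner_Integration.integrable_bound[OF _ Nm])
      show "integrable M (\<lambda>\<omega>. R \<omega> + 1)" using R_int by simp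
      show "AE \<omega> in M. norm (real (N j \<omega>)) \<le> norm (R \<omega> + 1)"
        using R(2) by (intro AE_I2) (simp add: order_trans[OF _ abs_ge_self])
    qed
    have ER: "expectation R = (real k * (real (m0 j) + ET j) + 1) / \<rho>"
      unfolding R_def ET_def using tau(1) by (simp add: prob_space)
    have "expectation R \<le> EN j" unfolding EN_def using R(1) by (intro integral_mono R_int int)
    moreover have "EN j \<le> expectation (\<lambda>\<omega>. R \<omega> + 1)" unfolding EN_def using R_int R(2) by (intro integral_mono int) auto
    moreover have "expectation (\<lambda>\<omega>. R \<omega> + 1) = expectation R + 1" using R_int by (simp add: prob_space)
    moreover have "expectation R - \<sigma> / b j = eta2 k / \<rho> + e j"
      unfolding ER c_eq e_def by (simp add: diff_divide_distrib add_divide_distrib)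
    ultimately show "eta2 k / \<rho> + e j \<le> EN j - \<sigma> / b j" "EN j - \<sigma> / b j \<le> eta2 k / \<rho> + 1 + e j" by linarith+
  qed
  have diff_eq: "expectation (\<lambda>\<omega>. real (N j \<omega>) - \<sigma> / b j) = EN j - \<sigma> / b j" if "good j" for j
    using N_int[OF that] by (simp add: EN_def prob_space)

  have i: "((\<lambda>j. expectation (\<lambda>\<omega>. real (N j \<omega>) / (\<sigma> / b j))) \<longlongrightarrow> 1) sequentially"
  proof (rule tendsto_sandwich)
    have eq: "expectation (\<lambda>\<omega>. real (N j \<omega>) / (\<sigma> / b j)) = 1 + (EN j - \<sigma> / b j) * (\<rho> / c j)" for j
    proof -
      have "expectation (\<lambda>\<omega>. real (N j \<omega>) / (\<sigma> / b j)) = EN j / (\<sigma> / b j)" unfolding EN_def by (rule integral_divide_zero)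
      then show ?thesis unfolding c_eq using c_pos[of j] \<rho> by (simp add: field_simps)
    qed
    have rc: "0 \<le> \<rho> / c j" for j using c_pos[of j] \<rho> by simp
    show "eventually (\<lambda>j. 1 + (eta2 k / \<rho> + e j) * (\<rho> / c j) \<le> expectation (\<lambda>\<omega>. real (N j \<omega>) / (\<sigma> / b j))) sequentially"
      using good unfolding eq by eventually_elim (intro add_left_mono mult_right_mono EN_bounds rc)
    show "eventually (\<lambda>j. expectation (\<lambda>\<omega>. real (N j \<omega>) / (\<sigma> / b j)) \<le> 1 + (eta2 k / \<rho> + 1 + e j) * (\<rho> / c j)) sequentially"
      using good unfolding eq by eventually_elim (intro add_left_mono mult_right_mono EN_bounds rc)
    have z: "((\<lambda>j. \<rho> / c j) \<longlongrightarrow> 0) sequentially"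
      by (rule tendsto_divide_0[OF tendsto_const filterlim_at_top_imp_at_infinity[OF c_top]])
    have "((\<lambda>j. 1 + (eta2 k / \<rho> + e j) * (\<rho> / c j)) \<longlongrightarrow> 1 + (eta2 k / \<rho> + 0) * 0) sequentially"
      by (intro tendsto_intros e_lim z)
    then show "((\<lambda>j. 1 + (eta2 k / \<rho> + e j) * (\<rho> / c j)) \<longlongrightarrow> 1) sequentially" by simp
    have "((\<lambda>j. 1 + (eta2 k / \<rho> + 1 + e j) * (\<rho> / c j)) \<longlongrightarrow> 1 + (eta2 k / \<rho> + 1 + 0) * 0) sequentially"
      by (intro tendsto_intros e_lim z)
    then show "((\<lambda>j. 1 + (eta2 k / \<rho> + 1 + e j) * (\<rho> / c j)) \<longlongrightarrow> 1) sequentially" by simp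
  qed
  have ii: "\<exists>e1 e2 :: nat \<Rightarrow> real. (e1 \<longlongrightarrow> 0) sequentially \<and> (e2 \<longlongrightarrow> 0) sequentially \<and>
         (\<forall>j. eta2 k / \<rho> + e1 j \<le> expectation (\<lambda>\<omega>. real (N j \<omega>) - \<sigma> / b j)
              \<and> expectation (\<lambda>\<omega>. real (N j \<omega>) - \<sigma> / b j) \<le> eta2 k / \<rho> + 1 + e2 j)"
  proof (intro exI conjI allI)
    \<comment> \<open>\<open>good\<close> may fail for finitely many j. There the error is chosen so
      that the lower bound is an equality, and the inequalities hold for every j.\<close>
    define D where "D = (\<lambda>j. expectation (\<lambda>\<omega>. real (N j \<omega>) - \<sigma> / b j) - eta2 k / \<rho>)"
    show "((\<lambda>j. if good j then e j else D j) \<longlongrightarrow> 0) sequentially"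
      by (rule Lim_transform_eventually[OF e_lim]) (use good in eventually_elim, simp)
    show "((\<lambda>j. if good j then e j else D j) \<longlongrightarrow> 0) sequentially"
      by (rule Lim_transform_eventually[OF e_lim]) (use good in eventually_elim, simp)
    show "eta2 k / \<rho> + (if good j then e j else D j) \<le> expectation (\<lambda>\<omega>. real (N j \<omega>) - \<sigma> / b j)" for j
      using EN_bounds[of j] by (cases "good j") (simp_all add: diff_eq D_def)
    show "expectation (\<lambda>\<omega>. real (N j \<omega>) - \<sigma> / b j) \<le> eta2 k / \<rho> + 1 + (if good j then e j else D j)" for j
      using EN_bounds[of j] by (cases "good j") (simp_all add: diff_eq D_def)
  qed
  have iii: "(\<lambda>j. variance (\<lambda>\<omega>. Ymin Y (N j \<omega>) \<omega>) - (b j)\<^sup>2) \<in> o(\<lambda>j. (b j)\<^sup>2)"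
  proof (rule smalloI_tendsto)
    define Q where "Q = (\<lambda>p j. expectation (\<lambda>\<omega>. (c j / \<rho> / real (N j \<omega>)) ^ p))"
    have Q: "((\<lambda>j. Q p j) \<longlongrightarrow> 1) sequentially" if "p \<le> 2" for p
      unfolding Q_def N_def L_def by (rule W.inverse_moment_limit[OF c_top pilot small \<rho> that])
    \<comment> \<open>The 2 is the second moment of a unit exponential; since both Q tend to 1, the
      bracket tends to 2 - 1 = 1.\<close>
    have var: "variance (\<lambda>\<omega>. Ymin Y (N j \<omega>) \<omega>) = (b j)\<^sup>2 * (2 * Q 2 j - (Q 1 j)\<^sup>2)" if g: "good j" for j
    proof -
      define U where "U = (\<lambda>\<omega>. Xmin X (N j \<omega>) \<omega>)"
      have N1: "N j \<omega> \<ge> 1" for \<omega> using L_bounds(4) by (simp add: N_def)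
      have Y_eq: "Ymin Y (N j \<omega>) \<omega> = \<mu> + \<sigma> * U \<omega>" for \<omega>
        unfolding U_def X_def by (rule Ymin_eq[OF \<sigma> N1])
      have ex: "AE \<omega> in M. \<exists>n. W.dev (c j) (m0 j + n) \<omega> \<le> 0"
        by (rule W.AE_tau_exists[OF g[unfolded good_def]])
      note mom = X.stopped_min_moment[OF k L_bounds(3) ex]
      have U1: "integrable M U" "expectation U = expectation (\<lambda>\<omega>. 1 / real (N j \<omega>))"
        using mom[of 1] by (simp_all add: U_def N_def)
      have U2: "integrable M (\<lambda>\<omega>. (U \<omega>)\<^sup>2)" "expectation (\<lambda>\<omega>. (U \<omega>)\<^sup>2) = expectation (\<lambda>\<omega>. 2 / (real (N j \<omega>))\<^sup>2)"
        using mom[of 2] by (simp_all add: U_def N_def)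
      have n: "\<sigma> = b j * (c j / \<rho>)" using assms(11)[of j] \<rho> by (simp add: c_def)
      have "expectation (\<lambda>\<omega>. c j / \<rho> * (1 / real (N j \<omega>))) = c j / \<rho> * expectation (\<lambda>\<omega>. 1 / real (N j \<omega>))"
        by (rule integral_mult_right_zero)
      then have q1: "\<sigma> * expectation U = b j * Q 1 j"
        unfolding U1(2) n by (simp add: Q_def)
      have "expectation (\<lambda>\<omega>. (c j / \<rho>)\<^sup>2 / 2 * (2 / (real (N j \<omega>))\<^sup>2)) = (c j / \<rho>)\<^sup>2 / 2 * expectation (\<lambda>\<omega>. 2 / (real (N j \<omega>))\<^sup>2)"
        by (rule integral_mult_right_zero)
      then have "expectation (\<lambda>\<omega>. (U \<omega>)\<^sup>2) * (c j / \<rho>)\<^sup>2 = 2 * Q 2 j"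
        unfolding U2(2) by (simp add: Q_def power_divide power_mult_distrib)
      note v = this
      have q2: "\<sigma>\<^sup>2 * expectation (\<lambda>\<omega>. (U \<omega>)\<^sup>2) = (b j)\<^sup>2 * (2 * Q 2 j)"
      proof -
        have "\<sigma>\<^sup>2 * expectation (\<lambda>\<omega>. (U \<omega>)\<^sup>2) = (b j)\<^sup>2 * (expectation (\<lambda>\<omega>. (U \<omega>)\<^sup>2) * (c j / \<rho>)\<^sup>2)"
          by (subst n) (simp add: power_mult_distrib power_divide)
        then show ?thesis unfolding v .
      qed
      have mean: "expectation (\<lambda>\<omega>. \<mu> + \<sigma> * U \<omega>) = \<mu> + \<sigma> * expectation U" using U1 by (simp add: prob_space)
      have "variance (\<lambda>\<omega>. Ymin Y (N j \<omega>) \<omega>) = expectation (\<lambda>\<omega>. (\<mu> + \<sigma> * U \<omega> - (\<mu> + \<sigma> * expectation U))\<^sup>2)"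
        by (simp add: Y_eq mean)
      also have "\<dots> = expectation (\<lambda>\<omega>. \<sigma>\<^sup>2 * (U \<omega> - expectation U)\<^sup>2)"
        by (intro Bochner_Integration.integral_cong refl) (simp add: power2_eq_square algebra_simps)
      also have "\<dots> = \<sigma>\<^sup>2 * variance U" by simp
      also have "variance U = expectation (\<lambda>\<omega>. (U \<omega>)\<^sup>2) - (expectation U)\<^sup>2"
        by (rule variance_eq[OF U1(1) U2(1)])
      also have "\<sigma>\<^sup>2 * (expectation (\<lambda>\<omega>. (U \<omega>)\<^sup>2) - (expectation U)\<^sup>2) = \<sigma>\<^sup>2 * expectation (\<lambda>\<omega>. (U \<omega>)\<^sup>2) - (\<sigma> * expectation U)\<^sup>2"
        by (simp add: right_diff_distrib power_mult_distrib)
      also have "\<dots> = (b j)\<^sup>2 * (2 * Q 2 j - (Q 1 j)\<^sup>2)"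
        unfolding q1 q2 by (simp add: right_diff_distrib power_mult_distrib)
      finally show ?thesis .
    qed
    have "((\<lambda>j. 2 * Q 2 j - (Q 1 j)\<^sup>2 - 1) \<longlongrightarrow> 2 * 1 - 1\<^sup>2 - 1) sequentially"
      by (intro tendsto_intros Q) auto
    then have lim: "((\<lambda>j. 2 * Q 2 j - (Q 1 j)\<^sup>2 - 1) \<longlongrightarrow> 0) sequentially" by simp
    show "((\<lambda>j. (variance (\<lambda>\<omega>. Ymin Y (N j \<omega>) \<omega>) - (b j)\<^sup>2) / (b j)\<^sup>2) \<longlongrightarrow> 0) sequentially"
    proof (rule Lim_transform_eventually[OF lim])
      show "eventually (\<lambda>j. 2 * Q 2 j - (Q 1 j)\<^sup>2 - 1 = (variance (\<lambda>\<omega>. Ymin Y (N j \<omega>) \<omega>) - (b j)\<^sup>2) / (b j)\<^sup>2) sequentially"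
        using good
      proof eventually_elim
        case (elim j)
        show ?case unfolding var[OF elim] using assms(11)[of j] by (simp add: field_simps)
      qed
    qed
    show "eventually (\<lambda>j. (b j)\<^sup>2 \<noteq> 0) sequentially" using assms(11) by (simp add: less_imp_neq[symmetric])
  qed
  show ?thesis unfolding stopN by (intro conjI i ii iii)
qed

end
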